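(* Let $p$ be an odd prime and let $r\in\mathbb{Z}_p^\times$ be an element that is not a root of unity. Then the $K$-theory of $A_r$ is given by $$K_0(A_r)\cong c_0\big(\mathbb{Z}_{\geq 0},H_{\mathrm{ord}_{\mathbb{Z}_p^\times}(r)}\big)\oplus\mathbb{Z}\quad\text{and}\quad K_1(A_r)\cong\mathbb{Z}\oplus c_0(\mathbb{Z}_{\geq 0},\mathbb{Z}).$$
   Context: $\mathbb{Z}_p$ is the ring of $p$-adic integers and $\mathbb{Z}_p^\times$ its group of units. For $r\in\mathbb{Z}_p^\times$, let $(\alpha_rf)(x)=f(x/r)$ for $f\in C(\mathbb{Z}_p)$. The algebra $A_r=C(\mathbb{Z}_p)\rtimes_{\alpha_r}\mathbb{N}$ is the universal unital C$^*$-algebra generated by a (unital) copy $\{M_f:f\in C(\mathbb{Z}_p)\}$ of $C(\mathbb{Z}_p)$ and an element $V_r$ satisfying $V_r^*V_r=I$ and $V_rM_fV_r^*=M_{\alpha_r(f)}$. $U_N$ denotes the group of units of $\mathbb{Z}/p^N\mathbb{Z}$, and $\mathrm{ord}_{U_N}(r)$ is the order of $r$ mod $p^N$ in $U_N$. $\mathrm{ord}_{\mathbb{Z}_p^\times}(r)$ is the supernatural number $\mathrm{lcm}\{\mathrm{ord}_{U_N}(r):N\geq 1\}$. For a supernatural number $S$, $H_S$ is the additive subgroup $H_S=\{k/l\in\mathbb{Q}:k\in\mathbb{Z},\ l\mid S\}$ of $\mathbb{Q}$. For a discrete abelian group $H$, $c_0(\mathbb{Z}_{\geq 0},H)$ is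 the group of sequences with values in $H$ that are eventually zero. *)

theory Defs
  imports "HOL-Analysis.Analysis" "HOL-Algebra.Product_Groups"
    "HOL-Algebra.Module" "HOL-Algebra.Subrings" "HOL-Number_Theory.Residues"
    "HOL-Library.Extended_Nat"
begin

section \<open>The ring of p-adic integers\<close>

text \<open>
  The inverse limit of the rings \<open>\<int>/p\<^sup>n\<int>\<close>: an element is the compatible sequence of its
  residues, with \<open>x n\<close> the residue modulo \<open>p\<^sup>n\<close>. The type \<open>nat \<Rightarrow> int\<close> carries the product
  topology of discrete spaces, so \<^const>\<open>continuous_on\<close> on this carrier refers to the usual
  p-adic topology.
\<close>

definition padic_int :: "nat \<Rightarrow> (nat \<Rightarrow> int) ring" where
  "padic_int p =
    \<lparr>carrier = {x. \<forall>n. x n \<in> {0..<int p ^ n} \<and> x (Suc n) mod int p ^ n = x n},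
     monoid.mult = (\<lambda>x y n. (x n * y n) mod int p ^ n),
     one = (\<lambda>n. 1 mod int p ^ n),
     ring.zero = (\<lambda>n. 0),
     ring.add = (\<lambda>x y n. (x n + y n) mod int p ^ n)\<rparr>"


section \<open>Unital C*-algebras\<close>

text \<open>
  Algebras are records with explicit carriers, extending the records of HOL-Algebra, because the
  universal property below quantifies over them.
\<close>

record 'a cstar = "(complex, 'a) module" +
  adj :: "'a \<Rightarrow> 'a"
  nrm :: "'a \<Rightarrow> real"

definition complex_ring :: "complex ring" where
  "complex_ring = \<lparr>carrier = UNIV, monoid.mult = (*), one = 1, ring.zero = 0, ring.add = (+)\<rparr>"

text \<open>
  The locale \<^locale>\<open>Metric_space\<close> asks for symmetry and nonnegativity of the distance on the whole
  type, whence the value \<open>0\<close> off the carrier.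
\<close>

definition nrm_dist :: "'a cstar \<Rightarrow> 'a \<Rightarrow> 'a \<Rightarrow> real" where
  "nrm_dist A x y =
    (if x \<in> carrier A \<and> y \<in> carrier A then nrm A (x \<ominus>\<^bsub>A\<^esub> y) else 0)"

definition nrm_topology :: "'a cstar \<Rightarrow> 'a topology" where
  "nrm_topology A = Metric_space.mtopology (carrier A) (nrm_dist A)"

locale unital_cstar_algebra = Ring.ring A + Module.module complex_ring A
  for A :: "'a cstar" (structure) +
  assumes smult_mult_left:
      "\<lbrakk>x \<in> carrier A; y \<in> carrier A\<rbrakk> \<Longrightarrow> (c \<odot> x) \<otimes> y = c \<odot> (x \<otimes> y)"
    and smult_mult_right:
      "\<lbrakk>x \<in> carrier A; y \<in> carrier A\<rbrakk> \<Longrightarrow> x \<otimes> (c \<odot> y) = c \<odot> (x \<otimes> y)"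
    and adj_closed: "x \<in> carrier A \<Longrightarrow> adj A x \<in> carrier A"
    and adj_adj: "x \<in> carrier A \<Longrightarrow> adj A (adj A x) = x"
    and adj_add:
      "\<lbrakk>x \<in> carrier A; y \<in> carrier A\<rbrakk> \<Longrightarrow> adj A (x \<oplus> y) = adj A x \<oplus> adj A y"
    and adj_mult:
      "\<lbrakk>x \<in> carrier A; y \<in> carrier A\<rbrakk> \<Longrightarrow> adj A (x \<otimes> y) = adj A y \<otimes> adj A x"
    and adj_smult: "x \<in> carrier A \<Longrightarrow> adj A (c \<odot> x) = cnj c \<odot> adj A x"
    and nrm_nonneg: "x \<in> carrier A \<Longrightarrow> 0 \<le> nrm A x"
    and nrm_eq_0: "x \<in> carrier A \<Longrightarrow> nrm A x = 0 \<longleftrightarrow> x = \<zero>"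
    and nrm_triangle:
      "\<lbrakk>x \<in> carrier A; y \<in> carrier A\<rbrakk> \<Longrightarrow> nrm A (x \<oplus> y) \<le> nrm A x + nrm A y"
    and nrm_smult: "x \<in> carrier A \<Longrightarrow> nrm A (c \<odot> x) = cmod c * nrm A x"
    and nrm_mult:
      "\<lbrakk>x \<in> carrier A; y \<in> carrier A\<rbrakk> \<Longrightarrow> nrm A (x \<otimes> y) \<le> nrm A x * nrm A y"
    and cstar_identity: "x \<in> carrier A \<Longrightarrow> nrm A (adj A x \<otimes> x) = (nrm A x)\<^sup>2"
    and complete: "Metric_space.mcomplete (carrier A) (nrm_dist A)"

text \<open>Unital *-homomorphisms; \<^const>\<open>ring_hom\<close> includes preservation of the unit.\<close>

definition star_hom :: "'a cstar \<Rightarrow> 'b cstar \<Rightarrow> ('a \<Rightarrow> 'b) set" where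
  "star_hom A B = {h \<in> ring_hom A B. \<forall>x\<in>carrier A.
     h (adj A x) = adj B (h x) \<and> (\<forall>c. h (c \<odot>\<^bsub>A\<^esub> x) = c \<odot>\<^bsub>B\<^esub> h x)}"

definition cstar_subalgebra :: "'a set \<Rightarrow> 'a cstar \<Rightarrow> bool" where
  "cstar_subalgebra S A \<longleftrightarrow> subring S A \<and> (\<forall>x\<in>S. adj A x \<in> S \<and> (\<forall>c. c \<odot>\<^bsub>A\<^esub> x \<in> S)) \<and>
     closedin (nrm_topology A) S"

definition cstar_generated :: "'a set \<Rightarrow> 'a cstar \<Rightarrow> 'a set" where
  "cstar_generated G A = \<Inter>{S. cstar_subalgebra S A \<and> G \<subseteq> S}"

text \<open>The algebra \<open>C(T)\<close> of a (nonempty compact) set \<open>T\<close>, with functions set to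
  \<^const>\<open>undefined\<close> outside \<open>T\<close>.\<close>

definition cont_algebra :: "'x::topological_space set \<Rightarrow> ('x \<Rightarrow> complex) cstar" where
  "cont_algebra T =
    \<lparr>carrier = {f \<in> extensional T. continuous_on T f},
     monoid.mult = (\<lambda>f g. \<lambda>x\<in>T. f x * g x),
     one = (\<lambda>x\<in>T. 1),
     ring.zero = (\<lambda>x\<in>T. 0),
     ring.add = (\<lambda>f g. \<lambda>x\<in>T. f x + g x),
     smult = (\<lambda>c f. \<lambda>x\<in>T. c * f x),
     adj = (\<lambda>f. \<lambda>x\<in>T. cnj (f x)),
     nrm = (\<lambda>f. SUP x\<in>T. cmod (f x))\<rparr>"


section \<open>The crossed product by multiplication with a unit\<close>

abbreviation padic_cont :: "nat \<Rightarrow> ((nat \<Rightarrow> int) \<Rightarrow> complex) cstar" where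
  "padic_cont p \<equiv> cont_algebra (carrier (padic_int p))"

definition padic_alpha ::
    "nat \<Rightarrow> (nat \<Rightarrow> int) \<Rightarrow> ((nat \<Rightarrow> int) \<Rightarrow> complex) \<Rightarrow> (nat \<Rightarrow> int) \<Rightarrow> complex" where
  "padic_alpha p r f =
    (\<lambda>x\<in>carrier (padic_int p). f (x \<otimes>\<^bsub>padic_int p\<^esub> inv\<^bsub>padic_int p\<^esub> r))"

definition covariant_pair ::
    "nat \<Rightarrow> (nat \<Rightarrow> int) \<Rightarrow> 'b cstar \<Rightarrow> (((nat \<Rightarrow> int) \<Rightarrow> complex) \<Rightarrow> 'b) \<Rightarrow> 'b \<Rightarrow> bool" where
  "covariant_pair p r B M V \<longleftrightarrow>
     M \<in> star_hom (padic_cont p) B \<and> V \<in> carrier B \<and>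
     adj B V \<otimes>\<^bsub>B\<^esub> V = \<one>\<^bsub>B\<^esub> \<and>
     (\<forall>f\<in>carrier (padic_cont p). V \<otimes>\<^bsub>B\<^esub> M f \<otimes>\<^bsub>B\<^esub> adj B V = M (padic_alpha p r f))"

text \<open>
  The universal property has to fix a type for the carriers of the target algebras. Nothing is
  lost by taking the functions on complex sequences, which include the operators on
  \<open>\<ell>\<^sup>2(\<nat>)\<close>: a covariant pair in any C*-algebra generates a separable C*-algebra, which has at
  most continuum many elements and hence an isomorphic copy carried by a subset of this type.
  Uniqueness of \<open>h\<close> on the carrier follows from the generation clause.
\<close>

type_synonym seq_op = "(nat \<Rightarrow> complex) \<Rightarrow> nat \<Rightarrow> complex"

definition is_crossed_product ::
    "nat \<Rightarrow> (nat \<Rightarrow> int) \<Rightarrow> 'a cstar \<Rightarrow> (((nat \<Rightarrow> int) \<Rightarrow> complex) \<Rightarrow> 'a) \<Rightarrow> 'a \<Rightarrow> bool" where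
  "is_crossed_product p r A M V \<longleftrightarrow>
     unital_cstar_algebra A \<and> covariant_pair p r A M V \<and>
     inj_on M (carrier (padic_cont p)) \<and>
     cstar_generated (insert V (M ` carrier (padic_cont p))) A = carrier A \<and>
     (\<forall>(B :: seq_op cstar) M' V'.
        unital_cstar_algebra B \<and> covariant_pair p r B M' V' \<longrightarrow>
        (\<exists>h\<in>star_hom A B. (\<forall>f\<in>carrier (padic_cont p). h (M f) = M' f) \<and> h V = V'))"


section \<open>K-theory of unital C*-algebras\<close>

definition quotient_monoid :: "'x set \<Rightarrow> ('x \<times> 'x) set \<Rightarrow> ('x \<Rightarrow> 'x \<Rightarrow> 'x) \<Rightarrow> 'x \<Rightarrow> 'x set monoid" where
  "quotient_monoid S R op e =
    \<lparr>carrier = S // R,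
     monoid.mult = (\<lambda>P Q. R `` {op x y | x y. x \<in> P \<and> y \<in> Q}),
     one = R `` {e}\<rparr>"

definition grothendieck_rel ::
    "('x, 'y) monoid_scheme \<Rightarrow> (('x \<times> 'x) \<times> ('x \<times> 'x)) set" where
  "grothendieck_rel G = {((a, b), (c, d)).
     a \<in> carrier G \<and> b \<in> carrier G \<and> c \<in> carrier G \<and> d \<in> carrier G \<and>
     (\<exists>k\<in>carrier G. a \<otimes>\<^bsub>G\<^esub> d \<otimes>\<^bsub>G\<^esub> k = c \<otimes>\<^bsub>G\<^esub> b \<otimes>\<^bsub>G\<^esub> k)}"

definition grothendieck_group :: "('x, 'y) monoid_scheme \<Rightarrow> ('x \<times> 'x) set monoid" where
  "grothendieck_group G = quotient_monoid (carrier G \<times> carrier G) (grothendieck_rel G)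
     (\<lambda>(a, b) (c, d). (a \<otimes>\<^bsub>G\<^esub> c, b \<otimes>\<^bsub>G\<^esub> d)) (\<one>\<^bsub>G\<^esub>, \<one>\<^bsub>G\<^esub>)"

text \<open>
  Matrices over \<open>A\<close> are functions of two indices that vanish outside the stated size. A pair
  \<open>(n, a)\<close> stands for a square matrix together with its size.
\<close>

type_synonym 'a matrix = "nat \<Rightarrow> nat \<Rightarrow> 'a"

definition mats :: "'a cstar \<Rightarrow> nat \<Rightarrow> nat \<Rightarrow> 'a matrix set" where
  "mats A m n = {a. (\<forall>i j. i < m \<and> j < n \<longrightarrow> a i j \<in> carrier A) \<and>
     (\<forall>i j. \<not> (i < m \<and> j < n) \<longrightarrow> a i j = \<zero>\<^bsub>A\<^esub>)}"

definition mat_one :: "'a cstar \<Rightarrow> nat \<Rightarrow> 'a matrix" where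
  "mat_one A n = (\<lambda>i j. if i < n \<and> i = j then \<one>\<^bsub>A\<^esub> else \<zero>\<^bsub>A\<^esub>)"

text \<open>The product of an \<open>m \<times> l\<close> matrix and an \<open>l \<times> n\<close> matrix.\<close>

definition mat_mult :: "'a cstar \<Rightarrow> nat \<Rightarrow> 'a matrix \<Rightarrow> 'a matrix \<Rightarrow> 'a matrix" where
  "mat_mult A l a b = (\<lambda>i j. \<Oplus>\<^bsub>A\<^esub>k\<in>{..<l}. a i k \<otimes>\<^bsub>A\<^esub> b k j)"

definition mat_adj :: "'a cstar \<Rightarrow> 'a matrix \<Rightarrow> 'a matrix" where
  "mat_adj A a = (\<lambda>i j. adj A (a j i))"

definition diag_sum :: "'a cstar \<Rightarrow> nat \<times> 'a matrix \<Rightarrow> nat \<times> 'a matrix \<Rightarrow> nat \<times> 'a matrix" where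
  "diag_sum A = (\<lambda>(n, a) (m, b). (n + m,
     \<lambda>i j. if i < n \<and> j < n then a i j
           else if n \<le> i \<and> n \<le> j then b (i - n) (j - n) else \<zero>\<^bsub>A\<^esub>))"

definition projections :: "'a cstar \<Rightarrow> (nat \<times> 'a matrix) set" where
  "projections A = {(n, e). e \<in> mats A n n \<and> mat_mult A n e e = e \<and> mat_adj A e = e}"

text \<open>Murray--von Neumann equivalence, for projections of possibly different sizes.\<close>

definition mvn_rel :: "'a cstar \<Rightarrow> ((nat \<times> 'a matrix) \<times> (nat \<times> 'a matrix)) set" where
  "mvn_rel A = {((n, e), (m, f)). (n, e) \<in> projections A \<and> (m, f) \<in> projections A \<and>
     (\<exists>v\<in>mats A m n. mat_mult A m (mat_adj A v) v = e \<and> mat_mult A n v (mat_adj A v) = f)}"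

definition mvn_monoid :: "'a cstar \<Rightarrow> (nat \<times> 'a matrix) set monoid" where
  "mvn_monoid A =
     quotient_monoid (projections A) (mvn_rel A) (diag_sum A) (0, mat_one A 0)"

definition K0 :: "'a cstar \<Rightarrow> ((nat \<times> 'a matrix) set \<times> (nat \<times> 'a matrix) set) set monoid" where
  "K0 A = grothendieck_group (mvn_monoid A)"

definition unitaries :: "'a cstar \<Rightarrow> (nat \<times> 'a matrix) set" where
  "unitaries A = {(n, u). u \<in> mats A n n \<and>
     mat_mult A n (mat_adj A u) u = mat_one A n \<and> mat_mult A n u (mat_adj A u) = mat_one A n}"

text \<open>
  The C*-norm on \<open>M\<^sub>n(A)\<close> induces the topology of entrywise convergence, so norm continuity of
  a path of matrices is continuity of its entries.
\<close>

definition unitary_homotopic :: "'a cstar \<Rightarrow> nat \<times> 'a matrix \<Rightarrow> nat \<times> 'a matrix \<Rightarrow> bool" where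
  "unitary_homotopic A = (\<lambda>(n, u) (m, v). n = m \<and> (\<exists>w :: real \<Rightarrow> 'a matrix.
     (\<forall>t\<in>{0..1}. (n, w t) \<in> unitaries A) \<and>
     (\<forall>i<n. \<forall>j<n. continuous_map (top_of_set {0..1}) (nrm_topology A) (\<lambda>t. w t i j)) \<and>
     w 0 = u \<and> w 1 = v))"

definition K1_rel :: "'a cstar \<Rightarrow> ((nat \<times> 'a matrix) \<times> (nat \<times> 'a matrix)) set" where
  "K1_rel A = {(x, y). x \<in> unitaries A \<and> y \<in> unitaries A \<and>
     (\<exists>k l. unitary_homotopic A (diag_sum A x (k, mat_one A k)) (diag_sum A y (l, mat_one A l)))}"

definition K1 :: "'a cstar \<Rightarrow> (nat \<times> 'a matrix) set monoid" where
  "K1 A = quotient_monoid (unitaries A) (K1_rel A) (diag_sum A) (0, mat_one A 0)"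


section \<open>Supernatural numbers and the groups in the conclusion\<close>

text \<open>
  A supernatural number is a formal product of prime powers with exponents in \<open>\<nat> \<union> {\<infinity>}\<close>,
  given by its exponent function; only the values at primes matter.
\<close>

type_synonym supernatural = "nat \<Rightarrow> enat"

definition nat_dvd_supernatural :: "nat \<Rightarrow> supernatural \<Rightarrow> bool" where
  "nat_dvd_supernatural l S \<longleftrightarrow> l > 0 \<and> (\<forall>q. prime q \<longrightarrow> enat (multiplicity q l) \<le> S q)"

definition supernatural_lcm :: "nat set \<Rightarrow> supernatural" where
  "supernatural_lcm L = (\<lambda>q. if prime q then SUP n\<in>L. enat (multiplicity q n) else 0)"

definition ord_mod_power :: "nat \<Rightarrow> nat \<Rightarrow> (nat \<Rightarrow> int) \<Rightarrow> nat" where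
  "ord_mod_power p N r = group.ord (units_of (residue_ring (int p ^ N))) (r N)"

definition padic_ord :: "nat \<Rightarrow> (nat \<Rightarrow> int) \<Rightarrow> supernatural" where
  "padic_ord p r = supernatural_lcm {ord_mod_power p N r | N. N \<ge> 1}"

definition H_group :: "supernatural \<Rightarrow> rat monoid" where
  "H_group S =
    \<lparr>carrier = {of_int k / of_nat l | k l. nat_dvd_supernatural l S},
     monoid.mult = (+), one = 0\<rparr>"

text \<open>
  The restricted direct sum \<^const>\<open>sum_group\<close> consists of the sequences with only finitely many
  nonzero terms, that is, those that are eventually zero.
\<close>

definition c0_group :: "('b, 'c) monoid_scheme \<Rightarrow> (nat \<Rightarrow> 'b) monoid" where
  "c0_group H = sum_group UNIV (\<lambda>_. H)"

end

theory Submission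
  imports Defs "HOL-Complex_Analysis.Complex_Analysis" "Jordan_Normal_Form.Determinant"
begin

text \<open>
  Evaluating covariance at the unit gives \<open>V V* = 1\<close>, so the algebra is generated by \<open>C(Z_p)\<close> and
  a unitary. The closed orbits of multiplication by \<open>r\<close> on the nonzero p-adic integers are countably
  many odometers. Cylinders of level \<open>L\<close> in the first \<open>L\<close> orbits, together with the clopen
  complement of these orbits, give a subalgebra isomorphic to a finite sum of matrix algebras over
  \<open>C(T)\<close>, and the union over \<open>L\<close> is dense. Unitaries and projections are moved into some level,
  where winding numbers of determinants and ranks classify them. Passing to the next level preserves
  the winding numbers and the quotients of rank by matrix size, and a new orbit splits off from the
  complement with the same values; hence both invariants are eventually constant sequences, integral
  for \<open>K1\<close> and rational with denominators dividing orders of \<open>r\<close> for \<open>K0\<close>, and taking the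
  limit splits off a copy of the integers.
\<close>

notation iff (infixr "<->" 25) and scaleR (infixr "*R" 75)

abbreviation cont where "cont \<equiv> continuous_on"

class banach_star = real_normed_algebra_1 + banach +
 fixes star :: "'a => 'a"
 assumes star_star [simp]: "star (star x) = x"
  and star_add: "star (x + y) = star x + star y"
  and star_mult: "star (x*y) = star y * star x"
  and star_scaleR: "star (c *R x) = c *R star x"
  and norm_star [simp]: "norm (star x) = norm x"
begin

lemma star_0 [simp]: "star 0 = 0"
 using star_add[of 0 0] by simp

lemma star_minus: "star (- x) = - star x"
 using star_add[of "- x" x] by(simp add: eq_neg_iff_add_eq_0)

lemma star_diff: "star (x - y) = star x - star y"
 using star_add[of x "- y"] by(simp add: star_minus)

lemma star_one [simp]: "star 1 = 1"
 by(metis mult_1_left mult_1_right star_mult star_star)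

lemma star_power: "star (x ^ n) = star x ^ n"
 by(induction n) (simp_all add: star_mult power_commutes)

lemma star_sum: "star (sum f S) = (SUM x:S. star (f x))"
 by(induction S rule: infinite_finite_induct) (simp_all add: star_add)

end

lemma bounded_linear_star: "bounded_linear (star :: 'a::banach_star => 'a)"
 by(rule bounded_linear_intro[where K = 1]) (simp_all add: star_add star_scaleR)

lemmas tendsto_star [tendsto_intros] = bounded_linear.tendsto[OF bounded_linear_star]
lemmas continuous_on_star [continuous_intros] = bounded_linear.continuous_on[OF bounded_linear_star]

instantiation complex :: banach_star
begin
definition star_complex :: "complex => complex" where "star_complex = cnj"
instance by standard (simp_all add: star_complex_def)
end

definition isqrt_coeff :: "nat => real" where
 "isqrt_coeff n = pochhammer (1/2) n / fact n"

lemma isqrt_coeff_0 [simp]: "isqrt_coeff 0 = 1"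
 by(simp add: isqrt_coeff_def)

lemma isqrt_coeff_bounds: "0 <= isqrt_coeff n & isqrt_coeff n <= 1"
proof (induction n)
 case (Suc n)
 have "isqrt_coeff (Suc n) = isqrt_coeff n*((1/2 + n) / (1 + n))"
  by(simp add: isqrt_coeff_def pochhammer_Suc)
 moreover have "0 <= (1/2 + real n) / (1 + n)" "(1/2 + real n) / (1 + n) <= 1"
  by(simp_all add: divide_simps)
 ultimately show ?case using Suc by(metis mult_nonneg_nonneg mult_le_one)
qed simp

lemma isqrt_coeff_convolution: "(SUM i<=n. isqrt_coeff i*isqrt_coeff (n - i)) = 1"
proof -
 have "fact n = pochhammer (1/2 + 1/2 :: real) n"
  by(simp add: pochhammer_fact)
 also have "... = (SUM k<=n. of_nat (n choose k)*pochhammer (1/2) k*pochhammer (1/2) (n - k))"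
  by(rule pochhammer_binomial_sum)
 also have "... = fact n*(SUM i<=n. isqrt_coeff i*isqrt_coeff (n - i))"
  unfolding sum_distrib_left
  by(intro sum.cong refl) (simp add: isqrt_coeff_def binomial_fact)
 finally show ?thesis by simp
qed

definition isqrt :: "'a::{real_normed_algebra_1,banach} => 'a" where
 "isqrt y = (\<Sum>n. isqrt_coeff n *R y ^ n)"

lemma norm_isqrt_term: "norm (isqrt_coeff n *R y ^ n) <= norm (y::'a::real_normed_algebra_1) ^ n"
proof -
 have "norm (isqrt_coeff n *R y ^ n) = isqrt_coeff n*norm (y ^ n)"
  using isqrt_coeff_bounds[of n] by simp
 also have "... <= 1*norm y ^ n"
  using isqrt_coeff_bounds[of n] by(intro mult_mono norm_power_ineq) auto
 finally show ?thesis by simp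
qed

lemma summable_norm_isqrt:
 fixes y :: "'a::{real_normed_algebra_1,banach}"
 assumes "norm y < 1"
 shows "summable (%n. norm (isqrt_coeff n *R y ^ n))"
 by(rule summable_comparison_test'[where g = "%n. norm y ^ n" and N = 0])
  (use assms norm_isqrt_term[of _ y] in "auto simp: summable_geometric")

lemma isqrt_sums:
 fixes y :: "'a::{real_normed_algebra_1,banach}"
 assumes "norm y < 1"
 shows "(%n. isqrt_coeff n *R y ^ n) sums isqrt y"
 unfolding isqrt_def
 by(rule summable_sums) (rule summable_norm_cancel[OF summable_norm_isqrt[OF assms]])

lemma isqrt_0 [simp]: "isqrt (0::'a::{real_normed_algebra_1,banach}) = 1"
proof -
 have "(%n. isqrt_coeff n *R (0::'a) ^ n) sums (SUM n:{0}. isqrt_coeff n *R 0 ^ n)"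
  by(rule sums_finite) (auto simp: power_0_left)
 from sums_unique2[OF isqrt_sums this] show ?thesis by simp
qed

lemma isqrt_square:
 fixes y :: "'a::{real_normed_algebra_1,banach}"
 assumes "norm y < 1"
 shows "isqrt y*isqrt y*(1 - y) = 1" "(1 - y)*(isqrt y*isqrt y) = 1"
proof -
 have "(%n. SUM i<=n. (isqrt_coeff i *R y ^ i)*(isqrt_coeff (n - i) *R y ^ (n - i))) sums (isqrt y*isqrt y)"
  using Cauchy_product_sums[OF summable_norm_isqrt[OF assms] summable_norm_isqrt[OF assms]]
  by(simp add: isqrt_def)
 moreover have "(SUM i<=n. (isqrt_coeff i *R y ^ i)*(isqrt_coeff (n - i) *R y ^ (n - i))) = y ^ n" for n
 proof -
  have "(SUM i<=n. (isqrt_coeff i *R y ^ i)*(isqrt_coeff (n - i) *R y ^ (n - i)))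
    = (SUM i<=n. (isqrt_coeff i*isqrt_coeff (n - i)) *R y ^ n)"
   by(intro sum.cong refl) (simp add: power_add[symmetric])
  also have "... = (SUM i<=n. isqrt_coeff i*isqrt_coeff (n - i)) *R y ^ n"
   by(simp only: scaleR_left.sum)
  finally show ?thesis by(simp add: isqrt_coeff_convolution)
 qed
 ultimately have s: "(%n. y ^ n) sums (isqrt y*isqrt y)" by simp
 have s1: "(%n. y ^ Suc n) sums (isqrt y*isqrt y - 1)"
  using s by(subst sums_Suc_iff) simp
 have "(%n. y ^ Suc n) sums (y*(isqrt y*isqrt y))" "(%n. y ^ Suc n) sums (isqrt y*isqrt y*y)"
  using sums_mult[OF s, of y] sums_mult2[OF s, of y] by(simp_all add: power_commutes)
 from sums_unique2[OF s1 this(1)] sums_unique2[OF s1 this(2)]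
 show "isqrt y*isqrt y*(1 - y) = 1" "(1 - y)*(isqrt y*isqrt y) = 1"
  by(simp_all add: algebra_simps)
qed

lemma isqrt_intertwine:
 fixes x y z :: "'a::{real_normed_algebra_1,banach}"
 assumes "x*y = z*x" "norm y < 1" "norm z < 1"
 shows "x*isqrt y = isqrt z*x"
proof -
 have *: "x*y ^ n = z ^ n*x" for n
  by(induction n) (simp_all add: mult.assoc[symmetric] assms(1), simp add: mult.assoc)
 have "(%n. x*(isqrt_coeff n *R y ^ n)) = (%n. (isqrt_coeff n *R z ^ n)*x)"
  by(simp add: *)
 with sums_mult[OF isqrt_sums[OF assms(2)], of x] sums_mult2[OF isqrt_sums[OF assms(3)], of x]
 show ?thesis by(metis sums_unique2)
qed

lemma isqrt_star:
 fixes y :: "'a::banach_star"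
 assumes "norm y < 1"
 shows "star (isqrt y) = isqrt (star y)"
proof -
 have "(%n. star (isqrt_coeff n *R y ^ n)) sums star (isqrt y)"
  by(rule bounded_linear.sums[OF bounded_linear_star isqrt_sums[OF assms]])
 thus ?thesis
  using sums_unique2[OF _ isqrt_sums[of "star y"]] assms by(simp add: star_scaleR star_power)
qed

definition closed_alg :: "'a::banach_star set => bool" where
 "closed_alg S <-> closed S & 1:S & (ALL x:S. ALL y:S. x + y:S & x*y:S) &
  (ALL x:S. star x:S & (ALL c. c *R x:S))"

lemma closed_algD:
 assumes "closed_alg S"
 shows "closed S" "1:S" "x:S ==> y:S ==> x + y:S" "x:S ==> y:S ==> x*y:S"
  "x:S ==> star x:S" "x:S ==> c *R x:S" "x:S ==> - x:S" "0:S"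
  "x:S ==> y:S ==> x - y:S" "x:S ==> x ^ n:S"
  "(!!i. i:I ==> f i:S) ==> sum f I:S"
proof -
 note D = assms[unfolded closed_alg_def]
 show "closed S" "1:S" "x:S ==> y:S ==> x + y:S" "x:S ==> y:S ==> x*y:S"
  "x:S ==> star x:S" "x:S ==> c *R x:S" using D by blast+
 have neg: "- x:S" if "x:S" for x using D that scaleR_minus1_left by metis
 thus "x:S ==> - x:S" .
 show "x:S ==> y:S ==> x - y:S" using D neg by(metis diff_conv_add_uminus)
 have z: "0:S" using D by(metis scale_zero_left)
 thus "0:S" .
 show "x:S ==> x ^ n:S" using D by(induction n) auto
 show "(!!i. i:I ==> f i:S) ==> sum f I:S"
  using D z by(induction I rule: infinite_finite_induct) auto
qed

lemma closed_alg_UNIV: "closed_alg UNIV"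
 by(simp add: closed_alg_def)

lemma isqrt_mem:
 fixes y :: "'a::banach_star"
 assumes "closed_alg S" "y:S" "norm y < 1"
 shows "isqrt y:S"
proof (rule closed_sequentially[OF closed_algD(1)[OF assms(1)]])
 show "(SUM i<n. isqrt_coeff i *R y ^ i):S" for n
  using assms by(intro closed_algD(6,10,11))
 show "(%n. SUM i<n. isqrt_coeff i *R y ^ i) \<longlonglongrightarrow> isqrt y"
  using isqrt_sums[OF assms(3)] by(simp add: sums_def)
qed

lemma continuous_on_isqrt: "cont (cball (0::'a::{real_normed_algebra_1,banach}) (1/2)) isqrt"
proof -
 have "uniform_limit (cball (0::'a) (1/2)) (%n y. SUM i<n. isqrt_coeff i *R y ^ i)
   (%y. suminf (%i. isqrt_coeff i *R y ^ i)) sequentially"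
 proof (rule Weierstrass_m_test[where M = "%n. (1/2) ^ n"])
  show "norm (isqrt_coeff n *R y ^ n) <= (1/2) ^ n" if "y:cball 0 (1/2)" for n and y :: 'a
   using norm_isqrt_term[of n y] power_mono[of "norm y" "1/2" n] that by auto
 qed (simp add: summable_geometric)
 thus ?thesis
  unfolding isqrt_def
  by(rule uniform_limit_theorem[rotated]) (auto intro!: continuous_intros always_eventually)
qed

lemma continuous_on_isqrt_compose [continuous_intros]:
 fixes f :: "'a::topological_space => 'b::{real_normed_algebra_1,banach}"
 assumes "cont S f" "!!x. x:S ==> norm (f x) <= 1/2"
 shows "cont S (%x. isqrt (f x))"
 by(rule continuous_on_compose2[OF continuous_on_isqrt assms(1)]) (use assms(2) in auto)

definition is_proj :: "'a::banach_star => bool" where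
 "is_proj p <-> p*p = p & star p = p"

definition is_unitary :: "'a::banach_star => bool" where
 "is_unitary u <-> star u*u = 1 & u * star u = 1"

lemma is_unitary_mult: "is_unitary u ==> is_unitary v ==> is_unitary (u * v)"
 unfolding is_unitary_def star_mult
 by(metis (no_types, lifting) mult.assoc mult_1_left)

definition polar :: "'a::banach_star => 'a" where
 "polar x = x*isqrt (1 - star x*x)"

lemma polar_unitary:
 fixes x :: "'a::banach_star"
 assumes "norm (1 - star x*x) < 1" "norm (1 - x * star x) < 1"
 shows "is_unitary (polar x)"
proof -
 let ?y = "1 - star x*x" and ?z = "1 - x * star x"
 let ?g = "isqrt ?y" and ?h = "isqrt ?z"
 have sg: "star ?g = ?g" using isqrt_star[OF assms(1)] by(simp add: star_diff star_mult)
 have sh: "star ?h = ?h" using isqrt_star[OF assms(2)] by(simp add: star_diff star_mult)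
 have xg: "x*?g = ?h*x" by(rule isqrt_intertwine) (use assms in "simp_all add: algebra_simps")
 have gy: "?y*?g = ?g*?y" by(rule isqrt_intertwine) (use assms in simp_all)
 have "(star x*x)*?g = ?g*(star x*x)" using gy by(simp add: algebra_simps)
 hence "?g*(star x*x)*?g = ?g*?g*(1 - ?y)" by(simp add: mult.assoc)
 hence 1: "star (polar x)*polar x = 1"
  using isqrt_square(1)[OF assms(1)] by(simp add: polar_def star_mult sg mult.assoc)
 have hz: "?z*?h = ?h*?z" by(rule isqrt_intertwine) (use assms in simp_all)
 have "polar x * star (polar x) = ?h*x * star (?h*x)" by(simp add: polar_def xg)
 also have "... = ?h*(x * star x)*?h" by(simp add: star_mult sh mult.assoc)
 also have "(x * star x)*?h = ?h*(x * star x)" using hz by(simp add: algebra_simps)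
 hence "?h*(x * star x)*?h = ?h*?h*(1 - ?z)" by(simp add: mult.assoc)
 finally show ?thesis using 1 isqrt_square(1)[OF assms(2)] by(simp add: is_unitary_def)
qed

lemma polar_mem:
 assumes "closed_alg S" "x:S" "norm (1 - star x*x) < 1"
 shows "polar x:S"
 unfolding polar_def using assms by(intro closed_algD(4) isqrt_mem closed_algD(9) closed_algD(2,5)) auto

lemma polar_of_unitary: "is_unitary u ==> polar u = u"
 by(simp add: polar_def is_unitary_def)

lemma continuous_on_polar [continuous_intros]:
 assumes "cont S f" "!!x. x:S ==> norm (1 - star (f x)*f x) <= 1/2"
 shows "cont S (%x. polar (f x))"
 unfolding polar_def using assms by(intro continuous_intros) auto

text \<open>A unitary carrying the projection \<open>p\<close> to a nearby projection \<open>q\<close>, equal to \<open>1\<close> if \<open>q = p\<close>.\<close>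

definition proj_rotation :: "'a::banach_star => 'a => 'a" where
 "proj_rotation q p = polar (q*p + (1 - q)*(1 - p))"

lemma proj_rotation:
 fixes p q :: "'a::banach_star"
 assumes p: "is_proj p" and q: "is_proj q" and n: "norm (q - p) < 1"
 shows "is_unitary (proj_rotation q p)" "proj_rotation q p*p = q*proj_rotation q p"
  "norm (1 - star (q*p + (1 - q)*(1 - p))*(q*p + (1 - q)*(1 - p))) <= norm (q - p) ^ 2"
proof -
 have pp: "p*p = p" "star p = p" "q*q = q" "star q = q" using p q by(auto simp: is_proj_def)
 have ppa: "p*(p*c) = p*c" "q*(q*c) = q*c" for c
  using pp by(metis mult.assoc)+
 let ?x = "q*p + (1 - q)*(1 - p)" and ?d = "(q - p)*(q - p)"
 have sx: "star ?x = p*q + (1 - p)*(1 - q)"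
  by(simp add: star_add star_mult star_diff pp)
 have e: "1 - star ?x*?x = ?d" "1 - ?x * star ?x = ?d"
  unfolding sx by(simp_all add: algebra_simps pp ppa)
 have nd: "norm ?d <= norm (q - p) ^ 2" using norm_mult_ineq[of "q - p" "q - p"] by(simp add: power2_eq_square)
 also have "... < 1" using n by(simp add: power_less_one_iff)
 finally have nd1: "norm ?d < 1" .
 show "is_unitary (proj_rotation q p)"
  unfolding proj_rotation_def by(rule polar_unitary) (simp_all add: e nd1)
 have c: "p*isqrt ?d = isqrt ?d*p"
  by(rule isqrt_intertwine) (use nd1 in "simp_all add: algebra_simps pp ppa")
 have xp: "?x*p = q*?x" by(simp add: algebra_simps pp ppa)
 have "proj_rotation q p*p = ?x*(isqrt ?d*p)"
  unfolding proj_rotation_def polar_def e by(simp add: mult.assoc)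
 also have "... = ?x*p*isqrt ?d" by(simp add: c[symmetric] mult.assoc)
 also have "... = q*(?x*isqrt ?d)" unfolding xp by(simp add: mult.assoc)
 finally show "proj_rotation q p*p = q*proj_rotation q p"
  unfolding proj_rotation_def polar_def e .
 show "norm (1 - star ?x*?x) <= norm (q - p) ^ 2" unfolding e by(rule nd)
qed

lemma proj_rotation_self: "is_proj p ==> proj_rotation p p = 1"
 by(force simp: is_proj_def algebra_simps proj_rotation_def polar_of_unitary is_unitary_def)

lemma continuous_on_proj_rotation:
 assumes "cont S f" "cont S g" "!!x. x:S ==> is_proj (f x)" "!!x. x:S ==> is_proj (g x)"
  "!!x. x:S ==> norm (f x - g x) <= 1/2"
 shows "cont S (%x. proj_rotation (f x) (g x))"
 unfolding proj_rotation_def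
proof (intro continuous_intros assms)
 fix x assume x: "x:S"
 have "norm (f x - g x) < 1" using assms(5)[OF x] by simp
 from proj_rotation(3)[OF assms(4)[OF x] assms(3)[OF x] this]
 have "norm (1 - star (f x*g x + (1 - f x)*(1 - g x))*(f x*g x + (1 - f x)*(1 - g x))) <= (1/2) ^ 2"
  by(rule order_trans) (intro power_mono assms(5)[OF x] norm_ge_zero)
 thus "norm (1 - star (f x*g x + (1 - f x)*(1 - g x))*(f x*g x + (1 - f x)*(1 - g x))) <= 1/2"
  by(simp add: power2_eq_square)
qed

text \<open>Parallel transport: composing the rotations \<open>proj_rotation\<close> along a fine partition, with the
 parameter clamped to \<open>min t (i/N)\<close>, makes all factors continuous on the whole interval.\<close>

lemma parallel_transport:
 fixes R :: "real \<times> 'k::metric_space => 'a::banach_star"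
 assumes K: "compact K" and R: "cont ({0..1} \<times> K) R"
  and pr: "!!t z. t:{0..1} ==> z:K ==> is_proj (R (t,z))"
  and S: "!!t z. t:{0..1} ==> z:K ==> R (t,z):S" "closed_alg S"
 obtains U where "cont ({0..1} \<times> K) U" "!!z. z:K ==> U (0,z) = 1"
  "!!t z. t:{0..1} ==> z:K ==> is_unitary (U (t,z)) & U (t,z) * R (0,z) = R (t,z)*U (t,z) & U (t,z):S"
proof -
 have "uniformly_continuous_on ({0..1} \<times> K) R"
  by(intro compact_uniformly_continuous R compact_Times K) auto
 hence "EX d>0. ALL x:{0..1} \<times> K. ALL y:{0..1} \<times> K. dist y x < d --> dist (R y) (R x) < 1/2"
  unfolding uniformly_continuous_on_def by(elim allE[where x = "1/2"]) simp
 then obtain d where d: "d > 0" and dd: "!!x y. x:{0..1} \<times> K ==> y:{0..1} \<times> K ==> dist y x < d ==> dist (R y) (R x) < 1/2"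
  by blast
 obtain N where N: "N > 0" "1 / real N < d"
  using d by(metis ex_inverse_of_nat_less inverse_eq_divide)
 define c where "c i t = min t (real i / N)" for i t
 have c01: "c i t:{0..1}" if "t:{0..1}" for i t using that by(auto simp: c_def intro: min.coboundedI1)
 have close: "norm (R (c (Suc i) t,z) - R (c i t,z)) < 1/2" if "t:{0..1}" "z:K" for i t z
 proof -
  have "real (Suc i) / N = real i / N + 1 / N" by(simp add: add_divide_distrib)
  moreover have "1 / real N > 0" using N by simp
  ultimately have "\<bar>c (Suc i) t - c i t\<bar> <= 1 / N" unfolding c_def by linarith
  hence "dist (c (Suc i) t,z) (c i t,z) < d" using N by(simp add: dist_Pair_Pair dist_real_def)
  from dd[OF _ _ this] show ?thesis using c01[OF that(1)] that(2) by(simp add: dist_norm)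
 qed
 have cc: "cont ({0..1} \<times> K) (%x. R (c i (fst x),snd x))" for i
  by(rule continuous_on_compose2[OF R]) (use c01 in "auto intro!: continuous_intros simp: c_def")
 have "EX U. cont ({0..1} \<times> K) U & (ALL z:K. U (0,z) = 1) &
   (ALL t:{0..1}. ALL z:K. is_unitary (U (t,z)) & U (t,z) * R (0,z) = R (c i t,z)*U (t,z) & U (t,z):S)" for i
 proof (induction i)
  case 0
  have "c 0 t = 0" if "t:{0..1}" for t using that by(auto simp: c_def)
  thus ?case
   by(intro exI[of _ "%_. 1"]) (auto simp: is_unitary_def closed_algD(2)[OF S(2)])
 next
  case (Suc i)
  then obtain U where U: "cont ({0..1} \<times> K) U" "!!z. z:K ==> U (0,z) = 1"
   "!!t z. t:{0..1} ==> z:K ==> is_unitary (U (t,z)) & U (t,z) * R (0,z) = R (c i t,z)*U (t,z) & U (t,z):S"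
   by blast
  define W where "W x = proj_rotation (R (c (Suc i) (fst x),snd x)) (R (c i (fst x),snd x))" for x
  have "cont ({0..1} \<times> K) W" unfolding W_def
   by(rule continuous_on_proj_rotation[OF cc cc]) (use close pr c01 in "force simp: less_imp_le")+
  hence "cont ({0..1} \<times> K) (%x. W x*U x)" by(intro continuous_intros U(1))
  moreover have "W (0,z)*U (0,z) = 1" if "z:K" for z
  proof -
   have "c j 0 = 0" for j by(simp add: c_def)
   thus ?thesis using U(2)[OF that] proj_rotation_self[OF pr[of 0 z]] that by(simp add: W_def)
  qed
  moreover have "is_unitary (W (t,z)*U (t,z)) & W (t,z)*U (t,z) * R (0,z) = R (c (Suc i) t,z)*(W (t,z)*U (t,z))
    & W (t,z)*U (t,z):S"
   if tz: "t:{0..1}" "z:K" for t z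
  proof -
   have cl: "norm (R (c (Suc i) t,z) - R (c i t,z)) < 1" using close[OF tz, of i] by simp
   note P = proj_rotation[OF pr[OF c01[OF tz(1)] tz(2)] pr[OF c01[OF tz(1)] tz(2)] cl]
   have "norm (1 - star (R (c (Suc i) t,z) * R (c i t,z) + (1 - R (c (Suc i) t,z))*(1 - R (c i t,z))) *
    (R (c (Suc i) t,z) * R (c i t,z) + (1 - R (c (Suc i) t,z))*(1 - R (c i t,z)))) < 1"
    by(rule le_less_trans[OF P(3)]) (use cl in "simp add: power_less_one_iff")
   hence WS: "W (t,z):S" unfolding W_def proj_rotation_def
    by(intro polar_mem S(2)) (auto intro!: closed_algD[OF S(2)] S(1) c01 tz simp del: atLeastAtMost_iff)
   have W: "is_unitary (W (t,z))" "W (t,z) * R (c i t,z) = R (c (Suc i) t,z)*W (t,z)"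
    using P(1,2) by(simp_all add: W_def)
   have "W (t,z)*U (t,z) * R (0,z) = W (t,z)*(R (c i t,z)*U (t,z))"
    using U(3)[OF tz] by(simp add: mult.assoc)
   also have "... = R (c (Suc i) t,z)*(W (t,z)*U (t,z))" using W(2) by(metis mult.assoc)
   finally show ?thesis using is_unitary_mult[OF W(1)] U(3)[OF tz] WS closed_algD(4)[OF S(2)] by blast
  qed
  ultimately show ?case by(intro exI[of _ "%x. W x*U x"]) auto
 qed
 from this[of N] obtain U where U: "cont ({0..1} \<times> K) U" "!!z. z:K ==> U (0,z) = 1"
   "!!t z. t:{0..1} ==> z:K ==> is_unitary (U (t,z)) & U (t,z) * R (0,z) = R (c N t,z)*U (t,z) & U (t,z):S"
  by blast
 have "c N t = t" if "t:{0..1}" for t using that N by(simp add: c_def)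
 thus thesis using U by(intro that[of U]) auto
qed

lemma murray_von_neumann_perturbation:
 fixes y p f :: "'a::banach_star"
 assumes p: "is_proj p" and f: "is_proj f" and y: "p*y = y" "y*f = y"
  and n: "norm (f - star y*y) < 1" "norm (p - y * star y) < 1"
  and S: "closed_alg S" "y:S" "f:S"
 obtains u where "u:S" "star u*u = f" "u * star u = p" "p*u = u" "u*f = u"
proof -
 let ?a = "f - star y*y" and ?b = "p - y * star y"
 have ff: "f*f = f" "star f = f" "p*p = p" "star p = p" using f p by(auto simp: is_proj_def)
 have fy: "f * star y = star y" "star y*p = star y"
  using arg_cong[OF y(2), of star] arg_cong[OF y(1), of star] by(simp_all add: star_mult ff)
 have fya: "f*(star y*c) = star y*c" "star y*(p*c) = star y*c" "p*(y*c) = y*c" "y*(f*c) = y*c" for c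
  using fy y by(metis mult.assoc)+
 let ?g = "isqrt ?a" and ?h = "isqrt ?b"
 have sg: "star ?g = ?g" using isqrt_star[OF n(1)] by(simp add: star_diff star_mult ff)
 have sh: "star ?h = ?h" using isqrt_star[OF n(2)] by(simp add: star_diff star_mult ff)
 have yg: "y*?g = ?h*y"
  by(rule isqrt_intertwine) (use n in "simp_all add: algebra_simps fya y")
 have gf: "f*?g = ?g*f" by(rule isqrt_intertwine) (use n in "simp_all add: algebra_simps fya y fy ff")
 have hp: "p*?h = ?h*p" by(rule isqrt_intertwine) (use n in "simp_all add: algebra_simps fya y fy ff")
 have ga: "(star y*y)*?g = ?g*(star y*y)"
  by(rule isqrt_intertwine) (use n in "simp_all add: algebra_simps fya y fy ff")
 have hb: "(y * star y)*?h = ?h*(y * star y)"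
  by(rule isqrt_intertwine) (use n in "simp_all add: algebra_simps fya y fy ff")
 let ?u = "y*?g"
 have "star ?u*?u = ?g*(star y*y)*?g" by(simp add: star_mult sg mult.assoc)
 also have "... = ?g*?g*(star y*y)" using ga by(simp add: mult.assoc)
 also have "... = ?g*?g*(1 - ?a)*f" by(simp add: algebra_simps ff y)
 also have "... = f" using isqrt_square(1)[OF n(1)] by simp
 finally have 1: "star ?u*?u = f" .
 have "?u * star ?u = ?h*(y * star y)*?h" unfolding yg by(simp add: star_mult sh mult.assoc)
 also have "... = ?h*?h*(y * star y)" using hb by(simp add: mult.assoc)
 also have "... = ?h*?h*(1 - ?b)*p" by(simp add: algebra_simps ff fy)
 also have "... = p" using isqrt_square(1)[OF n(2)] by simp
 finally have 2: "?u * star ?u = p" .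
 have "?u:S" using S n by(intro closed_algD(4)[OF S(1)] isqrt_mem closed_algD(9)[OF S(1)] closed_algD(5)[OF S(1)])
 moreover have "p*?u = ?u" using fya(3) by simp
 moreover have "?u*f = ?u" using gf y(2) by(metis mult.assoc)
 ultimately show thesis using that 1 2 by blast
qed

text \<open>If \<open>a\<close> is selfadjoint and almost idempotent, \<open>(2 a - 1)(1 - 4 (a - a\<^sup>2))\<^sup>-\<^sup>1\<^sup>/\<^sup>2\<close> is a selfadjoint
 unitary, because \<open>(2 a - 1)\<^sup>2 = 1 - 4 (a - a\<^sup>2)\<close>.\<close>

definition proj_round :: "'a::banach_star => 'a" where
 "proj_round a = (1/2) *R (1 + (2 *R a - 1)*isqrt (4 *R (a - a*a)))"

lemma proj_round:
 fixes a :: "'a::banach_star"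
 assumes "star a = a" "norm (4 *R (a - a*a)) < 1"
 shows "is_proj (proj_round a)" "closed_alg S ==> a:S ==> proj_round a:S"
proof -
 let ?y = "4 *R (a - a*a)" and ?s = "2 *R a - 1"
 let ?g = "isqrt ?y"
 have sg: "star ?g = ?g" using isqrt_star[OF assms(2)] by(simp add: star_diff star_mult star_scaleR assms)
 have c: "?s*?g = ?g*?s" by(rule isqrt_intertwine) (use assms in "simp_all add: algebra_simps")
 have ss: "?s*?s = 1 - ?y"
 proof -
  have "?s*?s = 4 *R (a*a) - 2 *R a - 2 *R a + 1" by(simp add: algebra_simps)
  also have "2 *R a + 2 *R a = 4 *R a" by(simp add: scaleR_left.add[symmetric])
  hence "4 *R (a*a) - 2 *R a - 2 *R a + 1 = 1 - ?y" by(simp add: algebra_simps)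
  finally show ?thesis .
 qed
 have "(?s*?g)*(?s*?g) = ?s*(?g*?s)*?g" by(simp only: mult.assoc)
 also have "... = (?s*?s)*(?g*?g)" by(simp only: c[symmetric] mult.assoc)
 also have "... = 1" unfolding ss by(rule isqrt_square(2)[OF assms(2)])
 finally have sq: "(?s*?g)*(?s*?g) = 1" .
 have st: "star (?s*?g) = ?s*?g" using c by(simp add: star_mult sg star_diff star_scaleR assms)
 define t where "t = ?s*?g"
 have tt: "t*t = 1" unfolding t_def by(rule sq)
 have pt: "proj_round a = (1/2) *R (1 + t)" by(simp add: proj_round_def t_def)
 have "(1 + t)*(1 + t) = 2 *R (1 + t)"
  by(simp add: tt scaleR_2 distrib_left distrib_right)
 hence "proj_round a*proj_round a = (1/4) *R (2 *R (1 + t))"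
  unfolding pt by(simp del: scaleR_add_right)
 also have "... = proj_round a" by(simp add: pt)
 finally show "is_proj (proj_round a)"
  by(simp add: is_proj_def proj_round_def star_scaleR star_add st del: star_mult)
 show "proj_round a:S" if "closed_alg S" "a:S"
  unfolding proj_round_def using assms that
  by(intro closed_algD(3,4,6,9,2)[OF that(1)] isqrt_mem that(1)) auto
qed

lemma proj_round_self: "is_proj p ==> proj_round p = p"
 by(simp add: proj_round_def is_proj_def)

section \<open>Finite matrices over a Banach algebra\<close>

definition rcsum :: "('i set => 'i => 'i => 'b::real_normed_vector) => 'i set => 'i => real" where
 "rcsum a J i = max (SUM j:J. norm (a J i j)) (SUM j:J. norm (a J j i))"

lemma rcsum_le_iff: "rcsum a J i <= C <-> (SUM j:J. norm (a J i j)) <= C & (SUM j:J. norm (a J j i)) <= C"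
 by(simp add: rcsum_def)

lemma rcsum_nonneg: "0 <= rcsum a J i"
 by(simp add: rcsum_def sum_nonneg le_max_iff_disj)

lemma rcsum_triangle: "rcsum (%J i j. a J i j + b J i j) J i <= rcsum a J i + rcsum b J i"
proof -
 have "(SUM j:J. norm (a J i j + b J i j)) <= (SUM j:J. norm (a J i j)) + (SUM j:J. norm (b J i j))"
  "(SUM j:J. norm (a J j i + b J j i)) <= (SUM j:J. norm (a J j i)) + (SUM j:J. norm (b J j i))"
  by(auto simp: sum.distrib[symmetric] intro: sum_mono norm_triangle_ineq)
 thus ?thesis by(auto simp: rcsum_def)
qed

lemma rcsum_scaleR: "rcsum (%J i j. c *R a J i j) J i = \<bar>c\<bar>*rcsum a J i"
 by(simp add: rcsum_def sum_distrib_left[symmetric] max_mult_distrib_left)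

lemma rcsum_entry: "finite J ==> j:J ==> norm (a J i j) <= rcsum a J i"
 using member_le_sum[of j J "%j. norm (a J i j)"] by(simp add: rcsum_def le_max_iff_disj)

lemma rcsum_mult:
 fixes a b :: "'i set => 'i => 'i => 'b::real_normed_algebra"
 assumes "!!i. rcsum a J i <= C" "!!i. rcsum b J i <= D"
 shows "rcsum (%J i j. SUM k:J. a J i k*b J k j) J i <= C*D"
proof -
 have C: "0 <= C" "0 <= D" by(rule order_trans[OF rcsum_nonneg assms(1)], rule order_trans[OF rcsum_nonneg assms(2)])
 note A = assms[unfolded rcsum_le_iff]
 have "(SUM j:J. norm (SUM k:J. a J i k*b J k j)) <= (SUM j:J. SUM k:J. norm (a J i k)*norm (b J k j))"
  by(intro sum_mono order_trans[OF norm_sum] norm_mult_ineq)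
 also have "... = (SUM k:J. norm (a J i k)*(SUM j:J. norm (b J k j)))"
  by(subst sum.swap) (simp add: sum_distrib_left)
 also have "... <= (SUM k:J. norm (a J i k)*D)"
  using A by(intro sum_mono mult_left_mono) auto
 also have "... <= C*D" unfolding sum_distrib_right[symmetric] using A C by(intro mult_right_mono) auto
 finally have 1: "(SUM j:J. norm (SUM k:J. a J i k*b J k j)) <= C*D" .
 have "(SUM j:J. norm (SUM k:J. a J j k*b J k i)) <= (SUM j:J. SUM k:J. norm (a J j k)*norm (b J k i))"
  by(intro sum_mono order_trans[OF norm_sum] norm_mult_ineq)
 also have "... = (SUM k:J. (SUM j:J. norm (a J j k))*norm (b J k i))"
  by(subst sum.swap) (simp add: sum_distrib_right)
 also have "... <= (SUM k:J. C*norm (b J k i))"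
  using A by(intro sum_mono mult_right_mono) auto
 also have "... <= C*D" unfolding sum_distrib_left[symmetric] using A C by(intro mult_left_mono) auto
 finally show ?thesis using 1 by(simp add: rcsum_le_iff)
qed

text \<open>The bounded families of \<open>J \<times> J\<close> matrices, \<open>J\<close> ranging over all finite index sets, form one
 Banach algebra, so that the matrix algebras of all sizes are summands of a single type.\<close>

definition bdd_fam :: "('i set => 'i => 'i => 'b::real_normed_vector) => bool" where
 "bdd_fam a <-> (ALL J i j. ~ (finite J & i:J & j:J) --> a J i j = 0) & (EX C. ALL J i. rcsum a J i <= C)"

lemma bdd_famI: "(!!J i j. ~ (finite J & i:J & j:J) ==> a J i j = 0) ==> (!!J i. rcsum a J i <= C) ==> bdd_fam a"
 unfolding bdd_fam_def by blast

lemma bdd_famE: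
 assumes "bdd_fam a"
 obtains C where "!!J i. rcsum a J i <= C" "!!J i j. ~ (finite J & i:J & j:J) ==> a J i j = 0"
 using assms unfolding bdd_fam_def by blast

typedef (overloaded) ('i, 'b::banach_star) mfam = "{a :: 'i set => 'i => 'i => 'b. bdd_fam a}"
 morphisms ent Abs_mfam
 by(rule exI[of _ "%_ _ _. 0"]) (auto simp: rcsum_def bdd_fam_def)

setup_lifting type_definition_mfam

lemma ent_outside: "~ (finite J & i:J & j:J) ==> ent a J i j = 0"
 using ent[of a] by(auto elim: bdd_famE)

lemma ent_bounded: "EX C. ALL J i. rcsum (ent a) J i <= C"
 using ent[of a] by(auto simp: bdd_fam_def)

lemma mfam_eqI: "(!!J i j. finite J ==> i:J ==> j:J ==> ent a J i j = ent b J i j) ==> a = b"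
 by(metis (no_types, opaque_lifting) ent_inject ent_outside ext)

instantiation mfam :: (type, banach_star) "real_normed_algebra_1"
begin

lift_definition zero_mfam :: "('a,'b) mfam" is "%_ _ _. 0"
 by(rule bdd_famI) (auto simp: rcsum_def)

lift_definition one_mfam :: "('a,'b) mfam" is
 "%J i j. if finite J & i:J & j = i then 1 else 0"
proof -
 have "rcsum (%J i j. if finite J & i:J & j = i then 1 else 0 :: 'b) J i <= 1" for J :: "'a set" and i
 proof (cases "finite J & i:J")
  case True
  have "(SUM j:J. norm (if finite J & j:J & i = j then 1 else 0 :: 'b)) = (SUM j:J. if i = j then 1 else (0::real))"
   "(SUM j:J. norm (if finite J & i:J & j = i then 1 else 0 :: 'b)) = (SUM j:J. if j = i then 1 else (0::real))"
   by(rule sum.cong; use True in auto)+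
  thus ?thesis using True
   unfolding rcsum_le_iff by(simp only: sum.delta sum.delta') simp
 next
  case False
  have "(SUM j:J. norm (if finite J & j:J & i = j then 1 else 0 :: 'b)) = 0"
   "(SUM j:J. norm (if finite J & i:J & j = i then 1 else 0 :: 'b)) = 0"
   by(rule sum.neutral; use False in auto)+
  thus ?thesis unfolding rcsum_le_iff by simp
 qed
 thus ?thesis by(rule bdd_famI[rotated]) auto
qed

lift_definition plus_mfam :: "('a,'b) mfam => ('a,'b) mfam => ('a,'b) mfam" is
 "%a b J i j. a J i j + b J i j"
 by(elim bdd_famE, rule bdd_famI, simp) (rule order_trans[OF rcsum_triangle add_mono])

lift_definition scaleR_mfam :: "real => ('a,'b) mfam => ('a,'b) mfam" is
 "%c a J i j. c *R a J i j"
 by(elim bdd_famE, rule bdd_famI, simp) (unfold rcsum_scaleR, rule mult_left_mono, auto)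

lift_definition uminus_mfam :: "('a,'b) mfam => ('a,'b) mfam" is "%a J i j. - a J i j"
 by(simp add: rcsum_def bdd_fam_def)

definition minus_mfam :: "('a,'b) mfam => ('a,'b) mfam => ('a,'b) mfam" where
 "minus_mfam a b = a + - b"

lift_definition times_mfam :: "('a,'b) mfam => ('a,'b) mfam => ('a,'b) mfam" is
 "%a b J i j. SUM k:J. a J i k*b J k j"
 by(elim bdd_famE, rule bdd_famI, rule sum.neutral, metis mult_zero_left mult_zero_right) (rule rcsum_mult; blast)

definition norm_mfam :: "('a,'b) mfam => real" where
 "norm_mfam a = (SUP x. rcsum (ent a) (fst x) (snd x))"

definition dist_mfam :: "('a,'b) mfam => ('a,'b) mfam => real" where
 "dist_mfam a b = norm (a - b)"

definition uniformity_mfam :: "(('a,'b) mfam \<times> ('a,'b) mfam) filter" where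
 "uniformity_mfam = (INF e\<in>{0<..}. principal {(x,y). dist x y < e})"

definition open_mfam :: "('a,'b) mfam set => bool" where
 "open_mfam U = (ALL x:U. \<forall>\<^sub>F (x',y) in uniformity. x' = x --> y:U)"

definition sgn_mfam :: "('a,'b) mfam => ('a,'b) mfam" where
 "sgn_mfam a = inverse (norm a) *R a"

lemmas ent_simps [simp] = zero_mfam.rep_eq plus_mfam.rep_eq scaleR_mfam.rep_eq uminus_mfam.rep_eq

lemma ent_diff [simp]: "ent (a - b) J i j = ent a J i j - ent b J i j"
 by(simp add: minus_mfam_def)

lemma ent_one: "ent 1 J i j = (if finite J & i:J & j = i then 1 else 0)"
 by(simp add: one_mfam.rep_eq)

lemma ent_mult: "ent (a*b) J i j = (SUM k:J. ent a J i k*ent b J k j)"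
 by(simp add: times_mfam.rep_eq)

lemma rcsum_le_norm: "rcsum (ent a) J i <= norm a"
proof -
 obtain C where "!!J i. rcsum (ent a) J i <= C" using ent_bounded by blast
 hence "bdd_above (range (%x. rcsum (ent a) (fst x) (snd x)))" by(auto intro!: bdd_aboveI)
 from cSUP_upper[OF _ this, of "(J,i)"] show ?thesis by(simp add: norm_mfam_def)
qed

lemma norm_mfam_le: "(!!J i. finite J ==> rcsum (ent a) J i <= C) ==> norm a <= C"
 unfolding norm_mfam_def
proof (rule cSUP_least)
 fix x :: "'a set \<times> 'a"
 assume *: "!!J i. finite J ==> rcsum (ent a) J i <= C"
 from *[of "{}"] have "0 <= C" by(simp add: rcsum_def)
 thus "rcsum (ent a) (fst x) (snd x) <= C"
  using * by(cases "finite (fst x)") (auto simp: rcsum_def)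
qed simp

lemma ent_le_norm: "norm (ent a J i j) <= norm a"
proof (cases "finite J & j:J")
 case True
 thus ?thesis using order_trans[OF rcsum_entry rcsum_le_norm] by blast
next
 case False
 thus ?thesis using ent_outside[of J i j a] rcsum_le_norm[of a "{}" i] by(auto simp: rcsum_def)
qed

instance
proof
 fix a b c :: "('a,'b) mfam" and r s :: real and U :: "('a,'b) mfam set"
 show "a + b + c = a + (b + c)" "a + b = b + a" "0 + a = a" "- a + a = 0" "a - b = a + - b"
  "r *R (a + b) = r *R a + r *R b" "(r + s) *R a = r *R a + s *R a" "r *R s *R a = (r * s) *R a" "1 *R a = a"
  by(rule mfam_eqI, simp add: algebra_simps; fail)+
 show "a*b*c = a*(b*c)"
 proof (rule mfam_eqI)
  fix J :: "'a set" and i j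
  show "ent (a*b*c) J i j = ent (a*(b*c)) J i j"
   by(simp add: ent_mult sum_distrib_left sum_distrib_right mult.assoc) (rule sum.swap)
 qed
 show "1*a = a"
  by(rule mfam_eqI) (simp add: ent_mult ent_one if_distrib[of "%x. x*_"] cong: if_cong)
 show "a*1 = a"
  by(rule mfam_eqI) (simp add: ent_mult ent_one if_distrib[of "%x. _*x"] cong: if_cong conj_cong)
 show "(a + b)*c = a*c + b*c" "a*(b + c) = a*b + a*c"
  by(rule mfam_eqI, simp add: ent_mult algebra_simps sum.distrib; fail)+
 have "ent 0 {i} i i ~= ent (1 :: ('a,'b) mfam) {i} i i" for i by(simp add: ent_one)
 thus "(0 :: ('a,'b) mfam) ~= 1" by metis
 show "r *R a*b = r *R (a*b)" "a*r *R b = r *R (a*b)"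
  by(rule mfam_eqI, simp add: ent_mult scaleR_sum_right; fail)+
 show "dist a b = norm (a - b)" "sgn a = inverse (norm a) *R a"
  "uniformity = (INF e\<in>{0<..}. principal {(x :: ('a,'b) mfam,y). dist x y < e})"
  "open U = (ALL x:U. \<forall>\<^sub>F (x',y) in uniformity. x' = x --> y:U)"
  by(simp_all only: dist_mfam_def sgn_mfam_def uniformity_mfam_def open_mfam_def)
 show "norm a = 0 <-> a = 0"
 proof
  assume "norm a = 0"
  thus "a = 0" using ent_le_norm[of a] by(intro mfam_eqI) simp
 next
  assume "a = 0"
  hence "norm a <= 0" by(intro norm_mfam_le) (simp add: rcsum_def)
  thus "norm a = 0" using rcsum_le_norm[of a] rcsum_nonneg[of "ent a"] by(meson order_antisym order_trans)
 qed
 show "norm (a + b) <= norm a + norm b"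
 proof (rule norm_mfam_le)
  fix J :: "'a set" and i
  show "rcsum (ent (a + b)) J i <= norm a + norm b"
   using rcsum_triangle[of "ent a" "ent b" J i] rcsum_le_norm[of a J i] rcsum_le_norm[of b J i]
   by(simp add: plus_mfam.rep_eq)
 qed
 show "norm (r *R a) = \<bar>r\<bar>*norm a"
 proof -
  have le: "norm (r *R a) <= \<bar>r\<bar>*norm a" for r and a :: "('a,'b) mfam"
   by(rule norm_mfam_le) (simp add: scaleR_mfam.rep_eq rcsum_scaleR mult_left_mono rcsum_le_norm)
  have "norm (0 :: ('a,'b) mfam) <= 0" by(intro norm_mfam_le) (simp add: rcsum_def)
  hence n0: "norm (0 :: ('a,'b) mfam) = 0"
   using order_trans[OF rcsum_nonneg rcsum_le_norm[of "0::('a,'b) mfam"]] by(intro order_antisym)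
  show ?thesis
  proof (cases "r = 0")
   case False
   have "inverse r *R r *R a = a" by(rule mfam_eqI) (simp add: False)
   hence "norm a <= \<bar>inverse r\<bar>*norm (r *R a)" using le[of "inverse r" "r *R a"] by simp
   hence "\<bar>r\<bar>*norm a <= norm (r *R a)" using False by(simp add: field_simps abs_inverse)
   with le[of r a] show ?thesis by linarith
  next
   case True
   have "0 *R a = 0" by(rule mfam_eqI) simp
   thus ?thesis using True n0 by simp
  qed
 qed
 show "norm (a*b) <= norm a*norm b"
  by(rule norm_mfam_le) (simp add: times_mfam.rep_eq rcsum_mult rcsum_le_norm)
 show "norm (1 :: ('a,'b) mfam) = 1"
 proof (rule antisym)
  show "norm (1 :: ('a,'b) mfam) <= 1"
  proof (rule norm_mfam_le)
   fix J :: "'a set" and i assume "finite J"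
   thus "rcsum (ent (1 :: ('a,'b) mfam)) J i <= 1"
    by(cases "i:J") (auto simp: rcsum_le_iff ent_one if_distrib[of norm] cong: if_cong conj_cong)
  qed
  fix i :: 'a
  show "1 <= norm (1 :: ('a,'b) mfam)" using ent_le_norm[of "1 :: ('a,'b) mfam" "{undefined}" undefined undefined]
   by(simp add: ent_one)
 qed
qed

end

lemma bounded_linear_ent: "bounded_linear (%a. ent a J i j)"
 by(rule bounded_linear_intro[where K = 1]) (simp_all add: ent_le_norm)

lemmas continuous_on_ent [continuous_intros] = bounded_linear.continuous_on[OF bounded_linear_ent]

instance mfam :: (type, banach_star) banach
proof
 fix X :: "nat => ('a,'b) mfam"
 assume X: "Cauchy X"
 have "convergent (%n. ent (X n) J i j)" for J i j
  using Cauchy_convergent bounded_linear.Cauchy[OF bounded_linear_ent X] by blast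
 then obtain L where L: "!!J i j. (%n. ent (X n) J i j) \<longlonglongrightarrow> L J i j"
  unfolding convergent_def by metis
 have L0: "L J i j = 0" if "~ (finite J & i:J & j:J)" for J i j
 proof -
  have "(%n. ent (X n) J i j) = (%n. 0)" using ent_outside[OF that] by auto
  thus ?thesis using LIMSEQ_unique[OF L[of J i j]] by simp
 qed
 have conv: "EX M. ALL m>=M. ALL J i. rcsum (%J i j. L J i j - ent (X m) J i j) J i <= e" if "e > 0" for e
 proof -
  from X that obtain M where M: "!!m n. m >= M ==> n >= M ==> norm (X n - X m) < e"
   unfolding Cauchy_def dist_norm by metis
  show ?thesis
  proof (intro exI[of _ M] allI impI)
   fix m J i assume m: "M <= m"
   have lim: "(%n. rcsum (ent (X n - X m)) J i) \<longlonglongrightarrow> rcsum (%J i j. L J i j - ent (X m) J i j) J i"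
    unfolding rcsum_def ent_diff by(intro tendsto_intros L)
   have "rcsum (ent (X n - X m)) J i <= e" if "n >= M" for n
    using rcsum_le_norm[of "X n - X m" J i] M[OF m that] by linarith
   thus "rcsum (%J i j. L J i j - ent (X m) J i j) J i <= e"
    by(intro LIMSEQ_le_const2[OF lim]) auto
  qed
 qed
 obtain M where M: "!!J i. rcsum (%J i j. L J i j - ent (X M) J i j) J i <= 1"
  using conv[of 1] by auto
 have "rcsum L J i <= 1 + norm (X M)" for J i
  using rcsum_triangle[of "%J i j. L J i j - ent (X M) J i j" "ent (X M)" J i] M[of J i] rcsum_le_norm[of "X M" J i]
  by simp
 hence eL: "ent (Abs_mfam L) = L" using L0 by(intro Abs_mfam_inverse CollectI bdd_famI) auto
 have "X \<longlonglongrightarrow> Abs_mfam L"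
 proof (rule LIMSEQ_I)
  fix e :: real assume "e > 0"
  then obtain M where M: "!!m J i. m >= M ==> rcsum (%J i j. L J i j - ent (X m) J i j) J i <= e / 2"
   using conv[of "e/2"] by auto
  have "norm (X m - Abs_mfam L) < e" if "m >= M" for m
  proof -
   have "ent (Abs_mfam L - X m) = (%J i j. L J i j - ent (X m) J i j)"
    by(simp add: fun_eq_iff eL)
   hence "norm (Abs_mfam L - X m) <= e / 2"
    using M[OF that] by(intro norm_mfam_le) simp
   thus ?thesis using `e > 0` by(simp add: norm_minus_commute)
  qed
  thus "EX no. ALL n>=no. norm (X n - Abs_mfam L) < e" by blast
 qed
 thus "convergent X" by(auto simp: convergent_def)
qed

instantiation mfam :: (type, banach_star) banach_star
begin

lift_definition star_mfam :: "('a,'b) mfam => ('a,'b) mfam" is "%a J i j. star (a J j i)"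
 by(auto simp: bdd_fam_def rcsum_def max.commute)

lemma ent_star [simp]: "ent (star a) J i j = star (ent a J j i)"
 by(simp add: star_mfam.rep_eq)

instance
proof
 fix a b :: "('a,'b) mfam" and c :: real
 show "star (star a) = a" "star (a + b) = star a + star b" "star (c *R a) = c *R star a"
  "star (a*b) = star b * star a"
  by(rule mfam_eqI, simp add: star_add star_scaleR ent_mult star_sum star_mult; fail)+
 have "rcsum (ent (star a)) J i = rcsum (ent a) J i" for J i
  by(simp add: rcsum_def max.commute)
 thus "norm (star a) = norm a" by(simp add: norm_mfam_def)
qed

end

text \<open>A matrix is a function of two indices; only its entries in \<open>J \<times> J\<close> matter to \<open>memb J\<close>.\<close>

definition mm :: "'k set => ('i => 'k => 'b::semiring_0) => ('k => 'j => 'b) => 'i => 'j => 'b" where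
 "mm J a b i j = (SUM k:J. a i k*b k j)"

definition madj :: "('i => 'j => 'b::banach_star) => 'j => 'i => 'b" where
 "madj a i j = star (a j i)"

definition mone :: "'i set => 'i => 'i => 'b::ring_1" where
 "mone J i j = (if i = j & i:J then 1 else 0)"

definition msupp :: "'i set => 'j set => ('i => 'j => 'b::zero) => bool" where
 "msupp I J a <-> (ALL i j. ~ (i:I & j:J) --> a i j = 0)"

lemma mm_assoc: "mm K (mm J a b) c = mm J a (mm K b c)"
 by(intro ext) (simp add: mm_def sum_distrib_left sum_distrib_right mult.assoc sum.swap[of _ K J])

lemma madj_mm: "madj (mm J a b) = mm J (madj b) (madj a)"
 by(intro ext) (simp add: mm_def madj_def star_sum star_mult)

lemma madj_madj [simp]: "madj (madj a) = a"
 by(intro ext) (simp add: madj_def)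

lemma madj_mone [simp]: "madj (mone J) = mone J"
 by(intro ext) (auto simp: mone_def madj_def)

lemma msupp_madj: "msupp I J a ==> msupp J I (madj a)"
 by(auto simp: msupp_def madj_def)

lemma msupp_mm: "msupp I K a ==> msupp K' J b ==> msupp I J (mm L a b)"
 unfolding msupp_def mm_def by(metis (no_types, lifting) mult_zero_left mult_zero_right sum.neutral)

lemma msupp_mone: "msupp J J (mone J)"
 by(auto simp: msupp_def mone_def)

lemma mm_mone:
 assumes "finite I" "msupp I J a"
 shows "mm I (mone I) a = a"
 using assms by(intro ext) (auto simp: mm_def mone_def msupp_def if_distrib[of "%x. x*_"] cong: if_cong conj_cong)

lemma mm_mone_right:
 assumes "finite J" "msupp I J a"
 shows "mm J a (mone J) = a"
proof (intro ext)
 fix i j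
 have "mm J a (mone J) i j = (SUM k:J. if k = j then a i k else 0)"
  unfolding mm_def mone_def by(intro sum.cong) auto
 thus "mm J a (mone J) i j = a i j" using assms by(auto simp: msupp_def)
qed

lemma rcsum_restrict_le:
 "rcsum (%K i j. if K = J & finite J & i:J & j:J then a i j else 0) K i <= (SUM i:J. SUM j:J. norm (a i j))"
proof (cases "finite J & i:J & K = J")
 case True
 hence "(SUM j:J. norm (a i j)) <= (SUM i:J. SUM j:J. norm (a i j))"
  using member_le_sum[of i J "%i. SUM j:J. norm (a i j)"] by(simp add: sum_nonneg)
 moreover have "(SUM j:J. norm (a j i)) <= (SUM i:J. SUM j:J. norm (a i j))"
  using True member_le_sum[of i J "%k. norm (a j k)" for j] by(intro sum_mono) auto
 ultimately show ?thesis using True by(simp add: rcsum_le_iff)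
next
 case False
 hence z: "(if K = J & finite J & i:J & j:J then a i j else 0) = 0"
  "(if K = J & finite J & j:J & i:J then a j i else 0) = 0" for j by auto
 have "rcsum (%K i j. if K = J & finite J & i:J & j:J then a i j else 0) K i = 0"
  unfolding rcsum_def z by simp
 thus ?thesis by(simp add: sum_nonneg)
qed

lift_definition memb :: "'i set => ('i => 'i => 'b::banach_star) => ('i,'b) mfam" is
 "%J a K i j. if K = J & finite J & i:J & j:J then a i j else 0"
 by(rule bdd_famI[OF _ rcsum_restrict_le]) auto

lemma ent_memb: "ent (memb J a) K i j = (if K = J & finite J & i:J & j:J then a i j else 0)"
 by(simp add: memb.rep_eq)

lemma norm_memb_le: "norm (memb J a) <= (SUM i:J. SUM j:J. norm (a i j))"
 by(rule norm_mfam_le) (simp only: memb.rep_eq rcsum_restrict_le)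

lemma memb_add: "memb J (%i j. a i j + b i j) = memb J a + memb J b"
 and memb_diff: "memb J (%i j. a i j - b i j) = memb J a - memb J b"
 and memb_scaleR: "memb J (%i j. c *R a i j) = c *R memb J a"
 and memb_star: "memb J (madj a) = star (memb J a)"
 by(rule mfam_eqI, simp add: ent_memb madj_def; fail)+

lemma memb_mult: "memb J (mm J a b) = memb J a*memb J b"
proof (rule mfam_eqI)
 fix K :: "'a set" and i j assume "finite K" "i:K" "j:K"
 thus "ent (memb J (mm J a b)) K i j = ent (memb J a*memb J b) K i j"
  by(cases "K = J") (simp_all add: ent_memb ent_mult mm_def)
qed

lemma memb_eq_iff: "finite J ==> msupp J J a ==> msupp J J b ==> memb J a = memb J b <-> a = b"
proof
 assume J: "finite J" "msupp J J a" "msupp J J b" and eq: "memb J a = memb J b"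
 show "a = b"
 proof (intro ext)
  fix i j
  have "ent (memb J a) J i j = ent (memb J b) J i j" by(simp add: eq)
  thus "a i j = b i j" using J by(cases "i:J & j:J") (auto simp: ent_memb msupp_def)
 qed
qed simp

lemma ent_mone_mult:
 assumes "finite K" "i:K" "j:K"
 shows "ent (memb J (mone J)*a) K i j = (if K = J then ent a K i j else 0)"
  "ent (a*memb J (mone J)) K i j = (if K = J then ent a K i j else 0)"
proof -
 have "ent (memb J (mone J)*a) K i j = (SUM k:K. if k = i then (if K = J then ent a K k j else 0) else 0)"
  "ent (a*memb J (mone J)) K i j = (SUM k:K. if k = j then (if K = J then ent a K i k else 0) else 0)"
  unfolding ent_mult by(rule sum.cong; use assms in "auto simp: ent_memb mone_def")+
 thus "ent (memb J (mone J)*a) K i j = (if K = J then ent a K i j else 0)"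
  "ent (a*memb J (mone J)) K i j = (if K = J then ent a K i j else 0)" using assms by simp_all
qed

lemma memb_ent: "finite J ==> memb J (ent a J) = memb J (mone J)*a"
 by(rule mfam_eqI) (auto simp: ent_mone_mult ent_memb)

lemma memb_mone_commute: "memb J (mone J)*a = a*memb J (mone J)"
 by(rule mfam_eqI) (simp add: ent_mone_mult)

lemma msupp_ent: "msupp J J (ent a J)"
 by(auto simp: msupp_def ent_outside)

lemma mm_ent: "ent (a*b) J = mm J (ent a J) (ent b J)"
 by(intro ext) (simp add: ent_mult mm_def)

lemma madj_ent: "ent (star a) J = madj (ent a J)"
 by(intro ext) (simp add: madj_def)

lemma ent_one': "finite J ==> ent 1 J = mone J"
 by(intro ext) (auto simp: ent_one mone_def)

lemma ent_memb': "finite J ==> msupp J J a ==> ent (memb J a) J = a"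
 by(intro ext) (auto simp: ent_memb msupp_def)

lemma continuous_on_memb [continuous_intros]:
 assumes "!!i j. i:J ==> j:J ==> cont S (%x. f x i j)"
 shows "cont S (%x. memb J (f x))"
 unfolding continuous_on_def
proof
 fix x assume "x:S"
 have "((%y. SUM i:J. SUM j:J. norm (f y i j - f x i j)) \<longlongrightarrow> (SUM i:J. SUM j:J. norm (f x i j - f x i j))) (at x within S)"
  using assms `x:S` by(intro tendsto_intros) (auto simp: continuous_on_def)
 hence "((%y. SUM i:J. SUM j:J. norm (f y i j - f x i j)) \<longlongrightarrow> 0) (at x within S)" by simp
 hence "((%y. memb J (f y) - memb J (f x)) \<longlongrightarrow> 0) (at x within S)"
  by(rule Lim_null_comparison[rotated]) (simp add: memb_diff[symmetric] norm_memb_le)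
 thus "((%y. memb J (f y)) \<longlongrightarrow> memb J (f x)) (at x within S)" using Lim_null by blast
qed

definition membu :: "'i set => ('i => 'i => 'b::banach_star) => ('i,'b) mfam" where
 "membu J a = memb J a + (1 - memb J (mone J))"

definition umat :: "'i set => ('i => 'i => 'b::banach_star) => bool" where
 "umat J u <-> msupp J J u & mm J (madj u) u = mone J & mm J u (madj u) = mone J"

definition pmat :: "'i set => ('i => 'i => 'b::banach_star) => bool" where
 "pmat J p <-> msupp J J p & mm J p p = p & madj p = p"

lemma membu_mult:
 assumes "finite J"
 shows "membu J a*membu J b = membu J (mm J a b)"
proof -
 let ?e = "memb J (mone J)"
 have e: "?e*memb J c = memb J c" for c :: "'a => 'a => 'b"
 proof -
  have "memb J (ent (memb J c) J) = memb J c" by(rule mfam_eqI) (auto simp: ent_memb)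
  thus ?thesis by(simp add: memb_ent[OF assms])
 qed
 have e': "memb J c*?e = memb J c" for c :: "'a => 'a => 'b"
  using e[of c] memb_mone_commute[of J "memb J c"] by simp
 show ?thesis unfolding membu_def memb_mult by(simp add: algebra_simps e e')
qed

lemma membu_star: "star (membu J a) = membu J (madj a)"
 by(simp add: membu_def star_add star_diff memb_star[symmetric])

lemma membu_mone: "membu J (mone J) = 1"
 by(simp add: membu_def)

lemma ent_membu: "finite J ==> msupp J J a ==> ent (membu J a) J = a"
 by(intro ext) (auto simp: membu_def ent_memb ent_one mone_def msupp_def)

lemma umat_iff_membu: "finite J ==> umat J u <-> msupp J J u & is_unitary (membu J u)"
proof -
 assume J: "finite J"
 have eq: "membu J a = 1 <-> a = mone J" if "msupp J J a" for a :: "'a => 'a => 'b"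
  using ent_membu[OF J that] ent_one'[OF J] membu_mone by metis
 show ?thesis
  unfolding umat_def is_unitary_def membu_star membu_mult[OF J]
  using eq[OF msupp_mm[OF msupp_madj]] eq[OF msupp_mm[OF _ msupp_madj]] by blast
qed

lemma umat_ent: "finite J ==> is_unitary u ==> umat J (ent u J)"
 unfolding umat_def is_unitary_def by(metis ent_one' madj_ent mm_ent msupp_ent)

lemma pmat_iff_memb: "finite J ==> pmat J p <-> msupp J J p & is_proj (memb J p)"
 unfolding pmat_def is_proj_def memb_mult[symmetric] memb_star[symmetric]
 using memb_eq_iff[of J "mm J p p" p] memb_eq_iff[of J "madj p" p] msupp_mm[of J J p J J p J] msupp_madj[of J J p] by blast

lemma pmat_ent: "is_proj p ==> pmat J (ent p J)"
 unfolding pmat_def is_proj_def by(metis madj_ent mm_ent msupp_ent)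

definition mfam_over :: "'b::banach_star set => ('i,'b) mfam set" where
 "mfam_over S = {a. ALL J i j. ent a J i j:S}"

lemma closed_alg_mfam_over:
 assumes "closed_alg S"
 shows "closed_alg (mfam_over S)"
 unfolding closed_alg_def
proof (intro conjI ballI allI)
 note C = closed_algD[OF assms]
 have "mfam_over S = (\<Inter>J i j. (%a. ent a J i j) -` S)" by(auto simp: mfam_over_def)
 moreover have "closed ((%a. ent a J i j) -` S)" for J i j
  by(intro closed_vimage C(1)) (intro continuous_intros)
 ultimately show "closed (mfam_over S)" by(metis (no_types, lifting) closed_INT)
qed (use closed_algD(2-8)[OF assms] in "auto simp: mfam_over_def ent_one ent_mult intro!: closed_algD(11)[OF assms]")

lemma memb_mem: "closed_alg S ==> (!!i j. i:J ==> j:J ==> a i j:S) ==> memb J a:mfam_over S"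
 using closed_algD(8) by(auto simp: mfam_over_def ent_memb)

lemma membu_mem: "closed_alg S ==> (!!i j. i:J ==> j:J ==> a i j:S) ==> membu J a:mfam_over S"
 unfolding membu_def using closed_alg_mfam_over[of S]
 by(intro closed_algD(3,9) closed_algD(2) memb_mem) (auto simp: mone_def closed_algD)

section \<open>Loops of complex matrices\<close>

abbreviation S1 :: "complex set" where "S1 \<equiv> sphere 0 1"

definition hom_in :: "'k::topological_space set => 'm::topological_space set => ('k => 'm) => ('k => 'm) => bool" where
 "hom_in K Y f g <-> homotopic_with_canon (%_. True) K Y f g"

lemma hom_in_iff: "hom_in K Y f g <->
 (EX h. cont ({0..1} \<times> K) h & h:({0..1::real} \<times> K) \<rightarrow> Y & (ALL x:K. h (0,x) = f x) & (ALL x:K. h (1,x) = g x))"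
 unfolding hom_in_def by(subst homotopic_with) (auto simp: prod_topology_subtopology_eu)

lemma hom_inI:
 assumes "cont ({0..1::real} \<times> K) h" "!!t x. 0 <= t ==> t <= 1 ==> x:K ==> h (t,x):Y"
  "!!x. x:K ==> h (0,x) = f x" "!!x. x:K ==> h (1,x) = g x"
 shows "hom_in K Y f g"
 unfolding hom_in_iff using assms by(intro exI[of _ h]) auto

lemma hom_in_trans: "hom_in K Y f g ==> hom_in K Y g h ==> hom_in K Y f h"
 unfolding hom_in_def by(rule homotopic_with_trans)

lemma hom_in_sym: "hom_in K Y f g ==> hom_in K Y g f"
 unfolding hom_in_def by(rule homotopic_with_symD)

lemma hom_in_eq:
 assumes "hom_in K Y f g" "!!x. x:K ==> f x = f' x" "!!x. x:K ==> g x = g' x"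
 shows "hom_in K Y f' g'"
 using assms unfolding hom_in_iff by fastforce

lemma hom_in_refl:
 assumes "cont K f" "f:K \<rightarrow> Y"
 shows "hom_in K Y f f"
proof (rule hom_inI[where h = "%x. f (snd x)"])
 show "cont ({0..1} \<times> K) (%x. f (snd x))"
  by(rule continuous_on_compose2[OF assms(1) continuous_on_snd[OF continuous_on_id]]) auto
qed (use assms(2) in auto)

lemma hom_in_continuous: "hom_in K Y f g ==> cont K f & cont K g"
 unfolding hom_in_def by(rule homotopic_with_imp_continuous)

lemma hom_in_maps: "hom_in K Y f g ==> f:K \<rightarrow> Y & g:K \<rightarrow> Y"
proof -
 assume "hom_in K Y f g"
 then obtain h :: "real \<times> 'a => 'b" where "h:{0..1} \<times> K \<rightarrow> Y" "ALL x:K. h (0,x) = f x" "ALL x:K. h (1,x) = g x"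
  unfolding hom_in_iff by blast
 moreover have "(0,x):{0..1::real} \<times> K" "(1,x):{0..1::real} \<times> K" if "x:K" for x using that by auto
 ultimately show ?thesis by(metis Pi_I Pi_mem)
qed

lemma hom_in_compose:
 assumes "hom_in K Y f g" "cont Y k" "k:Y \<rightarrow> Z"
 shows "hom_in K Z (%x. k (f x)) (%x. k (g x))"
 using homotopic_with_compose_continuous_left[of "%_. True" k K Y f g Z] assms
 unfolding hom_in_def o_def by simp

lemma hom_in_line:
 fixes f g :: "'k::topological_space => 'i => complex"
 assumes "!!i. cont K (%x. f x i)" "!!i. cont K (%x. g x i)"
  "!!t x. 0 <= t ==> t <= 1 ==> x:K ==> (%i. (1 - of_real t)*f x i + of_real t*g x i):Y"
 shows "hom_in K Y f g"
proof (rule hom_inI[where h = "%x i. (1 - of_real (fst x))*f (snd x) i + of_real (fst x)*g (snd x) i"])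
 show "cont ({0..1} \<times> K) (%x i. (1 - of_real (fst x))*f (snd x) i + of_real (fst x)*g (snd x) i)"
  by(intro continuous_intros continuous_on_compose2[OF assms(1)] continuous_on_compose2[OF assms(2)]) auto
qed (use assms(3) in auto)

definition turn :: "real => complex" where "turn t = exp (2 * of_real pi * of_real t * \<i>)"

lemma turn_circle: "turn t:S1"
 by(simp add: turn_def norm_exp_eq_Re)

lemma norm_turn [simp]: "norm (turn t) = 1"
 by(simp add: turn_def norm_exp_eq_Re)

lemma turn_0 [simp]: "turn 0 = 1" and turn_1 [simp]: "turn 1 = 1"
 by(simp_all add: turn_def)

lemma continuous_on_turn [continuous_intros]: "cont S f ==> cont S (%x. turn (f x))"
 unfolding turn_def by(intro continuous_intros)

lemma turn_Arg2pi: "z:S1 ==> turn (Arg2pi z / (2*pi)) = z"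
 using Arg2pi_eq[of z] by(simp add: turn_def mult.commute)

lemma circle_of_loop:
 fixes y :: "real => 'm::topological_space"
 assumes "cont {0..1} y" "y 0 = y 1"
 shows "cont S1 (%z. y (Arg2pi z / (2*pi)))"
proof -
 have "homotopic_loops (y ` {0..1}) y y"
  using assms by(simp add: homotopic_loops_refl path_def pathstart_def pathfinish_def path_image_def)
 from homotopic_loops_imp_homotopic_circlemaps[OF this]
 show ?thesis using homotopic_with_imp_continuous by(fastforce simp: o_def)
qed

lemma hom_in_circle_of_loop:
 fixes h :: "real \<times> real => 'm::topological_space"
 assumes "cont ({0..1} \<times> {0..1}) h" "!!s t. 0 <= s ==> s <= 1 ==> 0 <= t ==> t <= 1 ==> h (s,t):Y"
  "!!s. h (s,0) = h (s,1)"
 shows "hom_in S1 Y (%z. h (0,Arg2pi z / (2*pi))) (%z. h (1,Arg2pi z / (2*pi)))"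
proof -
 have "homotopic_loops Y (%t. h (0,t)) (%t. h (1,t))"
  unfolding homotopic_loops
  by(rule exI[of _ h]) (use assms in "auto simp: pathstart_def pathfinish_def")
 from homotopic_loops_imp_homotopic_circlemaps[OF this]
 show ?thesis unfolding hom_in_def o_def .
qed

lemma continuous_on_power_int_circle: "cont S1 (%z::complex. z powi n)"
 by(intro continuous_intros) auto

lemma winding_exists:
 assumes "cont S1 f" "!!z. z:S1 ==> f z ~= 0"
 shows "EX w. hom_in S1 (- {0}) f (%z. z powi w)"
proof -
 have "cont {0..1} (%t. f (turn t))"
  by(rule continuous_on_compose2[OF assms(1)]) (auto intro!: continuous_intros)
 then obtain g where g: "cont {0..1} g" "!!t. t:{0..1} ==> f (turn t) = exp (g t)"
  by(rule continuous_logarithm_on_contractible) (use assms(2) turn_circle in "auto intro: convex_imp_contractible")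
 have "exp (g 1) = exp (g 0)" using g(2)[of 0] g(2)[of 1] by simp
 then obtain w :: int where w: "g 1 = g 0 + (of_int (2*w)*pi) * \<i>" using exp_eq by auto
 define h where "h x = exp ((1 - of_real (fst x))*g (snd x) + of_real (fst x)*(2 * of_real pi * of_int w * of_real (snd x) * \<i>))" for x
 have "hom_in S1 (- {0}) (%z. h (0,Arg2pi z / (2*pi))) (%z. h (1,Arg2pi z / (2*pi)))"
 proof (rule hom_in_circle_of_loop)
  show "cont ({0..1} \<times> {0..1}) h"
   unfolding h_def by(intro continuous_intros continuous_on_compose2[OF g(1)]) auto
  show "h (s,0) = h (s,1)" for s
  proof -
   have "h (s,1) = exp ((1 - of_real s)*g 0 + 2 * of_real pi * of_int w * \<i>)"
    by(simp add: h_def w algebra_simps)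
   also have "... = exp ((1 - of_real s)*g 0)"
    using exp_plus_2pin[of "(1 - of_real s)*g 0" w] by(simp add: algebra_simps)
   finally show ?thesis by(simp add: h_def)
  qed
 qed (auto simp: h_def)
 thus ?thesis
 proof (intro exI[of _ w], elim hom_in_eq)
  fix z :: complex assume z: "z:S1"
  have a: "Arg2pi z / (2*pi):{0..1}" using Arg2pi_ge_0[of z] Arg2pi_lt_2pi[of z] by(simp add: field_simps)
  show "h (0,Arg2pi z / (2*pi)) = f z" using g(2)[OF a] turn_Arg2pi[OF z] by(simp add: h_def)
  have "h (1,Arg2pi z / (2*pi)) = exp (of_int w*(of_real (Arg2pi z) * \<i>))" by(simp add: h_def mult.commute mult.left_commute)
  also have "... = exp (of_real (Arg2pi z) * \<i>) powi w" by(rule exp_power_int[symmetric])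
  also have "exp (of_real (Arg2pi z) * \<i>) = z" using Arg2pi_eq[of z] z by(simp add: mult.commute)
  finally show "h (1,Arg2pi z / (2*pi)) = z powi w" .
 qed
qed

lemma powi_homotopic_imp_eq:
 assumes "hom_in S1 (- {0}) (%z. z powi v) (%z. z powi w)"
 shows "v = w"
proof -
 obtain h where h: "cont ({0..1} \<times> S1) h" "h:{0..1::real} \<times> S1 \<rightarrow> - {0}"
  "!!z. z:S1 ==> h (0,z) = z powi v" "!!z. z:S1 ==> h (1,z) = z powi w"
  using assms unfolding hom_in_iff by auto
 have "hom_in S1 (- {0}) (%z. z powi (v - w)) (%_. 1)"
 proof (rule hom_inI)
  show "cont ({0..1} \<times> S1) (%x. h x * snd x powi (- w))"
   by(intro continuous_intros h(1)) auto
  show "h (t,x) * snd (t,x) powi - w:- {0}" if "0 <= t" "t <= 1" "x:S1" for t x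
   using h(2) that by(force simp: Pi_iff)
  show "h (0,x) * snd (0,x) powi - w = x powi (v - w)" "h (1,x) * snd (1,x) powi - w = 1" if "x:S1" for x
   using h(3,4)[OF that] that by(auto simp: power_int_diff power_int_minus divide_simps)
 qed
 hence "EX g. cont S1 g & (ALL z:S1. z powi (v - w) = exp (g z))"
  unfolding hom_in_def by(rule iffD1[OF inessential_eq_continuous_logarithm, OF exI])
 then obtain g where g: "cont S1 g" "!!z. z:S1 ==> z powi (v - w) = exp (g z)" by blast
 define d where "d t = g (turn t) - 2 * of_real pi * of_int (v - w) * of_real t * \<i>" for t
 have cd: "cont {0..1} d" unfolding d_def
  by(intro continuous_intros continuous_on_compose2[OF g(1)]) (use turn_circle in auto)
 have "exp (d t) = 1" for t
 proof -
  have "exp (g (turn t)) = turn t powi (v - w)" using g(2) turn_circle by metis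
  also have "... = exp (of_int (v - w)*(2 * of_real pi * of_real t * \<i>))"
   by(simp add: turn_def exp_power_int)
  finally show ?thesis unfolding d_def exp_diff by(simp add: algebra_simps)
 qed
 hence di: "EX n::int. d t = of_int (2*n) * of_real pi * \<i>" for t
  using exp_eq_1[of "d t"] by(auto simp: complex_eq_iff)
 have "d constant_on {0..1}"
 proof (rule continuous_discrete_range_constant[OF _ cd])
  fix x :: real
  show "EX e>0. ALL y. y:{0..1} & d y ~= d x --> e <= norm (d y - d x)"
  proof (intro exI[of _ "2*pi"] conjI allI impI)
   fix y assume y: "y:{0..1} & d y ~= d x"
   obtain m n :: int where mn: "d y = of_int (2*m) * of_real pi * \<i>" "d x = of_int (2*n) * of_real pi * \<i>" using di by metis
   hence "m ~= n" using y by auto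
   have "d y - d x = of_real (2*pi * of_int (m - n)) * \<i>" unfolding mn by(simp add: algebra_simps)
   hence "norm (d y - d x) = 2*pi * \<bar>real_of_int (m - n)\<bar>" by(simp only: norm_mult norm_of_real) (simp add: abs_mult)
   moreover have "1 <= \<bar>real_of_int (m - n)\<bar>" using `m ~= n` by linarith
   ultimately show "2*pi <= norm (d y - d x)" by simp
  qed simp
 qed simp
 hence "d 0 = d 1" unfolding constant_on_def by(metis atLeastAtMost_iff order_refl zero_le_one)
 thus ?thesis by(simp add: d_def complex_eq_iff)
qed

definition wind :: "(complex => complex) => int" where
 "wind f = (THE w. hom_in S1 (- {0}) f (%z. z powi w))"

lemma wind_eqI: "hom_in S1 (- {0}) f (%z. z powi w) ==> wind f = w"
 unfolding wind_def
 by(rule the_equality) (auto intro: powi_homotopic_imp_eq hom_in_trans hom_in_sym)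

lemma wind_powi [simp]: "wind (%z. z powi w) = w"
 by(rule wind_eqI, rule hom_in_refl) (auto intro!: continuous_on_power_int_circle)

lemma wind_homotopic: "hom_in S1 (- {0}) f g ==> wind f = wind g"
proof -
 assume fg: "hom_in S1 (- {0}) f g"
 hence "cont S1 g" "!!z. z:S1 ==> g z ~= 0"
  using hom_in_continuous hom_in_maps by(blast, fastforce simp: Pi_iff)
 from winding_exists[OF this] show ?thesis
  using fg wind_eqI hom_in_trans by metis
qed

lemma wind_hom:
 assumes "cont S1 f" "!!z. z:S1 ==> f z ~= 0"
 shows "hom_in S1 (- {0}) f (%z. z powi wind f)"
 using winding_exists[OF assms] wind_eqI by blast

lemma wind_cong:
 assumes "cont S1 f" "!!z. z:S1 ==> f z ~= 0" "!!z. z:S1 ==> f z = g z"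
 shows "wind f = wind g"
 by(rule wind_homotopic, rule hom_in_eq[OF hom_in_refl[OF assms(1)]]) (use assms in auto)

lemma wind_mult:
 assumes "cont S1 f" "!!z. z:S1 ==> f z ~= 0"
  "cont S1 g" "!!z. z:S1 ==> g z ~= 0"
 shows "wind (%z. f z*g z) = wind f + wind g"
proof (rule wind_eqI)
 obtain h where h: "cont ({0..1} \<times> S1) h" "h:{0..1::real} \<times> S1 \<rightarrow> - {0}"
  "!!z. z:S1 ==> h (0,z) = f z" "!!z. z:S1 ==> h (1,z) = z powi wind f"
  using wind_hom[OF assms(1,2)] unfolding hom_in_iff by auto
 obtain k where k: "cont ({0..1} \<times> S1) k" "k:{0..1::real} \<times> S1 \<rightarrow> - {0}"
  "!!z. z:S1 ==> k (0,z) = g z" "!!z. z:S1 ==> k (1,z) = z powi wind g"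
  using wind_hom[OF assms(3,4)] unfolding hom_in_iff by auto
 show "hom_in S1 (- {0}) (%z. f z*g z) (%z. z powi (wind f + wind g))"
 proof (rule hom_inI)
  show "cont ({0..1} \<times> S1) (%x. h x * k x)" by(intro continuous_intros h k)
  show "h (t,x) * k (t,x):- {0}" if "0 <= t" "t <= 1" "x:S1" for t x
   using h(2) k(2) that by(auto simp: Pi_iff)
  show "h (0,x) * k (0,x) = f x*g x" "h (1,x) * k (1,x) = x powi (wind f + wind g)" if "x:S1" for x
   using h(3,4)[OF that] k(3,4)[OF that] that by(auto intro!: power_int_add[symmetric])
 qed
qed

lemma circle_map_homotopic_powi:
 assumes "cont S1 f" "f:S1 \<rightarrow> S1"
 shows "EX w. hom_in S1 S1 f (%z. z powi w)"
proof -
 have "!!z. z:S1 ==> f z ~= 0" using assms(2) by(force simp: Pi_iff)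
 from winding_exists[OF assms(1) this] obtain w where "hom_in S1 (- {0}) f (%z. z powi w)" by auto
 hence "hom_in S1 S1 (%z. sgn (f z)) (%z. sgn (z powi w))"
  by(rule hom_in_compose) (auto intro!: continuous_intros simp: norm_sgn)
 hence "hom_in S1 S1 f (%z. z powi w)"
  by(rule hom_in_eq) (use assms(2) in "auto simp: sgn_div_norm Pi_iff norm_power_int")
 thus ?thesis by blast
qed

section \<open>Moving a column\<close>

lemma avoid_cone:
 fixes p :: "complex => complex \<times> complex"
 assumes "polynomial_function p"
 obtains c where "snd c ~= 0" "!!s z. c ~= s *R p z"
proof -
 have "(%x :: real \<times> complex. fst x *R p (snd x)) differentiable_on UNIV"
 proof (intro differentiable_on_scaleR)
  show "(fst :: real \<times> complex => real) differentiable_on UNIV"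
   by(intro bounded_linear_imp_differentiable_on bounded_linear_fst)
  show "(%x :: real \<times> complex. p (snd x)) differentiable_on UNIV"
   by(rule differentiable_on_compose[OF bounded_linear_imp_differentiable_on[OF bounded_linear_snd]
      differentiable_on_polynomial_function[OF assms]])
 qed
 hence 1: "negligible (range (%x :: real \<times> complex. fst x *R p (snd x)))"
  by(rule negligible_differentiable_image_lowdim[rotated]) simp
 have "(%a :: complex. (a,0 :: complex)) differentiable_on UNIV"
  by(intro bounded_linear_imp_differentiable_on bounded_linear_Pair bounded_linear_ident bounded_linear_zero)
 hence 2: "negligible (range (%a :: complex. (a,0 :: complex)))"
  by(rule negligible_differentiable_image_lowdim[rotated]) simp
 from 1 2 have "range (%x :: real \<times> complex. fst x *R p (snd x)) \<union> range (%a :: complex. (a,0 :: complex)) ~= UNIV"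
  by(metis negligible_Un non_negligible_UNIV)
 then obtain c where c: "c ~: range (%x :: real \<times> complex. fst x *R p (snd x))" "c ~: range (%a :: complex. (a,0 :: complex))"
  by blast
 show thesis
 proof (rule that[of c])
  show "snd c ~= 0" using c(2) by(cases c) auto
  show "c ~= s *R p z" for s z using c(1) rangeI[of "%x :: real \<times> complex. fst x *R p (snd x)" "(s,z)"] by auto
 qed
qed

definition nzvec :: "'i set => ('i => complex) set" where
 "nzvec J = {v. (ALL i. i ~: J --> v i = 0) & (EX i:J. v i ~= 0)}"

definition unitvec :: "'i => 'i => complex" where
 "unitvec k i = (if i = k then 1 else 0)"

lemma vector_loop_null_homotopic:
 fixes v :: "complex => 'i => complex"
 assumes J: "finite J" "j0:J" "j1:J" "j0 ~= j1"
  and v: "!!i. cont S1 (%z. v z i)" "!!z. z:S1 ==> v z:nzvec J"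
 shows "hom_in S1 (nzvec J) v (%_. unitvec j0)"
proof -
 have nonempty: "S1 ~= {}" using turn_circle by blast
 have "cont S1 (%z. SUM i:J. norm (v z i))" by(intro continuous_intros v)
 from continuous_attains_inf[OF compact_sphere nonempty this] obtain z0 where
  z0: "z0:S1" "!!z. z:S1 ==> (SUM i:J. norm (v z0 i)) <= (SUM i:J. norm (v z i))" by blast
 define m where "m = (SUM i:J. norm (v z0 i))"
 obtain i where "i:J" "v z0 i ~= 0" using v(2)[OF z0(1)] by(auto simp: nzvec_def)
 hence m: "m > 0" unfolding m_def using J(1) by(intro sum_pos2[of J i]) auto
 have "cont S1 (%z. (v z j0,v z j1))" by(intro continuous_intros v)
 from Stone_Weierstrass_polynomial_function[OF compact_sphere this, of "m / 3"] m obtain p where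
  p: "polynomial_function p" "!!z. z:S1 ==> norm ((v z j0,v z j1) - p z) < m / 3" by auto
 obtain c where c: "snd c ~= 0" "!!s z. c ~= s *R p z" using avoid_cone[OF p(1)] by blast
 have cp: "cont S1 p" using p(1) by(rule continuous_on_polymonial_function)
 define v' where "v' z i = (if i = j0 then fst (p z) else if i = j1 then snd (p z) else v z i)" for z i
 define c' where "c' i = (if i = j0 then fst c else if i = j1 then snd c else 0)" for i
 have cv': "cont S1 (%z. v' z i)" for i
  unfolding v'_def using v(1)[of i] cp by(cases "i = j0"; cases "i = j1") (simp_all add: continuous_on_fst continuous_on_snd)
 have 1: "hom_in S1 (nzvec J) v v'"
 proof (rule hom_in_line[OF v(1) cv'])
  fix t :: real and z :: complex assume tz: "0 <= t" "t <= 1" "z:S1"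
  let ?w = "%i. (1 - of_real t) * v z i + of_real t * v' z i"
  have n1: "norm (v z j0 - fst (p z)) < m / 3" "norm (v z j1 - snd (p z)) < m / 3"
   using p(2)[OF tz(3)] norm_fst_le[of "v z j0 - fst (p z)" "v z j1 - snd (p z)"]
    norm_snd_le[of "v z j1 - snd (p z)" "v z j0 - fst (p z)"]
   by(cases "p z"; force)+
  have "EX i:J. ?w i ~= 0"
  proof (rule ccontr)
   assume "~ (EX i:J. ?w i ~= 0)"
   hence z: "?w i = 0" if "i:J" for i using that by blast
   have small: "norm (v z i) <= (if i = j0 then m / 3 else 0) + (if i = j1 then m / 3 else 0)" if "i:J" for i
   proof -
    have "v z i = of_real t*(v z i - v' z i)" using z[OF that] by(simp add: algebra_simps add_eq_0_iff)
    hence "norm (v z i) = t*norm (v z i - v' z i)" using tz by(metis abs_of_nonneg norm_mult norm_of_real)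
    also have "... <= 1*norm (v z i - v' z i)" using tz by(intro mult_right_mono) auto
    finally show ?thesis using n1 J(4) m by(auto simp: v'_def split: if_splits)
   qed
   have "(SUM i:J. norm (v z i)) <= (SUM i:J. (if i = j0 then m / 3 else 0) + (if i = j1 then m / 3 else 0))"
    by(rule sum_mono[OF small])
   also have "... = 2*m / 3" using J by(simp add: sum.distrib)
   finally show False using z0(2)[OF tz(3)] m by(simp add: m_def[symmetric])
  qed
  thus "?w:nzvec J" using v(2)[OF tz(3)] J by(auto simp: nzvec_def v'_def)
 qed
 have 2: "hom_in S1 (nzvec J) v' (%_. c')"
 proof (rule hom_in_line[OF cv' continuous_on_const])
  fix t :: real and z :: complex assume tz: "0 <= t" "t <= 1" "z:S1"
  let ?w = "%i. (1 - of_real t) * v' z i + of_real t*c' i"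
  have "v' z:nzvec J" using hom_in_maps[OF 1] tz(3) by auto
  have "EX i:J. ?w i ~= 0"
  proof (rule ccontr)
   assume "~ (EX i:J. ?w i ~= 0)"
   hence z: "?w i = 0" if "i:J" for i using that by blast
   show False
   proof (cases "t = 0")
    case True
    thus False using z `v' z:nzvec J` by(auto simp: nzvec_def)
   next
    case False
    have "fst c = ((t - 1) / t) *R fst (p z)" "snd c = ((t - 1) / t) *R snd (p z)"
     using z[OF J(2)] z[OF J(3)] False J(4)
     by(auto simp: v'_def c'_def field_simps scaleR_conv_of_real add_eq_0_iff)
    hence "c = ((t - 1) / t) *R p z" by(simp add: prod_eq_iff)
    thus False using c(2) by blast
   qed
  qed
  thus "?w:nzvec J" using `v' z:nzvec J` J by(auto simp: nzvec_def c'_def)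
 qed
 have 3: "hom_in S1 (nzvec J) (%_. c') (%_. unitvec j0)"
 proof (rule hom_in_line[OF continuous_on_const continuous_on_const])
  fix t :: real
  have "(1 - of_real t)*c' j1 + of_real t*unitvec j0 j1 ~= 0 | (1 - of_real t)*c' j0 + of_real t*unitvec j0 j0 ~= 0"
   using J(4) c(1) by(cases "t = 1") (auto simp: c'_def unitvec_def)
  thus "(%i. (1 - of_real t)*c' i + of_real t*unitvec j0 i):nzvec J"
   using J by(auto simp: nzvec_def c'_def unitvec_def)
 qed
 show ?thesis by(rule hom_in_trans[OF hom_in_trans[OF 1 2] 3])
qed

lemma continuous_on_mat:
 fixes f :: "'a::topological_space => 'i => 'j => 'b::topological_space"
 shows "cont S f <-> (ALL i j. cont S (%x. f x i j))"
 by(metis continuous_on_coordinatewise_then_product continuous_on_product_then_coordinatewise)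

lemma continuous_on_mm [continuous_intros]:
 fixes a :: "'x::topological_space => 'i => 'k => 'b::real_normed_algebra"
 assumes "!!k. k:J ==> cont S (%x. a x i k)" "!!k. k:J ==> cont S (%x. b x k j)"
 shows "cont S (%x. mm J (a x) (b x) i j)"
 unfolding mm_def by(intro continuous_intros assms)

lemma umat_mm: "finite J ==> umat J a ==> umat J b ==> umat J (mm J a b)"
 unfolding umat_iff_membu by(metis is_unitary_mult membu_mult msupp_mm)

lemma umat_mone: "finite J ==> umat J (mone J)"
 unfolding umat_def by(simp add: msupp_mone mm_mone[OF _ msupp_mone])

lemma umat_msupp: "umat J a ==> msupp J J a"
 by(simp add: umat_def)

lemma column_transport:
 fixes F :: "complex => 'i => 'i => complex"
 assumes J: "finite J" "j0:J" and cF: "!!i j. cont S1 (%z. F z i j)"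
  and uF: "!!z. z:S1 ==> umat J (F z)"
  and hom: "hom_in S1 (nzvec J) (%z i. F z i j0) (%_. unitvec j0)"
 obtains G where "hom_in S1 {u. umat J u} F G" "!!z i. z:S1 ==> i ~= j0 ==> G z i j0 = 0"
proof -
 obtain h where h: "cont ({0..1::real} \<times> S1) h" "h:{0..1} \<times> S1 \<rightarrow> nzvec J"
  "!!z. z:S1 ==> h (0,z) = (%i. F z i j0)" "!!z. z:S1 ==> h (1,z) = unitvec j0"
  using hom unfolding hom_in_iff by auto
 define n where "n x = (SUM i:J. h x i*cnj (h x i))" for x
 have n0: "n x ~= 0" if "x:{0..1} \<times> S1" for x
 proof -
  have "h x:nzvec J" using h(2) that by auto
  then obtain i where "i:J" "h x i ~= 0" by(auto simp: nzvec_def)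
  hence "(SUM i:J. (norm (h x i))\<^sup>2) > 0" using J(1) by(intro sum_pos2[of J i]) auto
  moreover have "n x = of_real (SUM i:J. (norm (h x i))\<^sup>2)"
   unfolding n_def of_real_sum by(intro sum.cong refl) (simp add: complex_norm_square del: of_real_power)
  ultimately show ?thesis by(simp only: of_real_eq_0_iff)
 qed
 define rm where "rm x i j = h x i*cnj (h x j) / n x" for x i j
 have ch: "cont ({0..1} \<times> S1) (%x. h x i)" for i
  using h(1) by(rule continuous_on_product_then_coordinatewise)
 have crm: "cont ({0..1} \<times> S1) (%x. rm x i j)" for i j
  unfolding rm_def n_def using n0 by(intro continuous_intros ch) (simp add: n_def)
 have cn: "cnj (n x) = n x" for x by(simp add: n_def mult.commute)
 have srm: "msupp J J (rm x)" if "x:{0..1} \<times> S1" for x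
  using h(2) that by(fastforce simp: msupp_def rm_def nzvec_def Pi_iff)
 have prm: "pmat J (rm x)" if x: "x:{0..1} \<times> S1" for x
  unfolding pmat_def
 proof (intro conjI ext srm[OF x])
  fix i j
  have "mm J (rm x) (rm x) i j = (SUM k:J. (h x i*cnj (h x j) / (n x*n x))*(h x k*cnj (h x k)))"
   unfolding mm_def rm_def by(intro sum.cong refl) (simp add: mult_ac)
  also have "... = (h x i*cnj (h x j) / (n x*n x))*n x" unfolding n_def by(simp only: sum_distrib_left)
  finally show "mm J (rm x) (rm x) i j = rm x i j" using n0[OF x] by(simp add: rm_def)
  show "madj (rm x) i j = rm x i j" by(simp add: madj_def rm_def star_complex_def cn mult.commute)
 qed
 define R where "R x = memb J (rm x)" for x
 have cR: "cont ({0..1} \<times> S1) R" unfolding R_def by(intro continuous_intros crm)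
 have pR: "is_proj (R (t,z))" if "t:{0..1}" "z:S1" for t z
  using prm[of "(t,z)"] that J(1) by(simp add: R_def pmat_iff_memb)
 obtain U where U: "cont ({0..1} \<times> S1) U" "!!z. z:S1 ==> U (0,z) = 1"
  "!!t z. t:{0..1} ==> z:S1 ==> is_unitary (U (t,z)) & U (t,z) * R (0,z) = R (t,z)*U (t,z) & U (t,z):UNIV"
  using parallel_transport[OF compact_sphere cR pR UNIV_I closed_alg_UNIV] by blast
 define u where "u x = ent (U x) J" for x
 have cu: "cont ({0..1} \<times> S1) (%x. u x i j)" for i j unfolding u_def by(intro continuous_intros U(1))
 have uu: "umat J (u (t,z))" if "t:{0..1}" "z:S1" for t z
  unfolding u_def using U(3)[OF that] umat_ent[OF J(1)] by blast
 define G where "G z = mm J (u (1,z)) (F z)" for z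
 have "hom_in S1 {u. umat J u} F G"
 proof (rule hom_inI[where h = "%x. mm J (u x) (F (snd x))"])
  show "cont ({0..1} \<times> S1) (%x. mm J (u x) (F (snd x)))"
   unfolding continuous_on_mat by(intro allI continuous_intros cu continuous_on_compose2[OF cF]) auto
  show "mm J (u (t,x)) (F (snd (t,x))):{u. umat J u}" if "0 <= t" "t <= 1" "x:S1" for t x
   using umat_mm[OF J(1) uu uF] that by simp
  show "mm J (u (0,x)) (F (snd (0,x))) = F x" if "x:S1" for x
   unfolding u_def U(2)[OF that] ent_one'[OF J(1)] using mm_mone[OF J(1) umat_msupp[OF uF[OF that]]] by simp
 qed (simp add: G_def)
 moreover have "G z i j0 = 0" if z: "z:S1" and i: "i ~= j0" for z i
 proof -
  have x: "(0,z):{0..1::real} \<times> S1" "(1,z):{0..1::real} \<times> S1" using z by auto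
  have "n (0,z) = mm J (madj (F z)) (F z) j0 j0"
   unfolding n_def mm_def h(3)[OF z] madj_def star_complex_def by(simp add: mult.commute)
  also have "... = 1" using uF[OF z] J(2) by(simp add: umat_def mone_def)
  finally have n1: "n (0,z) = 1" .
  have rF: "mm J (rm (0,z)) (F z) k j0 = F z k j0" for k
  proof -
   have "mm J (rm (0,z)) (F z) k j0 = (SUM l:J. F z k j0*(F z l j0*cnj (F z l j0)))"
    unfolding mm_def rm_def n1 h(3)[OF z] by(intro sum.cong refl) (simp add: mult_ac)
   also have "... = F z k j0*n (0,z)" unfolding n_def h(3)[OF z] by(simp only: sum_distrib_left)
   finally show ?thesis by(simp add: n1)
  qed
  have "ent (U (1,z) * R (0,z)) J = ent (R (1,z)*U (1,z)) J" using U(3)[of 1 z] z by simp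
  hence eq: "mm J (u (1,z)) (rm (0,z)) = mm J (rm (1,z)) (u (1,z))"
   unfolding mm_ent R_def ent_memb'[OF J(1) srm[OF x(1)]] ent_memb'[OF J(1) srm[OF x(2)]] u_def .
  have "G z i j0 = mm J (u (1,z)) (mm J (rm (0,z)) (F z)) i j0"
   unfolding G_def by(simp add: mm_def[of J "u (1,z)"] rF)
  also have "... = mm J (rm (1,z)) (mm J (u (1,z)) (F z)) i j0"
   by(simp add: mm_assoc[symmetric] eq)
  also have "... = 0" using i by(simp add: mm_def[of J "rm (1,z)"] rm_def h(4)[OF z] unitvec_def)
  finally show ?thesis .
 qed
 ultimately show thesis by(rule that)
qed

definition blk :: "'i => 'b => ('i => 'i => 'b) => 'i => 'i => 'b" where
 "blk k a B i j = (if i = k & j = k then a else B i j)"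

lemma mm_blk:
 assumes "finite J" "k ~: J" "msupp J J B" "msupp J J B'"
 shows "mm (insert k J) (blk k a B) (blk k a' B') = blk k (a*a') (mm J B B')"
proof (intro ext)
 fix i j
 have z: "B i k = 0" "B k i = 0" "B' i k = 0" "B' k i = 0" for i using assms(2-4) by(auto simp: msupp_def)
 have "(SUM l:J. blk k a B i l*blk k a' B' l j) = mm J B B' i j"
  unfolding mm_def by(rule sum.cong) (use assms(2) in "auto simp: blk_def")
 thus "mm (insert k J) (blk k a B) (blk k a' B') i j = blk k (a*a') (mm J B B') i j"
  using assms(1,2) by(auto simp: mm_def[of "insert k J"] blk_def z) (simp_all add: mm_def z)
qed

lemma madj_blk: "madj (blk k a B) = blk k (star a) (madj B)"
 by(intro ext) (simp add: madj_def blk_def)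

lemma mone_blk: "k ~: J ==> mone (insert k J) = blk k 1 (mone J)"
 by(intro ext) (auto simp: mone_def blk_def)

lemma msupp_blk: "msupp J J B ==> msupp (insert k J) (insert k J) (blk k a B)"
 by(auto simp: msupp_def blk_def)

lemma blk_inject:
 assumes "k ~: J" "msupp J J B" "msupp J J B'"
 shows "blk k a B = blk k a' B' <-> a = a' & B = B'"
proof
 assume eq: "blk k a B = blk k a' B'"
 have "B i j = B' i j" for i j
  using fun_cong[OF fun_cong[OF eq], of i j] assms by(cases "i = k & j = k") (auto simp: blk_def msupp_def)
 moreover have "a = a'" using fun_cong[OF fun_cong[OF eq], of k k] by(simp add: blk_def)
 ultimately show "a = a' & B = B'" by(intro conjI ext) auto
qed simp

lemma umat_blk_iff:
 assumes "finite J" "k ~: J" "msupp J J B"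
 shows "umat (insert k J) (blk k a B) <-> star a*a = 1 & a * star a = 1 & umat J B"
proof -
 note s = msupp_madj[OF assms(3)]
 show ?thesis
  unfolding umat_def madj_blk mm_blk[OF assms(1,2) s assms(3)] mm_blk[OF assms(1,2,3) s] mone_blk[OF assms(2)]
   blk_inject[OF assms(2) msupp_mm[OF s assms(3)] msupp_mone] blk_inject[OF assms(2) msupp_mm[OF assms(3) s] msupp_mone]
  using assms(3) msupp_blk[OF assms(3)] by blast
qed

definition dg :: "'i set => 'i => 'b::ring_1 => 'i => 'i => 'b" where
 "dg J k a i j = (if i = k & j = k then a else if i = j & i:J then 1 else 0)"

lemma dg_blk: "dg (insert k J) k a = blk k a (mone (J - {k}))"
 by(intro ext) (auto simp: dg_def blk_def mone_def)

lemma umat_dg: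
 assumes "finite J" "k:J" "star a*a = 1" "a * star a = 1"
 shows "umat J (dg J k a)"
proof -
 have "umat (insert k (J - {k})) (blk k a (mone (J - {k})))"
  using assms by(subst umat_blk_iff) (auto simp: msupp_mone umat_mone)
 thus ?thesis using dg_blk[of k J a] assms(2) by(simp add: insert_absorb)
qed

definition plane :: "'i set => 'i => 'i => 'b::ring_1 => 'b => 'b => 'b => 'i => 'i => 'b" where
 "plane J k l a b c d i j = (if i = k & j = k then a else if i = k & j = l then b
  else if i = l & j = k then c else if i = l & j = l then d else mone J i j)"

lemma mm_plane:
 assumes "finite J" "k ~: J" "l ~: J" "k ~= l"
 shows "mm (insert k (insert l J)) (plane J k l a b c d) (plane J k l a' b' c' d')
  = plane J k l (a*a' + b*c') (a*b' + b*d') (c*a' + d*c') (c*b' + d*d')"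
proof (intro ext)
 fix i j
 have "(SUM m:J. plane J k l a b c d i m*plane J k l a' b' c' d' m j) = mm J (mone J) (mone J) i j"
  unfolding mm_def by(rule sum.cong) (use assms in "auto simp: plane_def")
 also have "... = mone J i j" by(simp add: mm_mone[OF assms(1) msupp_mone])
 finally show "mm (insert k (insert l J)) (plane J k l a b c d) (plane J k l a' b' c' d') i j =
   plane J k l (a*a' + b*c') (a*b' + b*d') (c*a' + d*c') (c*b' + d*d') i j"
  using assms by(auto simp: mm_def plane_def mone_def)
qed

lemma madj_plane: "k ~= l ==> madj (plane J k l a b c d) = plane J k l (star a) (star c) (star b) (star d)"
proof (intro ext)
 fix i j assume "k ~= l"
 thus "madj (plane J k l a b c d) i j = plane J k l (star a) (star c) (star b) (star d) i j"
  by(cases "i = k"; cases "i = l"; cases "j = k"; cases "j = l"; cases "i = j") (simp_all add: madj_def plane_def mone_def)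
qed

lemma mone_plane: "k ~: J ==> l ~: J ==> k ~= l ==> mone (insert k (insert l J)) = plane J k l 1 0 0 1"
 by(fastforce simp: plane_def mone_def)

lemma umat_plane:
 assumes "finite J" "k ~: J" "l ~: J" "k ~= l"
  "star a*a + star c*c = 1" "star a*b + star c*d = 0" "star b*a + star d*c = 0" "star b*b + star d*d = 1"
  "a * star a + b * star b = 1" "a * star c + b * star d = 0" "c * star a + d * star b = 0" "c * star c + d * star d = 1"
 shows "umat (insert k (insert l J)) (plane J k l a b c d)"
 unfolding umat_def madj_plane[OF assms(4)] mm_plane[OF assms(1-4)] mone_plane[OF assms(2-4)] assms(5-12)
 by(force simp: msupp_def plane_def mone_def)

lemma continuous_on_if_const:
 "(b ==> cont S f) ==> (~ b ==> cont S g) ==> cont S (%x. if b then f x else g x)"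
 by(cases b) simp_all

lemma continuous_on_plane:
 assumes "cont S a" "cont S b" "cont S c" "cont S d"
 shows "cont S (%x. plane J k l (a x) (b x) (c x) (d x) i j)"
 unfolding plane_def using assms by(intro continuous_on_if_const continuous_on_const)

lemma whitehead_homotopy:
 assumes J: "finite J" "k ~: J" "l ~: J" "k ~= l"
  and f: "cont S1 f" "f:S1 \<rightarrow> S1" and g: "cont S1 g" "g:S1 \<rightarrow> S1"
 shows "hom_in S1 {u. umat (insert k (insert l J)) u} (%z. plane J k l (f z) 0 0 (g z))
  (%z. plane J k l (f z*g z) 0 0 1)"
proof -
 let ?K = "insert k (insert l J)"
 define c s where "c t = complex_of_real (cos (pi / 2*t))" and "s t = complex_of_real (sin (pi / 2*t))" for t
 have cs: "c t*c t + s t * s t = 1" for t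
  unfolding c_def s_def by(simp only: of_real_mult[symmetric] of_real_add[symmetric] of_real_eq_1_iff)
   (simp add: power2_eq_square[symmetric])
 define h where "h x = mm ?K (mm ?K (mm ?K (plane J k l (f (snd x)) 0 0 1)
  (plane J k l (c (fst x)) (- s (fst x)) (s (fst x)) (c (fst x)))) (plane J k l 1 0 0 (g (snd x))))
  (plane J k l (c (fst x)) (s (fst x)) (- s (fst x)) (c (fst x)))" for x
 have unit: "cnj (f z)*f z = 1" "f z*cnj (f z) = 1" "cnj (g z)*g z = 1" "g z*cnj (g z) = 1" if "z:S1" for z
  using f(2) g(2) that by(auto simp: complex_norm_square[symmetric] mult.commute[of "cnj _"] Pi_iff)
 have st: "cnj (c t) = c t" "cnj (s t) = s t" for t by(simp_all add: c_def s_def)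
 have fin: "finite ?K" using J by simp
 show ?thesis
 proof (rule hom_inI[where h = h])
  have 1: "cont ({0..1} \<times> S1) (%x. f (snd x))"
   by(rule continuous_on_compose2[OF f(1) continuous_on_snd[OF continuous_on_id]]) auto
  have 2: "cont ({0..1} \<times> S1) (%x. g (snd x))"
   by(rule continuous_on_compose2[OF g(1) continuous_on_snd[OF continuous_on_id]]) auto
  have 3: "cont ({0..1} \<times> S1) (%x. c (fst x))" "cont ({0..1} \<times> S1) (%x. s (fst x))"
   unfolding c_def s_def by(intro continuous_intros)+
  show "cont ({0..1} \<times> S1) h" unfolding h_def continuous_on_mat
   by(intro allI continuous_on_mm continuous_on_plane continuous_on_const continuous_on_minus 1 2 3)
  fix t :: real and z assume z: "z:S1"
  show "h (t,z):{u. umat ?K u}" unfolding h_def fst_conv snd_conv mem_Collect_eq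
   by(intro umat_mm[OF fin] umat_plane J)
    (use unit[OF z] cs[of t] in "simp_all add: star_complex_def st algebra_simps")
 next
  fix z :: complex
  show "h (0,z) = plane J k l (f z) 0 0 (g z)" "h (1,z) = plane J k l (f z*g z) 0 0 1"
   by(simp_all add: h_def mm_plane[OF J] c_def s_def)
 qed
qed

lemma unitary_loop_diagonal:
 fixes F :: "complex => 'i => 'i => complex"
 assumes "finite J" "j0:J" "cont S1 F" "F:S1 \<rightarrow> {u. umat J u}"
 shows "EX f. cont S1 f & f:S1 \<rightarrow> S1 & hom_in S1 {u. umat J u} F (%z. dg J j0 (f z))"
 using assms
proof (induction J arbitrary: j0 F rule: finite_psubset_induct)
 case (psubset J)
 have cF: "cont S1 (%z. F z i j)" for i j using psubset.prems(2) by(simp add: continuous_on_mat)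
 have uF: "umat J (F z)" if "z:S1" for z using psubset.prems(3) that by auto
 have norm1: "(%z. F' z j0 j0):S1 \<rightarrow> S1" if "!!z. z:S1 ==> umat J (F' z)" "!!z i. z:S1 ==> i ~= j0 ==> F' z i j0 = 0" for F' :: "complex => 'i => 'i => complex"
 proof
  fix z :: complex assume z: "z:S1"
  have "1 = mm J (madj (F' z)) (F' z) j0 j0" using that(1)[OF z] psubset.prems(1) by(simp add: umat_def mone_def)
  also have "... = (SUM k:J. if k = j0 then cnj (F' z k j0)*F' z k j0 else 0)"
   unfolding mm_def madj_def star_complex_def by(rule sum.cong) (use that(2)[OF z] in auto)
  also have "... = cnj (F' z j0 j0)*F' z j0 j0" using psubset by simp
  finally have "of_real ((cmod (F' z j0 j0))\<^sup>2) = (1 :: complex)" by(simp add: complex_norm_square mult.commute del: of_real_power)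
  hence "(cmod (F' z j0 j0))\<^sup>2 = 1" by(simp only: of_real_eq_1_iff)
  thus "F' z j0 j0:S1" by(simp add: power2_eq_1_iff) (smt (verit) norm_ge_zero)
 qed
 show ?case
 proof (cases "J = {j0}")
  case True
  have z: "F z i j0 = 0" if "z:S1" "i ~= j0" for z i using uF[OF that(1)] that(2) True by(auto simp: umat_def msupp_def)
  have "hom_in S1 {u. umat J u} F (%z. dg J j0 (F z j0 j0))"
  proof (rule hom_in_eq[OF hom_in_refl[OF psubset.prems(2,3)]])
   fix z :: complex assume "z:S1"
   hence "msupp J J (F z)" using uF umat_msupp by blast
   thus "F z = dg J j0 (F z j0 j0)" using True by(intro ext) (auto simp: dg_def msupp_def)
  qed auto
  thus ?thesis by(intro exI[of _ "%z. F z j0 j0"] conjI cF norm1[OF uF z])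
 next
  case False
  then obtain j1 where j1: "j1:J" "j1 ~= j0" using psubset.prems(1) by blast
  have "(%i. F z i j0):nzvec J" if "z:S1" for z
  proof -
   have "mm J (madj (F z)) (F z) j0 j0 = 1" using uF[OF that] psubset.prems(1) by(simp add: umat_def mone_def)
   hence "EX i:J. F z i j0 ~= 0" unfolding mm_def by(metis (no_types, lifting) mult_zero_right sum.neutral zero_neq_one)
   thus ?thesis using umat_msupp[OF uF[OF that]] by(auto simp: nzvec_def msupp_def)
  qed
  from vector_loop_null_homotopic[OF psubset.hyps psubset.prems(1) j1(1) j1(2)[symmetric] cF this]
  have "hom_in S1 (nzvec J) (%z i. F z i j0) (%_. unitvec j0)" .
  from column_transport[OF psubset.hyps psubset.prems(1) cF uF this] obtain G where
   G: "hom_in S1 {u. umat J u} F G" "!!z i. z:S1 ==> i ~= j0 ==> G z i j0 = 0" by blast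
  have uG: "umat J (G z)" if "z:S1" for z using hom_in_maps[OF G(1)] that by auto
  have cG: "cont S1 (%z. G z i j)" for i j
   using hom_in_continuous[OF G(1)] by(simp add: continuous_on_mat)
  define J' where "J' = J - {j0}"
  have J': "finite J'" "j0 ~: J'" "J = insert j0 J'" "j1:J'" "J' \<subset> J"
   using psubset j1 by(auto simp: J'_def)
  define B where "B z i j = (if i:J' & j:J' then G z i j else 0)" for z i j
  define phi where "phi z = G z j0 j0" for z
  have phi: "cont S1 phi" "phi:S1 \<rightarrow> S1"
   unfolding phi_def by(rule cG, rule norm1[OF uG G(2)])
  have sB: "msupp J' J' (B z)" for z by(auto simp: msupp_def B_def)
  have Gb: "G z = blk j0 (phi z) (B z)" if z: "z:S1" for z
  proof (intro ext)
   fix i j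
   have row: "G z j0 j = 0" if "j ~= j0" for j
   proof (cases "j:J")
    case True
    have "(SUM k:J. G z j0 k*cnj (G z j0 k)) = mm J (G z) (madj (G z)) j0 j0"
     unfolding mm_def madj_def star_complex_def ..
    also have "... = 1" using uG[OF z] psubset.prems(1) by(simp add: umat_def mone_def)
    also have "(SUM k:J. G z j0 k*cnj (G z j0 k)) = of_real (SUM k:J. (cmod (G z j0 k))\<^sup>2)"
     unfolding of_real_sum by(intro sum.cong refl) (simp add: complex_norm_square del: of_real_power)
    finally have "(SUM k:J. (cmod (G z j0 k))\<^sup>2) = 1" by(simp only: of_real_eq_1_iff)
    moreover have "cmod (phi z) = 1" using phi(2) z by(auto simp: Pi_iff)
    ultimately have "(SUM k:J'. (cmod (G z j0 k))\<^sup>2) = 0" using J' by(simp add: phi_def)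
    thus ?thesis using J' True that by(subst (asm) sum_nonneg_eq_0_iff) auto
   qed (use umat_msupp[OF uG[OF z]] in "auto simp: msupp_def")
   show "G z i j = blk j0 (phi z) (B z) i j"
    using row[of j] G(2)[OF z, of i] umat_msupp[OF uG[OF z]] J'(2,3)
    by(cases "i = j0"; cases "j = j0") (simp_all add: blk_def B_def phi_def msupp_def, blast)
  qed
  have uB: "umat J' (B z)" if "z:S1" for z
   using uG[OF that] J' sB unfolding Gb[OF that] by(simp add: umat_blk_iff)
  have "cont S1 B" unfolding continuous_on_mat B_def using cG by(intro allI continuous_on_if_const continuous_on_const)
  from psubset.IH[OF J'(5,4) this] uB obtain g where
   g: "cont S1 g" "g:S1 \<rightarrow> S1" "hom_in S1 {u. umat J' u} B (%z. dg J' j1 (g z))" by auto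
  have 2: "hom_in S1 {u. umat J u} (%z. blk j0 (phi z) (B z)) (%z. blk j0 (phi z) (dg J' j1 (g z)))"
  proof -
   obtain h where h: "cont ({0..1::real} \<times> S1) h" "h:{0..1} \<times> S1 \<rightarrow> {u. umat J' u}"
    "!!z. z:S1 ==> h (0,z) = B z" "!!z. z:S1 ==> h (1,z) = dg J' j1 (g z)"
    using g(3) unfolding hom_in_iff by auto
   show ?thesis
   proof (rule hom_inI[where h = "%x. blk j0 (phi (snd x)) (h x)"])
    have "cont ({0..1} \<times> S1) (%x. h x i j)" for i j using h(1) by(simp add: continuous_on_mat)
    moreover have "cont ({0..1} \<times> S1) (%x. phi (snd x))"
     by(rule continuous_on_compose2[OF phi(1)]) (auto intro!: continuous_intros)
    ultimately show "cont ({0..1} \<times> S1) (%x. blk j0 (phi (snd x)) (h x))"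
     unfolding continuous_on_mat blk_def by(intro allI continuous_on_if_const)
    fix t and z :: complex assume t: "0 <= t" "t <= (1::real)" "z:S1"
    hence "umat J' (h (t,z))" using h(2) by auto
    moreover have "cnj (phi z)*phi z = 1" "phi z*cnj (phi z) = 1"
     using phi(2) t(3) by(auto simp: complex_norm_square[symmetric] mult.commute[of "cnj _"] Pi_iff)
    ultimately show "blk j0 (phi (snd (t,z))) (h (t,z)):{u. umat J u}"
     using umat_blk_iff[OF J'(1,2) umat_msupp, of "h (t,z)" "phi z"] J'(3) by(simp add: star_complex_def)
   qed (use h in auto)
  qed
  define J'' where "J'' = J' - {j1}"
  have J'': "finite J''" "j0 ~: J''" "j1 ~: J''" "j0 ~= j1" "J = insert j0 (insert j1 J'')" "J' = insert j1 J''"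
   using J' j1 by(auto simp: J''_def)
  have e1: "blk j0 a (dg J' j1 b) = plane J'' j0 j1 a 0 0 b" for a b :: complex
  proof (intro ext)
   fix i j
   show "blk j0 a (dg J' j1 b) i j = plane J'' j0 j1 a 0 0 b i j"
    using J''(2-4) unfolding J''(6)
    by(cases "i = j0"; cases "i = j1"; cases "j = j0"; cases "j = j1"; cases "i = j")
     (simp_all add: blk_def dg_def plane_def mone_def)
  qed
  have e2: "plane J'' j0 j1 a 0 0 1 = dg J j0 a" for a :: complex
  proof (intro ext)
   fix i j
   show "plane J'' j0 j1 a 0 0 1 i j = dg J j0 a i j"
    using J''(2-4) unfolding J''(5)
    by(cases "i = j0"; cases "i = j1"; cases "j = j0"; cases "j = j1"; cases "i = j")
     (simp_all add: dg_def plane_def mone_def)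
  qed
  have 3: "hom_in S1 {u. umat J u} (%z. blk j0 (phi z) (dg J' j1 (g z))) (%z. dg J j0 (phi z*g z))"
   using whitehead_homotopy[OF J''(1-4) phi g(1,2)] unfolding e1 e2 J''(5)[symmetric] .
  have "hom_in S1 {u. umat J u} F (%z. dg J j0 (phi z*g z))"
   by(rule hom_in_trans[OF hom_in_trans[OF hom_in_eq[OF G(1) refl Gb] 2] 3])
  moreover have "cont S1 (%z. phi z*g z)" by(intro continuous_intros phi g)
  moreover have "(%z. phi z*g z):S1 \<rightarrow> S1" using phi(2) g(2) by(auto simp: norm_mult Pi_iff)
  ultimately show ?thesis by(intro exI[of _ "%z. phi z*g z"] conjI)
 qed
qed

lemma unitary_loop_normal_form:
 fixes F :: "complex => 'i => 'i => complex"
 assumes "finite J" "j0:J" "cont S1 F" "F:S1 \<rightarrow> {u. umat J u}"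
 shows "EX w. hom_in S1 {u. umat J u} F (%z. dg J j0 (z powi w))"
proof -
 obtain f where f: "cont S1 f" "f:S1 \<rightarrow> S1" "hom_in S1 {u. umat J u} F (%z. dg J j0 (f z))"
  using unitary_loop_diagonal[OF assms] by blast
 obtain w where w: "hom_in S1 S1 f (%z. z powi w)" using circle_map_homotopic_powi[OF f(1,2)] by blast
 have "hom_in S1 {u. umat J u} (%z. dg J j0 (f z)) (%z. dg J j0 (z powi w))"
 proof (rule hom_in_compose[OF w])
  show "cont S1 (%a. dg J j0 a)"
   unfolding continuous_on_mat dg_def by(intro allI continuous_on_if_const continuous_on_const continuous_on_id)
  show "dg J j0:S1 \<rightarrow> {u. umat J u}"
  proof (rule Pi_I)
   fix a :: complex assume "a:S1"
   hence "a*cnj a = 1" by(simp add: complex_norm_square[symmetric])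
   thus "dg J j0 a:{u. umat J u}" using umat_dg[OF assms(1,2), of a] by(simp add: star_complex_def mult.commute)
  qed
 qed
 thus ?thesis using hom_in_trans[OF f(3)] by blast
qed

lemma mm_diff_left: "mm J (%i k. a i k - b i k :: 'b::ring_1) c = (%i j. mm J a c i j - mm J b c i j)"
 by(intro ext) (simp add: mm_def left_diff_distrib sum_subtractf)

lemma mm_diff_right: "mm J c (%i k. a i k - b i k :: 'b::ring_1) = (%i j. mm J c a i j - mm J c b i j)"
 by(intro ext) (simp add: mm_def right_diff_distrib sum_subtractf)

lemma mm_zero: "mm J a (%i j. 0) = (%i j. 0)" "mm J (%i j. 0) b = (%i j. 0)"
 by(intro ext, simp add: mm_def)+

lemma trace_nonneg:
 fixes p :: "'i => 'i => complex"
 assumes "pmat J p"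
 shows "0 <= Re (SUM i:J. p i i)"
proof -
 have "(SUM i:J. p i i) = (SUM i:J. SUM k:J. of_real ((cmod (p i k))\<^sup>2))"
 proof (rule sum.cong[OF refl])
  fix i
  have "p i i = (SUM k:J. p i k*p k i)" using assms by(metis pmat_def mm_def)
  also have "... = (SUM k:J. of_real ((cmod (p i k))\<^sup>2))"
  proof (rule sum.cong[OF refl])
   fix k
   have "p k i = cnj (p i k)" using assms by(metis pmat_def madj_def star_complex_def)
   thus "p i k*p k i = of_real ((cmod (p i k))\<^sup>2)" by(simp only: complex_norm_square)
  qed
  finally show "p i i = (SUM k:J. of_real ((cmod (p i k))\<^sup>2))" .
 qed
 thus ?thesis by(simp add: sum_nonneg del: of_real_power)
qed

context
 fixes J :: "'i set" and R :: "complex => 'i => 'i => complex"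
 assumes J: "finite J" and cR: "!!i j. cont S1 (%z. R z i j)"
  and pR: "!!z. z:S1 ==> pmat J (R z)"
begin

lemma projection_loop_transport:
 obtains u where "!!i j. cont {0..1} (%t. u t i j)" "!!t. t:{0..1} ==> umat J (u t)" "u 0 = mone J"
  "!!t. t:{0..1} ==> mm J (u t) (R 1) = mm J (R (turn t)) (u t)"
proof -
 define R' where "R' x = memb J (R (turn (fst x)))" for x :: "real \<times> real"
 have c: "cont ({0..1} \<times> {0}) R'" unfolding R'_def
  by(intro continuous_on_memb continuous_on_compose2[OF cR continuous_on_turn[OF continuous_on_fst[OF continuous_on_id]]]) auto
 have sR: "msupp J J (R z)" if "z:S1" for z using pR[OF that] by(simp add: pmat_def)
 have p: "is_proj (R' (t,z))" for t z
  using pR[OF turn_circle] J by(simp add: R'_def pmat_iff_memb)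
 obtain U where U: "cont ({0..1} \<times> {0}) U" "!!z. z:{0} ==> U (0,z) = 1"
  "!!t z. t:{0..1} ==> z:{0} ==> is_unitary (U (t,z)) & U (t,z) * R' (0,z) = R' (t,z)*U (t,z) & U (t,z):UNIV"
  using parallel_transport[OF compact_sing c p UNIV_I closed_alg_UNIV] by blast
 show thesis
 proof (rule that[of "%t. ent (U (t,0)) J"])
  show "cont {0..1} (%t. ent (U (t,0)) J i j)" for i j
   by(intro continuous_on_ent continuous_on_compose2[OF U(1)] continuous_intros) auto
  show "umat J (ent (U (t,0)) J)" if "t:{0..1}" for t using U(3)[OF that] umat_ent[OF J] by blast
  show "ent (U (0,0)) J = mone J" by(simp add: U(2) ent_one'[OF J])
  show "mm J (ent (U (t,0)) J) (R 1) = mm J (R (turn t)) (ent (U (t,0)) J)" if t: "t:{0..1}" for t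
  proof -
   have "ent (U (t,0) * R' (0,0)) J = ent (R' (t,0)*U (t,0)) J" using U(3)[OF t] by simp
   thus ?thesis
    unfolding mm_ent R'_def fst_conv ent_memb'[OF J sR[OF turn_circle]] by simp
  qed
 qed
qed

lemma projection_loop_zero:
 assumes "R 1 = (%i j. 0)" "z:S1"
 shows "R z = (%i j. 0)"
proof -
 obtain u where u: "!!t. t:{0..1} ==> umat J (u t)"
  "!!t. t:{0..1} ==> mm J (u t) (R 1) = mm J (R (turn t)) (u t)"
  using projection_loop_transport by metis
 let ?t = "Arg2pi z / (2*pi)"
 have t: "?t:{0..1}" using Arg2pi_ge_0[of z] Arg2pi_lt_2pi[of z] by(simp add: field_simps)
 have "mm J (R z) (u ?t) = (%i j. 0)"
  using u(2)[OF t] turn_Arg2pi[OF assms(2)] by(simp add: assms(1) mm_zero)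
 hence "mm J (mm J (R z) (u ?t)) (madj (u ?t)) = (%i j. 0)" by(simp add: mm_zero)
 moreover have "mm J (u ?t) (madj (u ?t)) = mone J" using u(1)[OF t] by(simp add: umat_def)
 moreover have "mm J (R z) (mone J) = R z" using pR[OF assms(2)] by(intro mm_mone_right[OF J, of J]) (simp add: pmat_def)
 ultimately show ?thesis by(simp add: mm_assoc)
qed

lemma projection_loop_section:
 assumes "R 1 ~= (%i j. 0)"
 obtains v :: "complex => 'i => unit => complex" where "!!i. cont S1 (%z. v z i ())"
  "!!z. z:S1 ==> msupp J UNIV (v z) & mm J (madj (v z)) (v z) = mone UNIV & mm J (R z) (v z) = v z"
proof -
 have p1: "pmat J (R 1)" using pR[of 1] by simp
 obtain u where cu: "!!i j. cont {0..1} (%t. u t i j)" and u: "!!t. t:{0..1} ==> umat J (u t)" and u0: "u 0 = mone J"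
  and uR: "!!t. t:{0..1} ==> mm J (u t) (R 1) = mm J (R (turn t)) (u t)"
  using projection_loop_transport by metis
 have nsq: "mm J (madj w) w () () = of_real (SUM i:J. (cmod (w i ()))\<^sup>2)" for w :: "'i => unit => complex"
  unfolding mm_def madj_def star_complex_def of_real_sum
  by(intro sum.cong refl) (simp add: complex_norm_square mult.commute del: of_real_power)
 define nv where "nv w = sqrt (SUM i:J. (cmod (w i ()))\<^sup>2)" for w :: "'i => unit => complex"
 have nv_pos: "nv w > 0" if w: "msupp J UNIV w" "w ~= (%i j. 0)" for w
 proof -
  obtain i where "w i () ~= 0" using w(2) by(metis (full_types) ext old.unit.exhaust)
  hence "i:J" using w(1) by(auto simp: msupp_def)
  hence "(SUM i:J. (cmod (w i ()))\<^sup>2) > 0" using J `w i () ~= 0` by(intro sum_pos2[of J i]) auto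
  thus ?thesis by(simp add: nv_def)
 qed
 have normalize: "mm J (madj (%i j. w i j / of_real (nv w))) (%i j. w i j / of_real (nv w)) = mone UNIV"
  if "msupp J UNIV w" "w ~= (%i j. 0)" for w
 proof (intro ext)
  fix i j :: unit
  have "(SUM i:J. (cmod (w i () / of_real (nv w)))\<^sup>2) = (SUM i:J. (cmod (w i ()))\<^sup>2) / (nv w)\<^sup>2"
   using nv_pos[OF that] by(simp add: norm_divide power_divide sum_divide_distrib)
  also have "... = 1" using nv_pos[OF that] by(auto simp: nv_def)
  finally show "mm J (madj (%i j. w i j / of_real (nv w))) (%i j. w i j / of_real (nv w)) i j = mone UNIV i j"
   by(cases i; cases j) (simp add: nsq mone_def del: of_real_power of_real_sum)
 qed
 have scale: "mm J a (%i j. w i j / c) = (%i j. mm J a w i j / c)" for a :: "'i => 'i => complex" and w :: "'i => unit => complex" and c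
  by(intro ext) (simp add: mm_def sum_divide_distrib)
 obtain i0 k0 where ik: "R 1 i0 k0 ~= 0" using assms by(metis ext)
 define w0 where "w0 i (j::unit) = R 1 i k0" for i j
 have w0: "msupp J UNIV w0" "w0 ~= (%i j. 0)" "mm J (R 1) w0 = w0"
 proof -
  show "msupp J UNIV w0" using p1 by(auto simp: pmat_def msupp_def w0_def)
  show "w0 ~= (%i j. 0)" using ik by(auto simp: w0_def fun_eq_iff)
  have "mm J (R 1) (R 1) = R 1" using p1 by(simp add: pmat_def)
  thus "mm J (R 1) w0 = w0" by(simp add: fun_eq_iff mm_def w0_def)
 qed
 define v0 where "v0 i j = w0 i j / of_real (nv w0)" for i j
 have v0: "msupp J UNIV v0" "mm J (madj v0) v0 = mone UNIV" "mm J (R 1) v0 = v0"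
 proof -
  have e: "v0 = (%i j. w0 i j / of_real (nv w0))" by(intro ext v0_def)
  show "msupp J UNIV v0" using w0(1) by(simp add: v0_def msupp_def)
  show "mm J (madj v0) v0 = mone UNIV" unfolding e by(rule normalize[OF w0(1,2)])
  show "mm J (R 1) v0 = v0" unfolding e scale w0(3) ..
 qed
 have one: "(1::real):{0..1}" by simp
 define a where "a = mm J (madj (u 1)) v0"
 have comm: "mm J (R 1) (madj (u 1)) = mm J (madj (u 1)) (R 1)"
  using arg_cong[OF uR[OF one], of madj] p1 by(simp add: madj_mm pmat_def)
 have a: "msupp J UNIV a" "mm J (R 1) a = a" "mm J (madj a) a = mone UNIV"
 proof -
  show "msupp J UNIV a" unfolding a_def by(rule msupp_mm[OF msupp_madj[OF umat_msupp[OF u[OF one]]] v0(1)])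
  show "mm J (R 1) a = a" unfolding a_def using comm v0(3) by(metis mm_assoc)
  have "mm J (madj a) a = mm J (madj v0) (mm J (mm J (u 1) (madj (u 1))) v0)" by(simp add: a_def madj_mm mm_assoc)
  also have "mm J (u 1) (madj (u 1)) = mone J" using u[OF one] by(simp add: umat_def)
  finally show "mm J (madj a) a = mone UNIV" using v0 by(simp add: mm_mone[OF J v0(1)])
 qed
 define c where "c t i j = (if a = (%i j. - v0 i j) then exp (\<i> * of_real (pi*t)) * v0 i j
  else (1 - of_real t) * v0 i j + of_real t*a i j)" for t i j
 have cc: "cont {0..1} (%t. c t i j)" for i j
  unfolding c_def by(intro continuous_on_if_const continuous_intros)
 have c01: "c 0 = v0" "c 1 = a" by(auto simp: c_def fun_eq_iff)
 have c_supp: "msupp J UNIV (c t)" for t using v0(1) a(1) by(auto simp: msupp_def c_def)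
 have cR1: "mm J (R 1) (c t) = c t" for t
 proof (intro ext)
  fix i j
  have "(SUM k:J. R 1 i k * v0 k j) = v0 i j" "(SUM k:J. R 1 i k*a k j) = a i j"
   using fun_cong[OF fun_cong[OF v0(3)]] fun_cong[OF fun_cong[OF a(2)]] by(simp_all add: mm_def)
  moreover have "mm J (R 1) (c t) i j = (if a = (%i j. - v0 i j) then exp (\<i> * of_real (pi*t))*(SUM k:J. R 1 i k * v0 k j)
   else (1 - of_real t)*(SUM k:J. R 1 i k * v0 k j) + of_real t*(SUM k:J. R 1 i k*a k j))"
   by(simp add: mm_def c_def distrib_left sum.distrib sum_distrib_left mult_ac)
  ultimately show "mm J (R 1) (c t) i j = c t i j" by(simp add: c_def)
 qed
 have c_nz: "c t ~= (%i j. 0)" for t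
 proof
  assume z: "c t = (%i j. 0)"
  have v1: "(SUM i:J. (cmod (v0 i ()))\<^sup>2) = 1" "(SUM i:J. (cmod (a i ()))\<^sup>2) = 1"
   using nsq[of v0] nsq[of a] v0(2) a(3) by(simp_all add: mone_def flip: of_real_sum of_real_power)
  show False
  proof (cases "a = (%i j. - v0 i j)")
   case True
   hence "v0 i () = 0" for i using fun_cong[OF fun_cong[OF z], of i "()"] by(simp add: c_def)
   thus False using v1(1) by simp
  next
   case False
   have e: "(1 - of_real t) * v0 i j = - of_real t*a i j" for i j
    using fun_cong[OF fun_cong[OF z], of i j] False by(simp add: c_def add_eq_0_iff)
   have "cmod (of_real (1 - t) * v0 i ()) = cmod (of_real t*a i ())" for i using e[of i "()"] by simp
   hence "\<bar>1 - t\<bar>*cmod (v0 i ()) = \<bar>t\<bar>*cmod (a i ())" for i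
    by(simp only: norm_mult norm_of_real)
   hence "(1 - t)\<^sup>2*(cmod (v0 i ()))\<^sup>2 = t\<^sup>2*(cmod (a i ()))\<^sup>2" for i
    by(metis power_mult_distrib power2_abs)
   hence "(SUM i:J. (1 - t)\<^sup>2*(cmod (v0 i ()))\<^sup>2) = (SUM i:J. t\<^sup>2*(cmod (a i ()))\<^sup>2)" by simp
   hence "(1 - t)\<^sup>2 = t\<^sup>2" unfolding sum_distrib_left[symmetric] v1 by simp
   hence t: "t = 1/2" by(simp add: power2_eq_square algebra_simps)
   have "a i j = - v0 i j" for i j
   proof -
    have "(1/2)*(v0 i j + a i j) = 0" using e[of i j] unfolding t by(simp add: distrib_left)
    hence "v0 i j + a i j = 0" by simp
    thus ?thesis by(metis add.commute eq_neg_iff_add_eq_0)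
   qed
   hence "a = (%i j. - v0 i j)" by(intro ext)
   thus False using False by contradiction
  qed
 qed
 define y where "y t = mm J (u t) (c t)" for t
 have cy: "cont {0..1} (%t. y t i j)" for i j unfolding y_def by(intro continuous_on_mm cu cc)
 have y01: "y 0 = y 1"
 proof -
  have "y 1 = mm J (mm J (u 1) (madj (u 1))) v0" by(simp add: y_def c01 a_def mm_assoc)
  also have "mm J (u 1) (madj (u 1)) = mone J" using u[OF one] by(simp add: umat_def)
  finally show ?thesis by(simp add: y_def u0 c01)
 qed
 have y: "msupp J UNIV (y t)" "y t ~= (%i j. 0)" "mm J (R (turn t)) (y t) = y t" if t: "t:{0..1}" for t
 proof -
  show "msupp J UNIV (y t)" unfolding y_def by(rule msupp_mm[OF umat_msupp[OF u[OF t]] c_supp])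
  show "mm J (R (turn t)) (y t) = y t"
   unfolding y_def mm_assoc[symmetric] uR[OF t, symmetric] unfolding mm_assoc cR1 ..
  have "mm J (madj (u t)) (y t) = mm J (mm J (madj (u t)) (u t)) (c t)" by(simp add: y_def mm_assoc)
  also have "... = c t" using u[OF t] by(simp add: umat_def mm_mone[OF J c_supp])
  finally show "y t ~= (%i j. 0)" using c_nz[of t] by(auto simp: mm_zero)
 qed
 define x where "x t i j = y t i j / of_real (nv (y t))" for t i j
 have "cont {0..1} (%t. x t i ())" for i
  unfolding x_def nv_def using nv_pos[OF y(1,2)] by(intro continuous_intros cy) (force simp: nv_def)
 hence "cont S1 (%z. x (Arg2pi z / (2*pi)) i ())" for i
  by(rule circle_of_loop) (simp add: x_def y01)
 moreover have "msupp J UNIV (x (Arg2pi z / (2*pi))) & mm J (madj (x (Arg2pi z / (2*pi)))) (x (Arg2pi z / (2*pi))) = mone UNIV &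
   mm J (R z) (x (Arg2pi z / (2*pi))) = x (Arg2pi z / (2*pi))" if z: "z:S1" for z
 proof -
  let ?t = "Arg2pi z / (2*pi)"
  have t: "?t:{0..1}" using Arg2pi_ge_0[of z] Arg2pi_lt_2pi[of z] by(simp add: field_simps)
  have "mm J (R z) (y ?t) = y ?t" using y(3)[OF t] turn_Arg2pi[OF z] by simp
  moreover have e: "x ?t = (%i j. y ?t i j / of_real (nv (y ?t)))" by(intro ext x_def)
  moreover have "msupp J UNIV (x ?t)" using y(1)[OF t] by(simp add: x_def msupp_def)
  ultimately show ?thesis using normalize[OF y(1,2)[OF t]] scale[of "R z" "y ?t"] by metis
 qed
 ultimately show thesis by(intro that[of "%z. x (Arg2pi z / (2*pi))"])
qed

end

definition is_frame :: "'i set => nat => ('i => nat => complex) => ('i => 'i => complex) => bool" where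
 "is_frame J r W p <-> msupp J {..<r} W & mm J (madj W) W = mone {..<r} & mm {..<r} W (madj W) = p"

lemma is_frame_trace: "is_frame J r W p ==> (SUM i:J. p i i) = of_nat r"
proof -
 assume W: "is_frame J r W p"
 hence "(SUM i:J. p i i) = (SUM i:J. SUM l<r. W i l*cnj (W i l))"
  unfolding is_frame_def by(auto simp: mm_def madj_def star_complex_def)
 also have "... = (SUM l<r. mm J (madj W) W l l)"
  by(subst sum.swap) (simp add: mm_def madj_def star_complex_def mult.commute)
 also have "... = of_nat r" using W by(simp add: is_frame_def mone_def)
 finally show ?thesis .
qed

text \<open>Peel off one unit section of the range after another; the trace drops by one each time.\<close>

lemma projection_loop_frame:
 fixes R :: "complex => 'i => 'i => complex"
 assumes J: "finite J"
 shows "[|!!i j. cont S1 (%z. R z i j); !!z. z:S1 ==> pmat J (R z)|] ==>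
  EX r W. (ALL i l. cont S1 (%z. W z i l)) & (ALL z:S1. is_frame J r (W z) (R z))"
proof (induction "nat \<lceil>Re (SUM i:J. R 1 i i)\<rceil>" arbitrary: R rule: less_induct)
 case less
 note cR = less.prems(1) and pR = less.prems(2)
 show ?case
 proof (cases "R 1 = (%i j. 0)")
  case True
  have "is_frame J 0 (%i j. 0) (R z)" if "z:S1" for z
   using projection_loop_zero[OF J cR pR True that]
   by(auto simp: is_frame_def msupp_def mm_def mone_def fun_eq_iff)
  thus ?thesis by(intro exI[of _ 0] exI[of _ "%_ _ _. 0"]) auto
 next
  case False
  obtain v :: "complex => 'i => unit => complex" where cv: "!!i. cont S1 (%z. v z i ())"
   and v: "!!z. z:S1 ==> msupp J UNIV (v z) & mm J (madj (v z)) (v z) = mone UNIV & mm J (R z) (v z) = v z"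
   using projection_loop_section[OF J cR pR False] by metis
  define Q where "Q z = mm UNIV (v z) (madj (v z))" for z
  have Q: "Q z i j = v z i ()*cnj (v z j ())" for z i j
   by(simp add: Q_def mm_def madj_def star_complex_def UNIV_unit)
  define R' where "R' z i j = R z i j - Q z i j" for z i j
  have R'_def': "R' z = (%i j. R z i j - Q z i j)" for z by(simp add: R'_def fun_eq_iff)
  have cR': "cont S1 (%z. R' z i j)" for i j
   unfolding R'_def Q by(intro continuous_intros cR cv)
  have facts: "mm J (R z) (R z) = R z" "madj (R z) = R z" "mm J (R z) (Q z) = Q z" "mm J (Q z) (R z) = Q z" "mm J (Q z) (Q z) = Q z"
   "msupp J J (R z)" "msupp J J (Q z)" "madj (Q z) = Q z" "mm J (R' z) (v z) = (%i j. 0)"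
   if z: "z:S1" for z
  proof -
   show 1: "mm J (R z) (R z) = R z" "madj (R z) = R z" "msupp J J (R z)" using pR[OF z] by(simp_all add: pmat_def)
   have Rv: "mm J (R z) (v z) = v z" and vv: "mm J (madj (v z)) (v z) = mone UNIV" and sv: "msupp J UNIV (v z)" using v[OF z] by auto
   have m1: "mm UNIV (mone UNIV) b = b" for b :: "unit => 'i => complex" by(rule mm_mone) (auto simp: msupp_def)
   have m2: "mm UNIV b (mone UNIV) = b" for b :: "'i => unit => complex" by(rule mm_mone_right) (auto simp: msupp_def)
   show 2: "mm J (R z) (Q z) = Q z" by(simp add: Q_def mm_assoc[symmetric] Rv)
   show 3: "madj (Q z) = Q z" by(simp add: Q_def madj_mm)
   show "mm J (Q z) (R z) = Q z" using arg_cong[OF 2, of madj] by(simp add: madj_mm 1 3)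
   have Qv: "mm J (Q z) (v z) = v z" unfolding Q_def mm_assoc vv m2 ..
   show "mm J (Q z) (Q z) = Q z" by(subst (2 3) Q_def) (simp add: mm_assoc[symmetric] Qv)
   show "msupp J J (Q z)" unfolding Q_def by(rule msupp_mm[OF sv msupp_madj[OF sv]])
   show "mm J (R' z) (v z) = (%i j. 0)" unfolding R'_def' mm_diff_left Rv Qv by simp
  qed
  have pR': "pmat J (R' z)" if z: "z:S1" for z
   unfolding pmat_def
  proof (intro conjI)
   show "msupp J J (R' z)" using facts(6,7)[OF z] by(simp add: msupp_def R'_def)
   show "mm J (R' z) (R' z) = R' z"
    unfolding R'_def' mm_diff_left mm_diff_right facts(1,3-5)[OF z] by simp
   show "madj (R' z) = R' z"
    using facts(2,8)[OF z] unfolding R'_def' madj_def star_complex_def by(simp add: fun_eq_iff)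
  qed
  have one: "(1::complex):S1" by simp
  have "(SUM i:J. Q 1 i i) = mm J (madj (v 1)) (v 1) () ()"
   unfolding Q mm_def madj_def star_complex_def by(simp add: mult.commute)
  also have "... = 1" using v[OF one] by(simp add: mone_def)
  finally have tr: "Re (SUM i:J. R' 1 i i) = Re (SUM i:J. R 1 i i) - 1" by(simp add: R'_def sum_subtractf)
  have "nat \<lceil>Re (SUM i:J. R' 1 i i)\<rceil> < nat \<lceil>Re (SUM i:J. R 1 i i)\<rceil>"
   using trace_nonneg[OF pR'[OF one]] unfolding tr by linarith
  from less.hyps[OF this cR' pR'] obtain r W' where
   W': "!!i l. cont S1 (%z. W' z i l)" "!!z. z:S1 ==> is_frame J r (W' z) (R' z)" by blast
  define W where "W z i l = (if l < r then W' z i l else if l = r then v z i () else 0)" for z i l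
  have "is_frame J (Suc r) (W z) (R z)" if z: "z:S1" for z
  proof -
   have F: "msupp J {..<r} (W' z)" "mm J (madj (W' z)) (W' z) = mone {..<r}" "mm {..<r} (W' z) (madj (W' z)) = R' z"
    using W'(2)[OF z] by(auto simp: is_frame_def)
   have RW: "mm J (R' z) (W' z) = W' z"
    unfolding F(3)[symmetric] mm_assoc F(2) by(rule mm_mone_right[OF _ F(1)]) simp
   have "mm J (madj (W' z)) (R' z) = madj (W' z)"
    using arg_cong[OF RW, of madj] pR'[OF z] by(simp add: madj_mm pmat_def)
   hence "mm J (madj (W' z)) (v z) = mm J (madj (W' z)) (mm J (R' z) (v z))" by(simp add: mm_assoc[symmetric])
   also have "... = (%i j. 0)" unfolding facts(9)[OF z] by(rule mm_zero)
   finally have o1: "mm J (madj (W' z)) (v z) = (%i j. 0)" .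
   have o2: "mm J (madj (v z)) (W' z) = (%i j. 0)" using arg_cong[OF o1, of madj] by(simp add: madj_mm) (simp add: madj_def fun_eq_iff)
   have vv: "mm J (madj (v z)) (v z) () () = 1" using v[OF z] by(simp add: mone_def)
   show ?thesis
    unfolding is_frame_def
   proof (intro conjI ext)
    show "msupp J {..<Suc r} (W z)" using F(1) v[OF z] by(auto simp: msupp_def W_def less_Suc_eq)
    fix l m
    have "mm J (madj (W z)) (W z) l m = (if l < r & m < r then mm J (madj (W' z)) (W' z) l m
      else if l < r & m = r then mm J (madj (W' z)) (v z) l () else if l = r & m < r then mm J (madj (v z)) (W' z) () m
      else if l = r & m = r then mm J (madj (v z)) (v z) () () else 0)"
     by(cases "l < r"; cases "l = r"; cases "m < r"; cases "m = r") (simp_all add: mm_def madj_def W_def)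
    thus "mm J (madj (W z)) (W z) l m = mone {..<Suc r} l m"
     unfolding o1 o2 vv F(2)
     by(cases "l < r"; cases "l = r"; cases "m < r"; cases "m = r") (simp_all add: mone_def)
   next
    fix i j
    have "mm {..<Suc r} (W z) (madj (W z)) i j = mm {..<r} (W' z) (madj (W' z)) i j + Q z i j"
     by(simp add: mm_def madj_def W_def Q star_complex_def)
    thus "mm {..<Suc r} (W z) (madj (W z)) i j = R z i j" by(simp add: F(3) R'_def)
   qed
  qed
  moreover have "cont S1 (%z. W z i l)" for i l
   unfolding W_def by(intro continuous_on_if_const W'(1) cv continuous_on_const)
  ultimately show ?thesis by blast
 qed
qed

section \<open>Continuous functional calculus of a unitary in a corner\<close>

class cstar_alg = banach_star +
 fixes cx :: "complex => 'a"
 assumes cx_add: "cx (c + d) = cx c + cx d"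
  and cx_mult: "cx (c*d) = cx c*cx d"
  and cx_of_real: "cx (of_real r) = r *R 1"
  and cx_commute: "x*cx c = cx c*x"
  and star_cx: "star (cx c) = cx (cnj c)"
  and norm_cx: "norm (cx c) = cmod c"
  and cstar_id: "norm (star x*x) = norm x*norm x"

lemma cx_0 [simp]: "cx 0 = (0 :: 'a::cstar_alg)" and cx_1 [simp]: "cx 1 = (1 :: 'a::cstar_alg)"
 using cx_of_real[of 0, where 'a = 'a] cx_of_real[of 1, where 'a = 'a] by simp_all

lemma cx_minus: "cx (- c) = - cx c"
 using cx_add[of c "- c"] by(simp add: eq_neg_iff_add_eq_0 add.commute)

lemma cx_sum: "cx (sum f S) = (SUM x:S. cx (f x))"
 by(induction S rule: infinite_finite_induct) (simp_all add: cx_add)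

lemma cx_left_commute: "x*(cx c*y) = cx c*(x*(y :: 'a::cstar_alg))"
 by(metis cx_commute mult.assoc)

lemma norm_cx_mult: "norm (cx c*(x :: 'a::cstar_alg)) = cmod c*norm x"
proof -
 have "norm (cx c*x)*norm (cx c*x) = norm (star (cx c*x)*(cx c*x))" by(simp add: cstar_id)
 also have "star (cx c*x)*(cx c*x) = cx (cnj c*c)*(star x*x)"
 proof -
  have "star (cx c*x)*(cx c*x) = star x*(cx (cnj c)*cx c*x)"
   by(simp only: star_mult star_cx mult.assoc)
  also have "... = cx (cnj c*c)*(star x*x)"
   unfolding cx_mult[symmetric] by(rule cx_left_commute)
  finally show ?thesis .
 qed
 also have "cnj c*c = of_real ((cmod c)\<^sup>2)" by(simp only: complex_norm_square mult.commute[of "cnj c"])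
 also have "norm (cx (of_real ((cmod c)\<^sup>2))*(star x*x)) = (cmod c*norm x)*(cmod c*norm x)"
  unfolding cx_of_real by(simp add: cstar_id power2_eq_square)
 finally have "(norm (cx c*x))\<^sup>2 = (cmod c*norm x)\<^sup>2" by(simp only: power2_eq_square)
 thus ?thesis by(simp add: power2_eq_iff_nonneg)
qed

definition closed_calg :: "'a::cstar_alg set => bool" where
 "closed_calg S <-> closed_alg S & (ALL c. cx c:S)"

lemma is_proj_norm_le: "is_proj (p :: 'a::cstar_alg) ==> norm p <= 1"
 using cstar_id[of p] by(auto simp: is_proj_def)

lemma is_unitary_norm: "is_unitary (u :: 'a::cstar_alg) ==> norm u = 1"
 using cstar_id[of u] square_eq_1_iff[of "norm u"] norm_ge_zero[of u] by(auto simp: is_unitary_def)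

definition upow :: "'a::banach_star => int => 'a" where
 "upow u n = (if 0 <= n then u ^ nat n else star u ^ nat (- n))"

lemma upow_0 [simp]: "upow u 0 = 1" and upow_1 [simp]: "upow u 1 = u" and upow_of_nat: "upow u (int n) = u ^ n"
 by(simp_all add: upow_def)

lemma star_upow: "star (upow u n) = upow u (- n)"
 by(auto simp: upow_def star_power)

lemma upow_Suc:
 assumes "is_unitary u"
 shows "upow u (n + 1) = u*upow u n"
proof (cases "0 <= n")
 case True
 thus ?thesis by(simp add: upow_def nat_add_distrib)
next
 case False
 hence "nat (- n) = Suc (nat (- (n + 1)))" by simp
 hence "u * star u ^ nat (- n) = star u ^ nat (- (n + 1))"
  using assms by(simp only: power_Suc is_unitary_def mult.assoc[symmetric]) simp
 thus ?thesis using False by(cases "n = -1") (auto simp: upow_def)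
qed

lemma upow_pred: "is_unitary u ==> upow u (n - 1) = star u*upow u n"
 using upow_Suc[of u "n - 1"] by(simp add: is_unitary_def mult.assoc[symmetric])

lemma upow_add:
 assumes "is_unitary u"
 shows "upow u (m + n) = upow u m*upow u n"
proof (induction m rule: int_induct[where k = 0])
 case (step1 i)
 thus ?case using upow_Suc[OF assms, of "i + n"] upow_Suc[OF assms, of i] by(simp add: algebra_simps)
next
 case (step2 i)
 thus ?case using upow_pred[OF assms, of "i + n"] upow_pred[OF assms, of i] by(simp add: algebra_simps)
qed simp

lemma upow_unitary: "is_unitary u ==> is_unitary (upow u n)"
 unfolding is_unitary_def[of "upow u n"] star_upow
 using upow_add[of u n "- n"] upow_add[of u "- n" n] by simp

lemma upow_commute:
 assumes "e*u = u*e" "is_unitary u"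
 shows "e*upow u n = upow u n*e"
proof -
 have "e * star u = star u*(u*e) * star u" using assms(2) by(simp add: is_unitary_def mult.assoc[symmetric])
 also have "... = star u*e*(u * star u)" unfolding assms(1)[symmetric] by(simp add: mult.assoc)
 finally have "e * star u = star u*e" using assms(2) by(simp add: is_unitary_def)
 hence "e * star u ^ m = star u ^ m*e" for m by(metis power_commuting_commutes)
 moreover have "e*u ^ m = u ^ m*e" for m using assms(1) by(metis power_commuting_commutes)
 ultimately show ?thesis by(simp add: upow_def)
qed

lemma sum_roots_of_unity:
 assumes "M > 0"
 shows "(SUM j<M. turn (of_int k*real j / M)) = (if int M dvd k then of_nat M else 0)"
proof -
 define q where "q = turn (of_int k / M)"
 have pw: "turn (of_int k*real j / M) = q ^ j" for j
  unfolding q_def turn_def exp_of_nat_mult[symmetric] by(simp add: field_simps)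
 have qM: "q ^ M = 1"
 proof -
  have "q ^ M = exp (2 * of_real pi * of_int k * \<i>)"
   unfolding q_def turn_def exp_of_nat_mult[symmetric] using assms by(simp add: field_simps)
  thus ?thesis using exp_integer_2pi[of "of_int k"] by(simp add: mult_ac)
 qed
 have q1: "q = 1 <-> int M dvd k"
 proof
  assume "q = 1"
  then obtain n :: int where "2*pi*(of_int k / M) = of_int (2*n)*pi"
   unfolding q_def turn_def exp_eq_1 by auto
  hence "real_of_int k = of_int (n*int M)" using assms by(simp add: field_simps)
  thus "int M dvd k" by(simp only: of_int_eq_iff) simp
 next
  assume "int M dvd k"
  then obtain n where "k = int M*n" by auto
  hence "of_int k / real M = of_int n" using assms by simp
  thus "q = 1" using exp_integer_2pi[of "of_int n"] by(simp add: q_def turn_def mult_ac)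
 qed
 show ?thesis unfolding pw using q1 qM by(auto simp: sum_gp_strict)
qed

lemma turn_powi: "turn x powi n = turn (of_int n*x)"
 by(simp add: turn_def exp_power_int mult_ac)

lemma turn_add: "turn (x + y) = turn x*turn y"
 by(simp add: turn_def exp_add[symmetric] algebra_simps)

locale unitary_corner =
 fixes U e :: "'b::cstar_alg"
 assumes U: "is_unitary U" and e: "is_proj e" and comm: "e*U = U*e"
  and lower: "!!d c z. z:S1 ==>
   cmod (SUM n:{- int d..int d}. c n*z powi n) <= norm (SUM n:{- int d..int d}. cx (c n)*(upow U n*e))"
begin

definition laurent :: "nat => (complex => complex) => 'b => bool" where
 "laurent d f x <-> (EX c. (ALL z:S1. f z = (SUM n:{- int d..int d}. c n*z powi n)) &
  x = (SUM n:{- int d..int d}. cx (c n)*(upow U n*e)))"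

lemma laurent_family:
 assumes "finite I" "!!i. i:I ==> \<bar>k i\<bar> <= int d"
  "!!z. z:S1 ==> f z = (SUM i:I. a i*z powi k i)" "x = (SUM i:I. cx (a i)*(upow U (k i)*e))"
 shows "laurent d f x"
proof -
 define c where "c n = sum a {i:I. k i = n}" for n
 have sub: "k ` I \<subseteq> {- int d..int d}"
 proof
  fix n assume "n:k ` I"
  hence "\<bar>n\<bar> <= int d" using assms(2) by blast
  thus "n:{- int d..int d}" by auto
 qed
 have "(SUM i:I. a i*z powi k i) = (SUM n:{- int d..int d}. c n*z powi n)" for z
  by(subst sum.group[OF assms(1) _ sub, symmetric]) (simp_all add: c_def sum_distrib_right)
 moreover have "(SUM i:I. cx (a i)*(upow U (k i)*e)) = (SUM n:{- int d..int d}. cx (c n)*(upow U n*e))"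
  by(subst sum.group[OF assms(1) _ sub, symmetric]) (simp_all add: c_def sum_distrib_right cx_sum)
 ultimately show ?thesis using assms(3,4) unfolding laurent_def by(intro exI[of _ c]) simp
qed

lemma laurent_powi: "laurent (nat \<bar>n\<bar>) (%z. z powi n) (upow U n*e)"
 by(rule laurent_family[of "{()}" "%_. n" _ _ "%_. 1"]) auto

lemma laurent_add: "laurent d f x ==> laurent d' g y ==> laurent (d + d') (%z. f z + g z) (x + y)"
proof -
 assume "laurent d f x" "laurent d' g y"
 then obtain a b where a: "!!z. z:S1 ==> f z = (SUM n:{- int d..int d}. a n*z powi n)" "x = (SUM n:{- int d..int d}. cx (a n)*(upow U n*e))"
  and b: "!!z. z:S1 ==> g z = (SUM n:{- int d'..int d'}. b n*z powi n)" "y = (SUM n:{- int d'..int d'}. cx (b n)*(upow U n*e))"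
  unfolding laurent_def by blast
 show ?thesis
  by(rule laurent_family[of "{- int d..int d} <+> {- int d'..int d'}" "case_sum id id" _ _ "case_sum a b"])
   (auto simp: sum.Plus a b)
qed

lemma laurent_mult: "laurent d f x ==> laurent d' g y ==> laurent (d + d') (%z. f z*g z) (x*y)"
proof -
 assume "laurent d f x" "laurent d' g y"
 then obtain a b where a: "!!z. z:S1 ==> f z = (SUM n:{- int d..int d}. a n*z powi n)" "x = (SUM n:{- int d..int d}. cx (a n)*(upow U n*e))"
  and b: "!!z. z:S1 ==> g z = (SUM n:{- int d'..int d'}. b n*z powi n)" "y = (SUM n:{- int d'..int d'}. cx (b n)*(upow U n*e))"
  unfolding laurent_def by blast
 have ee: "e*e = e" using e by(simp add: is_proj_def)
 show ?thesis
 proof (rule laurent_family[of "{- int d..int d} \<times> {- int d'..int d'}" "%(m,n). m + n" _ _ "%(m,n). a m*b n"])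
  show "f z*g z = (SUM i:{- int d..int d} \<times> {- int d'..int d'}. (case i of (m,n) => a m*b n)*z powi (case i of (m,n) => m + n))"
   if "z:S1" for z
  proof -
   have "z ~= 0" using that by auto
   thus ?thesis unfolding a(1)[OF that] b(1)[OF that] sum_product sum.cartesian_product
    by(intro sum.cong refl) (auto simp: power_int_add)
  qed
  have t: "cx (a m)*(upow U m*e)*(cx (b n)*(upow U n*e)) = cx (a m*b n)*(upow U (m + n)*e)" for m n
  proof -
   have "upow U m*e*(upow U n*e) = upow U m*(e*upow U n)*e" by(simp add: mult.assoc)
   also have "... = upow U (m + n)*e" by(simp add: upow_commute[OF comm U] upow_add[OF U] mult.assoc ee)
   finally show ?thesis by(metis (no_types, lifting) cx_left_commute cx_mult mult.assoc)
  qed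
  show "x*y = (SUM i:{- int d..int d} \<times> {- int d'..int d'}. cx (case i of (m,n) => a m*b n)*(upow U (case i of (m,n) => m + n)*e))"
   unfolding a(2) b(2) sum_product sum.cartesian_product
   by(intro sum.cong refl) (auto simp: t)
 qed auto
qed

lemma laurent_cmult: "laurent d f x ==> laurent d (%z. c*f z) (cx c*x)"
proof -
 assume "laurent d f x"
 then obtain a where a: "!!z. z:S1 ==> f z = (SUM n:{- int d..int d}. a n*z powi n)" "x = (SUM n:{- int d..int d}. cx (a n)*(upow U n*e))"
  unfolding laurent_def by blast
 show ?thesis
  by(rule laurent_family[of "{- int d..int d}" "%n. n" _ _ "%n. c*a n"])
   (auto simp: a sum_distrib_left cx_mult mult.assoc)
qed

lemma laurent_star: "laurent d f x ==> laurent d (%z. cnj (f z)) (star x)"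
proof -
 assume "laurent d f x"
 then obtain a where a: "!!z. z:S1 ==> f z = (SUM n:{- int d..int d}. a n*z powi n)" "x = (SUM n:{- int d..int d}. cx (a n)*(upow U n*e))"
  unfolding laurent_def by blast
 have se: "star e = e" using e by(simp add: is_proj_def)
 show ?thesis
 proof (rule laurent_family[of "{- int d..int d}" "%n. - n" _ _ "%n. cnj (a n)"])
  show "cnj (f z) = (SUM i:{- int d..int d}. cnj (a i)*z powi - i)" if "z:S1" for z
  proof -
   have "z*cnj z = 1" using that by(simp add: complex_norm_square[symmetric])
   hence "cnj z = inverse z" by(metis inverse_unique)
   hence "cnj (z powi n) = z powi - n" for n by(simp add: power_int_minus power_int_inverse complex_cnj_power_int)
   thus ?thesis unfolding a(1)[OF that] by simp
  qed
  have t: "star (cx c*(upow U n*e)) = cx (cnj c)*(upow U (- n)*e)" for c n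
   using upow_commute[OF comm U, of "- n"] by(simp add: star_mult star_cx star_upow se cx_commute)
  show "star x = (SUM i:{- int d..int d}. cx (cnj (a i))*(upow U (- i)*e))"
   unfolding a(2) star_sum t ..
 qed auto
qed

lemma laurent_diff: "laurent d f x ==> laurent d' g y ==> laurent (d + d') (%z. f z - g z) (x - y)"
 using laurent_add[of d f x d' "%z. - 1*g z" "cx (- 1)*y"] laurent_cmult[of d' g y "- 1"] by(simp add: cx_minus)

text \<open>Every coefficient is a finite Fourier average, hence bounded by the supremum.\<close>

lemma laurent_crude_bound:
 assumes "laurent d f x" "!!z. z:S1 ==> cmod (f z) <= B"
 shows "norm x <= (2*real d + 1)*B"
proof -
 obtain c where c: "!!z. z:S1 ==> f z = (SUM n:{- int d..int d}. c n*z powi n)"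
  "x = (SUM n:{- int d..int d}. cx (c n)*(upow U n*e))"
  using assms(1) unfolding laurent_def by blast
 define M where "M = 2*d + 1"
 have M: "M > 0" by(simp add: M_def)
 have coeff: "cmod (c m) <= B" if m: "m:{- int d..int d}" for m
 proof -
  have "(SUM j<M. f (turn (real j / M))*turn (of_int (- m)*real j / M))
   = (SUM j<M. SUM n:{- int d..int d}. c n*turn (of_int (n - m)*real j / M))"
  proof (rule sum.cong[OF refl])
   fix j
   have "turn (real j / M) powi n*turn (of_int (- m)*real j / M) = turn (of_int (n - m)*real j / M)" for n
    unfolding turn_powi turn_add[symmetric] by(simp add: algebra_simps diff_divide_distrib)
   thus "f (turn (real j / M))*turn (of_int (- m)*real j / M) = (SUM n:{- int d..int d}. c n*turn (of_int (n - m)*real j / M))"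
    unfolding c(1)[OF turn_circle] sum_distrib_right mult.assoc by simp
  qed
  also have "... = (SUM n:{- int d..int d}. c n*(SUM j<M. turn (of_int (n - m)*real j / M)))"
   by(subst sum.swap) (simp add: sum_distrib_left)
  also have "... = (SUM n:{- int d..int d}. if n = m then c m * of_nat M else 0)"
  proof (rule sum.cong[OF refl])
   fix n assume n: "n:{- int d..int d}"
   have "\<bar>n - m\<bar> < int M" using n m by(auto simp: M_def)
   hence "int M dvd n - m <-> n = m" using zdvd_not_zless[of "\<bar>n - m\<bar>" "int M"] by(cases "n = m") auto
   thus "c n*(SUM j<M. turn (of_int (n - m)*real j / M)) = (if n = m then c m * of_nat M else 0)"
    unfolding sum_roots_of_unity[OF M] by auto
  qed
  also have "... = c m * of_nat M" using m by simp
  finally have "cmod (c m)*M = cmod (SUM j<M. f (turn (real j / M))*turn (of_int (- m)*real j / M))"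
   by(simp add: norm_mult)
  also have "... <= (SUM j<M. B)"
   by(rule order_trans[OF norm_sum]) (intro sum_mono, simp add: norm_mult assms(2))
  finally show ?thesis using M by(simp add: mult.commute)
 qed
 have ne: "norm (upow U n*e) <= 1" for n
  using norm_mult_ineq[of "upow U n" e] is_unitary_norm[OF upow_unitary[OF U]] is_proj_norm_le[OF e]
  by simp
 have "norm x <= (SUM n:{- int d..int d}. norm (cx (c n)*(upow U n*e)))" unfolding c(2) by(rule norm_sum)
 also have "... <= (SUM n:{- int d..int d}. B)"
 proof (rule sum_mono)
  fix n assume "n:{- int d..int d}"
  thus "norm (cx (c n)*(upow U n*e)) <= B"
   unfolding norm_cx_mult using coeff[of n] ne[of n] by(metis mult.right_neutral mult_mono norm_ge_zero order_trans)
 qed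
 finally show ?thesis by simp
qed

lemma exp_beats_linear:
 fixes q :: real
 assumes "!!k. q ^ (2 ^ k) <= C*real (2 ^ k) + D" "0 <= q"
 shows "q <= 1"
proof (rule ccontr)
 assume "~ q <= 1"
 hence q: "q > 1" by simp
 have "((%n. (C*real n + D) / q ^ n) \<longlonglongrightarrow> 0)" using q by real_asymp
 moreover have "filterlim (%k::nat. 2 ^ k :: nat) sequentially sequentially" by real_asymp
 ultimately have "(%k. (C*real (2 ^ k) + D) / q ^ (2 ^ k)) \<longlonglongrightarrow> 0" by(rule filterlim_compose)
 hence "eventually (%k. (C*real (2 ^ k) + D) / q ^ (2 ^ k) < 1) sequentially"
  by(rule order_tendstoD) simp
 then obtain k where "(C*real (2 ^ k) + D) / q ^ (2 ^ k) < 1" by(auto simp: eventually_sequentially)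
 thus False using assms(1)[of k] q by(simp add: field_simps)
qed

lemma laurent_upper:
 assumes "laurent d f x" "!!z. z:S1 ==> cmod (f z) <= B"
 shows "norm x <= B"
proof -
 have main: "norm x <= B" if B: "B > 0" "!!z. z:S1 ==> cmod (f z) <= B" for B
 proof -
  define y where "y = star x*x"
  have sy: "star y = y" by(simp add: y_def star_mult)
  have Ly: "laurent (d + d) (%z. cnj (f z)*f z) y"
   unfolding y_def by(intro laurent_mult laurent_star assms(1))
  have Lp: "EX f'. laurent (Suc n*(d + d)) f' (y ^ Suc n) & (ALL z:S1. cmod (f' z) <= (B ^ 2) ^ Suc n)" for n
  proof (induction n)
   case 0
   have "cmod (cnj (f z)*f z) <= B ^ 2" if "z:S1" for z
    using B(2)[OF that] B(1) by(simp add: norm_mult power2_eq_square mult_mono)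
   thus ?case using Ly by(intro exI[of _ "%z. cnj (f z)*f z"]) auto
  next
   case (Suc n)
   then obtain f' where f': "laurent (Suc n*(d + d)) f' (y ^ Suc n)" "!!z. z:S1 ==> cmod (f' z) <= (B ^ 2) ^ Suc n" by auto
   have "cmod (cnj (f z)*f z*f' z) <= B ^ 2*(B ^ 2) ^ Suc n" if "z:S1" for z
    unfolding norm_mult[of "cnj (f z)*f z"]
   proof (intro mult_mono f'(2)[OF that])
    show "cmod (cnj (f z)*f z) <= B\<^sup>2"
     using B(2)[OF that] B(1) by(simp add: norm_mult power2_eq_square mult_mono)
   qed auto
   thus ?case using laurent_mult[OF Ly f'(1)] by(intro exI[of _ "%z. cnj (f z)*f z*f' z"]) auto
  qed
  have pow: "norm (y ^ (2 ^ k)) = norm y ^ (2 ^ k)" for k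
  proof (induction k)
   case (Suc k)
   have "star (y ^ (2 ^ k)) = y ^ (2 ^ k)" by(simp add: star_power sy)
   hence "norm (y ^ (2 ^ k)*y ^ (2 ^ k)) = norm (y ^ (2 ^ k))*norm (y ^ (2 ^ k))"
    using cstar_id[of "y ^ (2 ^ k)"] by simp
   thus ?case using Suc by(simp add: power_add[symmetric] mult_2[symmetric])
  qed simp
  have "(norm y / B ^ 2) ^ (2 ^ k) <= (4*real d)*real (2 ^ k) + 1" for k
  proof -
   obtain n where n: "(2::nat) ^ k = Suc n" by(metis not0_implies_Suc power_not_zero zero_neq_numeral)
   obtain f' where f': "laurent (Suc n*(d + d)) f' (y ^ Suc n)" "!!z. z:S1 ==> cmod (f' z) <= (B ^ 2) ^ Suc n"
    using Lp[of n] by blast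
   have "norm y ^ (2 ^ k) <= (2*real (Suc n*(d + d)) + 1)*(B ^ 2) ^ Suc n"
    using laurent_crude_bound[OF f'] pow[of k] by(simp add: n)
   hence "norm y ^ (2 ^ k) / (B ^ 2) ^ (2 ^ k) <= 2*real (Suc n*(d + d)) + 1"
    using B(1) by(simp add: n field_simps)
   also have "2*real (Suc n*(d + d)) + 1 = (4*real d)*real (2 ^ k) + 1"
    unfolding n by(simp add: algebra_simps)
   finally show ?thesis by(simp add: power_divide)
  qed
  hence "norm y / B ^ 2 <= 1" by(rule exp_beats_linear) simp
  hence "norm x*norm x <= B*B" using B(1) by(simp add: y_def cstar_id power2_eq_square)
  thus ?thesis using B(1) by(intro power2_le_imp_le[of "norm x" B]) (auto simp: power2_eq_square)
 qed
 show ?thesis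
 proof (rule field_le_epsilon)
  fix eps :: real assume "eps > 0"
  have "cmod (f 1) <= B" using assms(2)[of 1] by simp
  hence "0 < B + eps" using `eps > 0` norm_ge_zero[of "f 1"] by linarith
  moreover have "cmod (f z) <= B + eps" if "z:S1" for z using assms(2)[OF that] `eps > 0` by linarith
  ultimately show "norm x <= B + eps" by(rule main)
 qed
qed

lemma laurent_lower: "laurent d f x ==> z:S1 ==> cmod (f z) <= norm x"
 unfolding laurent_def using lower by fastforce

end

context unitary_corner
begin

lemma laurent_cong: "laurent d f x ==> (!!z. z:S1 ==> f z = g z) ==> laurent d g x"
 unfolding laurent_def by metis

lemma real_polynomial_laurent:
 assumes "real_polynomial_function p"
 shows "EX d x. laurent d (%z. of_real (p z)) x"
 using assms
proof (induction rule: real_polynomial_function.induct)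
 case (linear f)
 let ?g = "%z. ((of_real (f 1) - \<i> * of_real (f \<i>)) / 2)*z powi 1 + ((of_real (f 1) + \<i> * of_real (f \<i>)) / 2)*z powi (- 1)"
 have 1: "laurent (nat \<bar>1\<bar> + nat \<bar>- 1\<bar>) ?g
   (cx ((of_real (f 1) - \<i> * of_real (f \<i>)) / 2)*(upow U 1*e) + cx ((of_real (f 1) + \<i> * of_real (f \<i>)) / 2)*(upow U (- 1)*e))"
  by(intro laurent_add laurent_cmult laurent_powi)
 have 2: "?g z = of_real (f z)" if "z:S1" for z
 proof -
  have "z*cnj z = 1" using that by(simp add: complex_norm_square[symmetric])
  hence inv: "inverse z = cnj z" by(metis inverse_unique)
  have "Re z *R 1 + Im z *R \<i> = z" by(simp add: complex_eq_iff)
  hence "f z = f (Re z *R 1 + Im z *R \<i>)" by simp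
  also have "... = Re z*f 1 + Im z*f \<i>"
   using linear by(simp add: linear_simps)
  finally have fz: "f z = Re z*f 1 + Im z*f \<i>" .
  show ?thesis unfolding fz by(simp add: power_int_minus inv complex_eq_iff) (simp add: field_simps)
 qed
 show ?case by(intro exI) (rule laurent_cong[OF 1 2])
next
 case (const c)
 have "laurent (nat \<bar>0\<bar>) (%z. of_real c*z powi 0) (cx (of_real c)*(upow U 0*e))"
  by(intro laurent_cmult laurent_powi)
 thus ?case by auto
next
 case (add f g)
 thus ?case using laurent_add unfolding of_real_add by blast
next
 case (mult f g)
 thus ?case using laurent_mult unfolding of_real_mult by blast
qed

lemma laurent_dense:
 assumes "cont S1 f" "eps > 0"
 shows "EX g d x. laurent d g x & (ALL z:S1. cmod (f z - g z) < eps)"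
proof -
 obtain p where p: "polynomial_function p" "!!z. z:S1 ==> cmod (f z - p z) < eps"
  using Stone_Weierstrass_polynomial_function[OF compact_sphere assms] by blast
 have "real_polynomial_function (Re \<circ> p)" "real_polynomial_function (Im \<circ> p)"
  using p(1) bounded_linear_Re bounded_linear_Im unfolding polynomial_function_def by blast+
 from this[THEN real_polynomial_laurent] obtain d x d' x' where
  1: "laurent d (%z. of_real ((Re \<circ> p) z)) x" "laurent d' (%z. of_real ((Im \<circ> p) z)) x'" by blast
 have "laurent (d + d') (%z. of_real ((Re \<circ> p) z) + \<i> * of_real ((Im \<circ> p) z)) (x + cx \<i>*x')"
  by(intro laurent_add laurent_cmult 1)
 moreover have "(%z. of_real ((Re \<circ> p) z) + \<i> * of_real ((Im \<circ> p) z)) = p" by(rule ext) (simp add: complex_eq_iff)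
 ultimately have "laurent (d + d') p (x + cx \<i>*x')" by simp
 thus ?thesis using p(2) by blast
qed

definition psi_rel :: "(complex => complex) => 'b => bool" where
 "psi_rel f x <-> (EX F X. (ALL n. EX d. laurent d (F n) (X n)) & uniform_limit S1 F f sequentially & X \<longlonglongrightarrow> x)"

lemma psi_relI: "(!!n. EX d. laurent d (F n) (X n)) ==> uniform_limit S1 F f sequentially ==> X \<longlonglongrightarrow> x ==> psi_rel f x"
 unfolding psi_rel_def by blast

lemma psi_rel_lower:
 assumes "psi_rel f x" "z:S1"
 shows "cmod (f z) <= norm x"
proof -
 obtain F X where F: "!!n. EX d. laurent d (F n) (X n)" "uniform_limit S1 F f sequentially" "X \<longlonglongrightarrow> x"
  using assms(1) unfolding psi_rel_def by blast
 have "(%n. F n z) \<longlonglongrightarrow> f z" by(rule tendsto_uniform_limitI[OF F(2) assms(2)])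
 hence "(%n. cmod (F n z)) \<longlonglongrightarrow> cmod (f z)" by(rule tendsto_norm)
 moreover have "(%n. norm (X n)) \<longlonglongrightarrow> norm x" by(rule tendsto_norm[OF F(3)])
 ultimately show ?thesis
  by(rule LIMSEQ_le) (use F(1) laurent_lower assms(2) in blast)
qed

lemma psi_rel_upper:
 assumes "psi_rel f x" "!!z. z:S1 ==> cmod (f z) <= B"
 shows "norm x <= B"
proof (rule field_le_epsilon)
 fix eps :: real assume eps: "eps > 0"
 obtain F X where F: "!!n. EX d. laurent d (F n) (X n)" "uniform_limit S1 F f sequentially" "X \<longlonglongrightarrow> x"
  using assms(1) unfolding psi_rel_def by blast
 obtain N where N: "!!n z. n >= N ==> z:S1 ==> dist (F n z) (f z) < eps"
  using F(2) eps unfolding uniform_limit_iff eventually_sequentially by blast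
 have "norm (X n) <= B + eps" if "n >= N" for n
 proof -
  obtain d where d: "laurent d (F n) (X n)" using F(1) by blast
  show ?thesis
  proof (rule laurent_upper[OF d])
   fix z :: complex assume z: "z:S1"
   have "cmod (F n z) <= cmod (f z) + cmod (F n z - f z)" using norm_triangle_ineq[of "f z" "F n z - f z"] by simp
   thus "cmod (F n z) <= B + eps" using N[OF that z] assms(2)[OF z] by(simp add: dist_norm)
  qed
 qed
 thus "norm x <= B + eps" by(intro LIMSEQ_le_const2[OF tendsto_norm[OF F(3)]]) auto
qed

lemma psi_rel_laurent: "laurent d f x ==> psi_rel f x"
 by(rule psi_relI[of "%_. f" "%_. x"]) (auto intro: uniform_limit_const)

lemma psi_rel_exists:
 assumes "cont S1 f"
 shows "EX x. psi_rel f x"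
proof -
 have "EX g x. (EX d. laurent d g x) & (ALL z:S1. cmod (f z - g z) < inverse (Suc n))" for n
  using laurent_dense[OF assms, of "inverse (Suc n)"] by auto
 then obtain F X where F: "!!n. EX d. laurent d (F n) (X n)" "!!n z. z:S1 ==> cmod (f z - F n z) < inverse (Suc n)"
  by metis
 have ul: "uniform_limit S1 F f sequentially"
  unfolding uniform_limit_iff
 proof (intro allI impI)
  fix eps :: real assume "eps > 0"
  hence "\<forall>\<^sub>F n in sequentially. inverse (real (Suc n)) < eps" using LIMSEQ_inverse_real_of_nat by(rule order_tendstoD[rotated])
  thus "\<forall>\<^sub>F n in sequentially. ALL z:S1. dist (F n z) (f z) < eps"
  proof (rule eventually_mono)
   fix n assume n: "inverse (real (Suc n)) < eps"
   show "ALL z:S1. dist (F n z) (f z) < eps"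
    using F(2)[of _ n] n by(metis dist_commute dist_norm order.strict_trans)
  qed
 qed
 have "Cauchy X"
 proof (rule CauchyI)
  fix eps :: real assume eps: "eps > 0"
  obtain N where N: "!!n z. n >= N ==> z:S1 ==> dist (F n z) (f z) < eps / 4"
   using ul eps unfolding uniform_limit_iff eventually_sequentially by(meson divide_pos_pos zero_less_numeral)
  have "norm (X m - X n) < eps" if "m >= N" "n >= N" for m n
  proof -
   obtain d d' where d: "laurent d (F m) (X m)" "laurent d' (F n) (X n)" using F(1) by blast
   have "norm (X m - X n) <= eps / 2"
   proof (rule laurent_upper[OF laurent_diff[OF d]])
    fix z :: complex assume z: "z:S1"
    show "cmod (F m z - F n z) <= eps / 2"
     using N[OF that(1) z] N[OF that(2) z] dist_triangle_half_l[of "F m z" "f z" "eps / 2" "F n z"]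
     by(simp add: dist_norm norm_minus_commute)
   qed
   thus ?thesis using eps by simp
  qed
  thus "EX M. ALL m>=M. ALL n>=M. norm (X m - X n) < eps" by blast
 qed
 then obtain x where "X \<longlonglongrightarrow> x" using Cauchy_convergent convergent_def by blast
 thus ?thesis using psi_relI[OF F(1) ul] by blast
qed

lemma psi_rel_diff: "psi_rel f x ==> psi_rel g y ==> psi_rel (%z. f z - g z) (x - y)"
 and psi_rel_add: "psi_rel f x ==> psi_rel g y ==> psi_rel (%z. f z + g z) (x + y)"
 and psi_rel_mult: "psi_rel f x ==> psi_rel g y ==> psi_rel (%z. f z*g z) (x*y)"
proof -
 assume f: "psi_rel f x" and g: "psi_rel g y"
 obtain F X where F: "!!n. EX d. laurent d (F n) (X n)" "uniform_limit S1 F f sequentially" "X \<longlonglongrightarrow> x"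
  using f unfolding psi_rel_def by blast
 obtain G Y where G: "!!n. EX d. laurent d (G n) (Y n)" "uniform_limit S1 G g sequentially" "Y \<longlonglongrightarrow> y"
  using g unfolding psi_rel_def by blast
 have bf: "bounded (f ` S1)" "bounded (g ` S1)"
  unfolding bounded_iff ball_simps using psi_rel_lower[OF f] psi_rel_lower[OF g]
  by(blast, blast)
 show "psi_rel (%z. f z - g z) (x - y)"
  by(rule psi_relI[OF _ uniform_limit_minus[OF F(2) G(2)] tendsto_diff[OF F(3) G(3)]]) (use F(1) G(1) laurent_diff in blast)
 show "psi_rel (%z. f z + g z) (x + y)"
  by(rule psi_relI[OF _ uniform_limit_add[OF F(2) G(2)] tendsto_add[OF F(3) G(3)]]) (use F(1) G(1) laurent_add in blast)
 show "psi_rel (%z. f z*g z) (x*y)"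
  by(rule psi_relI[OF _ uniform_lim_mult[OF F(2) G(2) bf] tendsto_mult[OF F(3) G(3)]]) (use F(1) G(1) laurent_mult in blast)
qed

lemma psi_rel_star: "psi_rel f x ==> psi_rel (%z. cnj (f z)) (star x)"
proof -
 assume f: "psi_rel f x"
 obtain F X where F: "!!n. EX d. laurent d (F n) (X n)" "uniform_limit S1 F f sequentially" "X \<longlonglongrightarrow> x"
  using f unfolding psi_rel_def by blast
 have "uniform_limit S1 (%n z. cnj (F n z)) (%z. cnj (f z)) sequentially"
  by(rule bounded_linear.uniform_limit[OF bounded_linear_cnj F(2)])
 thus ?thesis
  using F(1) laurent_star by(intro psi_relI[OF _ _ tendsto_star[OF F(3)]]) blast+
qed

lemma psi_rel_unique:
 assumes "psi_rel f x" "psi_rel g y" "!!z. z:S1 ==> f z = g z"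
 shows "x = y"
 using psi_rel_upper[OF psi_rel_diff[OF assms(1,2)], of 0] assms(3) by simp

definition psi :: "(complex => complex) => 'b" where
 "psi f = (THE x. psi_rel f x)"

lemma psi_eqI: "psi_rel f x ==> psi f = x"
 unfolding psi_def by(rule the_equality) (auto intro: psi_rel_unique)

lemma psi_rel_psi: "cont S1 f ==> psi_rel f (psi f)"
 using psi_rel_exists psi_eqI by blast

lemma psi_cong: "cont S1 f ==> (!!z. z:S1 ==> f z = g z) ==> psi f = psi g"
proof -
 assume f: "cont S1 f" and eq: "!!z. z:S1 ==> f z = g z"
 have "cont S1 g" by(rule continuous_on_eq[OF f eq])
 from psi_rel_unique[OF psi_rel_psi[OF f] psi_rel_psi[OF this] eq] show ?thesis .
qed

lemma psi_add: "cont S1 f ==> cont S1 g ==> psi (%z. f z + g z) = psi f + psi g"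
 by(intro psi_eqI psi_rel_add psi_rel_psi)

lemma psi_diff: "cont S1 f ==> cont S1 g ==> psi (%z. f z - g z) = psi f - psi g"
 by(intro psi_eqI psi_rel_diff psi_rel_psi)

lemma psi_mult: "cont S1 f ==> cont S1 g ==> psi (%z. f z*g z) = psi f*psi g"
 by(intro psi_eqI psi_rel_mult psi_rel_psi)

lemma psi_star: "cont S1 f ==> psi (%z. cnj (f z)) = star (psi f)"
 by(intro psi_eqI psi_rel_star psi_rel_psi)

lemma psi_powi: "psi (%z. z powi n) = upow U n*e"
 by(rule psi_eqI[OF psi_rel_laurent[OF laurent_powi]])

lemma psi_const: "psi (%z. c) = cx c*e"
 by(rule psi_eqI, rule psi_rel_laurent) (use laurent_cmult[OF laurent_powi[of 0], of c] in simp)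

lemma psi_one: "psi (%z. 1) = e" and psi_zero: "psi (%z. 0) = 0"
 by(simp_all add: psi_const)

lemma psi_sum: "(!!i. i:I ==> cont S1 (f i)) ==> psi (%z. SUM i:I. f i z) = (SUM i:I. psi (f i))"
 by(induction I rule: infinite_finite_induct) (simp_all add: psi_zero psi_add continuous_on_sum)

lemma psi_lower: "cont S1 f ==> z:S1 ==> cmod (f z) <= norm (psi f)"
 by(rule psi_rel_lower[OF psi_rel_psi])

lemma psi_upper: "cont S1 f ==> (!!z. z:S1 ==> cmod (f z) <= B) ==> norm (psi f) <= B"
 by(rule psi_rel_upper[OF psi_rel_psi])

lemma psi_inject:
 assumes "cont S1 f" "cont S1 g" "psi f = psi g" "z:S1"
 shows "f z = g z"
 using psi_lower[OF continuous_on_diff[OF assms(1,2)] assms(4)] psi_diff[OF assms(1,2)] assms(3) by simp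

lemma psi_corner: "cont S1 f ==> e*psi f = psi f" "cont S1 f ==> psi f*e = psi f"
 using psi_mult[of "%z. 1" f] psi_mult[of f "%z. 1"] by(simp_all add: psi_one)

definition psi_range :: "'b set" where
 "psi_range = psi ` {f. cont S1 f}"

lemma closed_psi_range: "closed psi_range"
 unfolding closed_sequential_limits
proof (intro allI impI)
 fix X x assume "(ALL n. X n:psi_range) & X \<longlonglongrightarrow> x"
 hence X: "!!n. X n:psi_range" "X \<longlonglongrightarrow> x" by auto
 have "EX f. cont S1 f & X n = psi f" for n using X(1)[of n] by(auto simp: psi_range_def)
 then obtain f where f: "!!n. cont S1 (f n)" "!!n. X n = psi (f n)" by metis
 have "uniformly_Cauchy_on S1 f"
  unfolding uniformly_Cauchy_on_def
 proof (intro allI impI)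
  fix eps :: real assume "eps > 0"
  then obtain M where M: "!!m n. m >= M ==> n >= M ==> dist (X m) (X n) < eps"
   using LIMSEQ_imp_Cauchy[OF X(2)] unfolding Cauchy_def by blast
  have "dist (f m z) (f n z) < eps" if "z:S1" "m >= M" "n >= M" for z m n
   using psi_lower[OF continuous_on_diff[OF f(1) f(1)] that(1), of m n] M[OF that(2,3)]
   unfolding psi_diff[OF f(1) f(1)] f(2)[symmetric] dist_norm by simp
  thus "EX M. ALL x:S1. ALL m>=M. ALL n>=M. dist (f m x) (f n x) < eps" by blast
 qed
 then obtain g where g: "uniform_limit S1 f g sequentially"
  using Cauchy_uniformly_convergent uniformly_convergent_on_def by blast
 have cg: "cont S1 g"
  by(rule uniform_limit_theorem[OF _ g]) (auto simp: f(1))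
 have "X \<longlonglongrightarrow> psi g"
 proof (rule LIMSEQ_I)
  fix eps :: real assume eps: "eps > 0"
  obtain N where N: "!!n z. n >= N ==> z:S1 ==> dist (f n z) (g z) < eps / 2"
   using g eps unfolding uniform_limit_iff eventually_sequentially by(meson half_gt_zero)
  have "norm (X n - psi g) < eps" if "n >= N" for n
  proof -
   have "norm (psi (%z. f n z - g z)) <= eps / 2"
    by(rule psi_upper[OF continuous_on_diff[OF f(1) cg]]) (use N[OF that] in "auto simp: dist_norm less_imp_le")
   thus ?thesis unfolding psi_diff[OF f(1) cg] f(2) using eps by simp
  qed
  thus "EX no. ALL n>=no. norm (X n - psi g) < eps" by blast
 qed
 hence "x = psi g" using X(2) LIMSEQ_unique by blast
 thus "x:psi_range" using cg by(simp add: psi_range_def)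
qed

lemma psi_mem:
 assumes S: "closed_calg S" "U:S" "e:S" and f: "cont S1 f"
 shows "psi f:S"
proof -
 have ca: "closed_alg S" "!!c. cx c:S" using S(1) by(auto simp: closed_calg_def)
 have up: "upow U n:S" for n unfolding upow_def using S by(auto intro!: closed_algD[OF ca(1)])
 have l: "x:S" if "laurent d g x" for d g x
  using that unfolding laurent_def by(auto intro!: closed_algD(11)[OF ca(1)] closed_algD(4)[OF ca(1)] ca(2) up S(3))
 obtain F X where F: "!!n. EX d. laurent d (F n) (X n)" "X \<longlonglongrightarrow> psi f"
  using psi_rel_psi[OF f] unfolding psi_rel_def by blast
 thus ?thesis using l closed_sequentially[OF closed_algD(1)[OF ca(1)]] by blast
qed

definition theta :: "'b => complex => complex" where
 "theta y = (SOME f. cont S1 f & psi f = y)"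

lemma theta: "y:psi_range ==> cont S1 (theta y)" "y:psi_range ==> psi (theta y) = y"
proof -
 assume "y:psi_range"
 hence "EX f. cont S1 f & psi f = y" by(auto simp: psi_range_def)
 from someI_ex[OF this] show "cont S1 (theta y)" "psi (theta y) = y" by(simp_all add: theta_def)
qed

lemma psi_in_range: "cont S1 f ==> psi f:psi_range"
 by(simp add: psi_range_def)

lemma theta_psi: "cont S1 f ==> z:S1 ==> theta (psi f) z = f z"
 using psi_inject[of "theta (psi f)" f z] theta[of "psi f"] psi_in_range by blast

lemma theta_lipschitz:
 assumes "x:psi_range" "y:psi_range" "z:S1"
 shows "cmod (theta x z - theta y z) <= norm (x - y)"
 using psi_lower[OF continuous_on_diff[OF theta(1)[OF assms(1)] theta(1)[OF assms(2)]] assms(3)]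
 unfolding psi_diff[OF theta(1)[OF assms(1)] theta(1)[OF assms(2)]] theta(2)[OF assms(1)] theta(2)[OF assms(2)] .

lemma continuous_on_theta:
 fixes x :: "'t::metric_space => 'b"
 assumes x: "cont T x" "!!t. t:T ==> x t:psi_range"
 shows "cont (T \<times> S1) (%p. theta (x (fst p)) (snd p))"
 unfolding continuous_on_iff
proof (intro ballI allI impI)
 fix p and eps :: real assume p: "p:T \<times> S1" and eps: "eps > 0"
 obtain t z where tz: "p = (t,z)" "t:T" "z:S1" using p by auto
 obtain d1 where d1: "d1 > 0" "!!s. s:T ==> dist s t < d1 ==> dist (x s) (x t) < eps / 2"
  using x(1) tz(2) eps unfolding continuous_on_iff by(meson half_gt_zero)
 obtain d2 where d2: "d2 > 0" "!!w. w:S1 ==> dist w z < d2 ==> dist (theta (x t) w) (theta (x t) z) < eps / 2"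
  using theta(1)[OF x(2)[OF tz(2)]] tz(3) eps unfolding continuous_on_iff by(meson half_gt_zero)
 show "EX d>0. ALL p':T \<times> S1. dist p' p < d --> dist (theta (x (fst p')) (snd p')) (theta (x (fst p)) (snd p)) < eps"
 proof (intro exI[of _ "min d1 d2"] conjI ballI impI)
  fix p' assume p': "p':T \<times> S1" "dist p' p < min d1 d2"
  obtain s w where sw: "p' = (s,w)" "s:T" "w:S1" using p'(1) by auto
  have "dist s t < d1" "dist w z < d2"
   using p'(2) dist_fst_le[of p' p] dist_snd_le[of p' p] by(auto simp: sw(1) tz(1))
  hence "dist (x s) (x t) < eps / 2" "dist (theta (x t) w) (theta (x t) z) < eps / 2"
   using d1(2)[OF sw(2)] d2(2)[OF sw(3)] by auto
  moreover have "dist (theta (x s) w) (theta (x t) w) <= dist (x s) (x t)"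
   unfolding dist_norm by(rule theta_lipschitz[OF x(2)[OF sw(2)] x(2)[OF tz(2)] sw(3)])
  ultimately show "dist (theta (x (fst p')) (snd p')) (theta (x (fst p)) (snd p)) < eps"
   using dist_triangle[of "theta (x s) w" "theta (x t) z" "theta (x t) w"] by(simp add: sw(1) tz(1))
 qed (use d1 d2 in auto)
qed

lemma continuous_on_psi:
 assumes h: "cont ({0..1::real} \<times> S1) h"
 shows "cont {0..1} (%t. psi (%z. h (t,z)))"
 unfolding continuous_on_iff
proof (intro ballI allI impI)
 fix t and eps :: real assume t: "t:{0..1::real}" and eps: "eps > 0"
 have c: "cont S1 (%z. h (s,z))" if "s:{0..1}" for s
  by(rule continuous_on_compose2[OF h]) (use that in "auto intro!: continuous_intros")
 have "uniformly_continuous_on ({0..1} \<times> S1) h"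
  by(intro compact_uniformly_continuous h compact_Times compact_sphere) auto
 then obtain d where d: "d > 0" "!!p q. p:{0..1} \<times> S1 ==> q:{0..1} \<times> S1 ==> dist q p < d ==> dist (h q) (h p) < eps / 2"
  using eps unfolding uniformly_continuous_on_def by(meson half_gt_zero)
 show "EX d>0. ALL s:{0..1}. dist s t < d --> dist (psi (%z. h (s,z))) (psi (%z. h (t,z))) < eps"
 proof (intro exI[of _ d] conjI ballI impI d(1))
  fix s assume s: "s:{0..1::real}" "dist s t < d"
  have "norm (psi (%z. h (s,z) - h (t,z))) <= eps / 2"
  proof (rule psi_upper[OF continuous_on_diff[OF c[OF s(1)] c[OF t]]])
   fix z :: complex assume z: "z:S1"
   have "dist (s,z) (t,z) < d" using s(2) by(simp add: dist_Pair_Pair)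
   from d(2)[OF _ _ this] show "cmod (h (s,z) - h (t,z)) <= eps / 2" using s(1) t z by(simp add: dist_norm less_imp_le)
  qed
  thus "dist (psi (%z. h (s,z))) (psi (%z. h (t,z))) < eps"
   unfolding psi_diff[OF c[OF s(1)] c[OF t]] dist_norm using eps by simp
 qed
qed

end

section \<open>Finite sums of matrix algebras over the circle\<close>

text \<open>
 \<open>S k i\<close> are the partial isometries of systems of matrix units of sizes \<open>kap k\<close>, with
 initial projections \<open>e k\<close>; the corner at \<open>e k\<close> is generated by \<open>U k * e k\<close>, a copy of the
 continuous functions on the circle.
\<close>

locale circle_matrix_sum =
 fixes Os :: "nat set" and kap :: "nat => nat" and S :: "nat => nat => 'b::cstar_alg" and U e :: "nat => 'b"
 assumes fin: "finite Os"
  and corner: "!!k. k:Os ==> unitary_corner (U k) (e k)"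
  and kap_pos: "!!k. k:Os ==> 0 < kap k"
  and S_orth: "!!k l i j. k:Os ==> l:Os ==> i < kap k ==> j < kap l ==>
   star (S k i)*S l j = (if k = l & i = j then e k else 0)"
  and S_sum: "(SUM k:Os. SUM i<kap k. S k i * star (S k i)) = 1"
  and S_e: "!!k i. k:Os ==> i < kap k ==> S k i*e k = S k i"
begin

abbreviation ps :: "nat => (complex => complex) => 'b" where "ps k \<equiv> unitary_corner.psi (U k) (e k)"
abbreviation ths :: "nat => 'b => complex => complex" where "ths k \<equiv> unitary_corner.theta (U k) (e k)"
abbreviation rg :: "nat => 'b set" where "rg k \<equiv> unitary_corner.psi_range (U k) (e k)"

definition alg :: "'b set" where
 "alg = {x. ALL k:Os. ALL l:Os. ALL i<kap k. ALL j<kap l. star (S k i)*x*S l j:(if k = l then rg k else {0})}"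

lemma algD: "x:alg ==> k:Os ==> i < kap k ==> j < kap k ==> star (S k i)*x*S k j:rg k"
 "x:alg ==> k:Os ==> l:Os ==> k ~= l ==> i < kap k ==> j < kap l ==> star (S k i)*x*S l j = 0"
 unfolding alg_def by force+

lemma rg_ops:
 assumes "k:Os"
 shows "x:rg k ==> y:rg k ==> x + y:rg k" "x:rg k ==> y:rg k ==> x*y:rg k"
  "x:rg k ==> star x:rg k" "0:rg k" "e k:rg k" "x:rg k ==> cx c*x:rg k" "closed (rg k)"
  "x:rg k ==> e k*x = x"
  "(!!i. i:I ==> f i:rg k) ==> sum f I:rg k"
proof -
 interpret C: unitary_corner "U k" "e k" by(rule corner[OF assms])
 show add: "x + y:rg k" if "x:rg k" "y:rg k" for x y
  using C.psi_in_range[OF continuous_on_add[OF C.theta(1)[OF that(1)] C.theta(1)[OF that(2)]]]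
  unfolding C.psi_add[OF C.theta(1)[OF that(1)] C.theta(1)[OF that(2)]] C.theta(2)[OF that(1)] C.theta(2)[OF that(2)] .
 show mult: "x*y:rg k" if "x:rg k" "y:rg k" for x y
  using C.psi_in_range[OF continuous_on_mult[OF C.theta(1)[OF that(1)] C.theta(1)[OF that(2)]]]
  unfolding C.psi_mult[OF C.theta(1)[OF that(1)] C.theta(1)[OF that(2)]] C.theta(2)[OF that(1)] C.theta(2)[OF that(2)] .
 show "star x:rg k" if "x:rg k"
  using C.psi_in_range[OF continuous_on_cnj[OF C.theta(1)[OF that]]]
  unfolding C.psi_star[OF C.theta(1)[OF that]] C.theta(2)[OF that] .
 show z: "0:rg k" using C.psi_in_range[of "%_. 0"] C.psi_zero by simp
 show "e k:rg k" using C.psi_in_range[of "%_. 1"] C.psi_one by simp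
 show "closed (rg k)" by(rule C.closed_psi_range)
 show ex: "e k*x = x" if "x:rg k" for x
  using C.psi_corner(1)[OF C.theta(1)[OF that]] unfolding C.theta(2)[OF that] .
 have "cx c*e k:rg k" using C.psi_in_range[of "%_. c"] C.psi_const by simp
 hence "x:rg k ==> cx c*e k*x:rg k" by(rule mult)
 thus "x:rg k ==> cx c*x:rg k" using ex by(simp add: mult.assoc)
 show "(!!i. i:I ==> f i:rg k) ==> sum f I:rg k"
  using z add by(induction I rule: infinite_finite_induct) auto
qed

lemma insert_one: "star (S k i)*(x*y)*S l j = (SUM m:Os. SUM r<kap m. (star (S k i)*x*S m r)*(star (S m r)*y*S l j))"
proof -
 have "star (S k i)*(x*y)*S l j = star (S k i)*x*(SUM m:Os. SUM r<kap m. S m r * star (S m r))*(y*S l j)"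
  unfolding S_sum by(simp add: mult.assoc)
 also have "... = (SUM m:Os. SUM r<kap m. (star (S k i)*x*S m r)*(star (S m r)*y*S l j))"
  unfolding sum_distrib_left sum_distrib_right by(simp add: mult.assoc)
 finally show ?thesis .
qed

lemma insert_one_alg:
 assumes "x:alg" "k:Os" "i < kap k"
 shows "star (S k i)*(x*y)*S l j = (SUM r<kap k. (star (S k i)*x*S k r)*(star (S k r)*y*S l j))"
proof -
 have "(SUM r<kap m. (star (S k i)*x*S m r)*(star (S m r)*y*S l j)) = 0" if "m:Os" "m ~= k" for m
  using algD(2)[OF assms(1,2) that(1) that(2)[symmetric] assms(3)] by simp
 hence "(SUM m:Os. SUM r<kap m. (star (S k i)*x*S m r)*(star (S m r)*y*S l j))
   = (SUM m:{k}. SUM r<kap m. (star (S k i)*x*S m r)*(star (S m r)*y*S l j))"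
  using fin assms(2) by(intro sum.mono_neutral_right) auto
 thus ?thesis unfolding insert_one by simp
qed

lemma closed_calg_alg: "closed_calg alg"
proof -
 have add: "x + y:alg" if "x:alg" "y:alg" for x y
  unfolding alg_def mem_Collect_eq distrib_left distrib_right
  using algD(1)[OF that(1)] algD(1)[OF that(2)] algD(2)[OF that(1)] algD(2)[OF that(2)] rg_ops(1) by auto
 have mult: "x*y:alg" if xy: "x:alg" "y:alg" for x y
  unfolding alg_def mem_Collect_eq
 proof (intro ballI allI impI)
  fix k l i j assume kl: "k:Os" "l:Os" "i < kap k" "j < kap l"
  show "star (S k i)*(x*y)*S l j:(if k = l then rg k else {0})"
   unfolding insert_one_alg[OF xy(1) kl(1,3)]
  proof (cases "k = l")
   case True
   have "(star (S k i)*x*S k r)*(star (S k r)*y*S k j):rg k" if "r < kap k" for r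
    by(rule rg_ops(2)[OF kl(1) algD(1)[OF xy(1) kl(1,3) that] algD(1)[OF xy(2) kl(1) that]]) (use kl(4) True in simp)
   hence "(SUM r<kap k. (star (S k i)*x*S k r)*(star (S k r)*y*S k j)):rg k"
    by(intro rg_ops(9)[OF kl(1)]) simp
   thus "(SUM r<kap k. (star (S k i)*x*S k r)*(star (S k r)*y*S l j)):(if k = l then rg k else {0})"
    using True by simp
  next
   case False
   have "star (S k r)*y*S l j = 0" if "r < kap k" for r
    by(rule algD(2)[OF xy(2) kl(1,2) False that kl(4)])
   thus "(SUM r<kap k. (star (S k i)*x*S k r)*(star (S k r)*y*S l j)):(if k = l then rg k else {0})"
    using False by simp
  qed
 qed
 have star: "star x:alg" if x: "x:alg" for x
  unfolding alg_def mem_Collect_eq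
 proof (intro ballI allI impI)
  fix k l i j assume kl: "k:Os" "l:Os" "i < kap k" "j < kap l"
  have "star (S k i) * star x*S l j = star (star (S l j)*x*S k i)" by(simp add: star_mult mult.assoc)
  thus "star (S k i) * star x*S l j:(if k = l then rg k else {0})"
   using algD(1)[OF x kl(2,4)] algD(2)[OF x kl(2,1) _ kl(4,3)] kl rg_ops(3) by auto
 qed
 have cxa: "cx c:alg" for c
  unfolding alg_def mem_Collect_eq
 proof (intro ballI allI impI)
  fix k l i j assume kl: "k:Os" "l:Os" "i < kap k" "j < kap l"
  have "star (S k i)*cx c*S l j = cx c*(star (S k i)*S l j)" by(simp add: cx_commute mult.assoc)
  thus "star (S k i)*cx c*S l j:(if k = l then rg k else {0})"
   using S_orth[OF kl] rg_ops(4)[OF kl(1)] rg_ops(6)[OF kl(1) rg_ops(5)[OF kl(1)], of c] by(cases "k = l"; cases "i = j") simp_all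
 qed
 have "closed ((%x. star (S k i)*x*S l j) -` (if k = l then rg k else {0}))" if "k:Os" for k l i j
 proof (rule closed_vimage)
  show "closed (if k = l then rg k else {0})" using rg_ops(7)[OF that] by(cases "k = l") auto
  show "cont UNIV (%x. star (S k i)*x*S l j)" by(intro continuous_intros)
 qed
 moreover have "alg = (\<Inter>k\<in>Os. \<Inter>l\<in>Os. \<Inter>i\<in>{..<kap k}. \<Inter>j\<in>{..<kap l}. (%x. star (S k i)*x*S l j) -` (if k = l then rg k else {0}))"
  by(rule Set.set_eqI) (simp only: alg_def mem_Collect_eq INT_iff vimage_eq Ball_def lessThan_iff)
 ultimately have cl: "closed alg" by(auto intro!: closed_INT)
 have one: "1:alg" using cxa[of 1] by simp
 have sc: "c *R x:alg" if "x:alg" for c x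
  using mult[OF cxa[of "of_real c"] that] by(simp add: cx_of_real)
 show ?thesis unfolding closed_calg_def closed_alg_def
  by(intro conjI ballI allI cl one add mult star sc cxa)
qed

lemma alg_ops: "closed_alg alg" "cx c:alg"
 using closed_calg_alg by(simp_all add: closed_calg_def)

definition fib :: "'b => nat => complex => nat => nat => complex" where
 "fib x k z i j = ths k (star (S k i)*x*S k j) z"

lemma fib_continuous: "x:alg ==> k:Os ==> i < kap k ==> j < kap k ==> cont S1 (%z. fib x k z i j)"
 unfolding fib_def using unitary_corner.theta(1)[OF corner algD(1)] by simp

lemma ps_fib: "x:alg ==> k:Os ==> i < kap k ==> j < kap k ==> ps k (%z. fib x k z i j) = star (S k i)*x*S k j"
 unfolding fib_def using unitary_corner.theta(2)[OF corner algD(1)] by simp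

lemma fib_eqI:
 assumes "k:Os" "cont S1 f" "star (S k i)*x*S k j = ps k f" "z:S1"
 shows "fib x k z i j = f z"
 unfolding fib_def assms(3) by(rule unitary_corner.theta_psi[OF corner[OF assms(1)] assms(2,4)])

lemma fib_mult:
 assumes "x:alg" "y:alg" "k:Os" "i < kap k" "j < kap k" "z:S1"
 shows "fib (x*y) k z i j = (SUM r<kap k. fib x k z i r*fib y k z r j)"
proof (rule fib_eqI[OF assms(3) _ _ assms(6)])
 interpret C: unitary_corner "U k" "e k" by(rule corner[OF assms(3)])
 have c: "cont S1 (%z. fib x k z i r)" "cont S1 (%z. fib y k z r j)" if "r < kap k" for r
  using fib_continuous assms that by auto
 show "cont S1 (%z. SUM r<kap k. fib x k z i r*fib y k z r j)"
  using c by(intro continuous_on_sum continuous_on_mult) auto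
 show "star (S k i)*(x*y)*S k j = ps k (%z. SUM r<kap k. fib x k z i r*fib y k z r j)"
  unfolding insert_one_alg[OF assms(1,3,4)]
  using c assms by(subst C.psi_sum) (auto intro!: continuous_on_mult sum.cong simp: C.psi_mult ps_fib)
qed

lemma fib_add:
 assumes "x:alg" "y:alg" "k:Os" "i < kap k" "j < kap k" "z:S1"
 shows "fib (x + y) k z i j = fib x k z i j + fib y k z i j"
proof (rule fib_eqI[OF assms(3) _ _ assms(6)])
 interpret C: unitary_corner "U k" "e k" by(rule corner[OF assms(3)])
 note c = fib_continuous[OF assms(1,3-5)] fib_continuous[OF assms(2,3-5)]
 show "cont S1 (%z. fib x k z i j + fib y k z i j)" by(intro continuous_on_add c)
 show "star (S k i)*(x + y)*S k j = ps k (%z. fib x k z i j + fib y k z i j)"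
  using assms by(simp add: C.psi_add c ps_fib distrib_left distrib_right)
qed

lemma fib_star:
 assumes "x:alg" "k:Os" "i < kap k" "j < kap k" "z:S1"
 shows "fib (star x) k z i j = cnj (fib x k z j i)"
proof (rule fib_eqI[OF assms(2) _ _ assms(5)])
 interpret C: unitary_corner "U k" "e k" by(rule corner[OF assms(2)])
 note c = fib_continuous[OF assms(1,2,4,3)]
 show "cont S1 (%z. cnj (fib x k z j i))" by(intro continuous_on_cnj c)
 show "star (S k i) * star x*S k j = ps k (%z. cnj (fib x k z j i))"
  using assms by(simp add: C.psi_star c ps_fib star_mult mult.assoc)
qed

lemma fib_one:
 assumes "k:Os" "i < kap k" "j < kap k" "z:S1"
 shows "fib 1 k z i j = (if i = j then 1 else 0)"
proof (rule fib_eqI[OF assms(1) _ _ assms(4)])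
 interpret C: unitary_corner "U k" "e k" by(rule corner[OF assms(1)])
 show "star (S k i)*1*S k j = ps k (%z. if i = j then 1 else 0)"
  using S_orth[OF assms(1,1,2,3)] by(simp add: C.psi_one C.psi_zero)
qed simp

lemma fib_zero:
 assumes "k:Os" "z:S1"
 shows "fib 0 k z i j = 0"
proof (rule fib_eqI[OF assms(1) _ _ assms(2)])
 interpret C: unitary_corner "U k" "e k" by(rule corner[OF assms(1)])
 show "star (S k i)*0*S k j = ps k (%z. 0)" by(simp add: C.psi_zero)
qed simp

lemma fib_sum:
 assumes "!!a. a:I ==> f a:alg" "k:Os" "i < kap k" "j < kap k" "z:S1"
 shows "fib (sum f I) k z i j = (SUM a:I. fib (f a) k z i j)"
 using assms(1)
proof (induction I rule: infinite_finite_induct)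
 case (insert a I)
 have "fib (f a + sum f I) k z i j = fib (f a) k z i j + fib (sum f I) k z i j"
  by(rule fib_add[OF _ closed_algD(11)[OF alg_ops(1)] assms(2-5)]) (use insert.prems in auto)
 thus ?case using insert by simp
qed (simp_all add: fib_zero[OF assms(2,5)])

lemma continuous_on_fib:
 fixes x :: "'t::metric_space => 'b"
 assumes "cont T x" "!!t. t:T ==> x t:alg" "k:Os" "i < kap k" "j < kap k"
 shows "cont (T \<times> S1) (%p. fib (x (fst p)) k (snd p) i j)"
 unfolding fib_def
 by(rule unitary_corner.continuous_on_theta[OF corner[OF assms(3)], where x = "%t. star (S k i)*x t*S k j"])
  (use assms algD(1) in "auto intro!: continuous_intros")

definition unfib :: "(nat => complex => nat => nat => complex) => 'b" where
 "unfib G = (SUM k:Os. SUM i<kap k. SUM j<kap k. S k i*ps k (%z. G k z i j) * star (S k j))"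

lemma unfib_entry:
 assumes "!!k i j. k:Os ==> i < kap k ==> j < kap k ==> cont S1 (%z. G k z i j)"
  and kl: "k:Os" "l:Os" "i < kap k" "j < kap l"
 shows "star (S k i)*unfib G*S l j = (if k = l then ps k (%z. G k z i j) else 0)"
proof -
 have c: "e m*ps m (%z. G m z a b) = ps m (%z. G m z a b)" "ps m (%z. G m z a b)*e m = ps m (%z. G m z a b)"
  if "m:Os" "a < kap m" "b < kap m" for m a b
  using unitary_corner.psi_corner[OF corner[OF that(1)] assms(1)[OF that]] by auto
 have t: "star (S k i)*(S m a*ps m (%z. G m z a b) * star (S m b))*S l j
  = (if m = k then if a = i then if b = j then if k = l then ps k (%z. G k z i j) else 0 else 0 else 0 else 0)"
  if m: "m:Os" "a < kap m" "b < kap m" for m a b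
 proof -
  have "star (S k i)*(S m a*ps m (%z. G m z a b) * star (S m b))*S l j =
   (star (S k i)*S m a)*ps m (%z. G m z a b)*(star (S m b)*S l j)" by(simp only: mult.assoc)
  also have "... = (if k = m & i = a then e k else 0)*ps m (%z. G m z a b)*(if m = l & b = j then e m else 0)"
   by(simp only: S_orth[OF kl(1) m(1) kl(3) m(2)] S_orth[OF m(1) kl(2) m(3) kl(4)])
  also have "... = (if m = k then if a = i then if b = j then if k = l then ps k (%z. G k z i j) else 0 else 0 else 0 else 0)"
   using c[OF m] by(cases "k = m"; cases "i = a"; cases "b = j"; cases "m = l") simp_all
  finally show ?thesis .
 qed
 have "star (S k i)*unfib G*S l j = (SUM m:Os. SUM a<kap m. SUM b<kap m. star (S k i)*(S m a*ps m (%z. G m z a b) * star (S m b))*S l j)"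
  unfolding unfib_def sum_distrib_left sum_distrib_right ..
 also have "... = (SUM m:Os. SUM a<kap m. SUM b<kap m. (if m = k then if a = i then if b = j then if k = l then ps k (%z. G k z i j) else 0 else 0 else 0 else 0))"
  by(intro sum.cong refl t) auto
 also have "... = (SUM m:Os. if m = k then if k = l then ps k (%z. G k z i j) else 0 else 0)"
 proof (intro sum.cong refl)
  fix m
  show "(SUM a<kap m. SUM b<kap m. (if m = k then if a = i then if b = j then if k = l then ps k (%z. G k z i j) else 0 else 0 else 0 else 0))
   = (if m = k then if k = l then ps k (%z. G k z i j) else 0 else 0)"
  proof (cases "m = k & k = l")
   case True
   have "(SUM b<kap k. if a = i then if b = j then ps k (%z. G k z i j) else 0 else 0) = (if a = i then ps k (%z. G k z i j) else 0)" for a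
    using kl True by(cases "a = i") simp_all
   thus ?thesis using True kl by simp
  next
   case False
   thus ?thesis by(cases "m = k") (simp_all cong: if_cong)
  qed
 qed
 also have "... = (if k = l then ps k (%z. G k z i j) else 0)" using fin kl by simp
 finally show ?thesis .
qed

lemma unfib_alg:
 assumes "!!k i j. k:Os ==> i < kap k ==> j < kap k ==> cont S1 (%z. G k z i j)"
 shows "unfib G:alg"
 unfolding alg_def mem_Collect_eq
proof (intro ballI allI impI)
 fix k l i j assume kl: "k:Os" "l:Os" "i < kap k" "j < kap l"
 thus "star (S k i)*unfib G*S l j:(if k = l then rg k else {0})"
  using unfib_entry[of G k l i j, OF assms kl] unitary_corner.psi_in_range[OF corner[OF kl(1)] assms[OF kl(1,3), of j]] by auto
qed

lemma fib_unfib: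
 assumes "!!k i j. k:Os ==> i < kap k ==> j < kap k ==> cont S1 (%z. G k z i j)"
  "k:Os" "i < kap k" "j < kap k" "z:S1"
 shows "fib (unfib G) k z i j = G k z i j"
 by(rule fib_eqI[OF assms(2) assms(1)[OF assms(2-4)] _ assms(5)])
  (use unfib_entry[OF assms(1) assms(2,2,3,4)] in simp)

lemma fib_inject:
 assumes "x:alg" "y:alg" "!!k z i j. k:Os ==> z:S1 ==> i < kap k ==> j < kap k ==> fib x k z i j = fib y k z i j"
 shows "x = y"
proof -
 have ent: "star (S k i)*x*S l j = star (S k i)*y*S l j" if kl: "k:Os" "l:Os" "i < kap k" "j < kap l" for k l i j
 proof (cases "k = l")
  case True
  have "star (S k i)*x*S k j = ps k (%z. fib x k z i j)" using ps_fib[OF assms(1)] kl True by simp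
  also have "... = ps k (%z. fib y k z i j)"
   by(rule unitary_corner.psi_cong[OF corner[OF kl(1)] fib_continuous[OF assms(1)]]) (use kl True assms(3) in auto)
  also have "... = star (S k i)*y*S k j" using ps_fib[OF assms(2)] kl True by simp
  finally show ?thesis using True by simp
 next
  case False
  thus ?thesis using algD(2)[OF assms(1)] algD(2)[OF assms(2)] kl by simp
 qed
 have exp: "w = (SUM k:Os. SUM i<kap k. SUM l:Os. SUM j<kap l. S k i*(star (S k i)*w*S l j) * star (S l j))" for w
 proof -
  have "w = (SUM k:Os. SUM i<kap k. S k i * star (S k i))*w" unfolding S_sum by simp
  also have "... = (SUM k:Os. SUM i<kap k. S k i * star (S k i)*w)" by(simp only: sum_distrib_right)
  also have "... = (SUM k:Os. SUM i<kap k. S k i * star (S k i)*w*(SUM l:Os. SUM j<kap l. S l j * star (S l j)))"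
   unfolding S_sum by simp
  also have "... = (SUM k:Os. SUM i<kap k. SUM l:Os. SUM j<kap l. S k i*(star (S k i)*w*S l j) * star (S l j))"
   by(simp only: sum_distrib_left mult.assoc)
  finally show ?thesis .
 qed
 have "x = (SUM k:Os. SUM i<kap k. SUM l:Os. SUM j<kap l. S k i*(star (S k i)*x*S l j) * star (S l j))" by(rule exp)
 also have "... = (SUM k:Os. SUM i<kap k. SUM l:Os. SUM j<kap l. S k i*(star (S k i)*y*S l j) * star (S l j))"
  by(intro sum.cong refl) (simp add: ent)
 also have "... = y" by(rule exp[symmetric])
 finally show "x = y" .
qed

end

definition jenum :: "'i set => nat => 'i" where
 "jenum J = (SOME f. bij_betw f {0..<card J} J)"

lemma one_circle: "1:S1"
 by simp

lemma jenum: "finite J ==> bij_betw (jenum J) {0..<card J} J"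
 unfolding jenum_def using ex_bij_betw_nat_finite someI_ex by metis

definition mdet :: "'i set => ('i => 'i => complex) => complex" where
 "mdet J a = Determinant.det (Matrix.mat (card J) (card J) (%(x,y). a (jenum J x) (jenum J y)))"

lemma mdet_mult:
 assumes "finite J"
 shows "mdet J (mm J a b) = mdet J a*mdet J b"
proof -
 let ?n = "card J" and ?f = "jenum J"
 let ?A = "Matrix.mat ?n ?n (%(x,y). a (?f x) (?f y))" and ?B = "Matrix.mat ?n ?n (%(x,y). b (?f x) (?f y))"
 have "Matrix.mat ?n ?n (%(x,y). mm J a b (?f x) (?f y)) = ?A*?B"
 proof (rule eq_matI)
  fix i j assume "i < dim_row (?A*?B)" "j < dim_col (?A*?B)"
  hence ij: "i < ?n" "j < ?n" by auto
  have "mm J a b (?f i) (?f j) = (SUM t:{0..<?n}. a (?f i) (?f t)*b (?f t) (?f j))"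
   unfolding mm_def by(rule sum.reindex_bij_betw[OF jenum[OF assms], symmetric])
  thus "Matrix.mat ?n ?n (%(x,y). mm J a b (?f x) (?f y)) $$ (i,j) = (?A*?B) $$ (i,j)"
   using ij by(simp add: scalar_prod_def)
 qed auto
 thus ?thesis unfolding mdet_def by(simp add: det_mult[of _ ?n])
qed

lemma mdet_diag:
 assumes "finite J"
 shows "mdet J (%i j. if i = j then d i else 0) = (PROD i:J. d i)"
proof -
 let ?n = "card J" and ?f = "jenum J"
 let ?A = "Matrix.mat ?n ?n (%(x,y). if ?f x = ?f y then d (?f x) else 0)"
 have inj: "inj_on ?f {0..<?n}" using jenum[OF assms] by(rule bij_betw_imp_inj_on)
 have "upper_triangular ?A"
  unfolding upper_triangular_def
 proof (intro allI impI)
  fix i j assume ij: "i < dim_row ?A" "j < i"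
  hence "?f i ~= ?f j" using inj_onD[OF inj, of i j] by auto
  thus "?A $$ (i,j) = 0" using ij by simp
 qed
 hence "mdet J (%i j. if i = j then d i else 0) = prod_list (diag_mat ?A)"
  unfolding mdet_def by(rule det_upper_triangular[of _ ?n]) simp
 also have "diag_mat ?A = map (%i. d (?f i)) [0..<?n]" unfolding diag_mat_def by(auto intro!: map_cong)
 also have "prod_list (map (%i. d (?f i)) [0..<?n]) = (PROD i:{0..<?n}. d (?f i))"
  using prod.distinct_set_conv_list[of "[0..<?n]" "%i. d (?f i)"] by simp
 also have "... = (PROD i:J. d i)" by(rule prod.reindex_bij_betw[OF jenum[OF assms]])
 finally show ?thesis .
qed

lemma mdet_cong: "finite J ==> (!!i j. i:J ==> j:J ==> a i j = b i j) ==> mdet J a = mdet J b"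
proof -
 assume J: "finite J" and ab: "!!i j. i:J ==> j:J ==> a i j = b i j"
 have "jenum J x:J" if "x < card J" for x using jenum[OF J] that by(auto simp: bij_betw_def)
 hence "Matrix.mat (card J) (card J) (%(x,y). a (jenum J x) (jenum J y)) = Matrix.mat (card J) (card J) (%(x,y). b (jenum J x) (jenum J y))"
  by(intro eq_matI) (auto simp: ab)
 thus ?thesis by(simp add: mdet_def)
qed

lemma mdet_mone: "finite J ==> mdet J (mone J) = 1"
 using mdet_diag[of J "%_. 1"] mdet_cong[of J "mone J" "%i j. if i = j then 1 else 0"] by(simp add: mone_def)

lemma continuous_on_mdet:
 assumes "finite J" "!!i j. i:J ==> j:J ==> cont T (%x. a x i j)"
 shows "cont T (%x. mdet J (a x))"
proof -
 let ?n = "card J" and ?f = "jenum J"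
 have f: "?f x:J" if "x < ?n" for x using jenum[OF assms(1)] that by(auto simp: bij_betw_def)
 have p: "p i < ?n" if "p permutes {0..<?n}" "i < ?n" for p i using permutes_in_image[OF that(1), of i] that(2) by simp
 have "mdet J (a x) = (SUM p:{p. p permutes {0..<?n}}. signof p*(PROD i = 0..<?n. a x (?f i) (?f (p i))))" for x
  unfolding mdet_def Determinant.det_def using p by(auto intro!: sum.cong prod.cong)
 moreover have "cont T (%x. SUM p:{p. p permutes {0..<?n}}. signof p*(PROD i = 0..<?n. a x (?f i) (?f (p i))))"
  by(intro continuous_intros assms(2) f) (use p in auto)
 ultimately show ?thesis by simp
qed

lemma mdet_umat: "finite J ==> umat J u ==> mdet J u ~= 0"
 using mdet_mult[of J "madj u" u] mdet_mone[of J] by(auto simp: umat_def)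

definition dsum :: "nat => (nat => nat => 'b::zero) => (nat => nat => 'b) => nat => nat => 'b" where
 "dsum n a b = (%i j. if i < n & j < n then a i j else if n <= i & n <= j then b (i - n) (j - n) else 0)"

lemma sum_lessThan_add: "(SUM i<n + m. f i) = (SUM i<n. f i) + (SUM i<m. f (i + n) :: 'a::comm_monoid_add)" for n m :: nat
 by(induction m) (simp_all add: ac_simps)

lemma mm_dsum:
 fixes a b :: "nat => nat => 'b::ring_1"
 assumes "msupp {..<n} {..<n} a" "msupp {..<n} {..<n} a'"
 shows "mm {..<n + m} (dsum n a b) (dsum n a' b') = dsum n (mm {..<n} a a') (mm {..<m} b b')"
 by(fastforce simp: mm_def sum_lessThan_add dsum_def)

lemma madj_dsum: "madj (dsum n a b) = dsum n (madj a) (madj b)"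
 by(intro ext) (auto simp: madj_def dsum_def)

lemma mone_dsum: "mone {..<n + m} = dsum n (mone {..<n}) (mone {..<m})"
 by(intro ext) (auto simp: mone_def dsum_def)

lemma msupp_dsum: "msupp {..<n} {..<n} a ==> msupp {..<m} {..<m} b ==> msupp {..<n + m} {..<n + m} (dsum n a b)"
 unfolding msupp_def
proof (intro allI impI)
 fix i j
 assume a: "ALL i j. ~ (i:{..<n} & j:{..<n}) --> a i j = 0" and b: "ALL i j. ~ (i:{..<m} & j:{..<m}) --> b i j = 0"
  and ij: "~ (i:{..<n + m} & j:{..<n + m})"
 hence "n <= i ==> n <= j ==> ~ (i - n:{..<m} & j - n:{..<m})" by auto
 thus "dsum n a b i j = 0" using b ij by(auto simp: dsum_def)
qed

lemma umat_dsum: "umat {..<n} u ==> umat {..<m} v ==> umat {..<n + m} (dsum n u v)"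
 unfolding umat_def
 by(simp add: mm_dsum msupp_madj madj_dsum mone_dsum msupp_dsum)

lemma pmat_dsum: "pmat {..<n} u ==> pmat {..<m} v ==> pmat {..<n + m} (dsum n u v)"
 unfolding pmat_def by(simp add: mm_dsum madj_dsum msupp_dsum)

context circle_matrix_sum
begin

definition idx :: "nat => nat => (nat \<times> nat) set" where "idx n k = {..<n} \<times> {..<kap k}"

definition bigm :: "nat => nat => nat => complex => (nat => nat => 'b) => nat \<times> nat => nat \<times> nat => complex" where
 "bigm n m k z x p q = (if p:idx n k & q:idx m k then fib (x (fst p) (fst q)) k z (snd p) (snd q) else 0)"

definition alg_mat :: "nat => nat => (nat => nat => 'b) => bool" where
 "alg_mat n m x <-> msupp {..<n} {..<m} x & (ALL i j. x i j:alg)"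

lemma finite_idx [simp]: "finite (idx n k)"
 by(simp add: idx_def)

lemma alg_matD: "alg_mat n m x ==> msupp {..<n} {..<m} x" "alg_mat n m x ==> x i j:alg"
 by(auto simp: alg_mat_def)

lemma alg_mat_mm: "alg_mat n l x ==> alg_mat l m y ==> alg_mat n m (mm {..<l} x y)"
 unfolding alg_mat_def mm_def[abs_def]
 using msupp_mm[of "{..<n}" "{..<l}" x "{..<l}" "{..<m}" y "{..<l}"]
 by(auto simp: mm_def[abs_def] intro!: closed_algD(11,4)[OF alg_ops(1)])

lemma alg_mat_madj: "alg_mat n m x ==> alg_mat m n (madj x)"
 unfolding alg_mat_def using msupp_madj closed_algD(5)[OF alg_ops(1)] by(auto simp: madj_def)

lemma alg_mat_mone: "alg_mat n n (mone {..<n})"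
 unfolding alg_mat_def using msupp_mone closed_algD(2,8)[OF alg_ops(1)] by(auto simp: mone_def)

lemma alg_mat_dsum: "alg_mat n n x ==> alg_mat m m y ==> alg_mat (n + m) (n + m) (dsum n x y)"
 unfolding alg_mat_def using msupp_dsum[of n x m y] closed_algD(8)[OF alg_ops(1)] by(auto simp: dsum_def)

lemma bigm_mm:
 assumes "alg_mat n l x" "alg_mat l m y" "k:Os" "z:S1"
 shows "bigm n m k z (mm {..<l} x y) = mm (idx l k) (bigm n l k z x) (bigm l m k z y)"
proof (intro ext)
 fix p q
 show "bigm n m k z (mm {..<l} x y) p q = mm (idx l k) (bigm n l k z x) (bigm l m k z y) p q"
 proof (cases "p:idx n k & q:idx m k")
  case True
  hence pq: "snd p < kap k" "snd q < kap k" by(auto simp: idx_def)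
  have "fib (mm {..<l} x y (fst p) (fst q)) k z (snd p) (snd q)
   = (SUM c<l. fib (x (fst p) c*y c (fst q)) k z (snd p) (snd q))"
   unfolding mm_def by(rule fib_sum[OF _ assms(3) pq assms(4)])
    (auto intro!: closed_algD(4)[OF alg_ops(1)] alg_matD(2)[OF assms(1)] alg_matD(2)[OF assms(2)])
  also have "... = (SUM c<l. SUM r<kap k. fib (x (fst p) c) k z (snd p) r*fib (y c (fst q)) k z r (snd q))"
   by(intro sum.cong refl fib_mult alg_matD(2)[OF assms(1)] alg_matD(2)[OF assms(2)] pq assms(3,4))
  also have "... = mm (idx l k) (bigm n l k z x) (bigm l m k z y) p q"
   unfolding mm_def sum.cartesian_product idx_def[of l] by(rule sum.cong) (use True in "auto simp: bigm_def idx_def")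
  finally show ?thesis using True by(simp add: bigm_def)
 next
  case False
  hence "bigm n l k z x p c*bigm l m k z y c q = 0" for c by(auto simp: bigm_def)
  hence "mm (idx l k) (bigm n l k z x) (bigm l m k z y) p q = 0" unfolding mm_def by(intro sum.neutral ballI)
  thus ?thesis using False by(simp only: bigm_def if_False)
 qed
qed

lemma bigm_madj:
 assumes "alg_mat n m x" "k:Os" "z:S1"
 shows "bigm m n k z (madj x) = madj (bigm n m k z x)"
proof (intro ext)
 fix p q
 show "bigm m n k z (madj x) p q = madj (bigm n m k z x) p q"
 proof (cases "p:idx m k & q:idx n k")
  case True
  hence "snd p < kap k" "snd q < kap k" by(auto simp: idx_def)
  from fib_star[OF alg_matD(2)[OF assms(1)] assms(2) this assms(3)] show ?thesis
   using True by(simp add: bigm_def madj_def star_complex_def)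
 qed (auto simp: bigm_def madj_def)
qed

lemma bigm_mone: "k:Os ==> z:S1 ==> bigm n n k z (mone {..<n}) = mone (idx n k)"
 by(force simp: fib_one fib_zero bigm_def mone_def idx_def)

lemma msupp_bigm: "msupp (idx n k) (idx m k) (bigm n m k z x)"
 by(auto simp: msupp_def bigm_def)

lemma continuous_bigm: "alg_mat n m x ==> k:Os ==> cont S1 (%z. bigm n m k z x p q)"
 unfolding bigm_def
 by(intro continuous_on_if_const fib_continuous alg_matD(2) continuous_on_const) (auto simp: idx_def)

lemma bigm_inject:
 assumes "alg_mat n m x" "alg_mat n m y" "!!k z. k:Os ==> z:S1 ==> bigm n m k z x = bigm n m k z y"
 shows "x = y"
proof (intro ext)
 fix i j
 show "x i j = y i j"
 proof (cases "i < n & j < m")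
  case True
  show ?thesis
  proof (rule fib_inject[OF alg_matD(2)[OF assms(1)] alg_matD(2)[OF assms(2)]])
   fix k z r s assume k: "k:Os" "z:S1" "r < kap k" "s < kap k"
   have "bigm n m k z x (i,r) (j,s) = bigm n m k z y (i,r) (j,s)" by(simp add: assms(3)[OF k(1,2)])
   thus "fib (x i j) k z r s = fib (y i j) k z r s" using True k by(simp add: bigm_def idx_def)
  qed
 next
  case False
  thus ?thesis using alg_matD(1)[OF assms(1)] alg_matD(1)[OF assms(2)] by(auto simp: msupp_def)
 qed
qed

definition unbig :: "nat => nat => (nat => complex => nat \<times> nat => nat \<times> nat => complex) => nat => nat => 'b" where
 "unbig n m G i j = (if i < n & j < m then unfib (%k z r s. G k z (i,r) (j,s)) else 0)"

lemma
 assumes "!!k p q. k:Os ==> cont S1 (%z. G k z p q)"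
 shows alg_mat_unbig: "alg_mat n m (unbig n m G)"
  and bigm_unbig: "k:Os ==> z:S1 ==> msupp (idx n k) (idx m k) (G k z) ==> bigm n m k z (unbig n m G) = G k z"
proof -
 have c: "k:Os ==> r < kap k ==> s < kap k ==> cont S1 (%z. G k z (i,r) (j,s))" for k i j r s by(rule assms)
 show "alg_mat n m (unbig n m G)"
  unfolding alg_mat_def unbig_def using unfib_alg[OF c] closed_algD(8)[OF alg_ops(1)] by(auto simp: msupp_def)
 assume k: "k:Os" "z:S1" and supp: "msupp (idx n k) (idx m k) (G k z)"
 show "bigm n m k z (unbig n m G) = G k z"
 proof (intro ext)
  fix p q
  show "bigm n m k z (unbig n m G) p q = G k z p q"
  proof (cases "p:idx n k & q:idx m k")
   case True
   hence "snd p < kap k" "snd q < kap k" by(auto simp: idx_def)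
   with fib_unfib[where G = "%k z r s. G k z (fst p,r) (fst q,s)", OF c k(1) _ _ k(2)]
   have "fib (unfib (%k z r s. G k z (fst p,r) (fst q,s))) k z (snd p) (snd q) = G k z p q" by simp
   thus ?thesis using True by(auto simp: bigm_def unbig_def idx_def)
  next
   case False
   hence "G k z p q = 0" using supp unfolding msupp_def by blast
   thus ?thesis by(simp only: bigm_def False if_False)
  qed
 qed
qed

lemma umat_bigm: "alg_mat n n u ==> umat {..<n} u ==> k:Os ==> z:S1 ==> umat (idx n k) (bigm n n k z u)"
 unfolding umat_def using bigm_mm[of n n _ n] bigm_madj[of n n u k z] bigm_mone[of k z n] alg_mat_madj[of n n u] msupp_bigm by metis

lemma pmat_bigm: "alg_mat n n u ==> pmat {..<n} u ==> k:Os ==> z:S1 ==> pmat (idx n k) (bigm n n k z u)"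
 unfolding pmat_def using bigm_mm[of n n u n u k z] bigm_madj[of n n u k z] msupp_bigm by metis

definition wv :: "nat => (nat => nat => 'b) => nat => int" where
 "wv n u k = wind (%z. mdet (idx n k) (bigm n n k z u))"

lemma mdet_bigm:
 assumes "alg_mat n n u" "umat {..<n} u" "k:Os"
 shows "cont S1 (%z. mdet (idx n k) (bigm n n k z u))" "z:S1 ==> mdet (idx n k) (bigm n n k z u) ~= 0"
 using continuous_on_mdet[OF finite_idx continuous_bigm[OF assms(1,3)]] mdet_umat[OF finite_idx umat_bigm[OF assms]] by auto

lemma wv_mm:
 assumes "alg_mat n n u" "umat {..<n} u" "alg_mat n n v" "umat {..<n} v" "k:Os"
 shows "wv n (mm {..<n} u v) k = wv n u k + wv n v k"
proof -
 have "wv n (mm {..<n} u v) k = wind (%z. mdet (idx n k) (bigm n n k z u)*mdet (idx n k) (bigm n n k z v))"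
  unfolding wv_def
 proof (rule wind_cong[OF mdet_bigm(1) mdet_bigm(2)])
  show "alg_mat n n (mm {..<n} u v)" "umat {..<n} (mm {..<n} u v)" using alg_mat_mm[OF assms(1,3)] umat_mm[OF finite_lessThan assms(2,4)] by auto
  thus "alg_mat n n (mm {..<n} u v)" "umat {..<n} (mm {..<n} u v)" by auto
  show "mdet (idx n k) (bigm n n k z (mm {..<n} u v)) = mdet (idx n k) (bigm n n k z u)*mdet (idx n k) (bigm n n k z v)"
   if "z:S1" for z
   unfolding bigm_mm[OF assms(1,3,5) that] by(rule mdet_mult) simp
 qed (use assms in auto)
 also have "... = wv n u k + wv n v k"
  unfolding wv_def by(rule wind_mult) (use mdet_bigm assms in auto)
 finally show ?thesis .
qed

lemma wv_path:
 assumes "!!i j. cont {0..1::real} (%t. w t i j)" "!!t. t:{0..1} ==> alg_mat n n (w t) & umat {..<n} (w t)" "k:Os"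
 shows "wv n (w 0) k = wv n (w 1) k"
 unfolding wv_def
proof (rule wind_homotopic, rule hom_inI[where h = "%x. mdet (idx n k) (bigm n n k (snd x) (w (fst x)))"])
 show "cont ({0..1} \<times> S1) (%x. mdet (idx n k) (bigm n n k (snd x) (w (fst x))))"
 proof (rule continuous_on_mdet[OF finite_idx])
  fix p q assume "p:idx n k" "q:idx n k"
  hence "snd p < kap k" "snd q < kap k" by(auto simp: idx_def)
  with continuous_on_fib[where x = "%t. w t (fst p) (fst q)", OF assms(1) _ assms(3)]
  have "cont ({0..1} \<times> S1) (%x. fib (w (fst x) (fst p) (fst q)) k (snd x) (snd p) (snd q))"
   using assms(2) alg_matD(2) by blast
  thus "cont ({0..1} \<times> S1) (%x. bigm n n k (snd x) (w (fst x)) p q)"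
   using `p:idx n k` `q:idx n k` by(simp add: bigm_def)
 qed
qed (use mdet_bigm(2) assms in auto)

lemma dg_mdet: "finite J ==> k:J ==> mdet J (dg J k a) = a"
proof -
 assume J: "finite J" "k:J"
 have "mdet J (dg J k a) = mdet J (%i j. if i = j then (if i = k then a else 1) else 0)"
  by(rule mdet_cong[OF J(1)]) (auto simp: dg_def)
 also have "... = (PROD i:J. if i = k then a else 1)" by(rule mdet_diag[OF J(1)])
 also have "... = a" using J by simp
 finally show ?thesis .
qed

lemma zero_idx: "n > 0 ==> k:Os ==> (0,0):idx n k"
 using kap_pos by(simp add: idx_def)

lemma bigm_normal_form:
 assumes "alg_mat n n u" "umat {..<n} u" "k:Os" "n > 0"
 shows "hom_in S1 {a. umat (idx n k) a} (%z. bigm n n k z u) (%z. dg (idx n k) (0,0) (z powi wv n u k))"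
proof -
 have c: "cont S1 (%z. bigm n n k z u)" unfolding continuous_on_mat using continuous_bigm[OF assms(1,3)] by blast
 obtain w where w: "hom_in S1 {a. umat (idx n k) a} (%z. bigm n n k z u) (%z. dg (idx n k) (0,0) (z powi w))"
  using unitary_loop_normal_form[OF finite_idx zero_idx[OF assms(4,3)] c] umat_bigm[OF assms(1-3)] by blast
 have "hom_in S1 (- {0}) (%z. mdet (idx n k) (bigm n n k z u)) (%z. mdet (idx n k) (dg (idx n k) (0,0) (z powi w)))"
 proof (rule hom_in_compose[OF w])
  show "cont {a. umat (idx n k) a} (mdet (idx n k))"
   by(rule continuous_on_mdet[OF finite_idx, where a = "%a. a"]) (rule continuous_on_mat[THEN iffD1, OF continuous_on_id, rule_format])
 qed (use mdet_umat[OF finite_idx] in auto)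
 hence "wv n u k = w" unfolding wv_def dg_mdet[OF finite_idx zero_idx[OF assms(4,3)]] by(rule wind_eqI)
 thus ?thesis using w by simp
qed

lemma umat_bigmI:
 assumes a: "alg_mat n n x" and u: "!!k z. k:Os ==> z:S1 ==> umat (idx n k) (bigm n n k z x)"
 shows "umat {..<n} x"
proof -
 note a' = alg_mat_madj[OF a]
 have "mm {..<n} (madj x) x = mone {..<n}"
  by(rule bigm_inject[OF alg_mat_mm[OF a' a] alg_mat_mone])
   (use u in "simp add: bigm_mm[OF a' a] bigm_madj[OF a] bigm_mone umat_def")
 moreover have "mm {..<n} x (madj x) = mone {..<n}"
  by(rule bigm_inject[OF alg_mat_mm[OF a a'] alg_mat_mone])
   (use u in "simp add: bigm_mm[OF a a'] bigm_madj[OF a] bigm_mone umat_def")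
 ultimately show ?thesis using alg_matD(1)[OF a] by(simp add: umat_def)
qed

lemma wv_eq_imp_path:
 assumes "alg_mat n n u" "umat {..<n} u" "alg_mat n n v" "umat {..<n} v" "!!k. k:Os ==> wv n u k = wv n v k" "n > 0"
 obtains w where "!!i j. cont {0..1::real} (%t. w t i j)" "!!t. t:{0..1} ==> alg_mat n n (w t) & umat {..<n} (w t)"
  "w 0 = u" "w 1 = v"
proof -
 define P where "P k h <-> cont ({0..1::real} \<times> S1) h & h:{0..1} \<times> S1 \<rightarrow> {a. umat (idx n k) a} &
  (ALL z:S1. h (0,z) = bigm n n k z u) & (ALL z:S1. h (1,z) = bigm n n k z v)" for k h
 have "EX h. P k h" if k: "k:Os" for k
 proof -
  have "hom_in S1 {a. umat (idx n k) a} (%z. bigm n n k z u) (%z. bigm n n k z v)"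
   using hom_in_trans[OF bigm_normal_form[OF assms(1,2) k assms(6)]] hom_in_sym[OF bigm_normal_form[OF assms(3,4) k assms(6)]]
   by(simp add: assms(5)[OF k])
  thus ?thesis unfolding hom_in_iff P_def .
 qed
 hence "EX h. ALL k:Os. P k (h k)" by(intro bchoice ballI)
 then obtain h where hP: "ALL k:Os. P k (h k)" ..
 have h: "cont ({0..1::real} \<times> S1) (h k)" "ALL x:{0..1} \<times> S1. umat (idx n k) (h k x)"
  "ALL z:S1. h k (0,z) = bigm n n k z u" "ALL z:S1. h k (1,z) = bigm n n k z v" if "k:Os" for k
  using bspec[OF hP that] unfolding P_def by blast+
 define w where "w t = unbig n n (%k z. h k (t,z))" for t
 have ch: "cont ({0..1} \<times> S1) (%x. h k x p q)" if "k:Os" for k p q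
  by(rule continuous_on_mat[THEN iffD1, OF h(1)[OF that], rule_format])
 have c: "cont S1 (%z. h k (t,z) p q)" if "k:Os" "t:{0..1}" for k t p q
  by(rule continuous_on_compose2[OF ch[OF that(1)]]) (use that(2) in "auto intro!: continuous_intros")
 have aw: "alg_mat n n (w t)" if "t:{0..1}" for t unfolding w_def by(rule alg_mat_unbig) (rule c[OF _ that])
 have bw: "bigm n n k z (w t) = h k (t,z)" if "t:{0..1}" "k:Os" "z:S1" for t k z
 proof -
  have "msupp (idx n k) (idx n k) (h k (t,z))" using bspec[OF h(2)[OF that(2)], of "(t,z)"] that umat_msupp by blast
  thus ?thesis unfolding w_def
   using bigm_unbig[where G = "%k z. h k (t,z)" and n = n and m = n, OF c[OF _ that(1)] that(2,3)] by simp
 qed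
 show thesis
 proof (rule that[of w])
  show "cont {0..1} (%t. w t i j)" for i j
  proof -
   have "cont {0..1} (%t. ps k (%z. h k (t,z) (i,r) (j,s)))" if "k:Os" for k r s
    by(rule unitary_corner.continuous_on_psi[OF corner[OF that], where h = "%x. h k x (i,r) (j,s)"]) (rule ch[OF that])
   hence "cont {0..1} (%t. unfib (%k z r s. h k (t,z) (i,r) (j,s)))"
    unfolding unfib_def by(intro continuous_on_sum continuous_on_mult continuous_on_const) auto
   thus ?thesis unfolding w_def unbig_def by(intro continuous_on_if_const continuous_on_const)
  qed
  show "alg_mat n n (w t) & umat {..<n} (w t)" if t: "t:{0..1}" for t
  proof
   show "umat {..<n} (w t)"
    by(rule umat_bigmI[OF aw[OF t]]) (use bspec[OF h(2)] t bw[OF t] in force)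
  qed (rule aw[OF t])
  show "w 0 = u" by(rule bigm_inject[OF aw assms(1)]) (use bw[of 0] h(3) in auto)
  show "w 1 = v" by(rule bigm_inject[OF aw assms(3)]) (use bw[of 1] h(4) in auto)
 qed
qed

lemma bigm_dsum:
 assumes "k:Os" "z:S1"
 shows "bigm (n + m) (n + m) k z (dsum n a b) (i,r) (j,s) =
  (if i < n & j < n then bigm n n k z a (i,r) (j,s)
  else if n <= i & n <= j then bigm m m k z b (i - n,r) (j - n,s) else 0)"
 using assms fib_zero by(cases "i < n"; cases "j < n") (auto simp: bigm_def idx_def dsum_def)

definition ndg :: "nat => (nat => int) => nat => nat => 'b" where
 "ndg n w = unbig n n (%k z. dg (idx n k) (0,0) (z powi w k))"

lemma
 assumes n: "n > 0"
 shows alg_mat_ndg: "alg_mat n n (ndg n w)"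
  and bigm_ndg: "[|k:Os; z:S1|] ==> bigm n n k z (ndg n w) = dg (idx n k) (0,0) (z powi w k)"
  and umat_ndg: "umat {..<n} (ndg n w)"
  and wv_ndg: "k:Os ==> wv n (ndg n w) k = w k"
proof -
 have c: "cont S1 (%z. dg (idx n k) (0,0) (z powi w k) p q)" if "k:Os" for k p q
  unfolding dg_def by(intro continuous_on_if_const continuous_on_const continuous_on_power_int continuous_on_id) auto
 have u: "umat (idx n k) (dg (idx n k) (0,0) (z powi w k))" if "k:Os" "z:S1" for k z
  using that zero_idx[OF n that(1)] complex_norm_square[of "z powi w k"]
  by(intro umat_dg) (auto simp: norm_power_int star_complex_def mult.commute)
 show a: "alg_mat n n (ndg n w)" unfolding ndg_def by(rule alg_mat_unbig) (rule c)
 have b: "bigm n n k z (ndg n w) = dg (idx n k) (0,0) (z powi w k)" if "k:Os" "z:S1" for k z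
  unfolding ndg_def by(rule bigm_unbig[OF c that]) (use umat_msupp[OF u] that in auto)
 show "[|k:Os; z:S1|] ==> bigm n n k z (ndg n w) = dg (idx n k) (0,0) (z powi w k)" by(rule b)
 show un: "umat {..<n} (ndg n w)" by(rule umat_bigmI[OF a]) (use b u in simp)
 assume k: "k:Os"
 have "wv n (ndg n w) k = wind (%z. z powi w k)"
  unfolding wv_def using b[OF k] dg_mdet[OF finite_idx zero_idx[OF n k]]
  by(intro wind_cong mdet_bigm[OF a un k]) simp_all
 thus "wv n (ndg n w) k = w k" by(simp add: wind_powi)
qed

lemma wv_dsum:
 assumes u: "alg_mat n n u" "umat {..<n} u" and v: "alg_mat m m v" "umat {..<m} v" and k: "k:Os"
 shows "wv (n + m) (dsum n u v) k = wv n u k + wv m v k"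
proof (cases "n = 0 | m = 0")
 case True
 have e: "dsum 0 u v = v" by(simp add: dsum_def fun_eq_iff)
 have e': "dsum n u v = u" if "m = 0"
 proof (intro ext)
  fix i j show "dsum n u v i j = u i j"
   using alg_matD(1)[OF u(1)] alg_matD(1)[OF v(1)] that by(cases "i < n & j < n") (auto simp: msupp_def dsum_def)
 qed
 have w0: "wv 0 x k = 0" for x using wind_powi[of 0] mdet_mone[of "{}"] by(simp add: wv_def idx_def mdet_def)
 show ?thesis using True e' e w0 by auto
next
 case False
 hence n: "n > 0" and m: "m > 0" by auto
 obtain a where a: "!!i j. cont {0..1::real} (%t. a t i j)" "!!t. t:{0..1} ==> alg_mat n n (a t) & umat {..<n} (a t)"
   "a 0 = u" "a 1 = ndg n (wv n u)"
  using wv_eq_imp_path[OF u alg_mat_ndg[OF n] umat_ndg[OF n] _ n] wv_ndg[OF n] by metis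
 obtain b where b: "!!i j. cont {0..1::real} (%t. b t i j)" "!!t. t:{0..1} ==> alg_mat m m (b t) & umat {..<m} (b t)"
   "b 0 = v" "b 1 = ndg m (wv m v)"
  using wv_eq_imp_path[OF v alg_mat_ndg[OF m] umat_ndg[OF m] _ m] wv_ndg[OF m] by metis
 let ?D = "dsum n (ndg n (wv n u)) (ndg m (wv m v))"
 have cp: "cont {0..1} (%t. dsum n (a t) (b t) i j)" for i j
  unfolding dsum_def by(intro continuous_on_if_const a(1) b(1) continuous_on_const)
 have "alg_mat (n + m) (n + m) (dsum n (a t) (b t)) & umat {..<n + m} (dsum n (a t) (b t))" if "t:{0..1}" for t
  using alg_mat_dsum umat_dsum a(2)[OF that] b(2)[OF that] by blast
 from wv_path[of "%t. dsum n (a t) (b t)", OF cp this k]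
 have "wv (n + m) (dsum n u v) k = wv (n + m) ?D k" by(simp add: a b)
 also have "... = wind (%z. z powi (wv n u k + wv m v k))"
  unfolding wv_def[of "n + m"]
 proof (rule wind_cong[OF mdet_bigm[OF _ _ k]])
  fix z assume z: "z:S1"
  define d where "d p = (if p = (0,0) then z powi wv n u k else if p = (n,0) then z powi wv m v k else 1)" for p :: "nat \<times> nat"
  have "mdet (idx (n + m) k) (bigm (n + m) (n + m) k z ?D) = mdet (idx (n + m) k) (%p q. if p = q then d p else 0)"
  proof (rule mdet_cong[OF finite_idx])
   fix p q assume pq: "p:idx (n + m) k" "q:idx (n + m) k"
   obtain i r j s where [simp]: "p = (i,r)" "q = (j,s)" by(cases p; cases q)
   have "n <= i ==> n <= j ==> i - n = j - n <-> i = j" by auto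
   thus "bigm (n + m) (n + m) k z ?D p q = (if p = q then d p else 0)"
    using pq n m kap_pos[OF k] by(cases "i < n"; cases "j < n") (auto simp: bigm_dsum[OF k z] bigm_ndg[OF n k z] bigm_ndg[OF m k z] dg_def d_def idx_def)
  qed
  also have "... = (PROD p:idx (n + m) k. d p)" by(rule mdet_diag[OF finite_idx])
  also have "... = (PROD p:{(0,0),(n,0)}. d p)"
   by(rule prod.mono_neutral_right) (use n m kap_pos[OF k] in "auto simp: idx_def d_def")
  also have "... = z powi (wv n u k + wv m v k)"
   using n z by(subst power_int_add) (auto simp: d_def)
  finally show "mdet (idx (n + m) k) (bigm (n + m) (n + m) k z ?D) = z powi (wv n u k + wv m v k)" .
 qed (auto intro!: alg_mat_dsum umat_dsum alg_mat_ndg umat_ndg n m)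
 finally show ?thesis by(simp add: wind_powi)
qed

definition tr :: "nat => (nat => nat => 'b) => nat => complex" where
 "tr n p k = (SUM q:idx n k. bigm n n k 1 p q q)"

lemma tr_commute:
 assumes "alg_mat n m x" "alg_mat m n y" "k:Os"
 shows "tr n (mm {..<m} x y) k = tr m (mm {..<n} y x) k"
 unfolding tr_def bigm_mm[OF assms one_circle] bigm_mm[OF assms(2,1,3) one_circle] mm_def
 by(subst sum.swap) (simp add: mult.commute)

lemma tr_dsum: "k:Os ==> tr (n + m) (dsum n a b) k = tr n a k + tr m b k"
 unfolding tr_def idx_def sum.cartesian_product' sum_lessThan_add
 by(simp add: bigm_dsum)

lemma bigm_frame:
 assumes "alg_mat n n p" "pmat {..<n} p" "k:Os"
 shows "EX r W. (ALL i l. cont S1 (%z. W z i l)) & (ALL z:S1. is_frame (idx n k) r (W z) (bigm n n k z p)) & tr n p k = of_nat r"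
proof -
 obtain r W where W: "ALL i l. cont S1 (%z. W z i l)" "ALL z:S1. is_frame (idx n k) r (W z) (bigm n n k z p)"
  using projection_loop_frame[OF finite_idx continuous_bigm[OF assms(1,3)] pmat_bigm[OF assms]] by blast
 thus ?thesis using is_frame_trace[OF bspec[OF W(2) one_circle]] unfolding tr_def by blast
qed

lemma tr_eq_imp_mvn:
 assumes p: "alg_mat n n p" "pmat {..<n} p" and q: "alg_mat m m q" "pmat {..<m} q" and tr: "!!k. k:Os ==> tr n p k = tr m q k"
 obtains v where "alg_mat m n v" "mm {..<m} (madj v) v = p" "mm {..<n} v (madj v) = q"
proof -
 define P where "P k x <-> (ALL i l. cont S1 (%z. fst (snd x) z i l)) & (ALL i l. cont S1 (%z. snd (snd x) z i l)) &
  (ALL z:S1. is_frame (idx n k) (fst x) (fst (snd x) z) (bigm n n k z p)) &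
  (ALL z:S1. is_frame (idx m k) (fst x) (snd (snd x) z) (bigm m m k z q))" for k x
 have "EX x. P k x" if k: "k:Os" for k
 proof -
  obtain r W where W: "ALL i l. cont S1 (%z. W z i l)" "ALL z:S1. is_frame (idx n k) r (W z) (bigm n n k z p)"
   "tr n p k = of_nat r" using bigm_frame[OF p k] by blast
  obtain r' W' where W': "ALL i l. cont S1 (%z. W' z i l)" "ALL z:S1. is_frame (idx m k) r' (W' z) (bigm m m k z q)"
   "tr m q k = of_nat r'" using bigm_frame[OF q k] by blast
  have "r' = r" using tr[OF k] W(3) W'(3) by simp
  hence "P k (r,W,W')" unfolding P_def fst_conv snd_conv using W(1,2) W'(1,2) by blast
  thus ?thesis ..
 qed
 hence "EX h. ALL k:Os. P k (h k)" by(intro bchoice ballI)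
 then obtain h where hP: "ALL k:Os. P k (h k)" ..
 define r W W' where "r k = fst (h k)" and "W k = fst (snd (h k))" and "W' k = snd (snd (h k))" for k
 have cW: "cont S1 (%z. W k z i l)" "cont S1 (%z. W' k z i l)" if "k:Os" for k i l
  using bspec[OF hP that] unfolding P_def W_def W'_def by blast+
 have fr: "is_frame (idx n k) (r k) (W k z) (bigm n n k z p)" "is_frame (idx m k) (r k) (W' k z) (bigm m m k z q)" if "k:Os" "z:S1" for k z
  using bspec[OF hP that(1)] that(2) unfolding P_def r_def W_def W'_def by blast+
 let ?G = "%k z. mm {..<r k} (W' k z) (madj (W k z))"
 define v where "v = unbig m n ?G"
 have cG: "cont S1 (%z. ?G k z i j)" if "k:Os" for k i j
  unfolding mm_def madj_def star_complex_def by(intro continuous_intros cW that)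
 have a: "alg_mat m n v" unfolding v_def by(rule alg_mat_unbig) (rule cG)
 have b: "bigm m n k z v = ?G k z" if k: "k:Os" "z:S1" for k z
 proof -
  have "msupp (idx m k) (idx n k) (?G k z)" using fr[OF that] msupp_mm msupp_madj unfolding is_frame_def by blast
  thus ?thesis unfolding v_def using bigm_unbig[where G = ?G and n = m and m = n, OF cG k] by simp
 qed
 note a' = alg_mat_madj[OF a]
 have "mm (idx m k) (madj (?G k z)) (?G k z) = bigm n n k z p & mm (idx n k) (?G k z) (madj (?G k z)) = bigm m m k z q"
  if k: "k:Os" "z:S1" for k z
 proof -
  have f: "mm (idx n k) (madj (W k z)) (W k z) = mone {..<r k}" "mm (idx m k) (madj (W' k z)) (W' k z) = mone {..<r k}"
   "msupp (idx n k) {..<r k} (W k z)" "msupp (idx m k) {..<r k} (W' k z)"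
   "mm {..<r k} (W k z) (madj (W k z)) = bigm n n k z p" "mm {..<r k} (W' k z) (madj (W' k z)) = bigm m m k z q"
   using fr[OF k] by(auto simp: is_frame_def)
  have "mm (idx m k) (madj (?G k z)) (?G k z) = mm {..<r k} (W k z) (mm {..<r k} (mm (idx m k) (madj (W' k z)) (W' k z)) (madj (W k z)))"
   by(simp add: madj_mm mm_assoc)
  also have "... = bigm n n k z p" unfolding f using f mm_mone[OF _ msupp_madj[OF f(3)]] by simp
  finally have 1: "mm (idx m k) (madj (?G k z)) (?G k z) = bigm n n k z p" .
  have "mm (idx n k) (?G k z) (madj (?G k z)) = mm {..<r k} (W' k z) (mm {..<r k} (mm (idx n k) (madj (W k z)) (W k z)) (madj (W' k z)))"
   by(simp add: madj_mm mm_assoc)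
  also have "... = bigm m m k z q" unfolding f using f mm_mone[OF _ msupp_madj[OF f(4)]] by simp
  finally show ?thesis using 1 by simp
 qed
 note G = this
 show thesis
 proof (rule that[OF a])
  show "mm {..<m} (madj v) v = p"
   by(rule bigm_inject[OF alg_mat_mm[OF a' a] p(1)]) (simp only: bigm_mm[OF a' a] bigm_madj[OF a] b G)
  show "mm {..<n} v (madj v) = q"
   by(rule bigm_inject[OF alg_mat_mm[OF a a'] q(1)]) (simp only: bigm_mm[OF a a'] bigm_madj[OF a] b G)
 qed
qed

end

lemma norm_mult_isometry:
 fixes u x :: "'b::cstar_alg"
 assumes "star u*u = 1"
 shows "norm (u*x) = norm x"
proof -
 have "star (u*x)*(u*x) = star x*(star u*u)*x" by(simp add: star_mult mult.assoc)
 hence "norm (u*x)*norm (u*x) = norm x*norm x" using assms cstar_id[of "u*x"] cstar_id[of x] by simp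
 thus ?thesis by(metis abs_norm_cancel power2_eq_square real_sqrt_abs)
qed

text \<open>The vectors \<open>h\<close> are approximate eigenvectors of \<open>U\<close> with eigenvalue \<open>z\<close>: \<open>norm h = sqrt m\<close> while
 \<open>norm (U * h - z * h) <= 2\<close>.\<close>

lemma tower_lower_bound:
 fixes U e :: "'b::cstar_alg"
 assumes U: "is_unitary U" and eU: "e*U = U*e"
  and tower: "!!M::nat. EX m E. M <= m & is_proj E & E ~= 0 & e*E = E & (ALL i<m. ALL j<m. i ~= j --> star (U ^ i*E)*(U ^ j*E) = 0)"
  and z: "z:S1"
 shows "cmod (SUM n:I. c n*z powi n) <= norm (SUM n:I. cx (c n)*(upow U n*e))" (is "cmod ?q <= norm ?Q")
proof (rule ccontr)
 assume neg: "~ ?thesis"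
 define K where "K = (SUM n:I. cmod (c n)*(2 * \<bar>real_of_int n\<bar>))"
 have z1: "cmod z = 1" "z ~= 0" using z by auto
 obtain M :: nat where M: "(K / (cmod ?q - norm ?Q))\<^sup>2 < real M" using reals_Archimedean2 by blast
 obtain m E where m: "M <= m" and E: "is_proj E" "E ~= 0" "e*E = E"
  and orth: "!!i j. i < m ==> j < m ==> i ~= j ==> star (U ^ i*E)*(U ^ j*E) = 0" using tower[of M] by blast
 have nE: "norm E = 1" using cstar_id[of E] E(1,2) by(auto simp: is_proj_def)
 have uU: "star (U ^ j)*U ^ j = 1" for j using upow_unitary[OF U, of "int j"] by(simp add: upow_of_nat is_unitary_def)
 define a where "a j = cx (inverse z ^ j)*(U ^ j*E)" for j
 have na: "norm (a j) = 1" for j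
  using norm_mult_isometry[OF uU] by(simp add: a_def norm_cx_mult norm_power norm_inverse z1 nE)
 have aa: "star (a i)*a j = (if i = j then E else 0)" if "i < m" "j < m" for i j
 proof -
  have "star (a i)*a j = (star (U ^ i*E)*cx (cnj (inverse z ^ i)))*(cx (inverse z ^ j)*(U ^ j*E))"
   by(simp only: a_def star_mult star_cx)
  also have "... = cx (cnj (inverse z ^ i)*inverse z ^ j)*(star (U ^ i*E)*(U ^ j*E))"
   by(metis (no_types, opaque_lifting) cx_commute cx_mult mult.assoc)
  also have "... = (if i = j then E else 0)"
  proof (cases "i = j")
   case True
   have "cnj (inverse z ^ i)*inverse z ^ i = 1"
    using complex_norm_square[of "inverse z ^ i"] by(simp add: norm_power norm_inverse z1 mult.commute)
   moreover have "star (U ^ i*E)*(U ^ i*E) = E*(star (U ^ i)*U ^ i)*E"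
    using E(1) by(simp add: star_mult is_proj_def mult.assoc)
   ultimately show ?thesis using True uU E(1) by(simp add: is_proj_def)
  qed (use orth that in simp)
  finally show ?thesis .
 qed
 define h where "h = (SUM j<m. a j)"
 have "star h*h = (SUM i<m. SUM j<m. star (a i)*a j)" by(simp add: h_def star_sum sum_product)
 also have "... = (SUM i<m. SUM j<m. if i = j then E else 0)" by(intro sum.cong refl) (simp add: aa)
 also have "... = real m *R E" by(simp add: scaleR_conv_of_real)
 finally have nh: "norm h*norm h = real m" using cstar_id[of h] nE by simp
 have Ua: "U*a j = cx z*a (Suc j)" for j
 proof -
  have "U*a j = cx (inverse z ^ j)*(U ^ Suc j*E)" by(simp add: a_def cx_left_commute mult.assoc)
  also have "inverse z ^ j = z*inverse z ^ Suc j" using z1 by simp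
  finally show ?thesis by(simp only: a_def cx_mult mult.assoc)
 qed
 have "U*h = cx z*(SUM j<m. a (Suc j))" by(simp add: h_def sum_distrib_left Ua)
 also have "(SUM j<m. a (Suc j)) = h + (a m - a 0)" using sum_lessThan_telescope[of a m] by(simp add: h_def sum_subtractf algebra_simps)
 finally have Uh: "U*h - cx z*h = cx z*(a m - a 0)" by(simp add: distrib_left)
 have n2: "norm (U*h - cx z*h) <= 2"
  unfolding Uh norm_cx_mult using norm_triangle_ineq4[of "a m" "a 0"] na z1 by simp
 have n2': "norm (star U*h - cx (inverse z)*h) <= 2"
 proof -
  have "star U*(U*h - cx z*h) = h - cx z*(star U*h)"
   unfolding right_diff_distrib cx_left_commute using U by(simp add: mult.assoc[symmetric] is_unitary_def)
  hence "star U*h - cx (inverse z)*h = - (cx (inverse z)*(star U*(U*h - cx z*h)))"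
   using z1 by(simp add: right_diff_distrib mult.assoc[symmetric] cx_mult[symmetric])
  thus ?thesis using n2 norm_mult_isometry[of "star U"] U by(simp add: norm_cx_mult norm_inverse z1 is_unitary_def)
 qed
 define d where "d n = upow U n*h - cx (z powi n)*h" for n
 have nz: "cmod (z powi n) = 1" for n by(simp add: norm_power_int z1)
 have d1: "d (n + 1) = U*d n + cx (z powi n)*(U*h - cx z*h)" for n
 proof -
  have "U*d n = U*(upow U n*h) - cx (z powi n)*(U*h)" by(simp only: d_def right_diff_distrib cx_left_commute)
  thus ?thesis using z1 by(simp add: d_def upow_Suc[OF U] power_int_add cx_mult right_diff_distrib mult.assoc)
 qed
 have d2: "d (n - 1) = star U*d n + cx (z powi n)*(star U*h - cx (inverse z)*h)" for n
 proof -
  have "star U*d n = star U*(upow U n*h) - cx (z powi n)*(star U*h)" by(simp only: d_def right_diff_distrib cx_left_commute)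
  moreover have "z powi (n - 1) = z powi n*inverse z" using z1 by(simp add: power_int_diff divide_inverse)
  ultimately show ?thesis by(simp add: d_def upow_pred[OF U] cx_mult right_diff_distrib mult.assoc)
 qed
 have nd: "norm (d n) <= 2 * \<bar>real_of_int n\<bar>" for n
 proof (induction n rule: int_induct[where k = 0])
  case base
  thus ?case by(simp add: d_def)
 next
  case (step1 i)
  have "norm (d (i + 1)) <= norm (U*d i) + norm (cx (z powi i)*(U*h - cx z*h))" unfolding d1 by(rule norm_triangle_ineq)
  thus ?case using step1 n2 norm_mult_isometry[of U "d i"] U by(simp add: norm_cx_mult nz is_unitary_def)
 next
  case (step2 i)
  have "norm (d (i - 1)) <= norm (star U*d i) + norm (cx (z powi i)*(star U*h - cx (inverse z)*h))" unfolding d2 by(rule norm_triangle_ineq)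
  thus ?case using step2 n2' norm_mult_isometry[of "star U" "d i"] U by(simp add: norm_cx_mult nz is_unitary_def)
 qed
 have eUj: "e*U ^ j = U ^ j*e" for j using upow_commute[OF eU U, of "int j"] by(simp add: upow_of_nat)
 have ea: "e*a j = a j" for j
  unfolding a_def cx_left_commute mult.assoc[of e, symmetric] eUj by(simp add: mult.assoc E(3))
 have eh: "e*h = h" by(simp add: h_def sum_distrib_left ea)
 have "?Q*h = (SUM n:I. cx (c n)*(upow U n*h))" by(simp add: sum_distrib_right mult.assoc eh)
 also have "... = (SUM n:I. cx (c n*z powi n)*h + cx (c n)*d n)"
  by(intro sum.cong refl) (simp add: d_def right_diff_distrib cx_mult mult.assoc)
 also have "... = cx ?q*h + (SUM n:I. cx (c n)*d n)" by(simp add: sum.distrib cx_sum sum_distrib_right)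
 finally have "cx ?q*h = ?Q*h - (SUM n:I. cx (c n)*d n)" by simp
 hence "norm (cx ?q*h) <= norm (?Q*h) + norm (SUM n:I. cx (c n)*d n)"
  by(metis norm_triangle_ineq4)
 also have "norm (SUM n:I. cx (c n)*d n) <= K"
  unfolding K_def by(rule sum_norm_le) (simp add: norm_cx_mult mult_left_mono nd)
 finally have "cmod ?q*norm h <= norm ?Q*norm h + K"
  using norm_mult_ineq[of ?Q h] by(simp add: norm_cx_mult)
 hence "(cmod ?q - norm ?Q)*norm h <= K" by(simp add: left_diff_distrib)
 hence "norm h <= K / (cmod ?q - norm ?Q)" using neg by(simp add: pos_le_divide_eq mult.commute)
 hence "(norm h)\<^sup>2 <= (K / (cmod ?q - norm ?Q))\<^sup>2" by(intro power_mono) auto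
 thus False using nh M m by(simp add: power2_eq_square)
qed

context circle_matrix_sum
begin

lemma algI:
 assumes "!!l j. l:Os ==> j < kap l ==> EX i<kap l. EX y:rg l. x*S l j = S l i*y"
 shows "x:alg"
 unfolding alg_def mem_Collect_eq
proof (intro ballI allI impI)
 fix k l i j assume kl: "k:Os" "l:Os" "i < kap k" "j < kap l"
 obtain s y where s: "s < kap l" "y:rg l" "x*S l j = S l s*y" using assms[OF kl(2,4)] by blast
 have "star (S k i)*x*S l j = star (S k i)*S l s*y" using s(3) by(simp add: mult.assoc)
 also have "... = (if k = l & i = s then y else 0)" unfolding S_orth[OF kl(1,2,3) s(1)] using rg_ops(8)[OF kl(2) s(2)] by auto
 finally show "star (S k i)*x*S l j:(if k = l then rg k else {0})" using s(2) rg_ops(4)[OF kl(1)] by auto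
qed

lemma alg_least:
 assumes C: "closed_calg C" and gen: "!!k i. k:Os ==> i < kap k ==> S k i:C" "!!k. k:Os ==> U k:C & e k:C"
 shows "alg \<subseteq> C"
proof
 fix x assume x: "x:alg"
 define G where "G k z i j = fib x k z i j" for k z i j
 have c: "cont S1 (%z. G k z i j)" if "k:Os" "i < kap k" "j < kap k" for k i j
  unfolding G_def by(rule fib_continuous[OF x that])
 have "x = unfib G" by(rule fib_inject[OF x unfib_alg[OF c]]) (use fib_unfib[OF c] in "simp_all add: G_def")
 moreover have "unfib G:C"
 proof -
  have Ca: "closed_alg C" using C by(simp add: closed_calg_def)
  have "ps k (%z. G k z i j):C" if "k:Os" "i < kap k" "j < kap k" for k i j
   using unitary_corner.psi_mem[OF corner[OF that(1)] C] gen(2)[OF that(1)] c[OF that] by blast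
  thus ?thesis unfolding unfib_def using gen(1) by(intro closed_algD(11)[OF Ca] closed_algD(4)[OF Ca] closed_algD(5)[OF Ca]) auto
 qed
 ultimately show "x:C" by simp
qed

lemma fib_diag:
 assumes "k:Os" "i < kap k" "j < kap k" "z:S1" "cont S1 f" "x*S k j = S k j*ps k f"
 shows "fib x k z i j = (if i = j then f z else 0)"
proof (rule fib_eqI[OF assms(1) _ _ assms(4)])
 interpret C: unitary_corner "U k" "e k" by(rule corner[OF assms(1)])
 show "cont S1 (%z. if i = j then f z else 0)" by(intro continuous_on_if_const assms(5) continuous_on_const)
 show "star (S k i)*x*S k j = ps k (%z. if i = j then f z else 0)"
 proof -
  have "star (S k i)*x*S k j = star (S k i)*S k j*ps k f" by(simp add: mult.assoc assms(6))
  thus ?thesis unfolding S_orth[OF assms(1,1,2,3)] using C.psi_corner(1)[OF assms(5)] by(cases "i = j") (simp_all add: C.psi_zero)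
 qed
qed

end

text \<open>\<open>V\<close> permutes the cylinders \<open>e i L t\<close> of the \<open>i\<close>-th orbit cyclically; \<open>t\<close> counts modulo \<open>k L\<close>.\<close>

locale odometer_system =
 fixes V :: "'b::cstar_alg" and k :: "nat => nat" and e :: "nat => nat => nat => 'b"
 assumes V: "is_unitary V"
  and k_pos: "0 < k L" and k_dvd: "k L dvd k (Suc L)" and k_unb: "EX L. N <= k L"
  and e_proj: "is_proj (e i L t)" and e_nz: "e i L t ~= 0"
  and e_orth: "s < k L ==> t < k L ==> (i,s) ~= (j,t) ==> e i L s*e j L t = 0"
  and e_per: "e i L (t + k L) = e i L t"
  and e_shift: "V*e i L t = e i L (Suc t)*V"
  and e_refine: "e i L t = (SUM j<k (Suc L) div k L. e i (Suc L) (t + j * k L))"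
  and generate: "closed_calg C ==> V:C ==> (!!i L t. e i L t:C) ==> x:C"
begin

lemma star_e: "star (e i L t) = e i L t" and ee: "e i L t*e i L t = e i L t"
 using e_proj by(auto simp: is_proj_def)

lemma e_per_mult: "e i L (t + j * k L) = e i L t"
proof (induction j)
 case (Suc j)
 thus ?case using e_per[of i L "t + j * k L"] by(simp add: ac_simps)
qed simp

lemma e_mod: "e i L (t mod k L) = e i L t"
 using e_per_mult[of i L "t mod k L" "t div k L"] by simp

lemma e_mult: "e i L s*e j L t = (if i = j & s mod k L = t mod k L then e i L s else 0)"
proof (cases "i = j & s mod k L = t mod k L")
 case True
 thus ?thesis using e_mod[of i L s] e_mod[of i L t] ee by metis
next
 case False
 thus ?thesis using e_orth[of "s mod k L" L "t mod k L" i j] k_pos by(auto simp: e_mod)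
qed

lemma Vpow_e: "V ^ j*e i L t = e i L (t + j)*V ^ j"
proof (induction j)
 case (Suc j)
 have "V ^ Suc j*e i L t = V*(e i L (t + j)*V ^ j)" by(simp add: mult.assoc Suc)
 also have "... = e i L (t + Suc j)*V ^ Suc j" by(simp add: mult.assoc[symmetric] e_shift)
 finally show ?case .
qed simp

lemma Vpow_unit: "star (V ^ j)*V ^ j = 1" "V ^ j * star (V ^ j) = 1"
 using upow_unitary[OF V, of "int j"] by(simp_all add: upow_of_nat is_unitary_def)

lemma e_sub: "L <= L' ==> e i L t*e i L' t = e i L' t"
proof (induction L' rule: dec_induct)
 case (step n)
 have m: "k (Suc n) div k n * k n = k (Suc n)" using k_dvd[of n] by simp
 have "e i n t*e i (Suc n) t = (SUM j<k (Suc n) div k n. e i (Suc n) (t + j * k n)*e i (Suc n) t)"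
  by(subst e_refine) (simp add: sum_distrib_right)
 also have "... = (SUM j<k (Suc n) div k n. if j = 0 then e i (Suc n) t else 0)"
 proof (intro sum.cong refl)
  fix j assume j: "j:{..<k (Suc n) div k n}"
  hence lt: "j * k n < k (Suc n)" using m k_pos[of n] by(metis lessThan_iff mult_less_mono1)
  have "(t + j * k n) mod k (Suc n) = t mod k (Suc n) ==> j * k n mod k (Suc n) = 0"
   by(metis add.right_neutral mod_0 cong_add_lcancel_nat cong_def)
  hence "(t + j * k n) mod k (Suc n) = t mod k (Suc n) <-> j = 0" using lt k_pos[of n] by auto
  thus "e i (Suc n) (t + j * k n)*e i (Suc n) t = (if j = 0 then e i (Suc n) t else 0)" unfolding e_mult by auto
 qed
 also have "... = e i (Suc n) t" using dvd_imp_le[OF k_dvd[of n] k_pos] k_pos by(simp add: div_greater_zero_iff)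
 finally have "e i n t*e i (Suc n) t = e i (Suc n) t" .
 thus ?case using step(3) by(metis mult.assoc)
qed (rule ee)

definition g :: "nat => nat => 'b" where "g i L = (SUM t<k L. e i L t)"
definition f :: "nat => 'b" where "f L = 1 - (SUM i<L. g i L)"

lemma g_Suc: "g i (Suc L) = g i L"
proof -
 have m: "k (Suc L) div k L * k L = k (Suc L)" using k_dvd[of L] by simp
 have "g i L = (SUM j<k (Suc L) div k L. SUM t<k L. e i (Suc L) (t + j * k L))"
  unfolding g_def by(subst sum.swap) (simp add: e_refine[of i L])
 also have "... = (SUM j<k (Suc L) div k L. SUM t:{j * k L..<j * k L + k L}. e i (Suc L) t)"
 proof (rule sum.cong[OF refl])
  fix j
  show "(SUM t<k L. e i (Suc L) (t + j * k L)) = (SUM t:{j * k L..<j * k L + k L}. e i (Suc L) t)"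
   using sum.shift_bounds_nat_ivl[of "e i (Suc L)" 0 "j * k L" "k L"] by(simp add: atLeast0LessThan add.commute)
 qed
 also have "... = g i (Suc L)" unfolding g_def sum.nat_group m ..
 finally show ?thesis by simp
qed

lemma f_Suc: "f L = g L (Suc L) + f (Suc L)"
 by(simp add: f_def g_Suc)

lemma g_e: "g i L*e j L t = (if i = j then e j L t else 0)" and e_g: "e j L t*g i L = (if i = j then e j L t else 0)"
proof -
 have t: "t mod k L < k L" using k_pos by simp
 have "g i L*e j L t = (SUM s<k L. if s = t mod k L then if i = j then e j L t else 0 else 0)"
  unfolding g_def sum_distrib_right
  by(intro sum.cong refl) (use e_mod[of j L t] in "auto simp: e_mult")
 thus "g i L*e j L t = (if i = j then e j L t else 0)" using t by simp
 have "e j L t*g i L = (SUM s<k L. if s = t mod k L then if i = j then e j L t else 0 else 0)"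
  unfolding g_def sum_distrib_left
  by(intro sum.cong refl) (use e_mod[of j L t] in "auto simp: e_mult")
 thus "e j L t*g i L = (if i = j then e j L t else 0)" using t by simp
qed

lemma f_e: "i < L ==> f L*e i L t = 0" and e_f: "i < L ==> e i L t*f L = 0"
 by(simp_all add: f_def left_diff_distrib right_diff_distrib sum_distrib_right sum_distrib_left g_e e_g)

lemma star_f: "star (f L) = f L"
 by(simp add: f_def g_def star_diff star_sum star_e)

lemma ff: "f L*f L = f L"
proof -
 have "f L*g i L = 0" if "i < L" for i unfolding g_def sum_distrib_left using that by(simp add: f_e)
 hence "f L*(SUM i<L. g i L) = 0" by(simp add: sum_distrib_left)
 moreover have "f L*f L = f L - f L*(SUM i<L. g i L)" by(subst (2) f_def) (simp add: right_diff_distrib)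
 ultimately show ?thesis by simp
qed

lemma V_f: "V*f L = f L*V"
proof -
 have "V*g i L = g i L*V" for i
 proof -
  have "V*g i L = (SUM t<k L. e i L (Suc t))*V" by(simp add: g_def sum_distrib_left sum_distrib_right e_shift)
  also have "(SUM t<k L. e i L (Suc t)) = g i L"
   unfolding g_def using sum.lessThan_Suc_shift[of "e i L" "k L"] e_per[of i L 0] by simp
  finally show ?thesis .
 qed
 thus ?thesis by(simp add: f_def right_diff_distrib left_diff_distrib sum_distrib_left sum_distrib_right)
qed

definition kp :: "nat => nat => nat" where "kp L i = (if i < L then k L else 1)"
definition Sp :: "nat => nat => nat => 'b" where "Sp L i j = (if i < L then V ^ j*e i L 0 else f L)"
definition Up :: "nat => nat => 'b" where "Up L i = (if i < L then V ^ k L else V)"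
definition ep :: "nat => nat => 'b" where "ep L i = (if i < L then e i L 0 else f L)"

lemma k_tower: "EX L'>=L. M * k L <= k L' & k L dvd k L'"
proof -
 obtain L1 where L1: "M * k L <= k L1" using k_unb by blast
 have mono: "k a <= k b" "k a dvd k b" if "a <= b" for a b
  using that by(induction b rule: dec_induct) (use k_dvd k_pos in "auto intro: dvd_trans dest: dvd_imp_le order_trans")
 show ?thesis using mono(2)[of L "max L L1"] mono(1)[of L1 "max L L1"] L1 by(intro exI[of _ "max L L1"]) auto
qed

lemma tower_orth:
 assumes "c*a < k L" "c*b < k L" "a ~= b" "c > 0"
 shows "star ((V ^ c) ^ a*e i L 0)*((V ^ c) ^ b*e i L 0) = 0"
proof -
 have "star ((V ^ c) ^ a*e i L 0)*((V ^ c) ^ b*e i L 0)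
  = star (V ^ (c*a))*(e i L (c*a)*e i L (c*b))*V ^ (c*b)"
  by(simp add: power_mult[symmetric] Vpow_e star_mult star_e mult.assoc)
 thus ?thesis using assms by(simp add: e_mult)
qed

lemma f_corner: "unitary_corner V (f L)"
proof
 fix d c and z :: complex assume z: "z:S1"
 show "cmod (SUM n:{- int d..int d}. c n*z powi n) <= norm (SUM n:{- int d..int d}. cx (c n)*(upow V n*f L))"
 proof (rule tower_lower_bound[OF V V_f[symmetric] _ z])
  fix M :: nat
  obtain L' where L': "L <= L'" "M * k L <= k L'" using k_tower by blast
  hence "M <= k L'" using k_pos[of L] by(cases "k L") auto
  have "g i L*e L L' 0 = 0" if "i < L" for i
   using g_e[of i L L 0] e_sub[OF L'(1), of L 0] that by(metis mult.assoc mult_zero_left nat_less_le)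
  hence "f L*e L L' 0 = e L L' 0" by(simp add: f_def left_diff_distrib sum_distrib_right)
  thus "EX m E. M <= m & is_proj E & E ~= 0 & f L*E = E & (ALL a<m. ALL b<m. a ~= b --> star (V ^ a*E)*(V ^ b*E) = 0)"
   using `M <= k L'` tower_orth[of 1 _ L'] e_proj e_nz by(intro exI[of _ "k L'"] exI[of _ "e L L' 0"]) simp
 qed
qed (simp_all add: V V_f is_proj_def star_f ff)

lemma e_corner: "unitary_corner (V ^ k L) (e i L 0)"
proof
 show U: "is_unitary (V ^ k L)" using upow_unitary[OF V, of "int (k L)"] by(simp add: upow_of_nat)
 show c: "e i L 0*V ^ k L = V ^ k L*e i L 0" using Vpow_e[of "k L" i L 0] e_per[of i L 0] by simp
 fix d c and z :: complex assume z: "z:S1"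
 show "cmod (SUM n:{- int d..int d}. c n*z powi n) <= norm (SUM n:{- int d..int d}. cx (c n)*(upow (V ^ k L) n*e i L 0))"
 proof (rule tower_lower_bound[OF U `e i L 0*V ^ k L = V ^ k L*e i L 0` _ z])
  fix M :: nat
  obtain L' where L': "L <= L'" "M * k L <= k L'" "k L dvd k L'" using k_tower by blast
  have lt: "k L*a < k L'" if "a < k L' div k L" for a
   using that L'(3) k_pos[of L] by(auto simp: less_mult_imp_div_less mult.commute elim!: dvdE)
  show "EX m E. M <= m & is_proj E & E ~= 0 & e i L 0*E = E & (ALL a<m. ALL b<m. a ~= b --> star ((V ^ k L) ^ a*E)*((V ^ k L) ^ b*E) = 0)"
   using L' k_pos[of L] tower_orth[OF lt lt _ k_pos] e_proj e_nz e_sub[OF L'(1)]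
   by(intro exI[of _ "k L' div k L"] exI[of _ "e i L' 0"]) (simp add: less_eq_div_iff_mult_less_eq)
 qed
qed (rule e_proj)

sublocale lev: circle_matrix_sum "{..L}" "kp L" "Sp L" "Up L" "ep L" for L
proof (rule circle_matrix_sum.intro)
 fix i assume "i:{..L}"
 show "unitary_corner (Up L i) (ep L i)" using f_corner e_corner by(simp add: Up_def ep_def)
 show "0 < kp L i" using k_pos by(simp add: kp_def)
next
 fix i j
 show "Sp L i j*ep L i = Sp L i j" by(simp add: Sp_def ep_def ff ee mult.assoc)
next
 fix a b i j assume ab: "a:{..L}" "b:{..L}" "i < kp L a" "j < kp L b"
 show "star (Sp L a i)*Sp L b j = (if a = b & i = j then ep L a else 0)"
 proof (cases "a < L")
  case a: True
  have s: "star (V ^ i*e a L 0) = star (V ^ i)*e a L i" by(simp add: Vpow_e star_mult star_e)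
  show ?thesis
  proof (cases "b < L")
   case True
   have ij: "i < k L" "j < k L" using ab a True by(auto simp: kp_def)
   have "star (Sp L a i)*Sp L b j = star (V ^ i)*(e a L i*e b L j)*V ^ j"
    using a True s by(simp add: Sp_def Vpow_e mult.assoc)
   also have "... = (if a = b & i = j then star (V ^ i)*e a L i*V ^ i else 0)" using ij by(simp add: e_mult)
   also have "star (V ^ i)*e a L i*V ^ i = e a L 0" using Vpow_e[of i a L 0] Vpow_unit[of i] by(simp add: mult.assoc, metis mult.assoc mult_1_left)
   finally show ?thesis using a by(simp add: ep_def)
  next
   case False
   thus ?thesis using a ab s by(auto simp: Sp_def mult.assoc e_f)
  qed
 next
  case False
  thus ?thesis using ab by(auto simp: Sp_def ep_def kp_def star_f ff Vpow_e f_e mult.assoc[symmetric])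
 qed
next
 have "(SUM j<kp L i. Sp L i j * star (Sp L i j)) = (if i < L then g i L else f L)" for i
 proof -
  have "V ^ j*e i L 0 * star (V ^ j*e i L 0) = e i L j" for j
   by(simp add: Vpow_e star_mult star_e mult.assoc Vpow_unit) (simp add: mult.assoc[symmetric] Vpow_unit ee)
  thus ?thesis by(simp add: kp_def Sp_def g_def star_f ff)
 qed
 thus "(SUM i<=L. SUM j<kp L i. Sp L i j * star (Sp L i j)) = 1"
  by(simp add: lessThan_Suc_atMost[symmetric] f_def)
qed simp

lemma V_mem: "V:lev.alg L"
proof (rule lev.algI)
 fix l j assume lj: "l:{..L}" "j < kp L l"
 note rg = lev.rg_ops[OF lj(1)]
 interpret C: unitary_corner "Up L l" "ep L l" by(rule lev.corner[OF lj(1)])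
 have Ue: "Up L l*ep L l:lev.rg L l" using C.psi_in_range[of "%z. z powi 1"] C.psi_powi[of 1] by simp
 show "EX i<kp L l. EX y:lev.rg L l. V*Sp L l j = Sp L l i*y"
 proof (cases "l < L & Suc j < k L")
  case True
  thus ?thesis using rg(5) by(intro exI[of _ "Suc j"] conjI bexI[of _ "ep L l"]) (auto simp: kp_def Sp_def ep_def mult.assoc ee)
 next
  case False
  have "V*Sp L l j = Sp L l 0*(Up L l*ep L l)"
  proof (cases "l < L")
   case True
   hence "Suc j = k L" using False lj by(simp add: kp_def)
   hence "V*Sp L l j = V ^ k L*e l L 0" using True by(simp add: Sp_def mult.assoc[symmetric]) (metis power_Suc)
   also have "... = e l L 0*(V ^ k L*e l L 0)" using C.comm True ee[of l L 0] by(simp add: Up_def ep_def) (metis mult.assoc)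
   finally show ?thesis using True by(simp add: Sp_def Up_def ep_def)
  next
   case f: False
   thus ?thesis using V_f[of L] ff[of L] by(simp add: Sp_def Up_def ep_def mult.assoc[symmetric])
  qed
  thus ?thesis using Ue lev.kap_pos[OF lj(1)] by blast
 qed
qed

lemma e_mem: "i < L ==> e i L t:lev.alg L"
proof (rule lev.algI)
 fix l j assume i: "i < L" and lj: "l:{..L}" "j < kp L l"
 note rg = lev.rg_ops[OF lj(1)]
 have "e i L t*Sp L l j = Sp L l j*(if l = i & t mod k L = j then ep L l else 0)"
 proof (cases "l < L")
  case True
  hence "j < k L" using lj by(simp add: kp_def)
  have "e i L t*Sp L l j = e i L t*e l L j*V ^ j" using True by(simp add: Sp_def Vpow_e mult.assoc)
  also have "... = (if l = i & t mod k L = j then e l L j*V ^ j else 0)"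
   using `j < k L` e_mod[of i L t] by(auto simp: e_mult)
  also have "e l L j*V ^ j = Sp L l j*ep L l" using True Vpow_e[of j l L 0, symmetric] by(simp add: Sp_def ep_def mult.assoc ee del: Vpow_e)
  finally show ?thesis by(simp only: if_distrib[of "%x. Sp L l j*x"] mult_zero_right)
 next
  case False
  thus ?thesis using i e_f by(simp add: Sp_def)
 qed
 moreover have "(if l = i & t mod k L = j then ep L l else 0):lev.rg L l" using rg(4,5) by(simp only: split: if_split) blast
 ultimately show "EX i'<kp L l. EX y:lev.rg L l. e i L t*Sp L l j = Sp L l i'*y" using lj(2) by blast
qed

lemma alg_closed: "closed_alg (lev.alg L)" "cx c:lev.alg L"
 by(rule lev.alg_ops)+

lemma g_mem: "i < L ==> g i L:lev.alg L"
 unfolding g_def by(intro closed_algD(11)[OF alg_closed(1)] e_mem)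

lemma f_mem: "f L:lev.alg L"
 unfolding f_def by(intro closed_algD(9)[OF alg_closed(1)] closed_algD(2)[OF alg_closed(1)] closed_algD(11)[OF alg_closed(1)] g_mem) simp

lemma alg_Suc: "lev.alg L \<subseteq> lev.alg (Suc L)"
proof (rule lev.alg_least)
 note C = closed_algD[OF alg_closed(1)[of "Suc L"]]
 have eS: "e i L t:lev.alg (Suc L)" if "i < L" for i t
  unfolding e_refine[of i L t] using that by(intro C(11) e_mem) simp
 have fS: "f L:lev.alg (Suc L)" unfolding f_Suc[of L] by(intro C(3) g_mem f_mem) simp
 show "closed_calg (lev.alg (Suc L))" by(rule lev.closed_calg_alg)
 show "Sp L i j:lev.alg (Suc L)" for i j using eS fS unfolding Sp_def[of L] by(auto intro!: C(4) C(10) V_mem)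
 show "Up L i:lev.alg (Suc L) & ep L i:lev.alg (Suc L)" for i
  using eS fS unfolding Up_def[of L] ep_def[of L] by(auto intro!: C(10) V_mem)
qed

lemma alg_mono: "L <= L' ==> lev.alg L \<subseteq> lev.alg L'"
 using lift_Suc_mono_le[of lev.alg, OF alg_Suc] by blast

lemma alg_dense:
 assumes "eps > 0"
 shows "EX L. EX y:lev.alg L. norm (x - y) < eps"
proof -
 define D where "D = (\<Union>L. lev.alg L)"
 have common: "EX L. x:lev.alg L & y:lev.alg L" if xy: "x:D" "y:D" for x y
 proof -
  obtain L L' where "x:lev.alg L" "y:lev.alg L'" using xy unfolding D_def by blast
  thus ?thesis using alg_mono[of L "max L L'"] alg_mono[of L' "max L L'"] by(intro exI[of _ "max L L'"]) auto
 qed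
 have sub: "y:closure D" if "y:lev.alg L" for y L
  using closure_subset[of D] that unfolding D_def by blast
 have two: "h (fst q) (snd q):closure D" if q: "q:closure (D \<times> D)" and h: "cont UNIV (%q. h (fst q) (snd q))"
  "!!L x y. x:lev.alg L ==> y:lev.alg L ==> h x y:lev.alg L" for h :: "'b => 'b => 'b" and q
 proof -
  have "h (fst q) (snd q):D" if "q:D \<times> D" for q
   using common[of "fst q" "snd q"] that h(2) unfolding D_def by fastforce
  hence "(%q. h (fst q) (snd q)) ` closure (D \<times> D) \<subseteq> closure D"
   by(intro image_closure_subset) (use h(1) closure_subset in "auto intro: continuous_on_subset")
  thus ?thesis using q by blast
 qed
 have "closed_alg (closure D)"
  unfolding closed_alg_def
 proof (intro conjI ballI allI)
  show "1:closure D" by(rule sub[OF closed_algD(2)[OF alg_closed(1)]])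
  fix x y assume xy: "x:closure D" "y:closure D"
  hence q: "(x,y):closure (D \<times> D)" by(simp add: closure_Times)
  show "x + y:closure D" using two[OF q, of "(+)"] closed_algD(3)[OF alg_closed(1)] by(simp add: continuous_intros)
  show "x*y:closure D" using two[OF q, of "(*)"] closed_algD(4)[OF alg_closed(1)] by(simp add: continuous_intros)
 next
  fix x c assume x: "x:closure D"
  hence q: "(x,x):closure (D \<times> D)" by(simp add: closure_Times)
  show "star x:closure D" using two[OF q, of "%x y. star x"] closed_algD(5)[OF alg_closed(1)] by(simp add: continuous_intros)
  show "c *R x:closure D" using two[OF q, of "%x y. c *R x"] closed_algD(6)[OF alg_closed(1)] by(simp add: continuous_intros)
 qed simp
 hence "closed_calg (closure D)" using sub[OF alg_closed(2)] by(simp add: closed_calg_def)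
 moreover have "V:closure D" by(rule sub[OF V_mem])
 moreover have "e i L t:closure D" for i L t
 proof -
  have "e i L t:lev.alg L'" if "L <= L'" "i < L'" for L'
   using that
  proof (induction "L' - L" arbitrary: L t)
   case (Suc d)
   have "e i (Suc L) s:lev.alg L'" for s by(rule Suc.hyps(1)) (use Suc in auto)
   thus ?case unfolding e_refine[of i L t] by(intro closed_algD(11)[OF alg_closed(1)])
  qed (use e_mem in auto)
  from this[of "Suc (max i L)"] show ?thesis by(intro sub[of _ "Suc (max i L)"]) simp
 qed
 ultimately have "x:closure D" by(rule generate)
 thus ?thesis using assms unfolding closure_approachable D_def by(auto simp: dist_norm norm_minus_commute)
qed

end

definition mat1 :: "'b::zero => nat => nat => 'b" where
 "mat1 x = (%i j. if i = 0 & j = 0 then x else 0)"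

lemma mm_mat1: "mm {..<Suc 0} (mat1 x) (mat1 y) = mat1 (x*y)" for x :: "'b::ring_1"
 by(intro ext) (simp add: mm_def mat1_def)

lemma madj_mat1: "madj (mat1 x) = mat1 (star x)"
 by(intro ext) (simp add: madj_def mat1_def)

lemma mone_mat1: "mone {..<Suc 0} = mat1 1"
 by(intro ext) (auto simp: mone_def mat1_def)

lemma msupp_mat1: "msupp {..<Suc 0} {..<Suc 0} (mat1 x)"
 by(auto simp: msupp_def mat1_def)

lemma mat1_eq [simp]: "mat1 x = mat1 y <-> x = y"
 by(auto simp: mat1_def fun_eq_iff)

lemma mat1_supp: "msupp {..<Suc 0} {..<Suc 0} a ==> a = mat1 (a 0 0)"
 by(intro ext) (auto simp: mat1_def msupp_def)

lemma umat_mat1: "umat {..<Suc 0} (mat1 x) <-> is_unitary x"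
 by(simp add: umat_def is_unitary_def madj_mat1 mm_mat1 mone_mat1 msupp_mat1)

lemma upow_power: "is_unitary u ==> upow (u ^ n) j = upow u (int n*j)"
proof -
 assume u: "is_unitary u"
 have un: "is_unitary (u ^ n)" using upow_unitary[OF u, of "int n"] by(simp add: upow_of_nat)
 show ?thesis
 proof (induction j rule: int_induct[where k = 0])
  case (step1 i)
  have "int n*(i + 1) = int n + int n*i" by(simp add: distrib_left)
  thus ?case using step1 upow_add[OF u, of "int n" "int n*i"] upow_Suc[OF un, of i] by(simp only: upow_of_nat)
 next
  case (step2 i)
  have "int n*(i - 1) = - int n + int n*i" by(simp add: right_diff_distrib)
  thus ?case using step2 upow_add[OF u, of "- int n" "int n*i"] upow_pred[OF un, of i]
   by(simp only: star_upow[symmetric] upow_of_nat)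
 qed simp
qed

context circle_matrix_sum
begin

lemma alg_mat1: "x:alg ==> alg_mat (Suc 0) (Suc 0) (mat1 x)"
 using closed_algD(8)[OF alg_ops(1)] msupp_mat1 by(auto simp: alg_mat_def mat1_def)

lemma bigm_mat1: "bigm (Suc 0) (Suc 0) k z (mat1 x) = (%p q. if p:idx (Suc 0) k & q:idx (Suc 0) k then fib x k z (snd p) (snd q) else 0)"
 by(intro ext) (auto simp: bigm_def mat1_def idx_def)

lemma S_diag:
 assumes "x:alg" "k:Os" "j < kap k" "cont S1 h"
  "!!i z. i < kap k ==> z:S1 ==> fib x k z i j = (if i = j then h z else 0)"
 shows "x*S k j = S k j*ps k h"
proof -
 interpret C: unitary_corner "U k" "e k" by(rule corner[OF assms(2)])
 have t: "star (S l i)*x*S k j = (if l = k & i = j then ps k h else 0)" if li: "l:Os" "i < kap l" for l i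
 proof (cases "l = k")
  case True
  have "star (S k i)*x*S k j = ps k (%z. fib x k z i j)" using ps_fib[OF assms(1,2) _ assms(3), of i] li True by simp
  also have "... = ps k (%z. if i = j then h z else 0)"
   by(rule C.psi_cong[OF fib_continuous[OF assms(1,2) _ assms(3)]]) (use li True assms(5) in auto)
  finally show ?thesis using True by(cases "i = j") (simp_all add: C.psi_zero)
 next
  case False
  thus ?thesis using algD(2)[OF assms(1) li(1) assms(2) False li(2) assms(3)] by simp
 qed
 have "x*S k j = (SUM l:Os. SUM i<kap l. S l i * star (S l i))*(x*S k j)" unfolding S_sum by simp
 also have "... = (SUM l:Os. SUM i<kap l. S l i*(star (S l i)*x*S k j))"
  by(simp add: sum_distrib_right mult.assoc)
 also have "... = (SUM l:Os. SUM i<kap l. if i = j then if l = k then S k j*ps k h else 0 else 0)"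
  by(intro sum.cong refl) (simp add: t)
 also have "... = (SUM l:Os. if l = k then S k j*ps k h else 0)"
 proof (intro sum.cong refl)
  fix l
  show "(SUM i<kap l. if i = j then if l = k then S k j*ps k h else 0 else 0) = (if l = k then S k j*ps k h else 0)"
   using assms(3) by(cases "l = k") (simp_all cong: if_cong)
 qed
 also have "... = S k j*ps k h" using fin assms(2) by simp
 finally show ?thesis .
qed

lemma wv_mat1_power:
 assumes "x:alg" "is_unitary x" "k:Os"
 shows "wv (Suc 0) (mat1 (x ^ m)) k = int m*wv (Suc 0) (mat1 x) k"
proof (induction m)
 case 0
 have a: "alg_mat (Suc 0) (Suc 0) (mat1 1)" by(rule alg_mat1[OF closed_algD(2)[OF alg_ops(1)]])
 have u: "umat {..<Suc 0} (mat1 (1::'b))" by(simp add: umat_mat1 is_unitary_def)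
 show ?case using wv_mm[OF a u a u assms(3)] by(simp add: mm_mat1)
next
 case (Suc m)
 have u: "umat {..<Suc 0} (mat1 (x ^ m))" using upow_unitary[OF assms(2), of "int m"] by(simp add: umat_mat1 upow_of_nat)
 show ?case
  using wv_mm[OF alg_mat1[OF assms(1)] _ alg_mat1[OF closed_algD(10)[OF alg_ops(1) assms(1)]] u assms(3)] assms(2) Suc
  by(simp add: umat_mat1 mm_mat1 algebra_simps)
qed

lemma wv_mat1_diag:
 assumes "x:alg" "is_unitary x" "k:Os" "!!j. j < kap k ==> x*S k j = S k j*ps k (%z. z powi d j)"
 shows "wv (Suc 0) (mat1 x) k = (SUM j<kap k. d j)"
proof -
 have "wv (Suc 0) (mat1 x) k = wind (%z. z powi (SUM j<kap k. d j))"
  unfolding wv_def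
 proof (rule wind_cong[OF mdet_bigm[OF _ _ assms(3)]])
  show "alg_mat (Suc 0) (Suc 0) (mat1 x)" "umat {..<Suc 0} (mat1 x)" "alg_mat (Suc 0) (Suc 0) (mat1 x)" "umat {..<Suc 0} (mat1 x)"
   using assms by(auto simp: umat_mat1 alg_mat1)
  fix z assume z: "z:S1"
  have "mdet (idx (Suc 0) k) (bigm (Suc 0) (Suc 0) k z (mat1 x)) = mdet (idx (Suc 0) k) (%p q. if p = q then z powi d (snd p) else 0)"
  proof (rule mdet_cong[OF finite_idx])
   fix p q assume pq: "p:idx (Suc 0) k" "q:idx (Suc 0) k"
   hence "snd p < kap k" "snd q < kap k" "fst p = 0" "fst q = 0" by(auto simp: idx_def)
   moreover have "cont S1 (%z. z powi d (snd q))" by(intro continuous_on_power_int continuous_on_id) auto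
   ultimately show "bigm (Suc 0) (Suc 0) k z (mat1 x) p q = (if p = q then z powi d (snd p) else 0)"
    using pq fib_diag[OF assms(3) _ _ z _ assms(4), of "snd p" "snd q"] by(auto simp: bigm_mat1 prod_eq_iff)
  qed
  also have "... = (PROD p:idx (Suc 0) k. z powi d (snd p))" by(rule mdet_diag[OF finite_idx])
  also have "... = (PROD j<kap k. z powi d j)" unfolding idx_def
   by(rule prod.reindex_bij_witness[of _ "%j. (0,j)" snd]) auto
  also have "... = z powi (SUM j<m. d j)" if "m = kap k" for m
   unfolding that[symmetric]
  proof (induction m)
   case (Suc m)
   have "z ~= 0" using z by auto
   thus ?case using Suc by(simp add: power_int_add)
  qed simp
  finally show "mdet (idx (Suc 0) k) (bigm (Suc 0) (Suc 0) k z (mat1 x)) = z powi (SUM j<kap k. d j)" by simp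
 qed
 thus ?thesis by(simp add: wind_powi)
qed

end

context odometer_system
begin

lemma upow_V_e: "i < L ==> e i L t*upow V (int (k L)*w) = upow V (int (k L)*w)*e i L t"
proof -
 have u: "is_unitary (V ^ k L)" using upow_unitary[OF V, of "int (k L)"] by(simp add: upow_of_nat)
 show ?thesis unfolding upow_power[OF V, symmetric]
  by(rule upow_commute[OF _ u]) (simp add: Vpow_e e_per)
qed

lemma upow_V_f: "f L*upow V w = upow V w*f L"
 by(rule upow_commute[OF V_f[symmetric] V])

text \<open>The unitary of level \<open>L\<close> with winding number \<open>w i\<close> on the \<open>i\<close>-th orbit.\<close>

definition wu :: "nat => (nat => int) => 'b" where "wu L w = lev.ndg L 1 w 0 0"

lemma
 shows wu_mat1: "lev.ndg L (Suc 0) w = mat1 (wu L w)" and wu_mem: "wu L w:lev.alg L" and wu_unitary: "is_unitary (wu L w)"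
proof -
 show 1: "lev.ndg L (Suc 0) w = mat1 (wu L w)"
  using mat1_supp[OF lev.alg_matD(1)[OF lev.alg_mat_ndg[of "Suc 0" L w]]] by(simp add: wu_def)
 show "wu L w:lev.alg L" using lev.alg_matD(2)[OF lev.alg_mat_ndg[of "Suc 0" L w]] by(simp add: wu_def)
 show "is_unitary (wu L w)" using lev.umat_ndg[of "Suc 0" L w] unfolding 1 umat_mat1 by simp
qed

lemma wu_S: "i <= L ==> j < kp L i ==> wu L w*Sp L i j = Sp L i j*lev.ps L i (%z. z powi (if j = 0 then w i else 0))"
proof (rule lev.S_diag[OF wu_mem])
 assume i: "i <= L" and j: "j < kp L i"
 show "cont S1 (%z. z powi (if j = 0 then w i else 0))" by(intro continuous_on_power_int continuous_on_id) auto
 fix r and z :: complex assume r: "r < kp L i" and z: "z:S1"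
 have "lev.bigm L (Suc 0) (Suc 0) i z (mat1 (wu L w)) (0,r) (0,j) = dg (lev.idx L (Suc 0) i) (0,0) (z powi w i) (0,r) (0,j)"
  using lev.bigm_ndg[of "Suc 0" i L z w] i z by(simp add: wu_mat1)
 thus "lev.fib L (wu L w) i z r j = (if r = j then z powi (if j = 0 then w i else 0) else 0)"
  using r j unfolding lev.bigm_mat1 dg_def lev.idx_def by(cases "r = j"; cases "j = 0") simp_all
qed auto

lemma wu_e: "i < L ==> wu L w*e i L t = (if t mod k L = 0 then upow V (int (k L)*w i)*e i L t else e i L t)"
proof -
 assume i: "i < L"
 let ?t = "t mod k L"
 interpret C: unitary_corner "V ^ k L" "e i L 0" by(rule e_corner)
 have t: "?t < kp L i" using k_pos i by(simp add: kp_def)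
 have e: "e i L t = Sp L i ?t * star (V ^ ?t)"
  using i Vpow_unit(2)[of ?t] Vpow_e[of ?t i L 0] by(simp add: Sp_def e_mod mult.assoc)
 have "wu L w*e i L t = Sp L i ?t*(upow (V ^ k L) (if ?t = 0 then w i else 0)*e i L 0) * star (V ^ ?t)"
  using wu_S[of i L ?t w] i t C.psi_powi by(simp add: e Up_def ep_def mult.assoc[symmetric])
 also have "... = (if ?t = 0 then upow V (int (k L)*w i)*e i L t else e i L t)"
 proof (cases "?t = 0")
  case True
  thus ?thesis using i e_mod[of i L t] upow_V_e[OF i, of 0 "w i"] ee[of i L 0]
   by(simp add: Sp_def upow_power[OF V] mult.assoc[symmetric]) (simp add: mult.assoc)
 next
  case False
  thus ?thesis using i e by(simp add: Sp_def mult.assoc[of _ "e i L 0" "e i L 0"] ee)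
 qed
 finally show ?thesis .
qed

lemma wu_f: "wu L w*f L = upow V (w L)*f L"
proof -
 interpret C: unitary_corner V "f L" by(rule f_corner)
 show ?thesis using wu_S[of L L 0 w] C.psi_powi[of "w L"] upow_V_f[of L "w L"] ff[of L]
  by(simp add: kp_def Sp_def Up_def ep_def mult.assoc[symmetric]) (simp add: mult.assoc)
qed

lemma pow_absorb:
 fixes x :: "'c::monoid_mult"
 assumes "x*q = v * q" "q * v = v * q" "q*y = y"
 shows "x ^ m*y = v ^ m*y"
proof (induction m)
 case (Suc m)
 have qv: "q * v ^ m = v ^ m*q" using power_commuting_commutes[OF assms(2)[symmetric], of m] by simp
 have "x ^ Suc m*y = x*(v ^ m*y)" by(simp add: mult.assoc Suc)
 also have "... = x*(q*(v ^ m*y))" using qv assms(3) by(metis mult.assoc)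
 also have "... = v * (q*(v ^ m*y))" by(simp add: mult.assoc[symmetric] assms(1))
 also have "... = v ^ Suc m*y" using qv assms(3) by(metis mult.assoc power_Suc)
 finally show ?case .
qed simp

lemma wv_wu:
 assumes w: "i <= L"
 shows "lev.wv L (Suc 0) (mat1 (wu L w)) i = w i"
 using lev.wv_ndg[of "Suc 0" i L w] assms by(simp add: wu_mat1)

lemma wv_wu_Suc:
 assumes "i <= Suc L"
 shows "lev.wv (Suc L) (Suc 0) (mat1 (wu L w)) i = w (min i L)"
proof -
 let ?L = "Suc L" and ?x = "wu L w"
 have x: "?x:lev.alg ?L" using wu_mem alg_Suc by blast
 have pw: "int m*lev.wv ?L (Suc 0) (mat1 ?x) i = (SUM j<kp ?L i. d j)"
  if "!!j. j < kp ?L i ==> ?x ^ m*Sp ?L i j = Sp ?L i j*lev.ps ?L i (%z. z powi d j)" for m d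
 proof -
  have "is_unitary (?x ^ m)" using upow_unitary[OF wu_unitary, of L w "int m"] by(simp add: upow_of_nat)
  thus ?thesis
   using lev.wv_mat1_diag[of "?x ^ m" ?L i d, OF closed_algD(10)[OF alg_closed(1) x] _ _ that]
    lev.wv_mat1_power[OF x wu_unitary, of i m] assms by simp
 qed
 have V2: "upow V a ^ m = upow V (int m*a)" for a m
  by(induction m) (simp_all add: upow_add[OF V] distrib_right)
 show ?thesis
 proof (cases "i < ?L")
  case i: True
  interpret C: unitary_corner "V ^ k ?L" "e i ?L 0" by(rule e_corner)
  have S: "Sp ?L i j*lev.ps ?L i (%z. z powi a) = upow V (int (k ?L)*a)*Sp ?L i j" for j a
  proof -
   have "Sp ?L i j*lev.ps ?L i (%z. z powi a) = V ^ j*(e i ?L 0*upow V (int (k ?L)*a))*e i ?L 0"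
    using i C.psi_powi by(simp add: Sp_def Up_def ep_def upow_power[OF V] mult.assoc)
   also have "... = (V ^ j*upow V (int (k ?L)*a))*e i ?L 0" by(simp add: upow_V_e[OF i] mult.assoc ee)
   also have "V ^ j*upow V (int (k ?L)*a) = upow V (int (k ?L)*a)*V ^ j"
    unfolding upow_of_nat[of V j, symmetric] upow_add[OF V, symmetric] by(simp add: add.commute)
   finally show ?thesis using i by(simp add: Sp_def mult.assoc)
  qed
  have Sj: "Sp ?L i j = e i ?L j*V ^ j" for j using i by(simp add: Sp_def Vpow_e)
  show ?thesis
  proof (cases "i < L")
   case True
   define m where "m = k ?L div k L"
   have mk: "m * k L = k ?L" using k_dvd[of L] by(simp add: m_def)
   have m0: "m > 0" using mk k_pos[of ?L] by(cases m) auto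
   define d where "d j = (if j mod k L = 0 then w i else 0)" for j
   have sub: "e i L j*e i ?L j = e i ?L j" for j by(rule e_sub) simp
   have "?x ^ m*e i ?L j = upow V (int (k ?L)*d j)*e i ?L j" for j
   proof (cases "j mod k L = 0")
    case T: True
    have "?x ^ m*e i ?L j = upow V (int (k L)*w i) ^ m*e i ?L j"
     by(rule pow_absorb[where q = "e i L j"]) (use T wu_e[OF True, of w j] sub upow_V_e[OF True] in simp_all)
    thus ?thesis using T by(simp add: V2 d_def mk[symmetric] mult.assoc)
   next
    case F: False
    have "?x ^ m*e i ?L j = 1 ^ m*e i ?L j"
     by(rule pow_absorb[where q = "e i L j"]) (use F wu_e[OF True, of w j] sub in simp_all)
    thus ?thesis using F by(simp add: d_def)
   qed
   hence "?x ^ m*Sp ?L i j = Sp ?L i j*lev.ps ?L i (%z. z powi d j)" for j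
    unfolding S by(simp add: Sj mult.assoc[symmetric])
   hence "int m*lev.wv ?L (Suc 0) (mat1 ?x) i = (SUM j<kp ?L i. d j)" by(rule pw)
   also have "... = (SUM a<m. SUM j:{a * k L..<a * k L + k L}. d j)" using i by(simp add: kp_def sum.nat_group mk)
   also have "... = (SUM a<m. w i)"
   proof (rule sum.cong[OF refl])
    fix a
    have "(SUM j:{a * k L..<a * k L + k L}. d j) = (SUM j<k L. d (j + a * k L))"
     using sum.shift_bounds_nat_ivl[of d 0 "a * k L" "k L"] by(simp add: atLeast0LessThan add.commute)
    also have "... = (SUM j<k L. if j = 0 then w i else 0)" by(intro sum.cong refl) (simp add: d_def)
    also have "... = w i" using k_pos[of L] by simp
    finally show "(SUM j:{a * k L..<a * k L + k L}. d j) = w i" .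
   qed
   finally show ?thesis using m0 True by simp
  next
   case False
   hence iL: "i = L" using i by simp
   have fe: "f L*e i ?L j = e i ?L j" for j
   proof -
    have "(SUM a<L. g a L)*e i ?L j = 0"
     unfolding sum_distrib_right using g_e[of _ ?L i j] iL by(intro sum.neutral) (auto simp: g_Suc)
    thus ?thesis by(simp add: f_def left_diff_distrib)
   qed
   have "?x ^ k ?L*e i ?L j = upow V (w L) ^ k ?L*e i ?L j" for j
    by(rule pow_absorb[where q = "f L"]) (use wu_f upow_V_f fe in auto)
   hence "?x ^ k ?L*Sp ?L i j = Sp ?L i j*lev.ps ?L i (%z. z powi w L)" for j
    unfolding S by(simp add: Sj V2 mult.assoc[symmetric])
   hence "int (k ?L)*lev.wv ?L (Suc 0) (mat1 ?x) i = (SUM j<kp ?L i. w L)" by(rule pw)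
   thus ?thesis using k_pos[of ?L] iL by(simp add: kp_def)
  qed
 next
  case False
  hence i: "i = ?L" using assms by simp
  interpret C: unitary_corner V "f ?L" by(rule f_corner)
  have gf: "g L ?L*f ?L = 0" unfolding g_def sum_distrib_right by(simp add: e_f)
  have fL: "f L*f ?L = f ?L" by(simp add: f_Suc[of L] distrib_right gf ff)
  have "?x*f ?L = ?x*f L*f ?L" by(simp add: fL mult.assoc)
  also have "... = upow V (w L)*f ?L" by(simp add: wu_f mult.assoc fL)
  also have "... = f ?L*(upow V (w L)*f ?L)" by(simp add: mult.assoc[symmetric] upow_V_f) (simp add: mult.assoc ff)
  finally have "?x ^ 1*Sp ?L i j = Sp ?L i j*lev.ps ?L i (%z. z powi w L)" for j
   using i C.psi_powi by(simp add: Sp_def Up_def ep_def)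
  hence "int 1*lev.wv ?L (Suc 0) (mat1 ?x) i = (SUM j<kp ?L i. w L)" by(rule pw)
  thus ?thesis using i by(simp add: kp_def)
 qed
qed

lemma alg_mat_mono: "L <= L' ==> lev.alg_mat L n m u ==> lev.alg_mat L' n m u"
 unfolding lev.alg_mat_def using alg_mono by blast

definition wh :: "nat => nat => (nat => nat => 'b) => nat => int" where "wh L n u i = lev.wv L n u (min i L)"

lemma wh_Suc:
 assumes u: "lev.alg_mat L n n u" "umat {..<n} u"
 shows "wh (Suc L) n u = wh L n u"
proof
 fix i
 let ?L = "Suc L"
 have u': "lev.alg_mat ?L n n u" by(rule alg_mat_mono[OF _ u(1)]) simp
 show "wh ?L n u i = wh L n u i"
 proof (cases "n = 0")
  case True
  have "dsum 0 u u = u" by(simp add: dsum_def fun_eq_iff)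
  hence "lev.wv a 0 u j = 0" if "j <= a" "L <= a" for a j
   using lev.wv_dsum[of a 0 u 0 u j] u alg_mat_mono[OF that(2) u(1)] that True by simp
  thus ?thesis using True by(simp add: wh_def)
 next
  case False
  define w where "w = lev.wv L n u"
  define y where "y = dsum (Suc 0) (mat1 (wu L w)) (mone {..<n - 1})"
  have n1: "Suc 0 + (n - 1) = n" using False by simp
  have um: "umat {..<n - 1} (mone {..<n - 1} :: nat => nat => 'b)" by(simp add: umat_mone)
  have y: "lev.alg_mat L n n y" "umat {..<n} y"
   using lev.alg_mat_dsum[OF lev.alg_mat1[OF wu_mem[of L w]] lev.alg_mat_mone[of L "n - 1"]]
    umat_dsum[OF _ um, of "Suc 0" "mat1 (wu L w)"] wu_unitary unfolding n1 y_def umat_mat1 by auto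
  have w1: "lev.wv a (n - 1) (mone {..<n - 1}) j = 0" if "j <= a" for a j
   using lev.wv_mm[OF lev.alg_mat_mone[of a] um lev.alg_mat_mone um, of j] that um by(simp add: umat_def)
  have wy: "lev.wv a n y j = lev.wv a (Suc 0) (mat1 (wu L w)) j" if "j <= a" "L <= a" for a j
  proof -
   have "lev.alg_mat a (Suc 0) (Suc 0) (mat1 (wu L w))" by(rule alg_mat_mono[OF that(2) lev.alg_mat1[OF wu_mem]])
   thus ?thesis unfolding y_def
    using lev.wv_dsum[of a "Suc 0" "mat1 (wu L w)" "n - 1" "mone {..<n - 1}" j] lev.alg_mat_mone[of a] um wu_unitary that w1
    unfolding n1 umat_mat1 by simp
  qed
  obtain h where h: "!!i j. cont {0..1::real} (%t. h t i j)" "!!t. t:{0..1} ==> lev.alg_mat L n n (h t) & umat {..<n} (h t)"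
   "h 0 = u" "h 1 = y"
   using lev.wv_eq_imp_path[OF u y] wy[OF _ order_refl] wv_wu False by(auto simp: w_def)
  have "lev.wv ?L n u j = lev.wv ?L n y j" if "j <= ?L" for j
   using lev.wv_path[of h ?L n j] h alg_mat_mono[of L ?L] that by auto
  hence "wh ?L n u i = w (min (min i ?L) L)" using wy wv_wu_Suc[of "min i ?L" L w] by(simp add: wh_def)
  also have "min (min i ?L) L = min i L" by simp
  finally show ?thesis by(simp add: wh_def w_def)
 qed
qed

lemma wh_mono:
 assumes u: "lev.alg_mat L n n u" "umat {..<n} u" and "L <= L'"
 shows "wh L' n u = wh L n u"
 using assms(3)
proof (induction L' rule: dec_induct)
 case (step m)
 thus ?case using wh_Suc[OF alg_mat_mono[OF step(1) u(1)] u(2)] by simp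
qed simp

end

definition upath :: "nat => (nat => nat => 'b::banach_star) => (nat => nat => 'b) => bool" where
 "upath n = path_component {u. umat {..<n} u}"

lemma upath_iff:
 "upath n u v <-> (EX w. (ALL i j. cont {0..1::real} (%t. w t i j)) & (ALL t:{0..1}. umat {..<n} (w t)) & w 0 = u & w 1 = v)"
 unfolding upath_def path_component_def path_def path_image_def pathstart_def pathfinish_def continuous_on_mat
 by(intro ex_cong1) auto

lemma upath_trans: "upath n u v ==> upath n v w ==> upath n u w" and upath_sym: "upath n u v ==> upath n v u"
 unfolding upath_def using path_component_trans path_component_sym by blast+

lemma memb_minus_membu: "membu J a - membu J b = memb J a - memb J b"
 by(simp add: membu_def)

lemma polar_near:
 fixes u :: "'a::banach_star"
 assumes "is_unitary u" "eps > 0"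
 obtains dl where "dl > 0" "!!x. norm (x - u) < dl ==> norm (1 - star x*x) <= 1/2 & norm (1 - x * star x) <= 1/2 & norm (polar x - u) < eps"
proof -
 have t1: "((%x. 1 - star x*x) \<longlongrightarrow> 1 - star u*u) (nhds u)" and t2: "((%x. 1 - x * star x) \<longlongrightarrow> 1 - u * star u) (nhds u)"
  by(rule continuous_on_tendsto_compose[OF _ filterlim_ident, of UNIV]; auto intro!: continuous_intros)+
 have "\<forall>\<^sub>F x in nhds u. norm (1 - star x*x) < 1/2 & norm (1 - x * star x) < 1/2"
  using tendstoD[OF t1, of "1/2"] tendstoD[OF t2, of "1/2"] assms(1) by(auto simp: is_unitary_def dist_norm elim: eventually_elim2)
 then obtain dl where dl: "dl > 0" "!!x. norm (x - u) < dl ==> norm (1 - star x*x) < 1/2 & norm (1 - x * star x) < 1/2"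
  unfolding eventually_nhds_metric dist_norm by blast
 have "cont (ball u dl) polar"
  by(rule continuous_on_polar[OF continuous_on_id]) (use dl(2) in "auto simp: dist_norm norm_minus_commute less_imp_le")
 then obtain et where et: "et > 0" "!!x. x:ball u dl ==> dist x u < et ==> dist (polar x) (polar u) < eps"
  using dl(1) assms(2) unfolding continuous_on_iff by(metis centre_in_ball)
 show thesis
  by(rule that[of "min dl et"]) (use dl et polar_of_unitary[OF assms(1)] in "auto simp: dist_norm norm_minus_commute less_imp_le")
qed

lemma polar_segment:
 fixes a b :: "'i => 'i => 'b::banach_star"
 assumes J: "finite J" and S: "closed_alg S" and a: "umat J a" "!!i j. a i j:S" and b: "umat J b" "!!i j. b i j:S"
  and near: "norm (memb J a - memb J u) < dl" "norm (memb J b - memb J u) < dl"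
   "!!x. norm (x - membu J u) < dl ==> norm (1 - star x*x) <= 1/2 & norm (1 - x * star x) <= 1/2"
 shows "EX w. (ALL i j. cont {0..1::real} (%t. w t i j)) & (ALL t:{0..1}. umat J (w t) & (ALL i j. w t i j:S)) & w 0 = a & w 1 = b"
proof -
 define x where "x t = (1 - t) *R membu J a + t *R membu J b" for t :: real
 have nx: "norm (x t - membu J u) < dl" if "t:{0..1}" for t
 proof -
  have "membu J a:ball (membu J u) dl" "membu J b:ball (membu J u) dl"
   using near(1,2) by(simp_all add: dist_norm norm_minus_commute memb_minus_membu)
  hence "x t:ball (membu J u) dl" unfolding x_def by(rule convexD[OF convex_ball]) (use that in auto)
  thus ?thesis by(simp add: dist_norm norm_minus_commute)
 qed
 have cx: "cont {0..1} (%t. polar (x t))"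
  by(rule continuous_on_polar) (use near(3)[OF nx] in "auto simp: x_def intro!: continuous_intros")
 define w where "w t = ent (polar (x t)) J" for t
 have un: "is_unitary (polar (x t))" if "t:{0..1}" for t
  using near(3)[OF nx[OF that]] by(intro polar_unitary) auto
 have mem: "polar (x t):mfam_over S" if "t:{0..1}" for t
 proof (rule polar_mem[OF closed_alg_mfam_over[OF S]])
  show "x t:mfam_over S" unfolding x_def
   by(intro closed_algD(3,6)[OF closed_alg_mfam_over[OF S]] membu_mem S a b)
 qed (use near(3)[OF nx[OF that]] in auto)
 have e: "ent (polar (membu J c)) J = c" if "umat J c" for c
  using that umat_iff_membu[OF J] polar_of_unitary ent_membu[OF J] by metis
 show ?thesis
 proof (intro exI[of _ w] conjI allI ballI)
  show "cont {0..1} (%t. w t i j)" for i j unfolding w_def by(rule continuous_on_ent[OF cx])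
  show "umat J (w t)" if "t:{0..1}" for t unfolding w_def by(rule umat_ent[OF J un[OF that]])
  show "w t i j:S" if "t:{0..1}" for t i j using mem[OF that] by(simp add: w_def mfam_over_def)
  show "w 0 = a" "w 1 = b" using e a(1) b(1) by(simp_all add: w_def x_def)
 qed
qed

context odometer_system
begin

lemma alg_mat_approx:
 fixes a :: "nat => nat => 'b"
 assumes "msupp {..<n} {..<n} a" "eps > 0"
 obtains L b where "lev.alg_mat L n n b" "norm (memb {..<n} b - memb {..<n} a) < eps"
proof -
 define et where "et = eps / (1 + real n*real n)"
 have et: "et > 0" using assms(2) by(simp add: et_def add_pos_nonneg)
 have "ALL p. EX q. snd q:lev.alg (fst q) & norm (a (fst p) (snd p) - snd q) < et" using alg_dense[OF et] by fastforce
 then obtain q where q: "!!p. snd (q p):lev.alg (fst (q p))" "!!p. norm (a (fst p) (snd p) - snd (q p)) < et" by metis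
 define L where "L = Max ((%p. fst (q p)) ` ({..<n} \<times> {..<n}))"
 define b where "b i j = (if i < n & j < n then snd (q (i,j)) else 0)" for i j
 have bm: "b i j:lev.alg L" for i j
 proof (cases "i < n & j < n")
  case True
  hence "fst (q (i,j)) <= L" unfolding L_def by(intro Max_ge) auto
  thus ?thesis using True q(1)[of "(i,j)"] alg_mono by(auto simp: b_def)
 next
  case False
  hence "b i j = 0" unfolding b_def by(rule if_not_P)
  thus ?thesis by(simp add: closed_algD(8)[OF alg_closed(1)])
 qed
 have "norm (memb {..<n} b - memb {..<n} a) <= (SUM i<n. SUM j<n. norm (b i j - a i j))"
  unfolding memb_diff[symmetric] by(rule norm_memb_le)
 also have "... <= (SUM i<n. SUM j<n. et)"
 proof (intro sum_mono)
  fix i j assume "i:{..<n}" "j:{..<n}"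
  thus "norm (b i j - a i j) <= et" using q(2)[of "(i,j)"] by(simp add: b_def norm_minus_commute)
 qed
 also have "... = real n*real n*et" by simp
 also have "... < (1 + real n*real n)*et" using et by(simp add: distrib_right)
 also have "... = eps" by(simp add: et_def add_nonneg_eq_0_iff)
 finally show thesis using that[of L b] bm by(auto simp: lev.alg_mat_def msupp_def b_def)
qed

lemma unitary_approx:
 assumes u: "umat {..<n} u" and "eps > 0"
 obtains L u' where "lev.alg_mat L n n u'" "umat {..<n} u'" "norm (memb {..<n} u' - memb {..<n} u) < eps"
proof -
 let ?J = "{..<n}"
 have fJ: "finite ?J" by simp
 have U: "is_unitary (membu ?J u)" "msupp ?J ?J u" using u umat_iff_membu[OF fJ] by auto
 define C where "C = norm (memb ?J (mone ?J) :: (nat,'b) mfam) + 1"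
 have C: "C > 0" by(simp add: C_def add_nonneg_pos)
 obtain dl where dl: "dl > 0" "!!x. norm (x - membu ?J u) < dl ==>
   norm (1 - star x*x) <= 1/2 & norm (1 - x * star x) <= 1/2 & norm (polar x - membu ?J u) < eps / C"
  using polar_near[OF U(1), of "eps / C"] assms(2) C by auto
 obtain L b where b: "lev.alg_mat L n n b" "norm (memb ?J b - memb ?J u) < dl" by(rule alg_mat_approx[OF U(2) dl(1)])
 let ?x = "membu ?J b"
 have x: "norm (1 - star ?x*?x) <= 1/2" "norm (1 - ?x * star ?x) <= 1/2" "norm (polar ?x - membu ?J u) < eps / C"
  using dl(2)[of ?x] b(2) by(auto simp: memb_minus_membu)
 define u' where "u' = ent (polar ?x) ?J"
 show thesis
 proof (rule that[of L u'])
  show "umat ?J u'" unfolding u'_def by(rule umat_ent[OF fJ polar_unitary]) (use x in auto)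
  have "polar ?x:mfam_over (lev.alg L)"
   by(rule polar_mem[OF closed_alg_mfam_over[OF alg_closed(1)] membu_mem[OF alg_closed(1)]]) (use x lev.alg_matD(2)[OF b(1)] in auto)
  thus "lev.alg_mat L n n u'" using msupp_ent unfolding lev.alg_mat_def u'_def mfam_over_def by blast
  have "memb ?J u = memb ?J (mone ?J)*membu ?J u" using memb_ent[OF fJ, of "membu ?J u"] ent_membu[OF fJ U(2)] by simp
  hence "memb ?J u' - memb ?J u = memb ?J (mone ?J)*(polar ?x - membu ?J u)"
   unfolding u'_def memb_ent[OF fJ] by(simp add: right_diff_distrib)
  hence "norm (memb ?J u' - memb ?J u) <= norm (memb ?J (mone ?J) :: (nat,'b) mfam)*norm (polar ?x - membu ?J u)"
   using norm_mult_ineq by metis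
  also have "... <= C*norm (polar ?x - membu ?J u)" by(intro mult_right_mono) (auto simp: C_def)
  also have "... < eps" using x(3) C by(simp add: pos_less_divide_eq mult.commute)
  finally show "norm (memb ?J u' - memb ?J u) < eps" .
 qed
qed

definition wcl :: "nat => (nat => nat => 'b) => (nat => int) => bool" where
 "wcl n u w <-> (EX dl>0. ALL L u'. lev.alg_mat L n n u' --> umat {..<n} u' --> norm (memb {..<n} u' - memb {..<n} u) < dl --> wh L n u' = w)"

definition kone :: "nat => (nat => nat => 'b) => nat => int" where "kone n u = (THE w. wcl n u w)"

lemma wcl_unique: "umat {..<n} u ==> wcl n u w ==> wcl n u w' ==> w = w'"
proof -
 assume u: "umat {..<n} u" and "wcl n u w" "wcl n u w'"
 then obtain d d' where d: "d > 0" "!!L u'. lev.alg_mat L n n u' ==> umat {..<n} u' ==> norm (memb {..<n} u' - memb {..<n} u) < d ==> wh L n u' = w"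
  "d' > 0" "!!L u'. lev.alg_mat L n n u' ==> umat {..<n} u' ==> norm (memb {..<n} u' - memb {..<n} u) < d' ==> wh L n u' = w'"
  unfolding wcl_def by blast
 obtain L v where "lev.alg_mat L n n v" "umat {..<n} v" "norm (memb {..<n} v - memb {..<n} u) < min d d'"
  using unitary_approx[OF u, of "min d d'"] d(1,3) by auto
 thus "w = w'" using d(2,4) by force
qed

lemma near_level:
 assumes "umat {..<n} u"
 obtains dl where "dl > 0" "!!L a M b. [|lev.alg_mat L n n a; umat {..<n} a; lev.alg_mat M n n b; umat {..<n} b;
   norm (memb {..<n} a - memb {..<n} u) < dl; norm (memb {..<n} b - memb {..<n} u) < dl|] ==> wh L n a = wh M n b"
  "!!b. [|umat {..<n} b; norm (memb {..<n} b - memb {..<n} u) < dl|] ==> upath n u b"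
proof -
 let ?J = "{..<n}"
 have U: "is_unitary (membu ?J u)" using assms umat_iff_membu[of ?J u] by simp
 obtain dl where dl: "dl > 0" "!!x. norm (x - membu ?J u) < dl ==> norm (1 - star x*x) <= 1/2 & norm (1 - x * star x) <= 1/2"
  by(rule polar_near[OF U, of 1]) (simp, blast)
 show thesis
 proof (rule that[OF dl(1)])
  fix L a M b
  assume a: "lev.alg_mat L n n a" "umat ?J a" and b: "lev.alg_mat M n n b" "umat ?J b"
   and n: "norm (memb ?J a - memb ?J u) < dl" "norm (memb ?J b - memb ?J u) < dl"
  let ?L = "max L M"
  have a': "lev.alg_mat ?L n n a" and b': "lev.alg_mat ?L n n b" using alg_mat_mono[OF _ a(1)] alg_mat_mono[OF _ b(1)] by auto
  obtain w where w: "!!i j. cont {0..1::real} (%t. w t i j)" "!!t. t:{0..1} ==> umat ?J (w t) & (ALL i j. w t i j:lev.alg ?L)" "w 0 = a" "w 1 = b"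
   using polar_segment[OF finite_lessThan alg_closed(1) a(2) lev.alg_matD(2)[OF a'] b(2) lev.alg_matD(2)[OF b'] n dl(2)] by blast
  have "lev.wv ?L n (w 0) i = lev.wv ?L n (w 1) i" if "i <= ?L" for i
  proof (rule lev.wv_path[OF w(1)])
   show "lev.alg_mat ?L n n (w t) & umat ?J (w t)" if "t:{0..1}" for t
    using w(2)[OF that] umat_msupp[of ?J "w t"] by(simp add: lev.alg_mat_def)
  qed (use that in simp)
  hence "wh ?L n a = wh ?L n b" unfolding wh_def[abs_def] w(3,4) by auto
  thus "wh L n a = wh M n b" using wh_mono[OF a, of ?L] wh_mono[OF b, of ?L] by simp
 next
  fix b assume b: "umat ?J b" and n: "norm (memb ?J b - memb ?J u) < dl"
  have "norm (memb ?J u - memb ?J u) < dl" using dl(1) by simp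
  from polar_segment[OF finite_lessThan closed_alg_UNIV assms UNIV_I b UNIV_I this n dl(2)]
  show "upath n u b" unfolding upath_iff by blast
 qed
qed

lemma wcl_kone:
 assumes u: "umat {..<n} u"
 shows "wcl n u (kone n u)"
proof -
 obtain dl where dl: "dl > 0" "!!L a M b. [|lev.alg_mat L n n a; umat {..<n} a; lev.alg_mat M n n b; umat {..<n} b;
   norm (memb {..<n} a - memb {..<n} u) < dl; norm (memb {..<n} b - memb {..<n} u) < dl|] ==> wh L n a = wh M n b"
  using near_level[OF u] by metis
 obtain L v where v: "lev.alg_mat L n n v" "umat {..<n} v" "norm (memb {..<n} v - memb {..<n} u) < dl" by(rule unitary_approx[OF u dl(1)])
 have "wcl n u (wh L n v)" unfolding wcl_def using dl v by blast
 thus ?thesis unfolding kone_def using wcl_unique[OF u] by(metis theI)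
qed

lemma kone_level: "lev.alg_mat L n n u ==> umat {..<n} u ==> kone n u = wh L n u"
 using wcl_kone[of n u] unfolding wcl_def by force

lemma kone_upath:
 assumes "upath n u v"
 shows "kone n u = kone n v"
proof -
 obtain w where w: "!!i j. cont {0..1::real} (%t. w t i j)" "!!t. t:{0..1} ==> umat {..<n} (w t)" "w 0 = u" "w 1 = v"
  using assms unfolding upath_iff by blast
 have cm: "cont {0..1} (%t. memb {..<n} (w t))" by(intro continuous_on_memb w(1))
 have "kone n (w 0) = kone n (w 1)"
 proof (rule connected_local_const[of "{0..1::real}"])
  show "ALL s:{0..1}. \<forall>\<^sub>F t in at s within {0..1}. kone n (w s) = kone n (w t)"
  proof
   fix s :: real assume s: "s:{0..1}"
   obtain d where d: "d > 0" "!!L u'. lev.alg_mat L n n u' ==> umat {..<n} u' ==> norm (memb {..<n} u' - memb {..<n} (w s)) < d ==> wh L n u' = kone n (w s)"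
    using wcl_kone[OF w(2)[OF s]] unfolding wcl_def by blast
   have "\<forall>\<^sub>F t in at s within {0..1}. dist (memb {..<n} (w t)) (memb {..<n} (w s)) < d"
    by(rule tendstoD[OF bspec[OF cm[unfolded continuous_on_def] s] d(1)])
   moreover have "\<forall>\<^sub>F t in at s within {0..1}. t:{0..1}" by(simp add: eventually_at_filter)
   ultimately show "\<forall>\<^sub>F t in at s within {0..1}. kone n (w s) = kone n (w t)"
   proof eventually_elim
    case (elim t)
    have "wcl n (w t) (kone n (w s))"
     unfolding wcl_def
    proof (intro exI[of _ "d - dist (memb {..<n} (w t)) (memb {..<n} (w s))"] conjI allI impI)
     fix L a assume a: "lev.alg_mat L n n a" "umat {..<n} a"
      "norm (memb {..<n} a - memb {..<n} (w t)) < d - dist (memb {..<n} (w t)) (memb {..<n} (w s))"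
     show "wh L n a = kone n (w s)"
      by(rule d(2)[OF a(1,2)])
       (use a(3) dist_triangle[of "memb {..<n} a" "memb {..<n} (w s)" "memb {..<n} (w t)"] in "simp add: dist_norm")
    qed (use elim in simp)
    thus ?case using wcl_unique[OF w(2)[OF elim(2)] _ wcl_kone[OF w(2)[OF elim(2)]]] by blast
   qed
  qed
 qed (auto simp: connected_Icc)
 thus ?thesis by(simp add: w)
qed

lemma level_representative:
 assumes "umat {..<n} u"
 obtains L v where "lev.alg_mat L n n v" "umat {..<n} v" "upath n u v" "kone n u = wh L n v"
proof -
 obtain dl where dl: "dl > 0" "!!b. [|umat {..<n} b; norm (memb {..<n} b - memb {..<n} u) < dl|] ==> upath n u b"
  using near_level[OF assms] by metis
 obtain L v where v: "lev.alg_mat L n n v" "umat {..<n} v" "norm (memb {..<n} v - memb {..<n} u) < dl" by(rule unitary_approx[OF assms dl(1)])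
 show thesis using that[OF v(1,2)] dl(2)[OF v(2,3)] kone_upath kone_level[OF v(1,2)] by simp
qed

lemma kone_eq_imp_upath:
 assumes u: "umat {..<n} u" and v: "umat {..<n} v" and eq: "kone n u = kone n v" and "n > 0"
 shows "upath n u v"
proof -
 obtain L a where a: "lev.alg_mat L n n a" "umat {..<n} a" "upath n u a" "kone n u = wh L n a" by(rule level_representative[OF u])
 obtain M b where b: "lev.alg_mat M n n b" "umat {..<n} b" "upath n v b" "kone n v = wh M n b" by(rule level_representative[OF v])
 let ?L = "max L M"
 have a': "lev.alg_mat ?L n n a" and b': "lev.alg_mat ?L n n b" using alg_mat_mono[OF _ a(1)] alg_mat_mono[OF _ b(1)] by auto
 have "wh ?L n a = wh ?L n b" using eq a(4) b(4) wh_mono[OF a(1,2), of ?L] wh_mono[OF b(1,2), of ?L] by simp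
 have "lev.wv ?L n a i = lev.wv ?L n b i" if "i <= ?L" for i
 proof -
  have "wh ?L n a i = wh ?L n b i" by(simp only: `wh ?L n a = wh ?L n b`)
  thus ?thesis unfolding wh_def using that by(simp add: min_absorb1)
 qed
 then obtain w where "!!i j. cont {0..1::real} (%t. w t i j)" "!!t. t:{0..1} ==> lev.alg_mat ?L n n (w t) & umat {..<n} (w t)"
   "w 0 = a" "w 1 = b"
  using lev.wv_eq_imp_path[OF a' a(2) b' b(2) _ assms(4)] by auto
 hence "upath n a b" unfolding upath_iff by blast
 thus ?thesis using a(3) b(3) upath_trans upath_sym by blast
qed

lemma kone_dsum:
 assumes u: "umat {..<n} u" and v: "umat {..<m} v"
 shows "kone (n + m) (dsum n u v) i = kone n u i + kone m v i"
proof -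
 obtain L a where a: "lev.alg_mat L n n a" "umat {..<n} a" "upath n u a" "kone n u = wh L n a" by(rule level_representative[OF u])
 obtain M b where b: "lev.alg_mat M m m b" "umat {..<m} b" "upath m v b" "kone m v = wh M m b" by(rule level_representative[OF v])
 let ?L = "max L M"
 have a': "lev.alg_mat ?L n n a" and b': "lev.alg_mat ?L m m b" using alg_mat_mono[OF _ a(1)] alg_mat_mono[OF _ b(1)] by auto
 obtain w w' where w: "!!i j. cont {0..1::real} (%t. w t i j)" "!!t. t:{0..1} ==> umat {..<n} (w t)" "w 0 = u" "w 1 = a"
  and w': "!!i j. cont {0..1::real} (%t. w' t i j)" "!!t. t:{0..1} ==> umat {..<m} (w' t)" "w' 0 = v" "w' 1 = b"
  using a(3) b(3) unfolding upath_iff by blast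
 have "upath (n + m) (dsum n u v) (dsum n a b)" unfolding upath_iff
 proof (intro exI[of _ "%t. dsum n (w t) (w' t)"] conjI allI ballI)
  show "cont {0..1} (%t. dsum n (w t) (w' t) i j)" for i j
   unfolding dsum_def by(intro continuous_on_if_const w(1) w'(1) continuous_on_const)
  show "umat {..<n + m} (dsum n (w t) (w' t))" if "t:{0..1}" for t by(rule umat_dsum[OF w(2)[OF that] w'(2)[OF that]])
 qed (simp_all add: w w')
 hence "kone (n + m) (dsum n u v) i = wh ?L (n + m) (dsum n a b) i"
  using kone_upath kone_level[OF lev.alg_mat_dsum[OF a' b'] umat_dsum[OF a(2) b(2)]] by simp
 also have "wh ?L (n + m) (dsum n a b) i = wh ?L n a i + wh ?L m b i"
  unfolding wh_def using lev.wv_dsum[OF a' a(2) b' b(2), of "min i ?L"] by(simp only: atMost_iff min.cobounded2)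
 finally show ?thesis using a(4) b(4) wh_mono[OF a(1,2), of ?L] wh_mono[OF b(1,2), of ?L] by simp
qed

lemma kone_eventually_const: "umat {..<n} u ==> EX L. ALL i>=L. kone n u i = kone n u L"
proof -
 assume "umat {..<n} u"
 then obtain L v where "kone n u = wh L n v" by(rule level_representative)
 thus ?thesis by(intro exI[of _ L]) (simp add: wh_def)
qed

lemma kone_surj:
 assumes "!!i. i >= L ==> w i = w L"
 shows "EX u. umat {..<Suc 0} u & kone (Suc 0) u = w"
proof (intro exI[of _ "mat1 (wu L w)"] conjI ext)
 show u: "umat {..<Suc 0} (mat1 (wu L w))" by(simp add: umat_mat1 wu_unitary)
 show "kone (Suc 0) (mat1 (wu L w)) i = w i" for i
  unfolding kone_level[OF lev.alg_mat1[OF wu_mem] u] wh_def using wv_wu[of "min i L" L w] assms[of i] by(simp add: min_def split: if_splits)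
qed

end

lemma mm_enlarge: "msupp I K a ==> K \<subseteq> K' ==> finite K' ==> mm K' a b = mm K a b"
proof (intro ext)
 fix i j assume "msupp I K a" "K \<subseteq> K'" "finite K'"
 thus "mm K' a b i j = mm K a b i j"
  unfolding mm_def by(intro sum.mono_neutral_right) (auto simp: msupp_def)
qed

lemma msupp_mono: "msupp I J a ==> I \<subseteq> I' ==> J \<subseteq> J' ==> msupp I' J' a"
 unfolding msupp_def by blast

definition mvn :: "nat => (nat => nat => 'b::banach_star) => nat => (nat => nat => 'b) => bool" where
 "mvn n p m q <-> (EX v. msupp {..<m} {..<n} v & mm {..<m} (madj v) v = p & mm {..<n} v (madj v) = q)"

lemma mvnI: "msupp {..<m} {..<n} v ==> mm {..<m} (madj v) v = p ==> mm {..<n} v (madj v) = q ==> mvn n p m q"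
 unfolding mvn_def by blast

lemma mvn_sym: "mvn n p m q ==> mvn m q n p"
proof -
 assume "mvn n p m q"
 then obtain v where "msupp {..<m} {..<n} v" "mm {..<m} (madj v) v = p" "mm {..<n} v (madj v) = q" unfolding mvn_def by blast
 thus ?thesis by(intro mvnI[of _ _ "madj v"]) (simp_all add: msupp_madj)
qed

lemma mvn_nice:
 assumes p: "pmat {..<n} p" and q: "pmat {..<m} q" and "mvn n p m q"
 obtains v where "msupp {..<m} {..<n} v" "mm {..<m} (madj v) v = p" "mm {..<n} v (madj v) = q"
  "mm {..<n} v p = v" "mm {..<m} q v = v"
proof -
 obtain v where v: "msupp {..<m} {..<n} v" "mm {..<m} (madj v) v = p" "mm {..<n} v (madj v) = q"
  using assms(3) unfolding mvn_def by blast
 have pp: "mm {..<n} p p = p" "madj p = p" "msupp {..<n} {..<n} p" "mm {..<m} q q = q" using p q by(auto simp: pmat_def)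
 define w where "w = mm {..<n} v p"
 have wp: "mm {..<n} w p = w" by(simp add: w_def mm_assoc pp)
 have qw: "mm {..<m} q w = w"
 proof -
  have "mm {..<m} q w = mm {..<n} v (mm {..<n} (mm {..<m} (madj v) v) p)" unfolding w_def v(3)[symmetric] by(simp add: mm_assoc)
  thus ?thesis by(simp add: v(2) pp w_def)
 qed
 have 1: "mm {..<m} (madj w) w = p"
 proof -
  have "mm {..<m} (madj w) w = mm {..<n} p (mm {..<n} (mm {..<m} (madj v) v) p)" unfolding w_def by(simp add: madj_mm mm_assoc pp)
  thus ?thesis by(simp add: v(2) pp)
 qed
 have 2: "mm {..<n} w (madj w) = q"
 proof -
  have "mm {..<n} w (madj w) = mm {..<n} w (mm {..<n} p (madj v))" by(simp add: w_def madj_mm pp)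
  also have "... = mm {..<n} w (madj v)" using wp by(simp add: mm_assoc[symmetric])
  also have "... = mm {..<n} v (mm {..<n} (mm {..<m} (madj v) v) (madj v))" by(simp add: w_def v(2) mm_assoc)
  also have "... = mm {..<m} (mm {..<n} v (madj v)) (mm {..<n} v (madj v))" by(simp only: mm_assoc)
  finally show ?thesis by(simp add: v(3) pp)
 qed
 show thesis by(rule that[OF _ 1 2 wp qw]) (simp add: w_def msupp_mm[OF v(1) pp(3)])
qed

lemma mvn_trans:
 assumes p: "pmat {..<n} p" and q: "pmat {..<m} q" and r: "pmat {..<l} r" and pq: "mvn n p m q" and qr: "mvn m q l r"
 shows "mvn n p l r"
proof -
 obtain v where v: "msupp {..<m} {..<n} v" "mm {..<m} (madj v) v = p" "mm {..<n} v (madj v) = q" "mm {..<n} v p = v" "mm {..<m} q v = v"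
  by(rule mvn_nice[OF p q pq])
 obtain w where w: "msupp {..<l} {..<m} w" "mm {..<l} (madj w) w = q" "mm {..<m} w (madj w) = r" "mm {..<m} w q = w" "mm {..<l} r w = w"
  by(rule mvn_nice[OF q r qr])
 show ?thesis
 proof (rule mvnI)
  show "msupp {..<l} {..<n} (mm {..<m} w v)" by(rule msupp_mm[OF w(1) v(1)])
  have "mm {..<l} (madj (mm {..<m} w v)) (mm {..<m} w v) = mm {..<m} (madj v) (mm {..<m} (mm {..<l} (madj w) w) v)" by(simp add: madj_mm mm_assoc)
  thus "mm {..<l} (madj (mm {..<m} w v)) (mm {..<m} w v) = p" by(simp add: w v)
  have "mm {..<n} (mm {..<m} w v) (madj (mm {..<m} w v)) = mm {..<m} (mm {..<m} w (mm {..<n} v (madj v))) (madj w)" by(simp add: madj_mm mm_assoc)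
  thus "mm {..<n} (mm {..<m} w v) (madj (mm {..<m} w v)) = r" by(simp add: w v)
 qed
qed

lemma mvn_dsum:
 assumes "mvn n p n p'" "mvn m q m q'"
 shows "mvn (n + m) (dsum n p q) (n + m) (dsum n p' q')"
proof -
 obtain v where v: "msupp {..<n} {..<n} v" "mm {..<n} (madj v) v = p" "mm {..<n} v (madj v) = p'" using assms(1) unfolding mvn_def by blast
 obtain w where w: "msupp {..<m} {..<m} w" "mm {..<m} (madj w) w = q" "mm {..<m} w (madj w) = q'" using assms(2) unfolding mvn_def by blast
 show ?thesis
  by(rule mvnI[OF msupp_dsum[OF v(1) w(1)]]) (simp_all add: madj_dsum mm_dsum v w msupp_madj)
qed

context circle_matrix_sum
begin

lemma tr_mat1_diag:
 assumes "x:alg" "k:Os" "!!j. j < kap k ==> x*S k j = (if P j then S k j else 0)"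
 shows "tr (Suc 0) (mat1 x) k = of_nat (card {j. j < kap k & P j})"
proof -
 have f: "fib x k 1 j j = (if P j then 1 else 0)" if j: "j < kap k" for j
 proof -
  interpret C: unitary_corner "U k" "e k" by(rule corner[OF assms(2)])
  have "x*S k j = S k j*ps k (%_. if P j then 1 else 0)" using assms(3)[OF j] S_e[OF assms(2) j] by(simp add: C.psi_one C.psi_zero)
  from fib_diag[OF assms(2) j j one_circle continuous_on_const this] show ?thesis by simp
 qed
 have "tr (Suc 0) (mat1 x) k = (SUM q:idx (Suc 0) k. fib x k 1 (snd q) (snd q))" by(simp add: tr_def bigm_mat1)
 also have "... = (SUM j<kap k. fib x k 1 j j)" unfolding idx_def by(rule sum.reindex_bij_witness[of _ "%j. (0,j)" snd]) auto
 also have "... = (SUM j<kap k. if P j then 1 else 0)" by(intro sum.cong refl) (simp add: f)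
 also have "... = of_nat (card {j. j < kap k & P j})" by(simp add: sum.If_cases lessThan_def Int_def conj_commute)
 finally show ?thesis .
qed

definition nrk :: "nat => (nat => nat => 'b) => nat => nat" where
 "nrk n p k = nat \<lfloor>Re (tr n p k)\<rfloor>"

lemma of_nat_nrk: "alg_mat n n p ==> pmat {..<n} p ==> k:Os ==> of_nat (nrk n p k) = tr n p k"
 using bigm_frame[of n p k] by(auto simp: nrk_def)

end

lemma card_multiples: "d > 0 ==> card {j. j < m*d & j mod d = 0} = m" for d m :: nat
proof -
 assume d: "d > 0"
 have "{j. j < m*d & j mod d = 0} = (%a. a*d) ` {..<m}"
 proof (intro Set.set_eqI iffI)
  fix j assume "j:{j. j < m*d & j mod d = 0}"
  hence "j = j div d*d" "j div d < m" using d by(auto simp: less_mult_imp_div_less)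
  thus "j:(%a. a*d) ` {..<m}" by blast
 qed (use d in auto)
 moreover have "inj_on (%a. a*d) {..<m}" using d by(auto simp: inj_on_def)
 ultimately show ?thesis by(simp add: card_image)
qed

context odometer_system
begin

primrec stdp :: "nat => nat list => nat => nat => 'b" where
 "stdp L [] = (%i j. 0)"
| "stdp L (i # is) = dsum (Suc 0) (mat1 (ep L i)) (stdp L is)"

lemma ep_mem: "ep L i:lev.alg L" and ep_proj: "is_proj (ep L i)"
 using e_mem f_mem e_proj by(auto simp: ep_def is_proj_def ff star_f)

lemma stdp: "lev.alg_mat L (length is) (length is) (stdp L is) & pmat {..<length is} (stdp L is)"
proof (induction "is")
 case Nil
 show ?case using closed_algD(8)[OF alg_closed(1)] by(simp add: lev.alg_mat_def pmat_def msupp_def mm_def madj_def fun_eq_iff)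
next
 case (Cons i "is")
 have "pmat {..<Suc 0} (mat1 (ep L i))" using ep_proj by(simp add: pmat_def is_proj_def mm_mat1 madj_mat1 msupp_mat1)
 from lev.alg_mat_dsum[OF lev.alg_mat1[OF ep_mem] conjunct1[OF Cons]] pmat_dsum[OF this conjunct2[OF Cons]]
 show ?case by simp
qed

lemma ep_S: "i <= L ==> l <= L ==> j < kp L l ==> ep L i*Sp L l j = (if i = l & j = 0 then Sp L l j else 0)"
proof -
 assume il: "i <= L" "l <= L" "j < kp L l"
 have ep: "ep L i*ep L i = ep L i" "star (ep L i) = ep L i" using ep_proj by(auto simp: is_proj_def)
 have ks: "(0::nat) < kp L i" using k_pos by(simp add: kp_def)
 have S0: "Sp L i 0 = ep L i" by(simp add: Sp_def ep_def)
 have "star (Sp L i 0)*Sp L l j = (if i = l & 0 = j then ep L i else 0)" by(rule lev.S_orth) (use il ks in auto)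
 thus ?thesis using S0 ep by auto
qed

lemma tr_ep: "i <= L ==> l <= L ==> lev.tr L (Suc 0) (mat1 (ep L i)) l = (if i = l then 1 else 0)"
proof -
 assume il: "i <= L" "l <= L"
 have "lev.tr L (Suc 0) (mat1 (ep L i)) l = of_nat (card {j. j < kp L l & (i = l & j = 0)})"
  by(rule lev.tr_mat1_diag[OF ep_mem]) (use il ep_S in auto)
 also have "{j. j < kp L l & (i = l & j = 0)} = (if i = l then {0} else {})" using k_pos by(auto simp: kp_def)
 finally show ?thesis by(cases "i = l") simp_all
qed

lemma tr_ep_Suc:
 assumes "i <= L" "l <= Suc L"
 shows "lev.tr (Suc L) (Suc 0) (mat1 (ep L i)) l =
  of_nat (if i < L then if l = i then k (Suc L) div k L else 0 else if l = L then k (Suc L) else if l = Suc L then 1 else 0)"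
proof -
 let ?L = "Suc L"
 have mem: "ep L i:lev.alg ?L" using ep_mem alg_Suc by blast
 have l: "l:{..?L}" using assms by simp
 have mk: "k ?L div k L * k L = k ?L" using k_dvd[of L] by simp
 show ?thesis
 proof (cases "i < L")
  case i: True
  have "lev.tr ?L (Suc 0) (mat1 (ep L i)) l = of_nat (card {j. j < kp ?L l & (l = i & j mod k L = 0)})"
  proof (rule lev.tr_mat1_diag[OF mem l])
   fix j assume j: "j < kp ?L l"
   show "ep L i*Sp ?L l j = (if l = i & j mod k L = 0 then Sp ?L l j else 0)"
   proof (cases "l < ?L")
    case True
    have sub: "e l L j*e l ?L j = e l ?L j" by(rule e_sub) simp
    have "ep L i*Sp ?L l j = e i L 0*(e l L j*e l ?L j)*V ^ j" using True i by(simp add: ep_def Sp_def Vpow_e sub mult.assoc)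
    also have "... = e i L 0*e l L j*(e l ?L j*V ^ j)" by(simp add: mult.assoc)
    also have "... = (if l = i & j mod k L = 0 then e l L j*(e l ?L j*V ^ j) else 0)"
     using e_mod[of l L j] by(auto simp: e_mult)
    also have "e l L j*(e l ?L j*V ^ j) = Sp ?L l j" using True by(simp add: mult.assoc[symmetric] sub Sp_def Vpow_e)
    finally show ?thesis .
   next
    case False
    have "e i L 0*f ?L = 0"
     unfolding e_refine[of i L 0] sum_distrib_right using i by(simp add: e_f)
    thus ?thesis using False i by(simp add: ep_def Sp_def)
   qed
  qed
  moreover have "{j. j < kp ?L l & (l = i & j mod k L = 0)} = (if l = i then {j. j < k ?L div k L * k L & j mod k L = 0} else {})"
   using i mk by(auto simp: kp_def)
  ultimately show ?thesis using i card_multiples[OF k_pos[of L]] by simp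
 next
  case False
  hence i: "i = L" using assms by simp
  have "lev.tr ?L (Suc 0) (mat1 (ep L i)) l = of_nat (card {j. j < kp ?L l & L <= l})"
  proof (rule lev.tr_mat1_diag[OF mem l])
   fix j assume j: "j < kp ?L l"
   have ge: "(SUM a<L. g a L)*e l ?L j = (if l < L then e l ?L j else 0)"
    unfolding sum_distrib_right using g_e[of _ ?L l j] by(simp add: g_Suc)
   have gf: "g L ?L*f ?L = 0" unfolding g_def sum_distrib_right by(simp add: e_f)
   have fL: "f L*f ?L = f ?L" by(simp add: f_Suc[of L] distrib_right gf ff)
   show "ep L i*Sp ?L l j = (if L <= l then Sp ?L l j else 0)"
   proof (cases "l < ?L")
    case True
    have "f L*e l ?L j = (if L <= l then e l ?L j else 0)" by(subst f_def) (simp add: left_diff_distrib ge)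
    thus ?thesis using True i by(simp add: ep_def Sp_def Vpow_e mult.assoc[symmetric])
   next
    case F: False
    thus ?thesis using i assms fL by(simp add: ep_def Sp_def)
   qed
  qed
  moreover have "{j. j < kp ?L l & L <= l} = (if L <= l then {..<kp ?L l} else {})" by auto
  ultimately show ?thesis using i assms by(auto simp: kp_def)
 qed
qed

lemma tr_stdp: "l <= M ==> lev.tr M (length is) (stdp L is) l = (\<Sum>i\<leftarrow>is. lev.tr M (Suc 0) (mat1 (ep L i)) l)"
proof (induction "is")
 case Nil
 show ?case by(simp add: lev.tr_def lev.idx_def)
next
 case (Cons i "is")
 thus ?case using lev.tr_dsum[of l M "Suc 0" "length is" "mat1 (ep L i)" "stdp L is"] by simp
qed

definition os :: "nat => (nat => nat) => nat list" where "os L c = concat (map (%i. replicate (c i) i) [0..<Suc L])"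

lemma sum_os: "(\<Sum>i\<leftarrow>os L c. h i) = (SUM i<=L. of_nat (c i)*(h i :: complex))"
proof -
 have "(\<Sum>i\<leftarrow>concat (map (%i. replicate (c i) i) [0..<N]). h i) = (SUM i<N. of_nat (c i)*h i)" for N
  by(induction N) (simp_all add: sum_list_replicate)
 thus ?thesis unfolding os_def by(simp only: lessThan_Suc_atMost)
qed

lemma tr_os: "l <= L ==> lev.tr L (length (os L c)) (stdp L (os L c)) l = of_nat (c l)"
proof -
 assume l: "l <= L"
 have "lev.tr L (length (os L c)) (stdp L (os L c)) l = (SUM i<=L. of_nat (c i)*lev.tr L (Suc 0) (mat1 (ep L i)) l)"
  by(simp add: tr_stdp[OF l] sum_os)
 also have "... = (SUM i<=L. if i = l then of_nat (c l) else 0)" by(rule sum.cong[OF refl]) (use l in "simp add: tr_ep")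
 finally show ?thesis using l by simp
qed

lemma nrk_os: "l <= L ==> lev.nrk L (length (os L c)) (stdp L (os L c)) l = c l"
 by(simp add: lev.nrk_def tr_os)

text \<open>Normalised so that passing from level \<open>L\<close> to level \<open>Suc L\<close>, where the matrix size of each orbit is
 multiplied by \<open>k (Suc L) / k L\<close>, does not change the value.\<close>

definition rk :: "nat => nat => (nat => nat => 'b) => nat => rat" where
 "rk L n p i = of_nat (lev.nrk L n p (min i L)) / of_nat (kp L i)"

lemma rk_Suc:
 assumes p: "lev.alg_mat L n n p" "pmat {..<n} p"
 shows "rk (Suc L) n p = rk L n p"
proof
 fix i
 let ?L = "Suc L" and ?c = "lev.nrk L n p"
 let ?o = "os L ?c"
 note s = stdp[of L ?o]
 have p': "lev.alg_mat ?L n n p" by(rule alg_mat_mono[OF _ p(1)]) simp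
 have tr: "lev.tr L n p l = lev.tr L (length ?o) (stdp L ?o) l" if "l:{..L}" for l
  using lev.of_nat_nrk[OF p that] tr_os that by simp
 obtain v where v: "lev.alg_mat L (length ?o) n v" "mm {..<length ?o} (madj v) v = p" "mm {..<n} v (madj v) = stdp L ?o"
  using lev.tr_eq_imp_mvn[OF p conjunct1[OF s] conjunct2[OF s] tr] by blast
 have v': "lev.alg_mat ?L (length ?o) n v" by(rule alg_mat_mono[OF _ v(1)]) simp
 have t: "complex_of_nat (lev.nrk ?L n p l) = (SUM i<=L. of_nat (?c i) *
   of_nat (if i < L then if l = i then k ?L div k L else 0 else if l = L then k ?L else if l = ?L then 1 else 0))" if "l <= ?L" for l
 proof -
  have "complex_of_nat (lev.nrk ?L n p l) = lev.tr ?L n p l" by(rule lev.of_nat_nrk[OF p' p(2)]) (use that in simp)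
  also have "... = lev.tr ?L (length ?o) (stdp L ?o) l"
   using lev.tr_commute[OF lev.alg_mat_madj[OF v'] v', of l] v that by simp
  also have "... = (SUM i<=L. of_nat (?c i)*lev.tr ?L (Suc 0) (mat1 (ep L i)) l)" unfolding tr_stdp[OF that] sum_os ..
  also have "... = (SUM i<=L. of_nat (?c i) *
   of_nat (if i < L then if l = i then k ?L div k L else 0 else if l = L then k ?L else if l = ?L then 1 else 0))"
   by(intro sum.cong refl arg_cong[where f = "%x. _*x"] tr_ep_Suc that) simp
  finally show ?thesis .
 qed
 have at: "{..L} = insert L {..<L}" by auto
 have t': "complex_of_nat (lev.nrk ?L n p l) = of_nat (if l < L then ?c l*(k ?L div k L) else if l = L then ?c L * k ?L else ?c L)" if l: "l <= ?L" for l
 proof -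
  have "(SUM i<L. complex_of_nat (?c i) * of_nat (if i < L then if l = i then k ?L div k L else 0 else if l = L then k ?L else if l = ?L then 1 else 0))
   = (SUM i<L. if i = l then of_nat (?c l) * of_nat (k ?L div k L) else 0)"
   by(intro sum.cong refl) auto
  also have "... = (if l < L then of_nat (?c l*(k ?L div k L)) else 0)" by simp
  finally show ?thesis unfolding t[OF l] at using l by(cases "l < L"; cases "l = L") simp_all
 qed
 have mk: "rat_of_nat (k ?L) = of_nat (k ?L div k L) * of_nat (k L)" using k_dvd[of L] by(simp flip: of_nat_mult)
 have nz: "rat_of_nat (k L) ~= 0" "rat_of_nat (k ?L) ~= 0" using k_pos by(metis of_nat_0_eq_iff less_irrefl)+
 hence "rat_of_nat (k ?L div k L) ~= 0" using mk by auto
 thus "rk ?L n p i = rk L n p i"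
  using t'[of "min i ?L"] nz mk unfolding rk_def of_nat_eq_iff
  by(cases "i < L"; cases "i = L") (simp_all add: kp_def min_def)
qed

lemma rk_mono:
 assumes p: "lev.alg_mat L n n p" "pmat {..<n} p" and "L <= L'"
 shows "rk L' n p = rk L n p"
 using assms(3)
proof (induction L' rule: dec_induct)
 case (step m)
 thus ?case using rk_Suc[OF alg_mat_mono[OF step(1) p(1)] p(2)] by simp
qed simp

lemma rk_eq_imp_mvn:
 assumes p: "lev.alg_mat L n n p" "pmat {..<n} p" and q: "lev.alg_mat L m m q" "pmat {..<m} q" and eq: "rk L n p = rk L m q"
 shows "mvn n p m q"
proof -
 have tr: "lev.tr L n p l = lev.tr L m q l" if l: "l:{..L}" for l
 proof -
  have "rk L n p l = rk L m q l" by(simp only: eq)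
  hence "lev.nrk L n p l = lev.nrk L m q l" using l k_pos[of L] by(auto simp: rk_def kp_def min_absorb1 split: if_splits)
  thus ?thesis using lev.of_nat_nrk[OF p l] lev.of_nat_nrk[OF q l] by simp
 qed
 obtain v where "lev.alg_mat L m n v" "mm {..<m} (madj v) v = p" "mm {..<n} v (madj v) = q"
  using lev.tr_eq_imp_mvn[OF p q tr] by blast
 thus ?thesis by(intro mvnI lev.alg_matD(1))
qed

end

lemma proj_round_near:
 fixes P :: "'a::banach_star"
 assumes P: "is_proj P"
 obtains dl where "dl > 0" "!!x. star x = x ==> norm (x - P) < dl ==> norm (4 *R (x - x*x)) < 1 &
  norm (P - star (proj_round x*P)*(proj_round x*P)) < 1 & norm (proj_round x - (proj_round x*P) * star (proj_round x*P)) < 1"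
proof -
 have pp: "P*P = P" "star P = P" using P by(auto simp: is_proj_def)
 have "((%x. 4 *R (x - x*x)) \<longlongrightarrow> 4 *R (P - P*P)) (nhds P)"
  by(rule continuous_on_tendsto_compose[OF _ filterlim_ident, of UNIV]) (auto intro!: continuous_intros)
 from tendstoD[OF this, of "1/2"] obtain d where d: "d > 0" "!!x. norm (x - P) < d ==> norm (4 *R (x - x*x)) < 1/2"
  unfolding eventually_nhds_metric by(auto simp: dist_norm pp)
 have B: "norm (4 *R (x - x*x)) <= 1/2" if "x:ball P d" for x
  using d(2)[of x] that by(simp add: dist_norm norm_minus_commute)
 have c: "cont (ball P d) proj_round" unfolding proj_round_def
  by(intro continuous_intros B)
 have c1: "cont (ball P d) (%x. P - star (proj_round x*P)*(proj_round x*P))"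
  and c2: "cont (ball P d) (%x. proj_round x - (proj_round x*P) * star (proj_round x*P))"
  by(intro continuous_intros c)+
 have P0: "P:ball P d" using d(1) by simp
 obtain d1 where d1: "d1 > 0" "!!x. x:ball P d ==> dist x P < d1 ==> norm (P - star (proj_round x*P)*(proj_round x*P)) < 1"
  using c1[unfolded continuous_on_iff, rule_format, OF P0, of 1] proj_round_self[OF P] pp by auto
 obtain d2 where d2: "d2 > 0" "!!x. x:ball P d ==> dist x P < d2 ==> norm (proj_round x - (proj_round x*P) * star (proj_round x*P)) < 1"
  using c2[unfolded continuous_on_iff, rule_format, OF P0, of 1] proj_round_self[OF P] pp by auto
 show thesis
 proof (rule that[of "min d (min d1 d2)"])
  fix x assume "star x = x" and "norm (x - P) < min d (min d1 d2)"
  hence "x:ball P d" "dist x P < d1" "dist x P < d2" by(auto simp: dist_norm norm_minus_commute)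
  thus "norm (4 *R (x - x*x)) < 1 & norm (P - star (proj_round x*P)*(proj_round x*P)) < 1 &
    norm (proj_round x - (proj_round x*P) * star (proj_round x*P)) < 1"
   using B[of x] d1(2) d2(2) by(intro conjI) (linarith | blast)+
 qed (use d d1 d2 in simp)
qed

lemma mvn_ent: "mvn n (ent (star u*u) {..<n}) n (ent (u * star u) {..<n})"
 by(rule mvnI[of _ _ "ent u {..<n}"]) (simp_all add: msupp_ent madj_ent[symmetric] mm_ent[symmetric])

lemma pmat_enlarge: "pmat {..<n} p ==> n <= N ==> pmat {..<N} p" for n N :: nat
proof -
 assume p: "pmat {..<n} p" and "n <= N"
 hence s: "msupp {..<n} {..<n} p" and sub: "{..<n} \<subseteq> {..<N}" by(simp_all add: pmat_def)
 show ?thesis using p mm_enlarge[OF s sub, of p] msupp_mono[OF s sub sub] by(simp add: pmat_def)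
qed

context odometer_system
begin

lemma proj_representative:
 assumes p: "pmat {..<n} p"
 obtains L q where "lev.alg_mat L n n q" "pmat {..<n} q" "mvn n p n q"
proof -
 let ?J = "{..<n}"
 have fJ: "finite ?J" by simp
 have P: "is_proj (memb ?J p)" "msupp ?J ?J p" using p pmat_iff_memb[OF fJ] by auto
 let ?P = "memb ?J p"
 obtain dl where dl: "dl > 0" "!!x. star x = x ==> norm (x - ?P) < dl ==> norm (4 *R (x - x*x)) < 1 &
  norm (?P - star (proj_round x*?P)*(proj_round x*?P)) < 1 & norm (proj_round x - (proj_round x*?P) * star (proj_round x*?P)) < 1"
  using proj_round_near[OF P(1)] by blast
 obtain L b where b: "lev.alg_mat L n n b" "norm (memb ?J b - ?P) < dl" by(rule alg_mat_approx[OF P(2) dl(1)])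
 define x where "x = (1/2) *R (memb ?J b + star (memb ?J b))"
 have cl: "closed_alg (mfam_over (lev.alg L) :: (nat,'b) mfam set)" by(rule closed_alg_mfam_over[OF alg_closed(1)])
 have bm: "memb ?J b:mfam_over (lev.alg L)" by(rule memb_mem[OF alg_closed(1)]) (rule lev.alg_matD(2)[OF b(1)])
 have xm: "x:mfam_over (lev.alg L)" unfolding x_def by(intro closed_algD(3,5,6)[OF cl] bm)
 have sx: "star x = x" by(simp add: x_def star_scaleR star_add add.commute)
 have "x - ?P = (1/2) *R (memb ?J b - ?P) + (1/2) *R star (memb ?J b - ?P)"
  using P(1) by(simp add: x_def is_proj_def star_diff algebra_simps flip: scaleR_left_distrib)
 hence "norm (x - ?P) <= (1/2)*norm (memb ?J b - ?P) + (1/2)*norm (star (memb ?J b - ?P))"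
  by(metis norm_triangle_ineq norm_scaleR abs_of_nonneg zero_le_divide_1_iff zero_le_numeral)
 hence "norm (x - ?P) < dl" using b(2) by(simp add: norm_star)
 note d = dl(2)[OF sx this]
 let ?Q = "proj_round x"
 have Q: "is_proj ?Q" "?Q:mfam_over (lev.alg L)" using proj_round[OF sx] d cl xm by auto
 have qp: "?Q*(?Q*?P) = ?Q*?P" "?Q*?P*?P = ?Q*?P"
  using Q(1) P(1) by(auto simp: is_proj_def mult.assoc[symmetric]) (simp add: mult.assoc)
 obtain u where u: "star u*u = ?P" "u * star u = ?Q"
  using murray_von_neumann_perturbation[OF Q(1) P(1) qp, of UNIV] d closed_alg_UNIV by auto
 define q where "q = ent ?Q ?J"
 show thesis
 proof (rule that[of L q])
  show "lev.alg_mat L n n q" using Q(2) msupp_ent unfolding lev.alg_mat_def q_def mfam_over_def by blast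
  show "pmat ?J q" unfolding q_def by(rule pmat_ent[OF Q(1)])
  show "mvn n p n q" using mvn_ent[of n u] ent_memb'[OF fJ P(2)] by(simp add: u q_def)
 qed
qed

lemma mvn_imp_rk_eq:
 assumes p: "lev.alg_mat L n n p" "pmat {..<n} p" and q: "lev.alg_mat L m m q" "pmat {..<m} q" and pq: "mvn n p m q"
 shows "rk L n p = rk L m q"
proof -
 obtain v where v: "msupp {..<m} {..<n} v" "mm {..<m} (madj v) v = p" "mm {..<n} v (madj v) = q" "mm {..<n} v p = v" "mm {..<m} q v = v"
  by(rule mvn_nice[OF p(2) q(2) pq])
 let ?N = "n + m"
 let ?J = "{..<?N}"
 have fJ: "finite ?J" and sub: "{..<n} \<subseteq> ?J" "{..<m} \<subseteq> ?J" by auto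
 define X P Q where "X = memb ?J v" and "P = memb ?J p" and "Q = memb ?J q"
 have sp: "msupp {..<n} {..<n} p" "msupp {..<m} {..<m} q" using p(2) q(2) by(auto simp: pmat_def)
 have PQ: "is_proj P" "is_proj Q"
  using pmat_enlarge[OF p(2), of ?N] pmat_enlarge[OF q(2), of ?N] pmat_iff_memb[OF fJ] by(auto simp: P_def Q_def)
 have X: "star X*X = P" "X * star X = Q" "X*P = X" "Q*X = X"
  unfolding X_def P_def Q_def memb_star[symmetric] memb_mult[symmetric]
  by(simp_all add: mm_enlarge[OF v(1) sub(1) fJ] mm_enlarge[OF msupp_madj[OF v(1)] sub(2) fJ] mm_enlarge[OF sp(2) sub(2) fJ] v)
 have QXP: "Q*X*P = X" by(simp add: X)
 have t: "((%a. P - star (Q*a*P)*(Q*a*P)) \<longlongrightarrow> P - star (Q*X*P)*(Q*X*P)) (nhds X)"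
  "((%a. Q - (Q*a*P) * star (Q*a*P)) \<longlongrightarrow> Q - (Q*X*P) * star (Q*X*P)) (nhds X)"
  by(rule continuous_on_tendsto_compose[OF _ filterlim_ident, of UNIV]; auto intro!: continuous_intros)+
 have "\<forall>\<^sub>F a in nhds X. norm (P - star (Q*a*P)*(Q*a*P)) < 1 & norm (Q - (Q*a*P) * star (Q*a*P)) < 1"
  using tendstoD[OF t(1), of 1] tendstoD[OF t(2), of 1] unfolding QXP X
  by(auto simp: dist_norm elim: eventually_elim2)
 then obtain dl where dl: "dl > 0" "!!a. norm (a - X) < dl ==> norm (P - star (Q*a*P)*(Q*a*P)) < 1 & norm (Q - (Q*a*P) * star (Q*a*P)) < 1"
  unfolding eventually_nhds_metric dist_norm by blast
 have sv: "msupp ?J ?J v" by(rule msupp_mono[OF v(1) sub(2,1)])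
 obtain M b where b: "lev.alg_mat M ?N ?N b" "norm (memb ?J b - memb ?J v) < dl" by(rule alg_mat_approx[OF sv dl(1)])
 define K where "K = max L M"
 have p': "lev.alg_mat K n n p" and q': "lev.alg_mat K m m q" and b': "lev.alg_mat K ?N ?N b"
  using alg_mat_mono[OF _ p(1)] alg_mat_mono[OF _ q(1)] alg_mat_mono[OF _ b(1)] by(auto simp: K_def)
 have cl: "closed_alg (mfam_over (lev.alg K) :: (nat,'b) mfam set)" by(rule closed_alg_mfam_over[OF alg_closed(1)])
 have mem: "P:mfam_over (lev.alg K)" "Q:mfam_over (lev.alg K)" "memb ?J b:mfam_over (lev.alg K)"
  unfolding P_def Q_def using lev.alg_matD(2)[OF p'] lev.alg_matD(2)[OF q'] lev.alg_matD(2)[OF b'] by(auto intro!: memb_mem alg_closed(1))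
 let ?y = "Q*memb ?J b*P"
 have y: "Q*?y = ?y" "?y*P = ?y" "?y:mfam_over (lev.alg K)"
  using PQ closed_algD(4)[OF cl] mem by(simp_all add: is_proj_def mult.assoc) (simp add: is_proj_def mult.assoc[symmetric])
 obtain u where u: "u:mfam_over (lev.alg K)" "star u*u = P" "u * star u = Q" "Q*u = u" "u*P = u"
  using murray_von_neumann_perturbation[OF PQ(2,1) y(1,2) _ _ cl y(3) mem(1)] dl(2)[of "memb ?J b"] b(2) unfolding X_def by blast
 define w where "w = ent u ?J"
 have eP: "ent P ?J = p" "ent Q ?J = q" unfolding P_def Q_def
  using ent_memb'[OF fJ] msupp_mono[OF sp(1) sub(1) sub(1)] msupp_mono[OF sp(2) sub(2) sub(2)] by auto
 have w: "mm ?J (madj w) w = p" "mm ?J w (madj w) = q" "mm ?J q w = w" "mm ?J w p = w"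
  unfolding w_def eP[symmetric] by(simp_all add: madj_ent[symmetric] mm_ent[symmetric] u)
 have sw: "msupp {..<m} {..<n} w"
  unfolding msupp_def
 proof (intro allI impI)
  fix i j assume "~ (i:{..<m} & j:{..<n})"
  then consider "i ~: {..<m}" | "j ~: {..<n}" by blast
  thus "w i j = 0"
  proof cases
   case 1
   hence "mm ?J q w i j = 0" using sp(2) by(simp add: mm_def msupp_def)
   thus ?thesis by(simp add: w)
  next
   case 2
   hence "mm ?J w p i j = 0" using sp(1) by(simp add: mm_def msupp_def)
   thus ?thesis by(simp add: w)
  qed
 qed
 have wm: "lev.alg_mat K m n w" using sw u(1) unfolding lev.alg_mat_def w_def mfam_over_def by blast
 have ww: "mm {..<m} (madj w) w = p" "mm {..<n} w (madj w) = q"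
  using w(1,2) mm_enlarge[OF sw sub(1) fJ, of "madj w"] mm_enlarge[OF msupp_madj[OF sw] sub(2) fJ, of w] by(simp_all only:)
 have "lev.tr K n p l = lev.tr K m q l" if "l:{..K}" for l
  using lev.tr_commute[OF lev.alg_mat_madj[OF wm] wm that] by(simp add: ww)
 hence "lev.nrk K n p (min i K) = lev.nrk K m q (min i K)" for i by(simp add: lev.nrk_def)
 hence "rk K n p = rk K m q" by(simp add: rk_def fun_eq_iff)
 thus ?thesis using rk_mono[OF p, of K] rk_mono[OF q, of K] by(simp add: K_def)
qed

definition kzero :: "nat => (nat => nat => 'b) => nat => rat" where
 "kzero n p = (THE w. EX L m q. lev.alg_mat L m m q & pmat {..<m} q & mvn n p m q & rk L m q = w)"

lemma kzero_eqI:
 assumes p: "pmat {..<n} p" and q: "lev.alg_mat L m m q" "pmat {..<m} q" "mvn n p m q"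
 shows "kzero n p = rk L m q"
 unfolding kzero_def
proof (rule the_equality)
 show "EX M m' q'. lev.alg_mat M m' m' q' & pmat {..<m'} q' & mvn n p m' q' & rk M m' q' = rk L m q" using q by blast
 fix w assume "EX M m' q'. lev.alg_mat M m' m' q' & pmat {..<m'} q' & mvn n p m' q' & rk M m' q' = w"
 then obtain M m' q' where q': "lev.alg_mat M m' m' q'" "pmat {..<m'} q'" "mvn n p m' q'" "rk M m' q' = w" by blast
 let ?K = "max L M"
 have "mvn m' q' m q" by(rule mvn_trans[OF q'(2) p q(2) mvn_sym[OF q'(3)] q(3)])
 hence "rk ?K m' q' = rk ?K m q"
  using mvn_imp_rk_eq[OF alg_mat_mono[OF max.cobounded2 q'(1)] q'(2) alg_mat_mono[OF max.cobounded1 q(1)] q(2)] by blast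
 thus "w = rk L m q" using rk_mono[OF q(1,2), of ?K] rk_mono[OF q'(1,2), of ?K] q'(4) by simp
qed

lemma mvn_refl: "pmat {..<n} p ==> mvn n p n p"
 by(rule mvnI[of _ _ p]) (simp_all add: pmat_def)

lemma kzero_level: "lev.alg_mat L n n p ==> pmat {..<n} p ==> kzero n p = rk L n p"
 by(rule kzero_eqI[OF _ _ _ mvn_refl])

lemma kzero_eq_iff:
 assumes p: "pmat {..<n} p" and q: "pmat {..<m} q"
 shows "kzero n p = kzero m q <-> mvn n p m q"
proof -
 obtain L p' where p': "lev.alg_mat L n n p'" "pmat {..<n} p'" "mvn n p n p'" by(rule proj_representative[OF p])
 obtain M q' where q': "lev.alg_mat M m m q'" "pmat {..<m} q'" "mvn m q m q'" by(rule proj_representative[OF q])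
 let ?K = "max L M"
 note a = alg_mat_mono[OF max.cobounded1 p'(1), of M] alg_mat_mono[OF max.cobounded2 q'(1), of L]
 have "kzero n p = kzero m q <-> rk ?K n p' = rk ?K m q'"
  using kzero_eqI[OF p a(1) p'(2,3)] kzero_eqI[OF q a(2) q'(2,3)] by simp
 also have "... <-> mvn n p' m q'"
  using rk_eq_imp_mvn[OF a(1) p'(2) a(2) q'(2)] mvn_imp_rk_eq[OF a(1) p'(2) a(2) q'(2)] by blast
 also have "... <-> mvn n p m q"
  using mvn_trans[OF p p'(2) q'(2) p'(3)] mvn_trans[OF p q'(2) q _ mvn_sym[OF q'(3)]]
   mvn_trans[OF p'(2) p q mvn_sym[OF p'(3)]] mvn_trans[OF p'(2) q q'(2) _ q'(3)] by blast
 finally show ?thesis .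
qed

lemma kzero_dsum:
 assumes p: "pmat {..<n} p" and q: "pmat {..<m} q"
 shows "kzero (n + m) (dsum n p q) i = kzero n p i + kzero m q i"
proof -
 obtain L p' where p': "lev.alg_mat L n n p'" "pmat {..<n} p'" "mvn n p n p'" by(rule proj_representative[OF p])
 obtain M q' where q': "lev.alg_mat M m m q'" "pmat {..<m} q'" "mvn m q m q'" by(rule proj_representative[OF q])
 define K where "K = max L M"
 have a: "lev.alg_mat K n n p'" "lev.alg_mat K m m q'"
  using alg_mat_mono[OF max.cobounded1 p'(1), of M] alg_mat_mono[OF max.cobounded2 q'(1), of L] by(simp_all add: K_def)
 note d = lev.alg_mat_dsum[OF a] pmat_dsum[OF p'(2) q'(2)]
 have l: "min i K:{..K}" by simp
 have "complex_of_nat (lev.nrk K (n + m) (dsum n p' q') (min i K)) = of_nat (lev.nrk K n p' (min i K) + lev.nrk K m q' (min i K))"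
  using lev.of_nat_nrk[OF d l] lev.of_nat_nrk[OF a(1) p'(2) l] lev.of_nat_nrk[OF a(2) q'(2) l] lev.tr_dsum[OF l] by simp
 hence "rk K (n + m) (dsum n p' q') i = rk K n p' i + rk K m q' i"
  unfolding of_nat_eq_iff by(simp add: rk_def add_divide_distrib)
 thus ?thesis
  using kzero_eqI[OF pmat_dsum[OF p q] d mvn_dsum[OF p'(3) q'(3)]] kzero_eqI[OF p a(1) p'(2,3)] kzero_eqI[OF q a(2) q'(2,3)] by simp
qed

lemma kzero_range:
 assumes p: "pmat {..<n} p"
 shows "EX L c. kzero n p = (%i. of_nat (c (min i L)) / of_nat (kp L i))"
proof -
 obtain L p' where p': "lev.alg_mat L n n p'" "pmat {..<n} p'" "mvn n p n p'" by(rule proj_representative[OF p])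
 show ?thesis using kzero_eqI[OF p p'] by(intro exI[of _ L] exI[of _ "lev.nrk L n p'"]) (simp add: rk_def fun_eq_iff)
qed

lemma kzero_surj: "EX n p. pmat {..<n} p & kzero n p = (%i. of_nat (c (min i L)) / of_nat (kp L i))"
proof -
 note s = stdp[of L "os L c"]
 show ?thesis using kzero_level[OF conjunct1[OF s] conjunct2[OF s]] nrk_os[of _ L c] s
  by(intro exI[of _ "length (os L c)"] exI[of _ "stdp L (os L c)"]) (simp add: rk_def fun_eq_iff)
qed

end

definition K_theory_claim :: "nat => (nat => int) => 'a cstar => bool" where
 "K_theory_claim p r A <-> K0 A \<cong> c0_group (H_group (padic_ord p r)) \<times>\<times> integer_group
  & K1 A \<cong> integer_group \<times>\<times> c0_group integer_group"

definition counterexample :: "nat => (nat => int) => 'a cstar => (((nat => int) => complex) => 'a) => 'a => bool" where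
 "counterexample p r A M V <-> prime p & odd p & r:Units (padic_int p) &
  (ALL n::nat. n > 0 --> r [^]\<^bsub>padic_int p\<^esub> n ~= \<one>\<^bsub>padic_int p\<^esub>) & is_crossed_product p r A M V & \<one>\<^bsub>A\<^esub> ~= \<zero>\<^bsub>A\<^esub> & ~ K_theory_claim p r A"

definition ce :: "'a itself => bool" where
 "ce _ <-> (EX p r (A :: 'a cstar) M V. counterexample p r A M V)"

definition Cx :: "'a cstar" where
 "Cx = (SOME A. EX p r M V. counterexample p r A M V)"

lemma ce_counterexample: "ce TYPE('a) ==> EX p r M V. counterexample p r (Cx :: 'a cstar) M V"
 unfolding ce_def Cx_def by(rule someI_ex) blast

text \<open>A type carrying the C*-algebra of a hypothetical counterexample, so that the theorem can be
 derived by contradiction from results about type classes. If there is none,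
 the type is a copy of the complex numbers.\<close>

typedef 'a calg = "{x :: 'a + complex. if ce TYPE('a) then x:Inl ` carrier (Cx :: 'a cstar) else x:range Inr}"
 using ce_counterexample[where 'a = 'a] 
proof (cases "ce TYPE('a)")
 case True
 then obtain p r M V where "counterexample p r (Cx :: 'a cstar) M V" using ce_counterexample by blast
 then interpret unital_cstar_algebra "Cx :: 'a cstar" by(simp add: counterexample_def is_crossed_product_def)
 show ?thesis using True zero_closed by auto
qed auto

definition val :: "'a calg => 'a" where "val x = projl (Rep_calg x)"
definition cval :: "'a calg => complex" where "cval x = projr (Rep_calg x)"
definition mk :: "'a => complex => 'a calg" where
 "mk a c = Abs_calg (if ce TYPE('a) then Inl a else Inr c)"

lemma calg_eq: "x = y <-> (if ce TYPE('a) then val x = val y else cval x = cval y)" for x y :: "'a calg"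
 using Rep_calg[of x] Rep_calg[of y] by(auto simp: val_def cval_def Rep_calg_inject[symmetric] split: if_splits)

lemma val_closed: "ce TYPE('a) ==> val (x :: 'a calg):carrier Cx"
 using Rep_calg[of x] by(auto simp: val_def)

lemma val_mk: "ce TYPE('a) ==> a:carrier Cx ==> val (mk a c :: 'a calg) = a"
 and cval_mk: "~ ce TYPE('a) ==> cval (mk a c :: 'a calg) = c"
 by(simp_all add: mk_def val_def cval_def Abs_calg_inverse)

context
 assumes ce: "ce TYPE('a)"
begin

lemma Cx: "unital_cstar_algebra (Cx :: 'a cstar)" and Cx_one: "\<one>\<^bsub>Cx\<^esub> ~= (\<zero>\<^bsub>Cx\<^esub> :: 'a)"
 using ce_counterexample[OF ce] by(auto simp: counterexample_def is_crossed_product_def)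

interpretation Q: Ring.ring "Cx :: 'a cstar" by(rule unital_cstar_algebra.axioms(1)[OF Cx])
interpretation U: unital_cstar_algebra "Cx :: 'a cstar" by(rule Cx)

lemma smult_closed: "x:carrier Cx ==> c \<odot>\<^bsub>Cx\<^esub> (x :: 'a):carrier Cx"
 using U.smult_closed[of c] by(simp add: complex_ring_def)

lemma smult_laws:
 fixes x :: 'a
 assumes "x:carrier Cx"
 shows "(c + d) \<odot>\<^bsub>Cx\<^esub> x = c \<odot>\<^bsub>Cx\<^esub> x \<oplus>\<^bsub>Cx\<^esub> d \<odot>\<^bsub>Cx\<^esub> x" "y:carrier Cx ==> c \<odot>\<^bsub>Cx\<^esub> (x \<oplus>\<^bsub>Cx\<^esub> y) = c \<odot>\<^bsub>Cx\<^esub> x \<oplus>\<^bsub>Cx\<^esub> c \<odot>\<^bsub>Cx\<^esub> y"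
  "(c*d) \<odot>\<^bsub>Cx\<^esub> x = c \<odot>\<^bsub>Cx\<^esub> (d \<odot>\<^bsub>Cx\<^esub> x)" "1 \<odot>\<^bsub>Cx\<^esub> x = x"
 using U.smult_l_distr[of c d x] U.smult_r_distr[of c x y] U.smult_assoc1[of c d x] U.smult_one[of x] assms
 by(simp_all add: complex_ring_def)

lemma adj_one: "adj Cx \<one>\<^bsub>Cx\<^esub> = (\<one>\<^bsub>Cx\<^esub> :: 'a)"
proof -
 have "adj Cx (adj Cx \<one>\<^bsub>Cx\<^esub> \<otimes>\<^bsub>Cx\<^esub> \<one>\<^bsub>Cx\<^esub>) = adj Cx \<one>\<^bsub>Cx\<^esub> \<otimes>\<^bsub>Cx\<^esub> (\<one>\<^bsub>Cx\<^esub> :: 'a)"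
  by(subst U.adj_mult) (simp_all add: U.adj_closed U.adj_adj)
 thus ?thesis by(simp add: U.adj_closed U.adj_adj)
qed

lemma nrm_adj: "x:carrier Cx ==> nrm Cx (adj Cx x) = nrm Cx (x :: 'a)"
proof -
 have le: "nrm Cx x <= nrm Cx (adj Cx x)" if x: "x:carrier Cx" for x :: 'a
 proof (cases "nrm Cx x = 0")
  case False
  have "nrm Cx x*nrm Cx x <= nrm Cx (adj Cx x)*nrm Cx x"
   using U.cstar_identity[OF x] U.nrm_mult[OF U.adj_closed[OF x] x] by(simp add: power2_eq_square)
  thus ?thesis using False U.nrm_nonneg[OF x] by simp
 qed (use U.nrm_nonneg[OF U.adj_closed[OF x]] in simp)
 assume "x:carrier Cx"
 thus ?thesis using le[of x] le[of "adj Cx x"] by(simp add: U.adj_closed U.adj_adj)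
qed

lemma nrm_one: "nrm Cx (\<one>\<^bsub>Cx\<^esub> :: 'a) = 1"
proof -
 have "nrm Cx (\<one>\<^bsub>Cx\<^esub> :: 'a) = (nrm Cx (\<one>\<^bsub>Cx\<^esub> :: 'a))\<^sup>2" using U.cstar_identity[of "\<one>\<^bsub>Cx\<^esub>"] by(simp add: adj_one)
 thus ?thesis using U.nrm_eq_0[of "\<one>\<^bsub>Cx\<^esub>"] Cx_one by(simp add: power2_eq_square)
qed

lemma nrm_minus: "x:carrier Cx ==> nrm Cx (\<ominus>\<^bsub>Cx\<^esub> x) = nrm Cx (x :: 'a)"
proof -
 assume x: "x:carrier Cx"
 have "nrm Cx ((- 1 + 1) \<odot>\<^bsub>Cx\<^esub> x) = 0" using U.nrm_smult[OF x, of 0] by simp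
 hence "(- 1) \<odot>\<^bsub>Cx\<^esub> x \<oplus>\<^bsub>Cx\<^esub> x = \<zero>\<^bsub>Cx\<^esub>"
  using U.nrm_eq_0[OF smult_closed[OF x, of "- 1 + 1"]] smult_laws(1)[OF x, of "- 1" 1] smult_laws(4)[OF x] by simp
 note m = this
 have c: "(- 1) \<odot>\<^bsub>Cx\<^esub> x:carrier Cx" by(rule smult_closed[OF x])
 have "\<ominus>\<^bsub>Cx\<^esub> x = (- 1) \<odot>\<^bsub>Cx\<^esub> x"
  by(rule Q.minus_equality[OF m x c])
 thus ?thesis using U.nrm_smult[OF x] by simp
qed

lemma Cx_metric: "Metric_space (carrier Cx) (nrm_dist (Cx :: 'a cstar))"
proof
 fix x y z :: 'a
 show "0 <= nrm_dist Cx x y" by(auto simp: nrm_dist_def U.nrm_nonneg)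
 have "nrm Cx (x \<ominus>\<^bsub>Cx\<^esub> y) = nrm Cx (y \<ominus>\<^bsub>Cx\<^esub> x)" if "x:carrier Cx" "y:carrier Cx"
  using nrm_minus[OF Q.minus_closed[OF that]] that by(simp add: a_minus_def Q.minus_add Q.a_comm)
 thus "nrm_dist Cx x y = nrm_dist Cx y x" by(simp add: nrm_dist_def)
 assume xy: "x:carrier Cx" "y:carrier Cx"
 show "(nrm_dist Cx x y = 0) = (x = y)" using xy by(simp add: nrm_dist_def U.nrm_eq_0 Q.r_right_minus_eq)
 assume z: "z:carrier Cx"
 have "x \<ominus>\<^bsub>Cx\<^esub> z = (x \<ominus>\<^bsub>Cx\<^esub> y) \<oplus>\<^bsub>Cx\<^esub> (y \<ominus>\<^bsub>Cx\<^esub> z)"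
  using xy z by(simp add: a_minus_def Q.a_assoc Q.r_neg2 Q.r_neg1)
 thus "nrm_dist Cx x z <= nrm_dist Cx x y + nrm_dist Cx y z"
  using xy z U.nrm_triangle[OF Q.minus_closed Q.minus_closed, of x y y z] by(simp add: nrm_dist_def)
qed

lemmas Cx_closed = Q.a_closed Q.m_closed Q.a_inv_closed Q.zero_closed Q.one_closed U.adj_closed smult_closed
lemmas Cx_ring = Q.a_assoc Q.a_comm Q.a_lcomm Q.r_zero Q.r_neg Q.l_zero Q.l_neg Q.m_assoc Q.l_one Q.r_one Q.l_distr Q.r_distr a_minus_def[of "Cx :: 'a cstar"]
lemmas Cx_star = U.smult_mult_left U.smult_mult_right U.adj_adj U.adj_add U.adj_mult U.adj_smult
 U.nrm_eq_0 U.nrm_triangle U.nrm_smult U.nrm_mult U.cstar_identity U.complete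

end

instantiation calg :: (type) real_normed_algebra_1
begin

definition zero_calg :: "'a calg" where "0 = mk \<zero>\<^bsub>Cx\<^esub> 0"
definition one_calg :: "'a calg" where "1 = mk \<one>\<^bsub>Cx\<^esub> 1"
definition plus_calg :: "'a calg => 'a calg => 'a calg" where "x + y = mk (val x \<oplus>\<^bsub>Cx\<^esub> val y) (cval x + cval y)"
definition uminus_calg :: "'a calg => 'a calg" where "- x = mk (\<ominus>\<^bsub>Cx\<^esub> val x) (- cval x)"
definition minus_calg :: "'a calg => 'a calg => 'a calg" where "x - y = x + - (y :: 'a calg)"
definition times_calg :: "'a calg => 'a calg => 'a calg" where "x*y = mk (val x \<otimes>\<^bsub>Cx\<^esub> val y) (cval x*cval y)"
definition scaleR_calg :: "real => 'a calg => 'a calg" where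
 "c *R x = mk (complex_of_real c \<odot>\<^bsub>Cx\<^esub> val x) (of_real c*cval x)"
definition norm_calg :: "'a calg => real" where "norm x = (if ce TYPE('a) then nrm Cx (val x) else cmod (cval x))"
definition dist_calg :: "'a calg => 'a calg => real" where "dist x y = norm (x - y :: 'a calg)"
definition sgn_calg :: "'a calg => 'a calg" where "sgn_calg x = inverse (norm x) *R x"
definition uniformity_calg :: "('a calg \<times> 'a calg) filter" where
 "uniformity_calg = (INF e\<in>{0<..}. principal {(x,y). dist x y < e})"
definition open_calg :: "'a calg set => bool" where
 "open_calg U = (ALL x:U. \<forall>\<^sub>F (x',y) in uniformity. x' = x --> y:U)"

lemma val_ops:
 assumes ce: "ce TYPE('a)"
 shows "val (0 :: 'a calg) = \<zero>\<^bsub>Cx\<^esub>" "val (1 :: 'a calg) = \<one>\<^bsub>Cx\<^esub>" "val (x + y) = val x \<oplus>\<^bsub>Cx\<^esub> val (y :: 'a calg)"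
  "val (- x) = \<ominus>\<^bsub>Cx\<^esub> val x" "val (x*y) = val x \<otimes>\<^bsub>Cx\<^esub> val y" "val (c *R x) = complex_of_real c \<odot>\<^bsub>Cx\<^esub> val x"
  "norm x = nrm Cx (val x)" "val (x - y) = val x \<ominus>\<^bsub>Cx\<^esub> val y"
 by(simp_all add: zero_calg_def one_calg_def plus_calg_def uminus_calg_def minus_calg_def times_calg_def scaleR_calg_def
   norm_calg_def ce val_mk val_closed Cx_closed Cx_ring)

lemma cval_ops:
 assumes ce: "~ ce TYPE('a)"
 shows "cval (0 :: 'a calg) = 0" "cval (1 :: 'a calg) = 1" "cval (x + y) = cval x + cval (y :: 'a calg)"
  "cval (- x) = - cval x" "cval (x*y) = cval x*cval y" "cval (c *R x) = of_real c*cval x"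
  "norm x = cmod (cval x)" "cval (x - y) = cval x - cval y"
 by(simp_all add: zero_calg_def one_calg_def plus_calg_def uminus_calg_def minus_calg_def times_calg_def scaleR_calg_def
   norm_calg_def ce cval_mk)

lemma calg_complete:
 fixes X :: "nat => 'a calg"
 assumes "!!e. e > 0 ==> EX N. ALL m>=N. ALL n>=N. norm (X m - X n) < e"
 shows "EX x. ALL e>0. EX N. ALL n>=N. norm (X n - x) < e"
proof (cases "ce TYPE('a)")
 case False
 have "Cauchy (%n. cval (X n))"
  using assms unfolding Cauchy_def dist_norm cval_ops[OF False] by blast
 then obtain c where "(%n. cval (X n)) \<longlonglongrightarrow> c" using Cauchy_convergent convergent_def by blast
 thus ?thesis
  using LIMSEQ_D[of "%n. cval (X n)" c] by(intro exI[of _ "mk undefined c"]) (simp add: cval_ops[OF False] cval_mk[OF False])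
next
 case ce: True
 interpret Met: Metric_space "carrier Cx" "nrm_dist (Cx :: 'a cstar)" by(rule Cx_metric[OF ce])
 have d: "nrm_dist Cx (val u) (val v) = norm (u - v)" for u v :: "'a calg"
  by(simp add: nrm_dist_def val_closed[OF ce] val_ops[OF ce])
 have "Met.MCauchy (%n. val (X n))" unfolding Met.MCauchy_def d using assms val_closed[OF ce] by blast
 then obtain a where a: "limitin Met.mtopology (%n. val (X n)) a sequentially"
  using Cx_star(12)[OF ce] unfolding Met.mcomplete_def by blast
 hence m: "a:carrier Cx" by(metis limitin_topspace Met.topspace_mtopology)
 have "nrm_dist Cx (val (X n)) a = norm (X n - mk a 0)" for n using d[of "X n" "mk a 0"] by(simp add: val_mk[OF ce m])
 thus ?thesis using a unfolding Met.limitin_metric eventually_sequentially by(intro exI[of _ "mk a 0"]) fastforce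
qed

instance
proof
 fix x y z :: "'a calg" and a b :: real and U :: "'a calg set"
 note E = calg_eq val_ops cval_ops val_closed Cx_closed Cx_ring smult_laws Cx_star
 show "x + y + z = x + (y + z)" "x + y = y + x" "0 + x = x" "- x + x = 0" "x - y = x + - y" "x*y*z = x*(y*z)"
  "1*x = x" "x*1 = x" "(x + y)*z = x*z + y*z" "x*(y + z) = x*y + x*z"
  by - (cases "ce TYPE('a)"; simp add: E algebra_simps; fail)+
 show "a *R (x + y) = a *R x + a *R y" "(a + b) *R x = a *R x + b *R x" "a *R b *R x = (a*b) *R x" "1 *R x = x"
  "a *R x*y = a *R (x*y)" "x*a *R y = a *R (x*y)"
  by - (cases "ce TYPE('a)"; simp add: E algebra_simps; fail)+
 show "0 ~= (1 :: 'a calg)" by(cases "ce TYPE('a)") (use Cx_one[where 'a = 'a] in "auto simp: E")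
 show "dist x y = norm (x - y)" "sgn x = inverse (norm x) *R x"
  "uniformity = (INF e\<in>{0<..}. principal {(x :: 'a calg,y). dist x y < e})"
  "open U = (ALL x:U. \<forall>\<^sub>F (x',y) in uniformity. x' = x --> y:U)"
  by(simp_all only: dist_calg_def sgn_calg_def uniformity_calg_def open_calg_def)
 show "norm x = 0 <-> x = 0" "norm (x + y) <= norm x + norm y" "norm (a *R x) = \<bar>a\<bar>*norm x" "norm (x*y) <= norm x*norm y"
  "norm (1 :: 'a calg) = 1"
  by - (cases "ce TYPE('a)"; simp add: E norm_triangle_ineq norm_mult nrm_one; fail)+
qed

end

instance calg :: (type) banach
proof
 fix X :: "nat => 'a calg" assume X: "Cauchy X"
 hence "EX N. ALL m>=N. ALL n>=N. norm (X m - X n) < e" if "e > 0" for e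
  using that by(simp add: Cauchy_def dist_norm)
 from calg_complete[OF this] show "convergent X"
  unfolding convergent_def lim_sequentially dist_norm by blast
qed

instantiation calg :: (type) cstar_alg
begin

definition cx_calg :: "complex => 'a calg" where "cx c = mk (c \<odot>\<^bsub>Cx\<^esub> \<one>\<^bsub>Cx\<^esub>) c"
definition star_calg :: "'a calg => 'a calg" where "star x = mk (adj Cx (val x)) (cnj (cval x))"

lemma star_cx_ops:
 shows "ce TYPE('a) ==> val (cx d :: 'a calg) = d \<odot>\<^bsub>Cx\<^esub> \<one>\<^bsub>Cx\<^esub>" "ce TYPE('a) ==> val (star (x :: 'a calg)) = adj Cx (val x)"
  "~ ce TYPE('a) ==> cval (cx d :: 'a calg) = d" "~ ce TYPE('a) ==> cval (star (x :: 'a calg)) = cnj (cval x)"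
 by(simp_all add: cx_calg_def star_calg_def val_mk cval_mk val_closed Cx_closed)

instance
proof
 fix x y :: "'a calg" and a :: real and c d :: complex
 note E = calg_eq val_ops cval_ops star_cx_ops val_closed Cx_closed Cx_ring smult_laws Cx_star
 show "star (star x) = x" "star (x + y) = star x + star y" "star (x*y) = star y * star x" "star (a *R x) = a *R star x" "norm (star x) = norm x"
  by - (cases "ce TYPE('a)"; simp add: E nrm_adj; fail)+
 show "cx (c*d) = cx c*(cx d :: 'a calg)"
  by(cases "ce TYPE('a)"; simp add: E del: Cx_star(2))
 show "cx (c + d) = cx c + (cx d :: 'a calg)" "cx (of_real a) = a *R (1 :: 'a calg)" "x*cx c = cx c*x"
  "star (cx c) = (cx (cnj c) :: 'a calg)" "norm (cx c :: 'a calg) = cmod c" "norm (star x*x) = norm x*norm x"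
  by - (cases "ce TYPE('a)"; simp add: E nrm_one adj_one norm_mult power2_eq_square; fail)+
qed

end

lemma quotient_monoid_eq:
 assumes R: "!!x y. (x,y):R <-> x:S & y:S & ph x = ph y"
  and op: "!!x y. x:S ==> y:S ==> op x y:S & ph (op x y) = ph x \<otimes>\<^bsub>G\<^esub> ph y" and e: "e:S"
 shows "carrier (quotient_monoid S R op e) = (%x. {y:S. ph y = ph x}) ` S"
  "\<one>\<^bsub>quotient_monoid S R op e\<^esub> = {y:S. ph y = ph e}"
  "x:S ==> y:S ==> {z:S. ph z = ph x} \<otimes>\<^bsub>quotient_monoid S R op e\<^esub> {z:S. ph z = ph y} = {z:S. ph z = ph x \<otimes>\<^bsub>G\<^esub> ph y}"
proof -
 have cl: "R `` {x} = {y:S. ph y = ph x}" if "x:S" for x using that R by(auto simp: Image_singleton)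
 show "carrier (quotient_monoid S R op e) = (%x. {y:S. ph y = ph x}) ` S"
  by(simp add: quotient_monoid_def quotient_def cl UNION_singleton_eq_range)
 show "\<one>\<^bsub>quotient_monoid S R op e\<^esub> = {y:S. ph y = ph e}" by(simp add: quotient_monoid_def cl e)
 assume xy: "x:S" "y:S"
 have "R `` {op u v |u v. u:{z:S. ph z = ph x} & v:{z:S. ph z = ph y}} = {z:S. ph z = ph x \<otimes>\<^bsub>G\<^esub> ph y}"
 proof (intro Set.set_eqI iffI)
  fix z assume "z:R `` {op u v |u v. u:{z:S. ph z = ph x} & v:{z:S. ph z = ph y}}"
  then obtain u v where "(op u v,z):R" "u:S" "v:S" "ph u = ph x" "ph v = ph y" by blast
  thus "z:{z:S. ph z = ph x \<otimes>\<^bsub>G\<^esub> ph y}" using R op[of u v] by simp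
 next
  fix z assume "z:{z:S. ph z = ph x \<otimes>\<^bsub>G\<^esub> ph y}"
  hence "(op x y,z):R" using R op[OF xy] by simp
  thus "z:R `` {op u v |u v. u:{z:S. ph z = ph x} & v:{z:S. ph z = ph y}}" using xy by blast
 qed
 thus "{z:S. ph z = ph x} \<otimes>\<^bsub>quotient_monoid S R op e\<^esub> {z:S. ph z = ph y} = {z:S. ph z = ph x \<otimes>\<^bsub>G\<^esub> ph y}"
  by(simp add: quotient_monoid_def)
qed

lemma quotient_monoid_iso:
 assumes G: "group G"
  and R: "!!x y. (x,y):R <-> x:S & y:S & ph x = ph y"
  and op: "!!x y. x:S ==> y:S ==> op x y:S & ph (op x y) = ph x \<otimes>\<^bsub>G\<^esub> ph y"
  and e: "e:S" and surj: "ph ` S = carrier G"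
 shows "quotient_monoid S R op e \<cong> G"
proof -
 let ?K = "quotient_monoid S R op e"
 have Q1: "carrier ?K = (%x. {y:S. ph y = ph x}) ` S" by(rule quotient_monoid_eq(1)[OF R op e])
 have Q3: "{z:S. ph z = ph x} \<otimes>\<^bsub>?K\<^esub> {z:S. ph z = ph y} = {z:S. ph z = ph x \<otimes>\<^bsub>G\<^esub> ph y}" if "x:S" "y:S" for x y
  by(rule quotient_monoid_eq(3)[OF R op e that])
 define h where "h g = {z:S. ph z = g}" for g
 have "h:iso G (quotient_monoid S R op e)"
  unfolding iso_def hom_def
 proof (intro CollectI conjI Pi_I ballI)
  show "h g:carrier ?K" if g: "g:carrier G" for g
  proof -
   obtain u where "u:S" "g = ph u" using g surj by blast
   thus ?thesis unfolding Q1 h_def by simp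
  qed
  show "h (x \<otimes>\<^bsub>G\<^esub> y) = h x \<otimes>\<^bsub>?K\<^esub> h y" if xy: "x:carrier G" "y:carrier G" for x y
  proof -
   obtain u v where "u:S" "v:S" "x = ph u" "y = ph v" using xy surj by blast
   thus ?thesis using Q3[of u v] by(simp add: h_def)
  qed
  show "bij_betw h (carrier G) (carrier (quotient_monoid S R op e))"
   unfolding bij_betw_def
  proof
   have "x = y" if "x:ph ` S" "h x = h y" for x y using that unfolding h_def by blast
   thus "inj_on h (carrier G)" unfolding surj[symmetric] inj_on_def by blast
   show "h ` carrier G = carrier (quotient_monoid S R op e)" unfolding Q1 surj[symmetric] h_def image_image ..
  qed
 qed
 thus ?thesis using group.iso_sym[OF G] is_isoI by blast
qed

lemma K0_iso:
 fixes G (structure) and A :: "'a cstar"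
 assumes G: "comm_group G"
  and char: "!!x y. (x,y):mvn_rel A <-> x:projections A & y:projections A & ph x = ph y"
  and add: "!!x y. x:projections A ==> y:projections A ==> diag_sum A x y:projections A & ph (diag_sum A x y) = ph x \<otimes>\<^bsub>G\<^esub> ph y"
  and zero: "(0,mat_one A 0):projections A"
  and closed: "ph ` projections A \<subseteq> carrier G"
  and surj: "!!g. g:carrier G ==> EX x:projections A. EX y:projections A. g \<otimes>\<^bsub>G\<^esub> ph y = ph x"
 shows "K0 A \<cong> G"
proof -
 interpret comm_group G by(rule G)
 let ?P = "projections A"
 define N where "N = mvn_monoid A"
 note Q = quotient_monoid_eq[where G = G, OF char add zero, folded mvn_monoid_def N_def]
 define h where "h g = {z:?P. ph z = g}" for g
 define f where "f X = ph (SOME x. x:X)" for X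
 have fh: "f (h (ph x)) = ph x" if "x:?P" for x
 proof -
  have "(SOME z. z:h (ph x)):h (ph x)" by(rule someI[of _ x]) (use that in "simp add: h_def")
  thus ?thesis by(simp add: f_def h_def)
 qed
 have N: "carrier N = h ` ph ` ?P" "x:?P ==> y:?P ==> h (ph x) \<otimes>\<^bsub>N\<^esub> h (ph y) = h (ph x \<otimes> ph y)" for x y
  using Q(1,3) unfolding h_def by(simp_all add: image_image)
 have f: "f X:carrier G" "X \<otimes>\<^bsub>N\<^esub> Y:carrier N" "f (X \<otimes>\<^bsub>N\<^esub> Y) = f X \<otimes> f Y" "X = Y <-> f X = f Y" if XY: "X:carrier N" "Y:carrier N" for X Y
 proof -
  obtain x y where xy: "x:?P" "y:?P" "X = h (ph x)" "Y = h (ph y)" using XY unfolding N(1) by blast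
  have d: "diag_sum A x y:?P" "X \<otimes>\<^bsub>N\<^esub> Y = h (ph (diag_sum A x y))" using add[OF xy(1,2)] N(2)[OF xy(1,2)] xy by auto
  show "f X:carrier G" using closed xy by(auto simp: fh)
  show "X \<otimes>\<^bsub>N\<^esub> Y:carrier N" using d unfolding N(1) by blast
  have "f (X \<otimes>\<^bsub>N\<^esub> Y) = ph (diag_sum A x y)" unfolding d(2) by(rule fh[OF d(1)])
  thus "f (X \<otimes>\<^bsub>N\<^esub> Y) = f X \<otimes> f Y" using add[OF xy(1,2)] xy by(simp add: fh)
  show "X = Y <-> f X = f Y" using fh[OF xy(1)] fh[OF xy(2)] xy(3,4) by metis
 qed
 define psf where "psf = (%(X,Y). f X \<otimes> inv f Y)"
 have cancel: "a \<otimes> inv b = c \<otimes> inv d <-> a \<otimes> d = c \<otimes> b" if "a:carrier G" "b:carrier G" "c:carrier G" "d:carrier G" for a b c d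
 proof -
  have "a \<otimes> inv b = c \<otimes> inv d <-> a \<otimes> inv b \<otimes> (b \<otimes> d) = c \<otimes> inv d \<otimes> (b \<otimes> d)" using that by(subst right_cancel) auto
  also have "a \<otimes> inv b \<otimes> (b \<otimes> d) = a \<otimes> d" using that by(simp add: m_assoc[symmetric]) (simp add: m_assoc)
  also have "c \<otimes> inv d \<otimes> (b \<otimes> d) = c \<otimes> b" using that by(simp add: m_comm[of b d] m_assoc[symmetric]) (simp add: m_assoc)
  finally show ?thesis .
 qed
 have "\<one>\<^bsub>N\<^esub> = h (ph (0,mat_one A 0))"
  unfolding N_def mvn_monoid_def h_def by(rule quotient_monoid_eq(2)[OF char add zero])
 hence one: "\<one>\<^bsub>N\<^esub>:carrier N" using zero unfolding N(1) by simp
 show ?thesis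
  unfolding K0_def grothendieck_group_def N_def[symmetric]
 proof (rule quotient_monoid_iso[where ph = psf])
  show "group G" by(rule is_group)
  show "(\<one>\<^bsub>N\<^esub>,\<one>\<^bsub>N\<^esub>):carrier N \<times> carrier N" using one by simp
  fix X Y :: "(nat \<times> 'a matrix) set \<times> (nat \<times> 'a matrix) set"
  obtain a b c d where [simp]: "X = (a,b)" "Y = (c,d)" by(cases X; cases Y)
  show "(X,Y):grothendieck_rel N <-> X:carrier N \<times> carrier N & Y:carrier N \<times> carrier N & psf X = psf Y"
  proof (cases "a:carrier N & b:carrier N & c:carrier N & d:carrier N")
   case True
   hence m: "a:carrier N" "b:carrier N" "c:carrier N" "d:carrier N" by auto
   have "a \<otimes>\<^bsub>N\<^esub> d \<otimes>\<^bsub>N\<^esub> u = c \<otimes>\<^bsub>N\<^esub> b \<otimes>\<^bsub>N\<^esub> u <-> f a \<otimes> f d = f c \<otimes> f b" if "u:carrier N" for u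
    using m that by(simp add: f(4)[of "a \<otimes>\<^bsub>N\<^esub> d \<otimes>\<^bsub>N\<^esub> u" "c \<otimes>\<^bsub>N\<^esub> b \<otimes>\<^bsub>N\<^esub> u"] f(1-3))
   thus ?thesis using m one by(auto simp: grothendieck_rel_def psf_def cancel f(1))
  qed (auto simp: grothendieck_rel_def)
  assume "X:carrier N \<times> carrier N" "Y:carrier N \<times> carrier N"
  hence m: "a:carrier N" "b:carrier N" "c:carrier N" "d:carrier N" by auto
  have g: "f a:carrier G" "f b:carrier G" "f c:carrier G" "f d:carrier G" using m f(1) by blast+
  have "f a \<otimes> f c \<otimes> inv (f b \<otimes> f d) = f a \<otimes> inv f b \<otimes> (f c \<otimes> inv f d)" using g by(simp add: inv_mult m_ac)
  thus "(case X of (a,b) => %(c,d). (a \<otimes>\<^bsub>N\<^esub> c,b \<otimes>\<^bsub>N\<^esub> d)) Y:carrier N \<times> carrier N &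
   psf ((case X of (a,b) => %(c,d). (a \<otimes>\<^bsub>N\<^esub> c,b \<otimes>\<^bsub>N\<^esub> d)) Y) = psf X \<otimes> psf Y"
   using m by(simp add: psf_def f(2,3))
 next
  show "psf ` (carrier N \<times> carrier N) = carrier G"
  proof (intro equalityI subsetI)
   fix g assume "g:psf ` (carrier N \<times> carrier N)"
   then obtain a b where "a:carrier N" "b:carrier N" "g = f a \<otimes> inv f b" by(auto simp: psf_def)
   thus "g:carrier G" using f(1) by simp
  next
   fix g assume g: "g:carrier G"
   then obtain x y where xy: "x:?P" "y:?P" "g \<otimes> ph y = ph x" using surj by blast
   have c: "ph x:carrier G" "ph y:carrier G" using xy closed by auto
   have "g = g \<otimes> (ph y \<otimes> inv ph y)" using g c by simp
   also have "... = ph x \<otimes> inv ph y" using g c by(simp only: m_assoc[symmetric] inv_closed xy(3))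
   also have "... = psf (h (ph x),h (ph y))" using xy by(simp add: psf_def fh)
   finally show "g:psf ` (carrier N \<times> carrier N)" using xy unfolding N(1) by blast
  qed
 qed
qed

section \<open>K-theory in terms of the type class\<close>

definition vm :: "(nat => nat => 'a calg) => 'a matrix" where "vm a = (%i j. val (a i j))"
definition tm :: "'a matrix => nat => nat => 'a calg" where "tm a = (%i j. mk (a i j) 0)"

context
 assumes ce: "ce TYPE('a)"
begin

interpretation Q: Ring.ring "Cx :: 'a cstar" by(rule unital_cstar_algebra.axioms(1)[OF Cx[OF ce]])

lemma val_eq: "val x = val y <-> x = (y :: 'a calg)"
 using ce by(simp add: calg_eq)

lemma vm_eq: "vm a = vm b <-> a = (b :: nat => nat => 'a calg)"
 by(simp add: vm_def fun_eq_iff val_eq)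

lemma vm_mats: "vm a:mats Cx m n <-> msupp {..<m} {..<n} (a :: nat => nat => 'a calg)"
 using val_eq[of _ 0] by(auto simp: mats_def msupp_def vm_def val_closed[OF ce] val_ops[OF ce])

lemma vm_tm: "a:mats Cx m n ==> vm (tm a) = (a :: 'a matrix)"
 unfolding vm_def tm_def mats_def
 by(intro ext val_mk[OF ce]) (metis (mono_tags, lifting) Q.zero_closed mem_Collect_eq)

lemma ex_vm: "(EX a:mats Cx m n. P a) <-> (EX b. msupp {..<m} {..<n} (b :: nat => nat => 'a calg) & P (vm b))"
 using vm_tm vm_mats by metis

lemma vm_mult: "mat_mult Cx l (vm a) (vm b) = vm (mm {..<l} a (b :: nat => nat => 'a calg))"
proof -
 have "finsum Cx (%k. val (f k)) {..<l} = val (SUM k<l. f k)" for f :: "nat => 'a calg"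
  by(induction l) (simp_all add: val_ops[OF ce] lessThan_Suc val_closed[OF ce] Q.a_comm Pi_def)
 from this[of "%k. a _ k*b k _"] show ?thesis
  by(simp add: mat_mult_def vm_def mm_def val_ops[OF ce])
qed

lemma vm_adj: "mat_adj Cx (vm a) = vm (madj (a :: nat => nat => 'a calg))"
 by(simp add: mat_adj_def vm_def madj_def star_cx_ops(2)[OF ce])

lemma vm_one: "mat_one Cx n = vm (mone {..<n} :: nat => nat => 'a calg)"
 by(auto simp: mat_one_def vm_def mone_def val_ops[OF ce] fun_eq_iff)

lemma vm_dsum: "diag_sum Cx (n,vm a) (m,vm b) = (n + m,vm (dsum n a (b :: nat => nat => 'a calg)))"
 by(auto simp: diag_sum_def vm_def dsum_def val_ops[OF ce] fun_eq_iff)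

lemma vm_projections: "(n,vm p):projections Cx <-> pmat {..<n} (p :: nat => nat => 'a calg)"
 by(simp add: projections_def pmat_def vm_mats vm_mult vm_adj vm_eq)

lemma vm_unitaries: "(n,vm u):unitaries Cx <-> umat {..<n} (u :: nat => nat => 'a calg)"
 by(simp add: unitaries_def umat_def vm_mats vm_mult vm_adj vm_eq vm_one)

lemma projections_vm: "x:projections Cx ==> EX n p. x = (n,vm p) & pmat {..<n} (p :: nat => nat => 'a calg)"
 and unitaries_vm: "x:unitaries Cx ==> EX n u. x = (n,vm u) & umat {..<n} (u :: nat => nat => 'a calg)"
 using vm_tm[of "snd x" "fst x" "fst x"] vm_projections[of "fst x" "tm (snd x)"] vm_unitaries[of "fst x" "tm (snd x)"]
 by(auto simp: projections_def unitaries_def intro!: exI[of _ "tm (snd x)"])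

lemma vm_mvn: "((n,vm p),(m,vm q)):mvn_rel Cx <-> pmat {..<n} p & pmat {..<m} q & mvn n p m (q :: nat => nat => 'a calg)"
 by(simp add: mvn_rel_def vm_projections ex_vm vm_mult vm_adj vm_eq mvn_def)

interpretation Met: Metric_space "carrier Cx" "nrm_dist (Cx :: 'a cstar)" by(rule Cx_metric[OF ce])

lemma dist_val: "nrm_dist Cx (val x) (val y) = dist x (y :: 'a calg)"
 by(simp add: nrm_dist_def val_closed[OF ce] val_ops[OF ce] dist_norm)

lemma continuous_map_val: "continuous_map (top_of_set T) (nrm_topology Cx) (%t. val (w t)) <-> cont T (w :: real => 'a calg)"
proof -
 have "continuous_map (top_of_set T) (nrm_topology Cx) (%t. val (w t)) <->
   (ALL x:T. ALL e>0. EX U. openin (top_of_set T) U & x:U & (ALL y:U. dist (w x) (w y) < e))"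
  unfolding nrm_topology_def Met.continuous_map_to_metric by(simp add: dist_val val_closed[OF ce])
 also have "... <-> cont T w"
 proof
  assume l: "ALL x:T. ALL e>0. EX U. openin (top_of_set T) U & x:U & (ALL y:U. dist (w x) (w y) < e)"
  show "cont T w" unfolding continuous_on_iff
  proof (intro ballI allI impI)
   fix x and e :: real assume "x:T" "e > 0"
   then obtain U where U: "openin (top_of_set T) U" "x:U" "ALL y:U. dist (w x) (w y) < e" using l by blast
   then obtain d where "d > 0" "ball x d \<inter> T \<subseteq> U" unfolding openin_contains_ball by blast
   thus "EX d>0. ALL y:T. dist y x < d --> dist (w y) (w x) < e"
    using U(3) by(intro exI[of _ d]) (auto simp: dist_commute subset_iff)
  qed
 next
  assume c: "cont T w"
  show "ALL x:T. ALL e>0. EX U. openin (top_of_set T) U & x:U & (ALL y:U. dist (w x) (w y) < e)"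
  proof (intro ballI allI impI)
   fix x and e :: real assume "x:T" "e > 0"
   thus "EX U. openin (top_of_set T) U & x:U & (ALL y:U. dist (w x) (w y) < e)"
    using continuous_openin_preimage_gen[OF c open_ball[of "w x" e]] by(intro exI[of _ "T \<inter> w -` ball (w x) e"]) auto
  qed
 qed
 finally show ?thesis .
qed

lemma vm_homotopic:
 assumes "umat {..<n} (u :: nat => nat => 'a calg)" "umat {..<m} (v :: nat => nat => 'a calg)"
 shows "unitary_homotopic Cx (n,vm u) (m,vm v) <-> n = m & upath n u v"
proof -
 have "(EX w. (ALL t:{0..1}. (n,w t):unitaries Cx) & (ALL i<n. ALL j<n. continuous_map (top_of_set {0..1::real}) (nrm_topology Cx) (%t. w t i j)) & w 0 = vm u & w 1 = vm v)
  <-> upath n u v" (is "?l <-> _")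
 proof
  assume ?l
  then obtain w where w: "!!t. t:{0..1} ==> (n,w t):unitaries Cx" "w 0 = vm u" "w 1 = vm v"
   "!!i j. i < n ==> j < n ==> continuous_map (top_of_set {0..1::real}) (nrm_topology Cx) (%t. w t i j)" by blast
  have t: "vm (tm (w t)) = w t" if "t:{0..1}" for t using w(1)[OF that] by(intro vm_tm[of _ n n]) (simp add: unitaries_def)
  have u: "umat {..<n} (tm (w t))" if "t:{0..1}" for t using w(1)[OF that] t[OF that] vm_unitaries by metis
  show "upath n u v" unfolding upath_iff
  proof (intro exI[of _ "%t. tm (w t)"] conjI allI ballI)
   show "cont {0..1} (%t. tm (w t) i j)" for i j
   proof (cases "i < n & j < n")
    case True
    have "continuous_map (top_of_set {0..1}) (nrm_topology Cx) (%s. val (tm (w s) i j))"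
     by(rule continuous_map_eq[OF w(4)]) (use True t in "auto simp: vm_def fun_eq_iff")
    thus ?thesis unfolding continuous_map_val .
   next
    case False
    hence "tm (w s) i j = 0" if "s:{0..1}" for s using umat_msupp[OF u[OF that]] by(auto simp: msupp_def)
    thus ?thesis by(intro continuous_on_eq[OF continuous_on_const[of _ 0]]) simp
   qed
   show "tm (w 0) = u" "tm (w 1) = v" using t[of 0] t[of 1] w(2,3) by(auto simp: vm_eq)
  qed (rule u)
 next
  assume "upath n u v"
  then obtain w where w: "ALL i j. cont {0..1::real} (%t. w t i j)" "ALL t:{0..1}. umat {..<n} (w t)" "w 0 = u" "w 1 = v" unfolding upath_iff by blast
  thus ?l by(intro exI[of _ "%t. vm (w t)"]) (auto simp: vm_unitaries, simp add: vm_def continuous_map_val)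
 qed
 thus ?thesis by(auto simp: unitary_homotopic_def)
qed

lemma calg_generated:
 fixes C :: "'a calg set"
 assumes gen: "cstar_generated (val ` D) Cx = carrier Cx" and C: "closed_calg C" "D \<subseteq> C"
 shows "x:C"
proof -
 have Ca: "closed_alg C" and cx: "cx c:C" for c using C(1) by(auto simp: closed_calg_def)
 note A = closed_algD[OF Ca]
 have "cstar_subalgebra (val ` C) Cx"
  unfolding cstar_subalgebra_def
 proof (intro conjI ballI allI)
  show "subring (val ` C) Cx"
  proof (rule Q.subringI)
   show "\<one>\<^bsub>Cx\<^esub>:val ` C" unfolding val_ops(2)[OF ce, symmetric] using A(2) by blast
   fix h assume "h:val ` C"
   then obtain y where "y:C" "h = val y" by blast
   thus "\<ominus>\<^bsub>Cx\<^esub> h:val ` C" using val_ops(4)[OF ce, of y] A(7)[of y] by(metis imageI)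
   fix h' assume "h':val ` C"
   then obtain z where z: "z:C" "h' = val z" by blast
   show "h \<otimes>\<^bsub>Cx\<^esub> h':val ` C" "h \<oplus>\<^bsub>Cx\<^esub> h':val ` C"
    using z `y:C` `h = val y` val_ops(3,5)[OF ce, symmetric] A(3,4) by auto
  qed (use val_closed[OF ce] in auto)
  fix h assume "h:val ` C"
  then obtain y where y: "y:C" "h = val y" by blast
  show "adj Cx h:val ` C" using y A(5) star_cx_ops(2)[OF ce, symmetric] by auto
  show "c \<odot>\<^bsub>Cx\<^esub> h:val ` C" for c
  proof -
   have "c \<odot>\<^bsub>Cx\<^esub> h = val (cx c*y)"
    by(simp add: y val_ops[OF ce] star_cx_ops(1)[OF ce] Cx_star(1)[OF ce] val_closed[OF ce])
   thus ?thesis using A(4)[OF cx y(1)] by blast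
  qed
 next
  show "closedin (nrm_topology Cx) (val ` C)"
   unfolding nrm_topology_def Met.closedin_metric
  proof (intro conjI allI impI)
   fix a assume a: "a:carrier Cx - val ` C"
   define y where "y = (mk a 0 :: 'a calg)"
   have y: "a = val y" "y ~: C" using a by(auto simp: y_def val_mk[OF ce] image_iff)
   then obtain e where "e > 0" "ball y e \<subseteq> - C" using A(1) open_contains_ball[of "- C"] by(auto simp: open_Compl)
   thus "EX r>0. disjnt (val ` C) (Met.mball a r)"
    by(intro exI[of _ e]) (auto simp: disjnt_iff y dist_val subset_iff)
  qed (use val_closed[OF ce] in auto)
 qed
 hence "carrier Cx \<subseteq> val ` C"
  unfolding gen[symmetric] cstar_generated_def using image_mono[OF C(2)] by(intro Inter_lower) simp
 from subsetD[OF this val_closed[OF ce]] obtain y where "val x = val y" "y:C" by(rule imageE)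
 thus ?thesis unfolding val_eq by simp
qed

end

section \<open>Orbits of multiplication by a p-adic unit\<close>

lemma power_cong_first_order: "[(1 + y) ^ i = 1 + int i*y] (mod y\<^sup>2)" for y :: int
proof (induction i)
 case (Suc i)
 have "[(1 + y) ^ Suc i = (1 + y)*(1 + int i*y)] (mod y\<^sup>2)" using cong_scalar_left[OF Suc] by simp
 moreover have "(1 + y)*(1 + int i*y) = 1 + int (Suc i)*y + int i*y\<^sup>2" by(simp add: algebra_simps power2_eq_square)
 ultimately show ?case by(simp add: cong_def)
qed simp

lemma power_cong_one_lift:
 fixes x :: int
 assumes p: "prime p" "odd p" and N: "N >= 1" and x: "[x = 1] (mod int p ^ N)" "~ [x = 1] (mod int p ^ Suc N)"
 shows "[x ^ q = 1] (mod int p ^ Suc N) <-> p dvd q" "~ [x ^ p = 1] (mod int p ^ Suc (Suc N))"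
proof -
 have pp: "prime (int p)" and p0: "int p ~= 0" using p(1) by(auto simp: prime_gt_0_nat)
 obtain c where c: "x = 1 + int p ^ N*c" using x(1) by(metis cong_iff_dvd_diff dvdE add.commute diff_add_cancel)
 have pc: "~ int p dvd c"
 proof
  assume "int p dvd c"
  hence "int p ^ Suc N dvd x - 1" unfolding c by(auto elim!: dvdE)
  thus False using x(2) by(simp add: cong_iff_dvd_diff)
 qed
 let ?y = "int p ^ N*c"
 have "int p ^ Suc N dvd int p ^ (2*N)" by(rule le_imp_power_dvd) (use N in simp)
 hence dy: "int p ^ Suc N dvd ?y\<^sup>2" by(simp add: power_mult_distrib power_mult[symmetric] mult.commute dvd_mult)
 have "[x ^ q = 1 + int q*?y] (mod int p ^ Suc N)"
  using power_cong_first_order[of ?y q] dy unfolding c by(rule cong_dvd_modulus)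
 hence "[x ^ q = 1] (mod int p ^ Suc N) <-> int p ^ Suc N dvd int q*?y"
  by(metis add_diff_cancel_left' cong_iff_dvd_diff cong_sym cong_trans)
 also have "... <-> int p dvd int q*c" using p0 by(simp add: mult.left_commute)
 also have "... <-> p dvd q" using pc prime_dvd_mult_iff[OF pp] by simp
 finally show "[x ^ q = 1] (mod int p ^ Suc N) <-> p dvd q" .
 obtain h where h: "p = 2*h + 1" using p(2) oddE by blast
 have d2: "(int p)\<^sup>2 dvd ?y*int p" using N p0 by(cases N) (simp_all add: power2_eq_square)
 have "[(SUM i<p. x ^ i) = (SUM i<p. 1 + int i*?y)] (mod (int p)\<^sup>2)"
 proof (rule cong_sum)
  fix i
  have "(int p)\<^sup>2 dvd ?y\<^sup>2" using N by(cases N) (simp_all add: power_mult_distrib)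
  thus "[x ^ i = 1 + int i*?y] (mod (int p)\<^sup>2)" unfolding c by(rule cong_dvd_modulus[OF power_cong_first_order])
 qed
 also have "(SUM i<p. 1 + int i*?y) = int p + ?y*int p*int h"
 proof -
  have "2*(SUM i<n. int i) = int n*(int n - 1)" for n by(induction n) (simp_all add: algebra_simps)
  from this[of p] have "(SUM i<p. int i) = int p*int h" by(simp add: h)
  thus ?thesis by(simp add: sum.distrib sum_distrib_right[symmetric] mult.assoc mult.commute)
 qed
 also have "[int p + ?y*int p*int h = int p] (mod (int p)\<^sup>2)" using d2 by(simp add: cong_iff_dvd_diff dvd_mult2)
 finally obtain w where "(SUM i<p. x ^ i) - int p = (int p)\<^sup>2*w" by(auto simp: cong_iff_dvd_diff elim!: dvdE)
 hence S: "(SUM i<p. x ^ i) = int p*(1 + int p*w)" by(simp add: power2_eq_square algebra_simps)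
 have "x ^ p - 1 = int p ^ Suc N*(c*(1 + int p*w))"
  using power_diff_1_eq[of x p] unfolding S by(simp add: c algebra_simps)
 moreover have "~ int p dvd 1 + int p*w"
  using pp by(metis dvd_add_left_iff dvd_triv_left not_prime_unit)
 hence "~ int p dvd c*(1 + int p*w)" using pc prime_dvd_mult_iff[OF pp] by blast
 ultimately show "~ [x ^ p = 1] (mod int p ^ Suc (Suc N))"
  using p0 by(simp add: cong_iff_dvd_diff mult.commute[of _ "int p ^ N"] mult.assoc)
qed

locale padic_unit =
 fixes p :: nat and r :: "nat => int"
 assumes p: "prime p" "odd p" and r: "r:Units (padic_int p)"
  and not_root: "!!n::nat. n > 0 ==> r [^]\<^bsub>padic_int p\<^esub> n ~= \<one>\<^bsub>padic_int p\<^esub>"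
begin

abbreviation Z :: "(nat => int) set" where "Z \<equiv> carrier (padic_int p)"

lemma p_pos: "int p > 0" and p_gt1: "int p > 1" and prime_int: "prime (int p)"
 using p(1) prime_gt_1_nat[of p] by auto

lemma Z_iff: "x:Z <-> (ALL n. 0 <= x n & x n < int p ^ n & x (Suc n) mod int p ^ n = x n)"
 by(auto simp: padic_int_def)

lemma Z_mod:
 assumes "x:Z" "n <= N"
 shows "x N mod int p ^ n = x n"
 using assms(2)
proof (induction N rule: dec_induct)
 case base
 thus ?case using assms by(simp add: Z_iff)
next
 case (step N)
 hence "x (Suc N) mod int p ^ n = x (Suc N) mod int p ^ N mod int p ^ n"
  by(intro mod_mod_cancel[symmetric] le_imp_power_dvd)
 thus ?case using step assms by(simp add: Z_iff)
qed

lemma Z_cong: "x:Z ==> n <= N ==> [x N = x n] (mod int p ^ n)"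
 using Z_mod[of x n N] Z_mod[of x n n] by(simp add: cong_def)

lemma Z_eqI: "x:Z ==> y:Z ==> [x n = y n] (mod int p ^ n) ==> x n = y n"
 using Z_mod[of x n n] Z_mod[of y n n] by(simp add: cong_def)

lemma rZ: "r:Z"
 using r by(simp add: Units_def)

lemma r_coprime: "n >= 1 ==> coprime (r n ^ t) (int p ^ m)"
proof -
 assume n: "n >= 1"
 obtain s where s: "r \<otimes>\<^bsub>padic_int p\<^esub> s = \<one>\<^bsub>padic_int p\<^esub>" using r by(auto simp: Units_def)
 have "(r n * s n) mod int p ^ n = 1 mod int p ^ n" using fun_cong[OF s, of n] by(simp add: padic_int_def)
 hence "[r n * s n = 1] (mod int p ^ n)" by(simp add: cong_def)
 hence "[r n * s n = 1] (mod int p)" using n by(elim cong_dvd_modulus) (simp add: dvd_power)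
 hence "coprime (r n) (int p)" by(metis coprime_iff_invertible_int)
 thus ?thesis by simp
qed

lemma r_pow_cong: "n <= N ==> [r N ^ t = r n ^ t] (mod int p ^ n)"
 by(rule cong_pow[OF Z_cong[OF rZ]])

abbreviation kk :: "nat => nat" where "kk N \<equiv> ord_mod_power p N r"

lemma kk:
 assumes N: "N >= 1"
 shows "[r N ^ d = 1] (mod int p ^ N) <-> kk N dvd d" "0 < kk N"
proof -
 let ?m = "int p ^ N"
 have m1: "1 < ?m" using p_gt1 N by(simp add: one_less_power)
 interpret R: residues ?m "residue_ring ?m" by unfold_locales (use m1 in auto)
 interpret U: group "units_of (residue_ring ?m)" by(rule R.units_group)
 have rb: "0 <= r N" "r N < ?m" "r N mod ?m = r N" using rZ Z_mod[OF rZ, of N N] by(auto simp: Z_iff)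
 have "r N ~= 0"
 proof
  assume "r N = 0"
  thus False using r_coprime[OF N, of 1 N] p_gt1 N by auto
 qed
 hence u: "r N:carrier (units_of (residue_ring ?m))"
  using rb r_coprime[OF N, of 1 N] by(simp add: units_of_carrier R.res_units_eq)
 have "r N [^]\<^bsub>units_of (residue_ring ?m)\<^esub> d = r N ^ d mod ?m" for d :: nat
  using R.pow_cong[of "r N" d] rb(3) R.units_of_pow[of "r N" d] u by(simp add: units_of_carrier)
 hence "r N ^ d mod ?m = 1 <-> kk N dvd d"
  using U.pow_eq_id[OF u, of d] unfolding ord_mod_power_def by(simp add: units_of_one R.res_one_eq)
 thus "[r N ^ d = 1] (mod ?m) <-> kk N dvd d" using m1 by(simp add: cong_def)
 have "finite (carrier (units_of (residue_ring ?m)))" using R.finite_Units by(simp add: units_of_carrier)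
 thus "0 < kk N" using U.ord_ge_1[OF _ u] unfolding ord_mod_power_def by simp
qed

lemma kk_cong: "N >= 1 ==> N <= M ==> [r M ^ d = 1] (mod int p ^ N) <-> kk N dvd d"
 using kk(1)[of N d] r_pow_cong[of N M d] by(metis cong_sym cong_trans)

lemma kk_dvd: "1 <= N ==> N <= M ==> kk N dvd kk M"
proof -
 assume N: "1 <= N" "N <= M"
 have "[r M ^ kk M = 1] (mod int p ^ M)" using kk(1)[of M "kk M"] N by simp
 hence "[r M ^ kk M = 1] (mod int p ^ N)" by(rule cong_dvd_modulus[OF _ le_imp_power_dvd[OF N(2)]])
 thus ?thesis using kk_cong[OF N] by blast
qed

lemma ex_a: "EX a>=1. ~ [r (Suc a) ^ kk a = 1] (mod int p ^ Suc a)"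
proof (rule ccontr)
 assume "~ ?thesis"
 hence c: "kk (Suc a) dvd kk a" if "a >= 1" for a using kk(1)[of "Suc a" "kk a"] that by auto
 have "kk (Suc n) dvd kk 1" for n
 proof (induction n)
  case (Suc n)
  thus ?case using c[of "Suc n"] by(auto intro: dvd_trans)
 qed simp
 hence d: "[r (Suc n) ^ kk 1 = 1] (mod int p ^ Suc n)" for n using kk(1)[of "Suc n"] by simp
 have "(r [^]\<^bsub>padic_int p\<^esub> m) n = r n ^ m mod int p ^ n" for m n
  by(induction m) (simp_all add: padic_int_def mod_mult_right_eq mult.commute)
 hence "(r [^]\<^bsub>padic_int p\<^esub> kk 1) n = \<one>\<^bsub>padic_int p\<^esub> n" for n
  using d[of "n - 1"] by(cases n) (simp_all add: padic_int_def cong_def)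
 thus False using not_root[of "kk 1"] kk(2)[of 1] by auto
qed

definition a :: nat where "a = (SOME a. a >= 1 & ~ [r (Suc a) ^ kk a = 1] (mod int p ^ Suc a))"

lemma a: "a >= 1" "~ [r (Suc a) ^ kk a = 1] (mod int p ^ Suc a)"
 using someI_ex[OF ex_a[unfolded Bex_def]] unfolding a_def by auto

lemma kk_Suc_aux:
 assumes N: "N >= a" and i: "~ [r (Suc N) ^ kk N = 1] (mod int p ^ Suc N)"
 shows "kk (Suc N) = p * kk N & ~ [r (Suc (Suc N)) ^ kk (Suc N) = 1] (mod int p ^ Suc (Suc N))"
proof -
 have N1: "N >= 1" using a N by simp
 let ?x = "r (Suc (Suc N)) ^ kk N"
 have x: "[?x = 1] (mod int p ^ N)" using kk_cong[of N "Suc (Suc N)" "kk N"] N1 by simp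
 have nx: "~ [?x = 1] (mod int p ^ Suc N)" using i r_pow_cong[of "Suc N" "Suc (Suc N)" "kk N"] by(metis cong_sym cong_trans le_SucI order_refl)
 note l = power_cong_one_lift[OF p N1 x nx]
 have d: "kk (Suc N) dvd kk N*q <-> p dvd q" for q
  using kk_cong[of "Suc N" "Suc (Suc N)" "kk N*q"] l(1)[of q] by(simp add: power_mult)
 obtain q where q: "kk (Suc N) = kk N*q" using kk_dvd[of N "Suc N"] N1 by(auto elim: dvdE)
 have "p dvd q" using d[of q] q by simp
 moreover have "kk N*q dvd kk N*p" using d[of p] q by simp
 hence "q dvd p" using kk(2)[OF N1] by simp
 ultimately have "q = p" by(rule dvd_antisym[rotated])
 hence q: "kk (Suc N) = kk N*p" using q by simp
 show ?thesis using l(2) unfolding q power_mult by simp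
qed

lemma kk_Suc: "N >= a ==> kk (Suc N) = p * kk N" and kk_not_cong: "N >= a ==> ~ [r (Suc N) ^ kk N = 1] (mod int p ^ Suc N)"
proof -
 have n: "~ [r (Suc N) ^ kk N = 1] (mod int p ^ Suc N)" if "N >= a" for N
  using that
 proof (induction N rule: dec_induct)
  case (step n)
  show ?case using kk_Suc_aux[OF step(1,3)] by blast
 qed (rule a)
 thus "N >= a ==> ~ [r (Suc N) ^ kk N = 1] (mod int p ^ Suc N)" .
 show "N >= a ==> kk (Suc N) = p * kk N" using kk_Suc_aux n by blast
qed

definition K :: "nat => nat" where "K L = kk (a + L)"

lemma K_pos: "0 < K L" and K_Suc: "K (Suc L) = p*K L"
 using kk(2)[of "a + L"] kk_Suc[of "a + L"] a by(auto simp: K_def)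

lemma K_ge: "L < K L"
proof (induction L)
 case (Suc L)
 have "2*K L <= p*K L" by(rule mult_right_mono[OF prime_ge_2_nat[OF p(1)]]) simp
 thus ?case using Suc unfolding K_Suc by linarith
qed (rule K_pos)

lemma r_cong_iff:
 assumes "a + L <= M" "[u = 0] (mod int p) ==> False"
 shows "[r M ^ s*u = r M ^ t*u] (mod int p ^ (a + L)) <-> [s = t] (mod K L)"
proof -
 have M: "M >= 1" "a + L >= 1" using a assms by auto
 have u: "coprime u (int p ^ (a + L))"
  using assms(2) prime_int by(metis cong_0_iff coprime_commute coprime_power_left_iff prime_imp_coprime)
 have le: "[r M ^ s = r M ^ t] (mod int p ^ (a + L)) <-> [s = t] (mod K L)" if "s <= t" for s t
 proof -
  have "[r M ^ s = r M ^ t] (mod int p ^ (a + L)) <-> [r M ^ s*1 = r M ^ s*r M ^ (t - s)] (mod int p ^ (a + L))"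
   using that by(simp flip: power_add)
  also have "... <-> K L dvd t - s" unfolding cong_mult_lcancel[OF r_coprime[OF M(1)]]
   using kk_cong[OF M(2) assms(1), of "t - s"] by(auto simp: K_def cong_sym_eq)
  also have "... <-> [s = t] (mod K L)" using cong_altdef_nat[OF that, of "K L"] cong_sym_eq[of s t "K L"] by simp
  finally show ?thesis .
 qed
 have "[r M ^ s*u = r M ^ t*u] (mod int p ^ (a + L)) <-> [r M ^ s = r M ^ t] (mod int p ^ (a + L))"
  by(rule cong_mult_rcancel[OF u])
 thus ?thesis using le[of s t] le[of t s] by(metis cong_sym_eq nat_le_linear)
qed

definition Ua :: "int set" where "Ua = {u. 0 <= u & u < int p ^ a & ~ int p dvd u}"
definition orb :: "int => int set" where "orb u = {v:Ua. EX s t. [r a ^ s * v = r a ^ t*u] (mod int p ^ a)}"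
definition reps :: "int set" where "reps = (%u. SOME v. v:orb u) ` Ua"

lemma some_orb: "u:Ua ==> (SOME v. v:orb u):orb u"
 by(rule someI[of _ u]) (auto simp: orb_def intro!: exI[of _ 0])

lemma orb_sub:
 assumes "[r a ^ s * v = r a ^ t*u] (mod int p ^ a)"
 shows "orb v \<subseteq> orb u"
proof
 fix w assume "w:orb v"
 then obtain s' t' where w: "w:Ua" "[r a ^ s'*w = r a ^ t' * v] (mod int p ^ a)" by(auto simp: orb_def)
 have "[r a ^ s*(r a ^ s'*w) = r a ^ s*(r a ^ t' * v)] (mod int p ^ a)" by(rule cong_scalar_left[OF w(2)])
 also have "r a ^ s*(r a ^ t' * v) = r a ^ t'*(r a ^ s * v)" by(simp add: ac_simps)
 also have "[r a ^ t'*(r a ^ s * v) = r a ^ t'*(r a ^ t*u)] (mod int p ^ a)" by(rule cong_scalar_left[OF assms])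
 finally show "w:orb u" using w(1) unfolding orb_def by(simp add: power_add[symmetric] mult.assoc[symmetric]) blast
qed

lemma reps_unique:
 assumes "u:reps" "v:reps" "[r a ^ s * v = r a ^ t*u] (mod int p ^ a)"
 shows "u = v"
proof -
 obtain u' v' where uv: "u':Ua" "v':Ua" "u = (SOME w. w:orb u')" "v = (SOME w. w:orb v')" using assms(1,2) by(auto simp: reps_def)
 have eq: "orb (SOME w. w:orb u) = orb u" if u: "u:Ua" for u
 proof -
  obtain s t where "[r a ^ s*(SOME w. w:orb u) = r a ^ t*u] (mod int p ^ a)" using some_orb[OF u] unfolding orb_def[of u] by auto
  thus ?thesis using orb_sub[of s _ t u] orb_sub[of t u s] cong_sym by blast
 qed
 have "orb u = orb v" using orb_sub[OF assms(3)] orb_sub[OF cong_sym[OF assms(3)]] by(rule equalityI[rotated])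
 hence "orb u' = orb v'" using eq[OF uv(1)] eq[OF uv(2)] uv(3,4) by simp
 thus ?thesis using uv(3,4) by simp
qed

lemma reps_cover: "u:Ua ==> EX v:reps. EX t. [u = r a ^ t * v] (mod int p ^ a)"
proof -
 assume u: "u:Ua"
 define v where "v = (SOME v. v:orb u)"
 obtain s t where st: "[r a ^ s * v = r a ^ t*u] (mod int p ^ a)" using some_orb[OF u] by(auto simp: orb_def v_def)
 define m where "m = kk a - 1"
 have "[r a ^ kk a = 1] (mod int p ^ a)" using kk(1)[OF a(1)] by simp
 hence "[(r a ^ kk a) ^ t*u = 1 ^ t*u] (mod int p ^ a)" by(intro cong_scalar_right cong_pow)
 moreover have "kk a = Suc m" using kk(2)[OF a(1)] by(simp add: m_def)
 hence "(r a ^ kk a) ^ t*u = (r a ^ m) ^ t*(r a ^ t*u)" by(simp add: power_mult_distrib ac_simps)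
 ultimately have "[u = (r a ^ m) ^ t*(r a ^ t*u)] (mod int p ^ a)" by(simp add: cong_sym)
 from cong_trans[OF this cong_scalar_left[OF cong_sym[OF st]]]
 have "[u = r a ^ (m*t + s) * v] (mod int p ^ a)" by(simp add: power_add power_mult mult.assoc)
 moreover have "v:reps" using u by(auto simp: reps_def v_def)
 ultimately show ?thesis by blast
qed

lemma reps: "reps \<subseteq> Ua" "finite reps" "reps ~= {}"
proof -
 show "reps \<subseteq> Ua" using some_orb by(auto simp: reps_def orb_def)
 have "finite Ua" by(rule finite_subset[of _ "{0..<int p ^ a}"]) (auto simp: Ua_def)
 thus "finite reps" by(simp add: reps_def)
 have "1:Ua" using p_gt1 one_less_power[OF p_gt1, of a] a by(auto simp: Ua_def)
 thus "reps ~= {}" by(auto simp: reps_def)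
qed

definition c :: nat where "c = card reps"
definition rep :: "nat => int" where "rep = (SOME f. bij_betw f {0..<c} reps)"

lemma c_pos: "c > 0" and rep_bij: "bij_betw rep {0..<c} reps"
proof -
 show "c > 0" using reps by(auto simp: c_def card_gt_0_iff)
 show "bij_betw rep {0..<c} reps" unfolding rep_def c_def by(rule someI_ex[OF ex_bij_betw_nat_finite[OF reps(2)]])
qed

lemma rep: "rep (i mod c):Ua"
 using rep_bij reps(1) c_pos by(auto simp: bij_betw_def)

text \<open>The points \<open>x = p ^ j * u\<close> with \<open>j = i div c\<close> and \<open>u\<close> congruent to \<open>r ^ t * rep (i mod c)\<close> modulo \<open>p ^ (a + L)\<close>.\<close>

definition cyl :: "nat => nat => nat => (nat => int) set" where
 "cyl i L t = {x:Z. [x (i div c + (a + L)) = int p ^ (i div c)*(r (i div c + (a + L)) ^ t*rep (i mod c))] (mod int p ^ (i div c + (a + L)))}"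

lemma cong_p_cancel: "[int p ^ j*x = int p ^ j*y] (mod int p ^ (j + n)) <-> [x = y] (mod int p ^ n)"
 using p_pos by(simp add: cong_iff_dvd_diff power_add right_diff_distrib[symmetric])

lemma rep_coprime: "~ int p dvd r (i div c + (a + L)) ^ t*rep (i mod c)"
proof -
 have "coprime (r (i div c + (a + L)) ^ t) (int p ^ 1)" by(rule r_coprime) (use a in simp)
 hence "~ int p dvd r (i div c + (a + L)) ^ t" using p_gt1 by(metis coprime_absorb_right not_prime_unit power_one_right prime_int)
 thus ?thesis using rep prime_int by(auto simp: Ua_def prime_dvd_mult_iff)
qed

lemma cyl_val: "x:cyl i L t ==> int p ^ n dvd x m <-> n <= i div c" if "n <= m" "n <= i div c + 1"
proof -
 assume x: "x:cyl i L t"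
 let ?j = "i div c" and ?u = "r (i div c + (a + L)) ^ t*rep (i mod c)"
 have xZ: "x:Z" using x by(simp add: cyl_def)
 have nle: "n <= ?j + (a + L)" using that a by linarith
 have "[x m = x (?j + (a + L))] (mod int p ^ n)" using Z_cong[OF xZ that(1)] Z_cong[OF xZ nle] by(metis cong_sym cong_trans)
 also have "[x (?j + (a + L)) = int p ^ ?j*?u] (mod int p ^ n)"
  using x by(auto simp: cyl_def intro: cong_dvd_modulus le_imp_power_dvd[OF nle])
 finally have "int p ^ n dvd x m <-> int p ^ n dvd int p ^ ?j*?u" by(rule cong_dvd_iff)
 also have "... <-> n <= ?j"
 proof
  assume d: "int p ^ n dvd int p ^ ?j*?u"
  show "n <= ?j"
  proof (rule ccontr)
   assume "~ n <= ?j"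
   hence "n = Suc ?j" using that by simp
   thus False using d rep_coprime[of i L t] p_pos by simp
  qed
 qed (auto intro: dvd_mult2 le_imp_power_dvd)
 finally show ?thesis .
qed

lemma cyl_disjoint:
 assumes "x:cyl i L s" "x:cyl i' L t"
 shows "i = i' & [s = t] (mod K L)"
proof -
 have j: "i div c = i' div c"
 proof (rule ccontr)
  assume "i div c ~= i' div c"
  then consider "Suc (i div c) <= i' div c" | "Suc (i' div c) <= i div c" by linarith
  thus False
   using cyl_val[OF _ _ assms(1), of "Suc (i div c)" "Suc (i div c)"] cyl_val[OF _ _ assms(2), of "Suc (i div c)" "Suc (i div c)"]
    cyl_val[OF _ _ assms(1), of "Suc (i' div c)" "Suc (i' div c)"] cyl_val[OF _ _ assms(2), of "Suc (i' div c)" "Suc (i' div c)"]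
   by cases auto
 qed
 let ?j = "i' div c"
 let ?M = "?j + (a + L)"
 have "[int p ^ ?j*(r ?M ^ s*rep (i mod c)) = int p ^ ?j*(r ?M ^ t*rep (i' mod c))] (mod int p ^ ?M)"
  using assms j unfolding cyl_def by(auto intro: cong_trans[OF cong_sym])
 hence e: "[r ?M ^ s*rep (i mod c) = r ?M ^ t*rep (i' mod c)] (mod int p ^ (a + L))" by(simp only: cong_p_cancel)
 have aM: "a <= ?M" by simp
 have "[r a ^ s*rep (i mod c) = r a ^ t*rep (i' mod c)] (mod int p ^ a)"
 proof -
  have "[r ?M ^ s*rep (i mod c) = r ?M ^ t*rep (i' mod c)] (mod int p ^ a)" by(rule cong_dvd_modulus[OF e]) (simp add: power_add)
  thus ?thesis using cong_scalar_right[OF r_pow_cong[OF aM, of s], of "rep (i mod c)"] cong_scalar_right[OF r_pow_cong[OF aM, of t], of "rep (i' mod c)"]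
   by(metis cong_sym cong_trans)
 qed
 moreover have "rep (i mod c):reps" "rep (i' mod c):reps" using rep_bij c_pos by(auto simp: bij_betw_def)
 ultimately have "rep (i' mod c) = rep (i mod c)" using reps_unique by blast
 hence "i mod c = i' mod c" using rep_bij c_pos by(auto simp: bij_betw_def inj_on_def)
 hence ii: "i = i'" using j by(metis div_mult_mod_eq)
 have "[s = t] (mod K L)" using e unfolding ii
  by(subst r_cong_iff[symmetric, where M = ?M and u = "rep (i' mod c)"]) (use rep[of i'] in "auto simp: Ua_def cong_0_iff")
 thus ?thesis using ii by simp
qed

lemma cyl_cong:
 assumes "[s = t] (mod K L)"
 shows "cyl i L s = cyl i L t"
proof -
 let ?M = "i div c + (a + L)"
 have "[r ?M ^ s*rep (i mod c) = r ?M ^ t*rep (i mod c)] (mod int p ^ (a + L))"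
  by(subst r_cong_iff) (use assms rep[of i] in "auto simp: Ua_def cong_0_iff")
 hence "[int p ^ (i div c)*(r ?M ^ s*rep (i mod c)) = int p ^ (i div c)*(r ?M ^ t*rep (i mod c))] (mod int p ^ ?M)"
  by(simp only: cong_p_cancel)
 thus ?thesis unfolding cyl_def by(auto intro: cong_trans cong_sym)
qed

lemma cyl_cover:
 assumes x: "x:Z" "x j = 0" "x (Suc j) ~= 0"
 shows "EX i t. i div c = j & x:cyl i 0 t"
proof -
 have "int p ^ j dvd x (j + a)" using Z_mod[OF x(1), of j "j + a"] x(2) by(auto simp: mod_eq_0_iff_dvd)
 then obtain w where w: "x (j + a) = int p ^ j*w" by(auto elim: dvdE)
 have "~ int p dvd w"
 proof
  assume "int p dvd w"
  hence "int p ^ Suc j dvd x (j + a)" unfolding w by(auto elim!: dvdE)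
  thus False using Z_mod[OF x(1), of "Suc j" "j + a"] x(3) a by auto
 qed
 moreover have "int p dvd int p ^ a" using a by(simp add: dvd_power)
 ultimately have "w mod int p ^ a:Ua" using p_pos by(auto simp: Ua_def dvd_mod_iff)
 then obtain v t where v: "v:reps" "[w mod int p ^ a = r a ^ t * v] (mod int p ^ a)" using reps_cover by blast
 have "v:rep ` {0..<c}" using v(1) rep_bij by(simp add: bij_betw_def)
 then obtain b where b: "b < c" "v = rep b" by auto
 have "[w = r (j + a) ^ t * v] (mod int p ^ a)"
  using v(2) cong_scalar_right[OF r_pow_cong[of a "j + a" t], of v] by(metis cong_mod_left cong_sym cong_trans le_add2)
 hence "x:cyl (j*c + b) 0 t" using x(1) b w by(simp add: cyl_def cong_p_cancel)
 moreover have "(j*c + b) div c = j" using b by simp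
 ultimately show ?thesis by blast
qed

lemma cyl_Suc:
 shows "x:cyl i (Suc L) t ==> x:cyl i L t"
  and "x:cyl i L t ==> EX j<p. x:cyl i (Suc L) (t + j*K L)"
proof -
 let ?j = "i div c"
 let ?N = "a + L"
 let ?M = "?j + ?N" and ?q = "rep (i mod c)"
 have rr: "[int p ^ ?j*(r (Suc ?M) ^ t*?q) = int p ^ ?j*(r ?M ^ t*?q)] (mod int p ^ ?M)" for t
  by(intro cong_scalar_left cong_scalar_right r_pow_cong) simp
 show "x:cyl i L t" if x: "x:cyl i (Suc L) t"
 proof -
  have "[x (Suc ?M) = int p ^ ?j*(r (Suc ?M) ^ t*?q)] (mod int p ^ ?M)"
   using x by(auto simp: cyl_def intro: cong_dvd_modulus)
  thus ?thesis using x rr[of t] Z_cong[of x ?M "Suc ?M"] unfolding cyl_def by(auto intro: cong_trans cong_sym)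
 qed
 assume x: "x:cyl i L t"
 hence xZ: "x:Z" by(simp add: cyl_def)
 let ?u = "r (Suc ?M) ^ t*?q"
 have "[x (Suc ?M) = int p ^ ?j*?u] (mod int p ^ ?M)"
  using x rr[of t] Z_cong[OF xZ, of ?M "Suc ?M"] unfolding cyl_def by(auto intro: cong_trans cong_sym)
 then obtain y where y: "x (Suc ?M) - int p ^ ?j*?u = int p ^ ?M*y" by(auto simp: cong_iff_dvd_diff elim: dvdE)
 have "[r (Suc ?M) ^ kk ?N = 1] (mod int p ^ ?N)" using kk_cong[of ?N "Suc ?M" "kk ?N"] a by simp
 then obtain z where z: "r (Suc ?M) ^ kk ?N - 1 = int p ^ ?N*z" by(auto simp: cong_iff_dvd_diff elim: dvdE)
 have pz: "~ int p dvd z"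
 proof
  assume "int p dvd z"
  hence "[r (Suc ?M) ^ kk ?N = 1] (mod int p ^ Suc ?N)" unfolding cong_iff_dvd_diff z by(auto elim!: dvdE)
  thus False using kk_not_cong[of ?N] cong_trans[OF cong_sym[OF r_pow_cong[of "Suc ?N" "Suc ?M" "kk ?N"]]] by simp
 qed
 have pu: "~ int p dvd ?u" using rep_coprime[of i "Suc L" t] by simp
 hence "coprime (?u*z) (int p)" using pz prime_int by(metis coprime_commute prime_dvd_mult_iff prime_imp_coprime)
 then obtain b where b: "[?u*z*b = 1] (mod int p)" using cong_solve_coprime_int by blast
 define n where "n = nat ((b*y) mod int p)"
 have n: "int n = (b*y) mod int p" "n < p" using p_pos by(auto simp: n_def nat_less_iff)
 have "[?u*z*int n = ?u*z*(b*y)] (mod int p)" unfolding n(1) by(intro cong_scalar_left) simp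
 also have "?u*z*(b*y) = ?u*z*b*y" by simp
 also have "[?u*z*b*y = 1*y] (mod int p)" by(rule cong_scalar_right[OF b])
 finally have uz: "[int n*z*?u = y] (mod int p)" by(simp add: ac_simps)
 have "[r (Suc ?M) ^ (n*K L) = 1 + int n*(int p ^ ?N*z)] (mod int p ^ Suc ?N)"
 proof -
  have "int p ^ Suc ?N dvd (int p ^ ?N*z)\<^sup>2"
   using a le_imp_power_dvd[of "Suc ?N" "2*?N" "int p"] by(simp add: power_mult_distrib power_mult[symmetric] mult.commute dvd_mult)
  moreover have "r (Suc ?M) ^ (n*K L) = (1 + int p ^ ?N*z) ^ n" unfolding z[symmetric] by(simp add: K_def power_mult[symmetric] mult.commute)
  ultimately show ?thesis using cong_dvd_modulus[OF power_cong_first_order] by metis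
 qed
 hence "[r (Suc ?M) ^ (n*K L)*?u = (1 + int n*(int p ^ ?N*z))*?u] (mod int p ^ Suc ?N)" by(rule cong_scalar_right)
 also have "(1 + int n*(int p ^ ?N*z))*?u = ?u + int p ^ ?N*(int n*z*?u)" by(simp add: algebra_simps)
 also have "[?u + int p ^ ?N*(int n*z*?u) = ?u + int p ^ ?N*y] (mod int p ^ Suc ?N)"
 proof (rule cong_add[OF cong_refl])
  show "[int p ^ ?N*(int n*z*?u) = int p ^ ?N*y] (mod int p ^ Suc ?N)" using cong_cmult_leftI[OF uz, of "int p ^ ?N"] by(simp add: mult.commute)
 qed
 finally have "[int p ^ ?j*(r (Suc ?M) ^ (n*K L)*?u) = int p ^ ?j*(?u + int p ^ ?N*y)] (mod int p ^ (?j + Suc ?N))"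
  unfolding cong_p_cancel .
 moreover have "int p ^ ?j*(?u + int p ^ ?N*y) = x (Suc ?M)" using y by(simp add: power_add algebra_simps)
 ultimately have "x:cyl i (Suc L) (t + n*K L)"
  using xZ by(simp add: cyl_def power_add cong_sym_eq ac_simps)
 thus "EX j<p. x:cyl i (Suc L) (t + j*K L)" using n(2) by blast
qed

lemma cyl_shift: "x:Z ==> x \<otimes>\<^bsub>padic_int p\<^esub> r:cyl i L (Suc t) <-> x:cyl i L t" and mult_rZ: "x:Z ==> x \<otimes>\<^bsub>padic_int p\<^esub> r:Z"
proof -
 assume x: "x:Z"
 show z: "x \<otimes>\<^bsub>padic_int p\<^esub> r:Z"
 proof -
  have "(x (Suc n)*r (Suc n)) mod int p ^ Suc n mod int p ^ n = (x n*r n) mod int p ^ n" for n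
   using cong_mult[OF Z_cong[OF x, of n "Suc n"] Z_cong[OF rZ, of n "Suc n"]] mod_mod_cancel[of "int p ^ n" "int p ^ Suc n"] by(simp add: cong_def)
  thus ?thesis using p_pos unfolding Z_iff by(simp add: padic_int_def)
 qed
 let ?M = "i div c + (a + L)"
 have "coprime (r ?M) (int p ^ ?M)" using r_coprime[of ?M 1 ?M] a by simp
 hence "[r ?M*x ?M = r ?M*(int p ^ (i div c)*(r ?M ^ t*rep (i mod c)))] (mod int p ^ ?M) <->
   [x ?M = int p ^ (i div c)*(r ?M ^ t*rep (i mod c))] (mod int p ^ ?M)" by(rule cong_mult_lcancel)
 thus "x \<otimes>\<^bsub>padic_int p\<^esub> r:cyl i L (Suc t) <-> x:cyl i L t"
  using x z unfolding cyl_def by(simp add: padic_int_def ac_simps)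
qed

lemma cyl_nonempty: "cyl i L t ~= {}"
proof -
 define x where "x n = (int p ^ (i div c)*(r n ^ t*rep (i mod c))) mod int p ^ n" for n
 have "x (Suc n) mod int p ^ n = x n" for n
 proof -
  have "[int p ^ (i div c)*(r (Suc n) ^ t*rep (i mod c)) = int p ^ (i div c)*(r n ^ t*rep (i mod c))] (mod int p ^ n)"
   by(intro cong_scalar_left cong_scalar_right r_pow_cong) simp
  thus ?thesis using mod_mod_cancel[of "int p ^ n" "int p ^ Suc n"] by(simp add: x_def cong_def)
 qed
 hence "x:cyl i L t" using p_pos by(simp add: cyl_def Z_iff) (simp add: x_def)
 thus ?thesis by blast
qed

end

definition ind :: "'x set => 'x => complex" where "ind S x = (if x:S then 1 else 0)"

context padic_unit
begin

lemma continuous_coordinate: "cont Z (%x. h (x N) :: complex)"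
proof -
 have "cont Z (%x. x N)" by(rule continuous_on_product_then_coordinatewise[OF continuous_on_id])
 thus ?thesis using continuous_on_compose2[OF Topological_Spaces.continuous_on_discrete[of UNIV h]] by blast
qed

lemma ball_continuous: "cont Z (ind {x:Z. x N = b})"
 by(rule continuous_on_eq[OF continuous_coordinate[of "%y. if y = b then 1 else 0" N]]) (simp add: ind_def)

lemma cyl_continuous: "cont Z (ind (cyl i L t))"
 by(rule continuous_on_eq[OF continuous_coordinate[of "%y. if [y = int p ^ (i div c)*(r (i div c + (a + L)) ^ t*rep (i mod c))] (mod int p ^ (i div c + (a + L))) then 1 else 0"]])
  (auto simp: ind_def cyl_def)

lemma compact_Z: "compact Z"
proof -
 have "compactin (product_topology (%i. euclidean) UNIV) (PiE UNIV (%n. {0..<int p ^ n}))"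
  unfolding compactin_PiE by(intro disjI2) (auto intro: finite_imp_compact)
 hence c: "compact (PiE UNIV (%n. {0..<int p ^ n}))" by(simp add: euclidean_product_topology)
 have "closed {x. (x (Suc n) :: int) mod int p ^ n = x n}" for n
 proof -
  have "open {x. (x (Suc n) :: int) mod int p ^ n ~= x n}"
  proof -
   have "open ((%x. (x :: nat => int) N) -` S)" for N S
    by(rule open_vimage[OF open_discrete]) (rule continuous_on_product_then_coordinatewise[OF continuous_on_id])
   hence "open ((%x. x (Suc n)) -` {u} \<inter> (%x. (x :: nat => int) n) -` {v})" for u v by(intro open_Int)
   moreover have "{x. (x (Suc n) :: int) mod int p ^ n ~= x n} = (\<Union>(u,v)\<in>{(u,v). u mod int p ^ n ~= v}. (%x. x (Suc n)) -` {u} \<inter> (%x. (x :: nat => int) n) -` {v})"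
    by auto
   ultimately show ?thesis by(auto intro!: open_UN)
  qed
  thus ?thesis unfolding closed_def by(simp add: Collect_neg_eq[symmetric])
 qed
 hence "closed (\<Inter>n. {x. (x (Suc n) :: int) mod int p ^ n = x n})" by(intro closed_INT) simp
 moreover have "Z = PiE UNIV (%n. {0..<int p ^ n}) \<inter> (\<Inter>n. {x. x (Suc n) mod int p ^ n = x n})"
  by(auto simp: Z_iff PiE_iff)
 ultimately show ?thesis using compact_Int_closed[OF c] by simp
qed

lemma uniform_modulus:
 fixes f :: "(nat => int) => complex"
 assumes f: "cont Z f" and e: "e > 0"
 shows "EX N. ALL x:Z. ALL y:Z. x N = y N --> cmod (f x - f y) < e"
proof -
 have "EX N. ALL y:Z. y N = x N --> cmod (f y - f x) < e / 2" if x: "x:Z" for x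
 proof -
  obtain U where U: "open U" "x:U" "ALL y:U \<inter> Z. dist (f y) (f x) < e / 2"
   using f e x unfolding continuous_on_topological by(metis IntE centre_in_ball dist_commute half_gt_zero mem_ball open_ball)
  obtain X where X: "x:PiE UNIV X" "!!i. open (X i)" "finite {i. X i ~= UNIV}" "PiE UNIV X \<subseteq> U"
   using product_topology_open_contains_basis[of "%_. euclidean" UNIV U x] U(1,2) by(auto simp: open_fun_def)
  obtain N where N: "!!i. X i ~= UNIV ==> i <= N" using X(3) by(metis (mono_tags, lifting) finite_nat_set_iff_bounded_le mem_Collect_eq)
  have "y:U" if y: "y:Z" "y N = x N" for y
  proof -
   have "y i:X i" for i
   proof (cases "X i = UNIV")
    case False
    hence "y i = x i" using Z_mod[OF y(1) N] Z_mod[OF x N] y(2) by metis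
    thus ?thesis using X(1) by(auto simp: PiE_iff)
   qed simp
   thus ?thesis using X(4) by(auto simp: PiE_iff)
  qed
  thus ?thesis using U(3) by(intro exI[of _ N]) (auto simp: dist_norm)
 qed
 then obtain N where N: "!!x y. x:Z ==> y:Z ==> y (N x) = x (N x) ==> cmod (f y - f x) < e / 2" by metis
 have op: "open {y. y (N x) = x (N x)}" for x :: "nat => int"
  using open_vimage[OF open_discrete[of "{x (N x)}"] continuous_on_product_then_coordinatewise[OF continuous_on_id], of "N x"] by(simp add: vimage_def)
 obtain D where D: "D \<subseteq> Z" "finite D" "Z \<subseteq> (\<Union>x\<in>D. {y. y (N x) = x (N x)})"
  by(rule compactE_image[OF compact_Z, of Z "%x. {y. y (N x) = x (N x)}"]) (use op in auto)
 obtain M where M: "!!x. x:D ==> N x <= M" using D(2) by(metis finite_imageI finite_nat_set_iff_bounded_le imageI)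
 show ?thesis
 proof (intro exI[of _ M] ballI impI)
  fix x y assume xy: "x:Z" "y:Z" "x M = y M"
  obtain z where z: "z:D" "x (N z) = z (N z)" using D(3) xy(1) by blast
  hence "y (N z) = z (N z)" using Z_mod[OF xy(1) M] Z_mod[OF xy(2) M] xy(3) by metis
  hence "cmod (f x - f z) < e / 2" "cmod (f y - f z) < e / 2" using N z D(1) xy by blast+
  thus "cmod (f x - f y) < e" using norm_triangle_ineq4[of "f x - f z" "f y - f z"] by simp
 qed
qed

end

locale zp_system = padic_unit p r for p r +
 fixes m :: "((nat => int) => complex) => 'b::cstar_alg" and V :: 'b
 assumes V: "is_unitary V"
  and m_add: "cont Z f ==> cont Z g ==> m (%x. f x + g x) = m f + m g"
  and m_mult: "cont Z f ==> cont Z g ==> m (%x. f x*g x) = m f*m g"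
  and m_cnj: "cont Z f ==> m (%x. cnj (f x)) = star (m f)"
  and m_const: "m (%_. z) = cx z"
  and m_cong: "(!!x. x:Z ==> f x = g x) ==> m f = m g"
  and m_inj: "cont Z f ==> m f = 0 ==> x:Z ==> f x = 0"
  and m_shift: "cont Z f ==> V*m (%x. f (x \<otimes>\<^bsub>padic_int p\<^esub> r)) = m f*V"
  and generate: "closed_calg C ==> V:C ==> (!!f. cont Z f ==> m f:C) ==> w:C"
begin

definition e :: "nat => nat => nat => 'b" where "e i L t = m (ind (cyl i L t))"

lemma m_sum: "(!!i. i:I ==> cont Z (f i)) ==> m (%x. SUM i:I. f i x) = (SUM i:I. m (f i))"
 by(induction I rule: infinite_finite_induct) (simp_all add: m_add m_const continuous_on_sum)

lemma m_cmult: "cont Z f ==> m (%x. z*f x) = cx z*m f"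
 by(simp add: m_mult m_const)

lemma m_diff: "cont Z f ==> cont Z g ==> m (%x. f x - g x) = m f - m g"
 using m_add[of f "%x. (- 1)*g x"] m_cmult[of g "- 1"] by(simp add: cx_minus continuous_on_minus)

text \<open>A real function \<open>g\<close> with values in \<open>[-1, 1]\<close> is the real part of the unitary \<open>g + i sqrt (1 - g\<^sup>2)\<close>.\<close>

lemma m_real_contractive:
 assumes g: "cont Z g" "!!x. x:Z ==> \<bar>g x\<bar> <= (1 :: real)"
 shows "norm (m (%x. of_real (g x))) <= 1"
proof -
 define u where "u x = Complex (g x) (sqrt (1 - (g x)\<^sup>2))" for x
 have cu: "cont Z u"
  unfolding u_def Complex_eq by(intro continuous_intros g(1))
 have cc: "cont Z (%x. cnj (u x))" by(intro continuous_on_cnj cu)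
 have uu: "u x*cnj (u x) = 1" if "x:Z" for x
 proof -
  have "(g x)\<^sup>2 <= 1" using g(2)[OF that] by(simp add: abs_square_le_1)
  thus ?thesis unfolding complex_mult_cnj u_def by(simp add: real_sqrt_pow2)
 qed
 have cg: "cont Z (%x. complex_of_real (g x))" using g(1) by(intro continuous_intros)
 have "m u * star (m u) = 1" "star (m u)*m u = 1"
  unfolding m_cnj[OF cu, symmetric] m_mult[OF cu cc, symmetric] m_mult[OF cc cu, symmetric]
  using m_const[of 1] m_cong[of "%x. u x*cnj (u x)" "%_. 1"] m_cong[of "%x. cnj (u x)*u x" "%_. 1"] uu by(simp_all add: mult.commute)
 hence nu: "norm (m u) = 1" by(intro is_unitary_norm) (simp add: is_unitary_def)
 have "m (%x. 2 * of_real (g x)) = m u + star (m u)"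
  unfolding m_cnj[OF cu, symmetric] m_add[OF cu cc, symmetric] by(rule m_cong) (simp add: u_def complex_eq_iff)
 hence "norm (cx 2*m (%x. of_real (g x))) <= 1 + 1"
  using norm_triangle_ineq[of "m u" "star (m u)"] nu by(simp add: m_cmult[OF cg, of 2])
 thus ?thesis by(simp add: norm_cx_mult)
qed

lemma m_bound:
 assumes f: "cont Z f" "!!x. x:Z ==> cmod (f x) <= eps" and e: "eps > 0"
 shows "norm (m f) <= 2*eps"
proof -
 define g h where "g x = Re (f x) / eps" and "h x = Im (f x) / eps" for x
 have c: "cont Z g" "cont Z h"
  unfolding g_def h_def using f(1) e by(auto intro!: continuous_intros)
 have b: "\<bar>g x\<bar> <= 1" "\<bar>h x\<bar> <= 1" if "x:Z" for x
  using f(2)[OF that] abs_Re_le_cmod[of "f x"] abs_Im_le_cmod[of "f x"] e by(auto simp: g_def h_def divide_le_eq)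
 have cc: "cont Z (%x. complex_of_real (g x))" "cont Z (%x. complex_of_real (h x))"
  using c by(auto intro!: continuous_intros)
 have "m f = m (%x. of_real eps * of_real (g x) + \<i> * of_real eps * of_real (h x))"
  by(rule m_cong) (use e in "simp add: g_def h_def complex_eq_iff")
 also have "... = cx (of_real eps)*m (%x. of_real (g x)) + cx (\<i> * of_real eps)*m (%x. of_real (h x))"
  using cc by(subst m_add) (auto intro!: continuous_intros simp: m_cmult)
 also have "norm ... <= eps*norm (m (%x. of_real (g x))) + eps*norm (m (%x. of_real (h x)))"
  by(rule order_trans[OF norm_triangle_ineq]) (use e in "simp add: norm_cx_mult norm_mult")
 also have "... <= eps*1 + eps*1"
  by(intro add_mono mult_left_mono m_real_contractive c b) (use e in auto)
 finally show ?thesis by simp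
qed

lemma cyl_le: "x:cyl i 0 t ==> EX t<K L. x:cyl i L t"
proof -
 assume x: "x:cyl i 0 t"
 have "EX t. x:cyl i L t" using x by(induction L) (use cyl_Suc(2) in blast)+
 then obtain t where "x:cyl i L t" ..
 hence "x:cyl i L (t mod K L)" using cyl_cong[of "t mod K L" t L i] by simp
 thus ?thesis using K_pos[of L] by(intro exI[of _ "t mod K L"]) simp
qed

lemma ball_mem:
 assumes C: "closed_calg C" "!!i L t. e i L t:C"
 shows "m (ind {x:Z. x N = b}):C"
proof -
 have Ca: "closed_alg C" and cx: "cx z:C" for z using C(1) by(auto simp: closed_calg_def)
 have nz: "m (ind {x:Z. x N = b}):C" if b: "b ~= 0" for b
 proof (cases "0 <= b & b < int p ^ N")
  case False
  have "m (ind {x:Z. x N = b}) = m (%_. 0)" by(rule m_cong) (use False in "auto simp: ind_def Z_iff")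
  thus ?thesis by(simp add: m_const closed_algD(8)[OF Ca])
 next
  case True
  define B where "B = {x:Z. x N = b}"
  define j where "j = (LEAST n. b mod int p ^ Suc n ~= 0)"
  have N: "N = Suc (N - 1)" using True b by(cases N) auto
  have "b mod int p ^ Suc (N - 1) ~= 0" using True b unfolding N[symmetric] by simp
  hence j: "b mod int p ^ Suc j ~= 0" "j <= N - 1" unfolding j_def by(rule LeastI, rule Least_le)
  have j0: "b mod int p ^ j = 0" 
  proof (cases j)
   case (Suc n)
   hence "n < j" by simp
   hence "b mod int p ^ Suc n = 0" using not_less_Least[of n "%n. b mod int p ^ Suc n ~= 0"] unfolding j_def by blast
   thus ?thesis using Suc by simp
  qed simp
  define P where "P = {(i,t). i div c = j & t < K N & cyl i N t \<subseteq> B}"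
  have fP: "finite P"
  proof (rule finite_subset)
   have "i < Suc j*c" if "i div c = j" for i using that c_pos by(metis div_less_iff_less_mult lessI)
   thus "P \<subseteq> {..<Suc j*c} \<times> {..<K N}" unfolding P_def by auto
  qed simp
  have "ind B x = (SUM q:P. ind (cyl (fst q) N (snd q)) x)" if x: "x:Z" for x
  proof (cases "x:B")
   case False
   hence "(SUM q:P. ind (cyl (fst q) N (snd q)) x) = 0" by(intro sum.neutral) (auto simp: P_def ind_def)
   thus ?thesis using False by(simp add: ind_def)
  next
   case xB: True
   have "x n = b mod int p ^ n" if "n <= N" for n using Z_mod[OF x that] xB by(simp add: B_def)
   hence "x j = 0" "x (Suc j) ~= 0" using j j0 N by auto
   from cyl_cover[OF x this] obtain i t where it: "i div c = j" "t < K N" "x:cyl i N t" using cyl_le by blast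
   have "y N = b" if y: "y:cyl i N t" for y
   proof -
    let ?M = "i div c + (a + N)"
    have yZ: "y:Z" using y by(simp add: cyl_def)
    have "[y ?M = x ?M] (mod int p ^ ?M)" using y it(3) unfolding cyl_def by(auto intro: cong_trans cong_sym)
    hence "y ?M = x ?M" by(rule Z_eqI[OF yZ x])
    thus ?thesis using Z_mod[OF yZ, of N ?M] Z_mod[OF x, of N ?M] xB by(simp add: B_def)
   qed
   hence "(i,t):P" using it by(auto simp: P_def B_def cyl_def)
   moreover have "ind (cyl (fst q) N (snd q)) x = (if q = (i,t) then 1 else 0)" if "q:P" for q
   proof (cases "x:cyl (fst q) N (snd q)")
    case True
    hence "fst q = i" "[snd q = t] (mod K N)" using cyl_disjoint[OF True it(3)] by auto
    hence "q = (i,t)" using that it(2) by(auto simp: P_def cong_def prod_eq_iff)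
    thus ?thesis using it(3) by(simp add: ind_def)
   qed (use it(3) in "auto simp: ind_def")
   ultimately have "(SUM q:P. ind (cyl (fst q) N (snd q)) x) = 1" using fP by simp
   thus ?thesis using xB by(simp add: ind_def)
  qed
  hence "m (ind B) = m (%x. SUM q:P. ind (cyl (fst q) N (snd q)) x)" by(rule m_cong)
  also have "... = (SUM q:P. e (fst q) N (snd q))" by(subst m_sum) (simp_all add: cyl_continuous e_def)
  finally show ?thesis unfolding B_def using C(2) by(simp add: closed_algD(11)[OF Ca])
 qed
 show ?thesis
 proof (cases "b = 0")
  case True
  have "ind {x:Z. x N = 0} x = 1 - (SUM b:{1..<int p ^ N}. ind {x:Z. x N = b} x)" if "x:Z" for x
  proof -
   have "(SUM b:{1..<int p ^ N}. ind {x:Z. x N = b} x) = (SUM b:{1..<int p ^ N}. if b = x N then 1 else 0)"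
    by(intro sum.cong refl) (use that in "auto simp: ind_def")
   also have "... = (if x N = 0 then 0 else 1)" using Z_iff[THEN iffD1, OF that, THEN spec, of N] by(simp; linarith)
   finally show ?thesis using that by(simp add: ind_def)
  qed
  hence "m (ind {x:Z. x N = 0}) = m (%x. 1 - (SUM b:{1..<int p ^ N}. ind {x:Z. x N = b} x))" by(rule m_cong)
  also have "... = 1 - (SUM b:{1..<int p ^ N}. m (ind {x:Z. x N = b}))"
   using m_diff[of "%_. 1"] m_const[of 1] by(simp add: m_sum ball_continuous continuous_on_sum)
  also have "...:C" by(intro closed_algD(9,11)[OF Ca] closed_algD(2)[OF Ca] nz) simp
  finally show ?thesis using True by simp
 qed (rule nz)
qed

lemma m_mem:
 assumes C: "closed_calg C" "!!i L t. e i L t:C" and f: "cont Z f"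
 shows "m f:C"
proof -
 have Ca: "closed_alg C" and cx: "cx z:C" for z using C(1) by(auto simp: closed_calg_def)
 have "EX w:C. dist w (m f) < eps" if e: "eps > 0" for eps
 proof -
  obtain N where N: "!!x y. x:Z ==> y:Z ==> x N = y N ==> cmod (f x - f y) < eps / 4" using uniform_modulus[OF f, of "eps / 4"] e by auto
  define pt where "pt b = (SOME x. x:Z & x N = b)" for b
  define g where "g x = (SUM b:{0..<int p ^ N}. f (pt b)*ind {x:Z. x N = b} x)" for x
  have cg: "cont Z g" unfolding g_def by(intro continuous_on_sum continuous_on_mult continuous_on_const ball_continuous)
  have gx: "g x = f (pt (x N))" if "x:Z" for x
  proof -
   have "g x = (SUM b:{0..<int p ^ N}. if b = x N then f (pt (x N)) else 0)"
    unfolding g_def by(intro sum.cong refl) (use that in "auto simp: ind_def")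
   thus ?thesis using that by(simp add: Z_iff)
  qed
  have "cmod (g x - f x) <= eps / 4" if "x:Z" for x
  proof -
   have "pt (x N):Z & pt (x N) N = x N" unfolding pt_def by(rule someI[of _ x]) (use that in simp)
   thus ?thesis using N[of "pt (x N)" x] that by(simp add: gx less_imp_le)
  qed
  hence "norm (m (%x. g x - f x)) <= 2*(eps / 4)" by(intro m_bound continuous_on_diff cg f) (use e in auto)
  hence "dist (m g) (m f) < eps" using e by(simp add: m_diff[OF cg f] dist_norm)
  moreover have "m g = (SUM b:{0..<int p ^ N}. cx (f (pt b))*m (ind {x:Z. x N = b}))"
   unfolding g_def[abs_def] by(subst m_sum) (simp_all add: m_cmult[OF ball_continuous] continuous_on_mult ball_continuous)
  hence "m g:C" using cx ball_mem[OF C] by(simp add: closed_algD(4,11)[OF Ca])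
  ultimately show ?thesis by blast
 qed
 thus ?thesis using closed_algD(1)[OF Ca] closure_approachable[of "m f" C] by(simp add: closure_closed)
qed

sublocale odometer_system V K e
proof
 show "is_unitary V" by(rule V)
 show "0 < K L" for L by(rule K_pos)
 show "K L dvd K (Suc L)" for L by(simp add: K_Suc)
 show "EX L. N <= K L" for N using K_ge[of N] by(intro exI[of _ N]) simp
 have ii: "m (%x. ind (cyl i L s) x*ind (cyl j L t) x) = e i L s*e j L t" for i j L s t
  by(simp add: m_mult cyl_continuous e_def)
 show "is_proj (e i L t)" for i L t
 proof -
  have "m (%x. ind (cyl i L t) x*ind (cyl i L t) x) = m (ind (cyl i L t))" by(rule m_cong) (simp add: ind_def)
  hence "e i L t*e i L t = e i L t" unfolding ii by(simp add: e_def)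
  moreover have "star (e i L t) = e i L t" unfolding e_def m_cnj[OF cyl_continuous, symmetric] by(rule m_cong) (simp add: ind_def)
  ultimately show ?thesis by(simp add: is_proj_def)
 qed
 show "e i L t ~= 0" for i L t
 proof
  assume z: "e i L t = 0"
  obtain x where x: "x:cyl i L t" using cyl_nonempty by blast
  hence "x:Z" by(simp add: cyl_def)
  from m_inj[OF cyl_continuous z[unfolded e_def] this] show False using x by(simp add: ind_def)
 qed
 show "e i L s*e j L t = 0" if "s < K L" "t < K L" "(i,s) ~= (j,t)" for i j L s t
 proof -
  have "ind (cyl i L s) x*ind (cyl j L t) x = 0" for x
   using cyl_disjoint[of x i L s j t] that by(auto simp: ind_def cong_def)
  hence "(%x. ind (cyl i L s) x*ind (cyl j L t) x) = (%_. 0)" by(rule ext)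
  thus ?thesis using ii[of i L s j t] m_const[of 0] by simp
 qed
 show "e i L (t + K L) = e i L t" for i L t
  using cyl_cong[of "t + K L" t L i] by(simp add: e_def cong_def)
 show "V*e i L t = e i L (Suc t)*V" for i L t
 proof -
  have "e i L t = m (%x. ind (cyl i L (Suc t)) (x \<otimes>\<^bsub>padic_int p\<^esub> r))"
   unfolding e_def by(rule m_cong) (simp add: ind_def cyl_shift)
  thus ?thesis unfolding e_def[of i L "Suc t"] by(simp add: m_shift[OF cyl_continuous])
 qed
 show "e i L t = (SUM j<K (Suc L) div K L. e i (Suc L) (t + j*K L))" for i L t
 proof -
  have "ind (cyl i L t) x = (SUM j<p. ind (cyl i (Suc L) (t + j*K L)) x)" for x
  proof (cases "x:cyl i L t")
   case False
   have "x ~: cyl i (Suc L) (t + j*K L)" for j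
    using False cyl_Suc(1)[of x i L "t + j*K L"] cyl_cong[of "t + j*K L" t L i] by(auto simp: cong_def)
   thus ?thesis using False by(simp add: ind_def)
  next
   case True
   then obtain j where j: "j < p" "x:cyl i (Suc L) (t + j*K L)" using cyl_Suc(2) by blast
   have uniq: "j' = j" if "j' < p" "x:cyl i (Suc L) (t + j'*K L)" for j'
   proof -
    have "[t + j'*K L = t + j*K L] (mod K (Suc L))" using cyl_disjoint[OF that(2) j(2)] by simp
    hence "[j'*K L = j*K L] (mod K (Suc L))" by(simp add: cong_add_lcancel_nat)
    moreover have "j'*K L < K (Suc L)" "j*K L < K (Suc L)" using that(1) j(1) K_pos[of L] by(simp_all add: K_Suc)
    ultimately have "j'*K L = j*K L" by(simp add: cong_def)
    thus ?thesis using K_pos[of L] by simp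
   qed
   have "ind (cyl i (Suc L) (t + j'*K L)) x = (if j' = j then 1 else 0)" if "j':{..<p}" for j'
   proof -
    have "x:cyl i (Suc L) (t + j'*K L) <-> j' = j" using uniq[of j'] j(2) that by blast
    thus ?thesis by(simp only: ind_def)
   qed
   hence "(SUM j'<p. ind (cyl i (Suc L) (t + j'*K L)) x) = (SUM j'<p. if j' = j then 1 else 0)"
    by(rule sum.cong[OF refl])
   thus ?thesis using True j(1) by(simp add: ind_def)
  qed
  hence "e i L t = m (%x. SUM j<p. ind (cyl i (Suc L) (t + j*K L)) x)" unfolding e_def by(intro m_cong)
  also have "... = (SUM j<p. e i (Suc L) (t + j*K L))" by(subst m_sum) (simp_all add: cyl_continuous e_def)
  finally show ?thesis using K_pos[of L] by(simp add: K_Suc)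
 qed
 show "x:C" if "closed_calg C" "V:C" "!!i L t. e i L t:C" for C x
  using generate[OF that(1,2)] m_mem[OF that(1,3)] by blast
qed

end

section \<open>The groups in the conclusion\<close>

definition evl :: "(nat => 'x) => 'x" where "evl s = (THE c. EX L. ALL i>=L. s i = c)"
definition evc :: "(nat => 'x) => bool" where "evc s <-> (EX L. ALL i>=L. s i = evl s)"

lemma evl:
 assumes "!!i. i >= L ==> s i = c"
 shows "evl s = c" "evc s"
proof -
 show e: "evl s = c" unfolding evl_def
 proof (rule the_equality)
  fix d assume "EX L. ALL i>=L. s i = d"
  then obtain M where "ALL i>=M. s i = d" ..
  thus "d = c" using assms[of "max L M"] by(metis max.cobounded1 max.cobounded2)
 qed (use assms in blast)
 show "evc s" unfolding evc_def e using assms by blast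
qed

lemma evl_add:
 assumes "evc s" "evc t"
 shows "evl (%i. s i + t i) = evl s + evl t"
proof -
 obtain L M where "ALL i>=L. s i = evl s" "ALL i>=M. t i = evl t" using assms unfolding evc_def by blast
 thus ?thesis by(intro evl(1)[of "max L M"]) simp
qed

lemma finite_evl: "evc s ==> finite {i. s i - evl s ~= (0 :: 'x::ab_group_add)}"
proof -
 assume "evc s"
 then obtain L where "ALL i>=L. s i = evl s" unfolding evc_def ..
 hence "{i. s i - evl s ~= 0} \<subseteq> {..<L}" by(auto simp: not_le[symmetric])
 thus ?thesis by(rule finite_subset) simp
qed

lemma comm_group_c0:
 assumes "comm_group H"
 shows "comm_group (c0_group H)" "carrier (c0_group H) = {x. (ALL i. x i:carrier H) & finite {i. x i ~= \<one>\<^bsub>H\<^esub>}}"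
  "(\<otimes>\<^bsub>c0_group H\<^esub>) = (%x y i. x i \<otimes>\<^bsub>H\<^esub> y i)"
proof -
 interpret comm_group H by(rule assms)
 show c: "carrier (c0_group H) = {x. (ALL i. x i:carrier H) & finite {i. x i ~= \<one>\<^bsub>H\<^esub>}}"
  unfolding c0_group_def by(subst carrier_sum_group) (auto simp: PiE_iff)
 show m: "(\<otimes>\<^bsub>c0_group H\<^esub>) = (%x y i. x i \<otimes>\<^bsub>H\<^esub> y i)" by(simp add: c0_group_def restrict_def)
 have "group (c0_group H)" by(simp add: c0_group_def)
 thus "comm_group (c0_group H)"
  by(rule group.group_comm_groupI) (auto simp: c m m_comm)
qed

lemma comm_group_DirProd: "comm_group G ==> comm_group H ==> comm_group (G \<times>\<times> H)"
 by(rule group.group_comm_groupI[OF DirProd_group]) (auto simp: comm_group_def DirProd_def comm_monoid.m_comm)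

context padic_unit
begin

lemma K_dvd: "L <= M ==> K L dvd K M"
 by(induction M rule: dec_induct) (auto simp: K_Suc)

lemma nat_dvd_padic_ord: "nat_dvd_supernatural l (padic_ord p r) <-> (EX L. l dvd K L)"
proof
 assume "EX L. l dvd K L"
 then obtain L where L: "l dvd K L" ..
 hence l: "l > 0" using K_pos[of L] by(auto intro: Nat.gr0I)
 have "enat (multiplicity q l) <= padic_ord p r q" if q: "prime q" for q
 proof -
  have "enat (multiplicity q l) <= enat (multiplicity q (K L))" using dvd_imp_multiplicity_le[OF L] K_pos[of L] by simp
  also have "... <= (SUP n\<in>{kk N | N. N >= 1}. enat (multiplicity q n))"
   by(rule SUP_upper) (use a(1) in \<open>auto simp: K_def intro!: exI[of _ "a + L"]\<close>)
  finally show ?thesis using q by(simp add: padic_ord_def supernatural_lcm_def)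
 qed
 thus "nat_dvd_supernatural l (padic_ord p r)" using l by(simp add: nat_dvd_supernatural_def)
next
 assume s: "nat_dvd_supernatural l (padic_ord p r)"
 hence l: "l > 0" by(simp add: nat_dvd_supernatural_def)
 have "EX L. multiplicity q l <= multiplicity q (K L)" if q: "prime q" for q
 proof (rule ccontr)
  assume n: "\<nexists>L. multiplicity q l <= multiplicity q (K L)"
  have "enat (multiplicity q (kk N)) <= enat (multiplicity q l - 1)" if N: "N >= 1" for N
  proof -
   have "kk N dvd K N" unfolding K_def using N by(intro kk_dvd) auto
   hence "multiplicity q (kk N) <= multiplicity q (K N)" using K_pos[of N] by(intro dvd_imp_multiplicity_le) auto
   thus ?thesis using n by(metis enat_ord_simps(1) le_trans less_Suc_eq_le not_le Suc_pred' gr0I zero_le)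
  qed
  hence "(SUP n\<in>{kk N | N. N >= 1}. enat (multiplicity q n)) <= enat (multiplicity q l - 1)" by(intro SUP_least) auto
  moreover have "enat (multiplicity q l) <= (SUP n\<in>{kk N | N. N >= 1}. enat (multiplicity q n))"
   using s q by(simp add: nat_dvd_supernatural_def padic_ord_def supernatural_lcm_def)
  ultimately have "enat (multiplicity q l) <= enat (multiplicity q l - 1)" by(rule order_trans[rotated])
  hence "multiplicity q l = 0" by(cases "multiplicity q l") auto
  thus False using n by simp
 qed
 then obtain f where f: "!!q. prime q ==> multiplicity q l <= multiplicity q (K (f q))" by metis
 define L where "L = Max (insert 0 (f ` prime_factors l))"
 have "multiplicity q l <= multiplicity q (K L)" if q: "prime q" for q
 proof (cases "q:prime_factors l")
  case True
  hence "K (f q) dvd K L" unfolding L_def by(intro K_dvd Max_ge) auto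
  thus ?thesis using f[OF q] dvd_imp_multiplicity_le[of "K (f q)" "K L" q] K_pos[of L] by simp
 next
  case False
  hence "multiplicity q l = 0" using q l by(auto simp: prime_factors_multiplicity)
  thus ?thesis by simp
 qed
 hence "l dvd K L" using l by(intro multiplicity_le_imp_dvd) auto
 thus "EX L. l dvd K L" ..
qed

abbreviation H where "H \<equiv> H_group (padic_ord p r)"

lemma H_mono: "L <= M ==> EX k'. (of_int k / of_nat (K L) :: rat) = of_int k' / of_nat (K M)"
proof -
 assume "L <= M"
 then obtain d where d: "K M = K L*d" using dvdE[OF K_dvd] by blast
 hence "d > 0" using K_pos[of M] by(auto intro: Nat.gr0I)
 thus ?thesis using d K_pos[of L] by(intro exI[of _ "k*int d"]) simp
qed

lemma H_carrier: "x:carrier H <-> (EX L k. x = of_int k / of_nat (K L))"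
proof
 assume "x:carrier H"
 then obtain k l where x: "x = of_int k / of_nat l" "nat_dvd_supernatural l (padic_ord p r)" by(auto simp: H_group_def)
 then obtain L d where d: "K L = l*d" unfolding nat_dvd_padic_ord by(auto elim: dvdE)
 hence "d > 0" using K_pos[of L] by(auto intro: Nat.gr0I)
 thus "EX L k. x = of_int k / of_nat (K L)" using x(1) d by(intro exI[of _ L] exI[of _ "k*int d"]) simp
next
 assume "EX L k. x = of_int k / of_nat (K L)"
 then obtain L k where x: "x = of_int k / of_nat (K L)" by blast
 have "nat_dvd_supernatural (K L) (padic_ord p r)" unfolding nat_dvd_padic_ord by(blast intro: dvd_refl)
 thus "x:carrier H" unfolding x H_group_def by auto
qed

lemma H_add: "x:carrier H ==> y:carrier H ==> x + y:carrier H"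
proof -
 assume "x:carrier H" "y:carrier H"
 then obtain L k M j where "x = of_int k / of_nat (K L)" "y = of_int j / of_nat (K M)" unfolding H_carrier by blast
 then obtain k' j' where "x = of_int k' / of_nat (K (max L M))" "y = of_int j' / of_nat (K (max L M))"
  using H_mono[of L "max L M" k] H_mono[of M "max L M" j] by auto
 thus ?thesis unfolding H_carrier by(intro exI[of _ "max L M"] exI[of _ "k' + j'"]) (simp add: add_divide_distrib)
qed

lemma H_minus: "x:carrier H ==> - x:carrier H"
 unfolding H_carrier by(metis minus_divide_left of_int_minus)

lemma H_of_int: "of_int k:carrier H"
 unfolding H_carrier using K_pos[of 0] by(intro exI[of _ 0] exI[of _ "k*int (K 0)"]) simp

lemma H_of_nat: "of_nat k:carrier H"
 using H_of_int[of "int k"] by simp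

lemma H_simps: "(\<otimes>\<^bsub>H\<^esub>) = (+)" "\<one>\<^bsub>H\<^esub> = 0"
 by(simp_all add: H_group_def)

lemma H_comm_group: "comm_group H"
proof (rule comm_groupI)
 show "EX y:carrier H. y \<otimes>\<^bsub>H\<^esub> x = \<one>\<^bsub>H\<^esub>" if "x:carrier H" for x
  using H_minus[OF that] by(intro bexI[of _ "- x"]) (simp_all add: H_simps)
qed (use H_of_int[of 0] in "auto simp: H_simps H_add")

end

section \<open>The K-groups\<close>

lemma (in odometer_system) kone_mone: "kone n (mone {..<n}) = (%_. 0)"
proof
 fix i
 have u: "umat {..<n} (mone {..<n} :: nat => nat => 'b)" by(simp add: umat_mone)
 thus "kone n (mone {..<n}) i = 0"
  using lev.wv_mm[OF lev.alg_mat_mone u lev.alg_mat_mone u, of "min i 0" 0] by(simp add: kone_level[OF lev.alg_mat_mone[of 0]] wh_def umat_def)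
qed

lemma K1_calg:
 fixes m :: "((nat => int) => complex) => 'a calg"
 assumes ce: "ce TYPE('a)" and z: "zp_system p r m V"
 shows "K1 (Cx :: 'a cstar) \<cong> integer_group \<times>\<times> c0_group integer_group"
proof -
 interpret zp_system p r m V by(rule z)
 note c0 = comm_group_c0[OF abelian_integer_group]
 let ?G = "integer_group \<times>\<times> c0_group integer_group"
 define ph where "ph = (%(n,u). (evl (kone n (tm u)),%i. kone n (tm u) i - evl (kone n (tm u))))"
 have tv: "tm (vm u) = u" for u :: "nat => nat => 'a calg"
  using ce by(simp add: tm_def vm_def fun_eq_iff calg_eq val_mk val_closed)
 have ph: "ph (n,vm u) = (evl (kone n u),%i. kone n u i - evl (kone n u))" for n u by(simp add: ph_def tv)
 have ev: "evc (kone n u)" if "umat {..<n} u" for n u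
  using kone_eventually_const[OF that] evl(2) by metis
 have ph_eq: "ph (n,vm u) = ph (l,vm v) <-> kone n u = kone l v" for n u l v
 proof
  assume "ph (n,vm u) = ph (l,vm v)"
  hence "evl (kone n u) = evl (kone l v)" "(%i. kone n u i - evl (kone n u)) = (%i. kone l v i - evl (kone l v))" by(auto simp: ph)
  thus "kone n u = kone l v" by(simp add: fun_eq_iff)
 qed (simp add: ph)
 have um: "umat {..<k} (mone {..<k} :: nat => nat => 'a calg)" for k by(simp add: umat_mone)
 have pad: "kone (n + k) (dsum n u (mone {..<k})) = kone n u" if "umat {..<n} u" for n k u
  using kone_dsum[OF that um[of k]] by(simp add: fun_eq_iff kone_mone)
 show ?thesis
  unfolding K1_def
 proof (rule quotient_monoid_iso[where ph = ph])
  show "group ?G" by(intro DirProd_group group_integer_group comm_group.axioms(2)[OF c0(1)])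
  show "(0,mat_one Cx 0):unitaries (Cx :: 'a cstar)" using um[of 0] by(simp add: vm_one[OF ce] vm_unitaries[OF ce])
  fix x y :: "nat \<times> 'a matrix"
  show "(x,y):K1_rel Cx <-> x:unitaries Cx & y:unitaries Cx & ph x = ph y"
  proof (cases "x:unitaries Cx & y:unitaries Cx")
   case True
   obtain n u l v where x: "x = (n,vm u)" "umat {..<n} u" and y: "y = (l,vm v)" "umat {..<l} v"
    using unitaries_vm[OF ce] True by metis
   have "unitary_homotopic Cx (diag_sum Cx x (k,mat_one Cx k)) (diag_sum Cx y (j,mat_one Cx j))
     <-> n + k = l + j & upath (n + k) (dsum n u (mone {..<k})) (dsum l v (mone {..<j}))" for k j
    unfolding x y vm_one[OF ce] vm_dsum[OF ce] by(rule vm_homotopic[OF ce umat_dsum[OF x(2) um] umat_dsum[OF y(2) um]])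
   hence K: "(x,y):K1_rel Cx <-> (EX k j. n + k = l + j & upath (n + k) (dsum n u (mone {..<k})) (dsum l v (mone {..<j})))"
    using True by(simp add: K1_rel_def)
   have "(EX k j. n + k = l + j & upath (n + k) (dsum n u (mone {..<k})) (dsum l v (mone {..<j}))) <-> kone n u = kone l v"
   proof
    assume "EX k j. n + k = l + j & upath (n + k) (dsum n u (mone {..<k})) (dsum l v (mone {..<j}))"
    then obtain k j where "n + k = l + j" "upath (n + k) (dsum n u (mone {..<k})) (dsum l v (mone {..<j}))" by blast
    thus "kone n u = kone l v" using kone_upath pad[OF x(2), of k] pad[OF y(2), of j] by metis
   next
    assume eq: "kone n u = kone l v"
    have s: "n + Suc l = l + Suc n" by simp
    have "umat {..<n + Suc l} (dsum l v (mone {..<Suc n}))" unfolding s by(rule umat_dsum[OF y(2) um])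
    moreover have "kone (n + Suc l) (dsum n u (mone {..<Suc l})) = kone (n + Suc l) (dsum l v (mone {..<Suc n}))"
     unfolding pad[OF x(2)] using pad[OF y(2), of "Suc n"] eq unfolding s by simp
    ultimately have "upath (n + Suc l) (dsum n u (mone {..<Suc l})) (dsum l v (mone {..<Suc n}))"
     by(rule kone_eq_imp_upath[OF umat_dsum[OF x(2) um]]) simp
    thus "EX k j. n + k = l + j & upath (n + k) (dsum n u (mone {..<k})) (dsum l v (mone {..<j}))" using s by blast
   qed
   thus ?thesis using K True x(1) y(1) ph_eq by simp
  qed (auto simp: K1_rel_def)
  assume xy: "x:unitaries Cx" "y:unitaries Cx"
  obtain n u l v where x: "x = (n,vm u)" "umat {..<n} u" and y: "y = (l,vm v)" "umat {..<l} v"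
   using unitaries_vm[OF ce] xy by metis
  have k: "kone (n + l) (dsum n u v) = (%i. kone n u i + kone l v i)" using kone_dsum[OF x(2) y(2)] by(simp add: fun_eq_iff)
  show "diag_sum Cx x y:unitaries Cx & ph (diag_sum Cx x y) = ph x \<otimes>\<^bsub>?G\<^esub> ph y"
   unfolding x y vm_dsum[OF ce] vm_unitaries[OF ce] ph
   using umat_dsum[OF x(2) y(2)] by(simp add: k c0(3) evl_add ev x(2) y(2) fun_eq_iff)
 next
  show "ph ` unitaries Cx = carrier ?G"
  proof (intro equalityI subsetI)
   fix g assume "g:ph ` unitaries Cx"
   then obtain n u where u: "umat {..<n} u" "g = ph (n,vm u)" using unitaries_vm[OF ce] by blast
   thus "g:carrier ?G" using finite_evl[OF ev[OF u(1)]] by(simp add: ph c0(2))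
  next
   fix g assume "g:carrier ?G"
   then obtain d x where g: "g = (d,x)" "finite {i. x i ~= 0}" by(auto simp: c0(2))
   then obtain L where L: "!!i. x i ~= 0 ==> i < L" unfolding finite_nat_set_iff_bounded by auto
   have l: "x i + d = d" if "i >= L" for i using L[of i] that by auto
   obtain u where u: "umat {..<Suc 0} u" "kone (Suc 0) u = (%i. x i + d)" using kone_surj[of L "%i. x i + d"] l by auto
   have "evl (%i. x i + d) = d" using evl(1)[of L "%i. x i + d" d] l by blast
   hence "ph (Suc 0,vm u) = g" by(simp add: ph u(2) g(1))
   thus "g:ph ` unitaries Cx" using u(1) vm_unitaries[OF ce] by blast
  qed
 qed
qed

lemma K0_calg:
 fixes m :: "((nat => int) => complex) => 'a calg"
 assumes ce: "ce TYPE('a)" and z: "zp_system p r m V"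
 shows "K0 (Cx :: 'a cstar) \<cong> c0_group (H_group (padic_ord p r)) \<times>\<times> integer_group"
proof -
 interpret zp_system p r m V by(rule z)
 note c0 = comm_group_c0[OF H_comm_group]
 let ?G = "c0_group H \<times>\<times> integer_group"
 define sp where "sp = (%s :: nat => rat. (%i. s i - evl s,\<lfloor>evl s\<rfloor>))"
 define good where "good s <-> (EX c. (EX L. ALL i>=L. s i = (of_int c :: rat)))" for s :: "nat => rat"
 have gd: "EX c. evl s = of_int c" "evc s" if s: "good s" for s
 proof -
  obtain c L where "ALL i>=L. s i = of_int c" using s unfolding good_def by blast
  thus "EX c. evl s = of_int c" "evc s" using evl[of L s "of_int c"] by auto
 qed
 have sp_add: "sp (%i. s i + t i) = sp s \<otimes>\<^bsub>?G\<^esub> sp t" if s: "good s" "good t" for s t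
 proof -
  obtain c d where "evl s = of_int c" "evl t = of_int d" using gd(1) s by blast
  thus ?thesis unfolding sp_def by(simp add: c0(3) H_simps evl_add[OF gd(2)[OF s(1)] gd(2)[OF s(2)]] fun_eq_iff)
 qed
 have sp_eq: "sp s = sp t <-> s = t" if s: "good s" "good t" for s t
 proof
  assume e: "sp s = sp t"
  obtain c d where cd: "evl s = of_int c" "evl t = of_int d" using gd(1) s by blast
  hence "evl s = evl t" using e by(simp add: sp_def)
  thus "s = t" using e by(simp add: sp_def fun_eq_iff)
 qed simp
 define ph where "ph = (%(n,q). sp (kzero n (tm q)))"
 have tv: "tm (vm u) = u" for u :: "nat => nat => 'a calg"
  using ce by(simp add: tm_def vm_def fun_eq_iff calg_eq val_mk val_closed)
 have ph: "ph (n,vm q) = sp (kzero n q)" for n q by(simp add: ph_def tv)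
 have kz: "good (kzero n q)" "kzero n q i:carrier H" if q: "pmat {..<n} q" for n q i
 proof -
  obtain L c where k: "kzero n q = (%i. of_nat (c (min i L)) / of_nat (kp L i))" using kzero_range[OF q] by blast
  show "good (kzero n q)" unfolding good_def k by(intro exI[of _ "int (c L)"] exI[of _ L]) (simp add: kp_def min_def)
  have "kzero n q i = of_int (int (c (min i L))) / of_nat (K L)" if "i < L" using that by(simp add: k kp_def)
  moreover have "kzero n q i = of_nat (c (min i L))" if "~ i < L" using that by(simp add: k kp_def)
  ultimately show "kzero n q i:carrier H" unfolding H_carrier[of "kzero n q i"] using H_of_nat[of "c (min i L)"] unfolding H_carrier by metis
 qed
 show ?thesis
 proof (rule K0_iso[where ph = ph])
  show "comm_group ?G" by(intro comm_group_DirProd c0(1) abelian_integer_group)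
  have "pmat {..<0} (mone {..<0} :: nat => nat => 'a calg)" by(simp add: pmat_def mone_def mm_def madj_def msupp_def fun_eq_iff)
  thus "(0,mat_one Cx 0):projections (Cx :: 'a cstar)" by(simp add: vm_one[OF ce] vm_projections[OF ce])
  show "ph ` projections Cx \<subseteq> carrier ?G"
  proof
   fix g assume "g:ph ` projections Cx"
   then obtain n q where q: "pmat {..<n} q" "g = ph (n,vm q)" using projections_vm[OF ce] by blast
   obtain c where c: "evl (kzero n q) = of_int c" using gd(1)[OF kz(1)[OF q(1)]] by blast
   have "kzero n q i - evl (kzero n q):carrier H" for i using H_add[OF kz(2)[OF q(1)] H_of_int[of "- c"], of i] by(simp add: c)
   thus "g:carrier ?G" using finite_evl[OF gd(2)[OF kz(1)[OF q(1)]]] by(simp add: q(2) ph sp_def c0(2) H_simps)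
  qed
  fix x y :: "nat \<times> 'a matrix"
  show "(x,y):mvn_rel Cx <-> x:projections Cx & y:projections Cx & ph x = ph y"
  proof (cases "x:projections Cx & y:projections Cx")
   case True
   obtain n q l q' where x: "x = (n,vm q)" "pmat {..<n} q" and y: "y = (l,vm q')" "pmat {..<l} q'"
    using projections_vm[OF ce] True by metis
   show ?thesis unfolding x y vm_mvn[OF ce] vm_projections[OF ce] ph
    using sp_eq[OF kz(1)[OF x(2)] kz(1)[OF y(2)]] kzero_eq_iff[OF x(2) y(2)] by blast
  qed (auto simp: mvn_rel_def)
  assume xy: "x:projections Cx" "y:projections Cx"
  obtain n q l q' where x: "x = (n,vm q)" "pmat {..<n} q" and y: "y = (l,vm q')" "pmat {..<l} q'"
   using projections_vm[OF ce] xy by metis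
  have k: "kzero (n + l) (dsum n q q') = (%i. kzero n q i + kzero l q' i)" using kzero_dsum[OF x(2) y(2)] by(simp add: fun_eq_iff)
  show "diag_sum Cx x y:projections Cx & ph (diag_sum Cx x y) = ph x \<otimes>\<^bsub>?G\<^esub> ph y"
   unfolding x y vm_dsum[OF ce] vm_projections[OF ce] ph k sp_add[OF kz(1)[OF x(2)] kz(1)[OF y(2)]]
   using pmat_dsum[OF x(2) y(2)] by simp
 next
  fix g assume "g:carrier ?G"
  then obtain d x where g: "g = (x,d)" "finite {i. x i ~= 0}" "!!i. x i:carrier H" by(auto simp: c0(2) H_simps)
  then obtain N where N: "!!i. x i ~= 0 ==> i < N" unfolding finite_nat_set_iff_bounded by auto
  obtain l k where lk: "!!i. x i = of_int (k i) / of_nat (K (l i))" using g(3) unfolding H_carrier by metis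
  define L where "L = Max (insert N (l ` {..<N}))"
  have NL: "N <= L" and lL: "l i <= L" if "i < N" for i unfolding L_def using that by(auto intro!: Max_ge)
  have "EX j. x i = of_int j / of_nat (K L)" for i
  proof (cases "i < N")
   case True
   thus ?thesis using H_mono[OF lL[OF True], of "k i"] lk[of i] by simp
  next
   case False
   thus ?thesis using N[of i] by(intro exI[of _ 0]) auto
  qed
  then obtain j where j: "!!i. x i = of_int (j i) / of_nat (K L)" by metis
  define b where "b i = (if i < L then j i + d*int (K L) else d)" for i
  have N0: "x i = 0" if "~ i < L" for i
  proof -
   have "N <= L" unfolding L_def by(rule Max_ge) auto
   thus ?thesis using N[of i] that by auto
  qed
  have xd: "x i + of_int d = of_int (b (min i L)) / of_nat (kp L i)" for i
   using K_pos[of L] j[of i] N0[of i] by(auto simp: b_def kp_def min_def add_divide_distrib)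
  obtain n q where q: "pmat {..<n} q" "kzero n q = (%i. of_nat (nat (b (min i L))) / of_nat (kp L i))" using kzero_surj[of "%i. nat (b i)" L] by auto
  obtain n' q' where q': "pmat {..<n'} q'" "kzero n' q' = (%i. of_nat (nat (- b (min i L))) / of_nat (kp L i))" using kzero_surj[of "%i. nat (- b i)" L] by auto
  have nn: "of_int z + of_nat (nat (- z)) = (of_nat (nat z) :: rat)" for z by(cases "z >= 0") auto
  have e: "(%i. (x i + of_int d) + kzero n' q' i) = kzero n q"
   unfolding xd q(2) q'(2) add_divide_distrib[symmetric] nn ..
  have xe: "x i + of_int d = of_int d" if "i >= L" for i using N0[of i] that by simp
  have "good (%i. x i + of_int d)" unfolding good_def using xe by blast
  from sp_add[OF this kz(1)[OF q'(1)]] have "sp (%i. x i + of_int d) \<otimes>\<^bsub>?G\<^esub> ph (n',vm q') = ph (n,vm q)" unfolding e ph by simp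
  moreover have "sp (%i. x i + of_int d) = g" using evl(1)[of L "%i. x i + of_int d" "of_int d"] xe by(simp add: sp_def g(1))
  ultimately show "EX x:projections Cx. EX y:projections Cx. g \<otimes>\<^bsub>?G\<^esub> ph y = ph x" using q(1) q'(1) vm_projections[OF ce] by blast
 qed
qed

context padic_unit
begin

lemma Z_monoid: "monoid (padic_int p)"
proof
 fix x y z assume xyz: "x:Z" "y:Z"
 have "(x (Suc n)*y (Suc n)) mod int p ^ Suc n mod int p ^ n = (x n*y n) mod int p ^ n" for n
 proof -
  have "(x (Suc n)*y (Suc n)) mod int p ^ Suc n mod int p ^ n = (x (Suc n)*y (Suc n)) mod int p ^ n"
   by(rule mod_mod_cancel) simp
  also have "... = (x n*y n) mod int p ^ n"
   using mod_mult_cong[OF trans[OF Z_mod[OF xyz(1), of n "Suc n"] Z_mod[OF xyz(1), of n n, symmetric]] trans[OF Z_mod[OF xyz(2), of n "Suc n"] Z_mod[OF xyz(2), of n n, symmetric]]] by simp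
  finally show ?thesis .
 qed
 thus "x \<otimes>\<^bsub>padic_int p\<^esub> y:Z" using p_pos by(simp add: padic_int_def)
 show "\<one>\<^bsub>padic_int p\<^esub> \<otimes>\<^bsub>padic_int p\<^esub> x = x" "x \<otimes>\<^bsub>padic_int p\<^esub> \<one>\<^bsub>padic_int p\<^esub> = x"
  using Z_mod[OF xyz(1) order_refl] by(simp_all add: padic_int_def mod_mult_left_eq mod_mult_right_eq fun_eq_iff)
 show "x \<otimes>\<^bsub>padic_int p\<^esub> y \<otimes>\<^bsub>padic_int p\<^esub> z = x \<otimes>\<^bsub>padic_int p\<^esub> (y \<otimes>\<^bsub>padic_int p\<^esub> z)"
  by(simp add: padic_int_def mod_mult_left_eq mod_mult_right_eq mult.assoc)
next
 show "\<one>\<^bsub>padic_int p\<^esub>:Z" using p_pos by(auto simp: padic_int_def mod_mod_cancel)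
qed

lemma continuous_shift:
 fixes f :: "(nat => int) => complex"
 assumes "cont Z f"
 shows "cont Z (%x. f (x \<otimes>\<^bsub>padic_int p\<^esub> r))"
proof (rule continuous_on_compose2[OF assms])
 have "cont Z (%x. (x n*r n) mod int p ^ n)" for n
  by(rule continuous_on_compose2[OF Topological_Spaces.continuous_on_discrete[of UNIV "%y. (y*r n) mod int p ^ n"] continuous_on_product_then_coordinatewise[OF continuous_on_id]]) simp
 thus "cont Z (%x. x \<otimes>\<^bsub>padic_int p\<^esub> r)"
  by(intro continuous_on_coordinatewise_then_product) (simp add: padic_int_def)
qed (use mult_rZ in auto)

end

lemma counterexample_calg:
 assumes ce: "ce TYPE('a)"
 shows "EX p r m (V :: 'a calg). zp_system p r m V & ~ K_theory_claim p r (Cx :: 'a cstar)"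
proof -
 obtain p r M V where c: "counterexample p r (Cx :: 'a cstar) M V" using ce_counterexample[OF ce] by blast
 interpret padic_unit p r by unfold_locales (use c in "auto simp: counterexample_def")
 let ?P = "padic_int p"
 let ?C = "cont_algebra Z"
 interpret P: monoid ?P by(rule Z_monoid)
 have cp: "is_crossed_product p r Cx M V" using c by(simp add: counterexample_def)
 hence M: "M:star_hom ?C Cx" and V: "V:carrier Cx" "adj Cx V \<otimes>\<^bsub>Cx\<^esub> V = \<one>\<^bsub>Cx\<^esub>"
  and cov: "!!f. f:carrier ?C ==> V \<otimes>\<^bsub>Cx\<^esub> M f \<otimes>\<^bsub>Cx\<^esub> adj Cx V = M (padic_alpha p r f)"
  and inj: "inj_on M (carrier ?C)" and gen: "cstar_generated (insert V (M ` carrier ?C)) Cx = carrier Cx"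
  by(auto simp: is_crossed_product_def covariant_pair_def)
 interpret Q: Ring.ring "Cx :: 'a cstar" by(rule unital_cstar_algebra.axioms(1)[OF Cx[OF ce]])
 define m where "m f = (mk (M (restrict f Z)) 0 :: 'a calg)" for f
 define W where "W = (mk V 0 :: 'a calg)"
 have rc: "restrict f Z:carrier ?C <-> cont Z f" for f :: "(nat => int) => complex"
  by(auto simp: cont_algebra_def cong: continuous_on_cong)
 have Mh: "M:Ring.ring_hom ?C Cx" and Ms: "!!f. f:carrier ?C ==> M (adj ?C f) = adj Cx (M f)" "!!f z. f:carrier ?C ==> M (z \<odot>\<^bsub>?C\<^esub> f) = z \<odot>\<^bsub>Cx\<^esub> M f"
  using M by(auto simp: star_hom_def)
 have vm: "val (m f) = M (restrict f Z)" if "cont Z f" for f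
  unfolding m_def using ring_hom_closed[OF Mh] that by(intro val_mk[OF ce]) (simp add: rc)
 have vW: "val W = V" unfolding W_def using V(1) by(rule val_mk[OF ce])
 note eqI = val_eq[OF ce, THEN iffD1]
 note ops = val_ops[OF ce] star_cx_ops(1,2)[OF ce]
 have const: "m (%_. z) = cx z" for z
 proof -
  have "M (restrict (%_. z) Z) = M (z \<odot>\<^bsub>?C\<^esub> \<one>\<^bsub>?C\<^esub>)" by(rule arg_cong[of _ _ M]) (auto simp: cont_algebra_def)
  also have "... = z \<odot>\<^bsub>Cx\<^esub> M \<one>\<^bsub>?C\<^esub>" by(rule Ms(2)) (auto simp: cont_algebra_def cong: continuous_on_cong)
  also have "... = z \<odot>\<^bsub>Cx\<^esub> \<one>\<^bsub>Cx\<^esub>" using ring_hom_one[OF Mh] by simp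
  finally show ?thesis by(intro eqI) (simp add: vm ops)
 qed
 have alpha: "V \<otimes>\<^bsub>Cx\<^esub> M (restrict (%x. f (x \<otimes>\<^bsub>?P\<^esub> r)) Z) \<otimes>\<^bsub>Cx\<^esub> adj Cx V = M (restrict f Z)" if f: "cont Z f" for f
 proof -
  have "padic_alpha p r (restrict (%x. f (x \<otimes>\<^bsub>?P\<^esub> r)) Z) = restrict f Z"
   unfolding padic_alpha_def
  proof (rule restrict_ext)
   fix x assume x: "x:Z"
   have "x \<otimes>\<^bsub>?P\<^esub> inv\<^bsub>?P\<^esub> r:Z" "x \<otimes>\<^bsub>?P\<^esub> inv\<^bsub>?P\<^esub> r \<otimes>\<^bsub>?P\<^esub> r = x" using x P.Units_inv_closed[OF r] P.Units_l_inv[OF r] P.m_assoc[OF x P.Units_inv_closed[OF r] rZ] by simp_all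
   thus "restrict (%x. f (x \<otimes>\<^bsub>?P\<^esub> r)) Z (x \<otimes>\<^bsub>?P\<^esub> inv\<^bsub>?P\<^esub> r) = f x" by simp
  qed
  thus ?thesis using cov[of "restrict (%x. f (x \<otimes>\<^bsub>?P\<^esub> r)) Z"] continuous_shift[OF f] by(simp add: rc)
 qed
 have WmW: "W*m (%x. f (x \<otimes>\<^bsub>?P\<^esub> r)) * star W = m f" if "cont Z f" for f
  using alpha[OF that] by(intro eqI) (simp add: ops vW vm that continuous_shift)
 have WW: "star W*W = 1" by(intro eqI) (simp add: ops vW V(2))
 have "zp_system p r m W"
 proof
  show "is_unitary W" using WW WmW[of "%_. 1"] by(simp add: is_unitary_def const)
  show "m (%_. z) = cx z" for z by(rule const)
  show "m f = m g" if "!!x. x:Z ==> f x = g x" for f g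
   using restrict_ext[of Z f g] that by(simp add: m_def)
  fix f :: "(nat => int) => complex" assume f: "cont Z f"
  show "W*m (%x. f (x \<otimes>\<^bsub>?P\<^esub> r)) = m f*W" using WW by(simp add: WmW[OF f, symmetric] mult.assoc)
  have "restrict (%x. cnj (f x)) Z = adj ?C (restrict f Z)" by(auto simp: cont_algebra_def)
  thus "m (%x. cnj (f x)) = star (m f)"
   using Ms(1)[of "restrict f Z"] f by(intro eqI) (simp add: ops vm continuous_on_cnj rc)
  show "f x = 0" if "m f = 0" "x:Z" for x
  proof -
   have "m f = m (%_. 0)" using that const[of 0] by simp
   hence "M (restrict f Z) = M (restrict (%_. 0) Z)" using f vm[of f] vm[of "%_. 0"] by simp
   hence "restrict f Z = restrict (%_. 0) Z" by(rule inj_onD[OF inj]) (use f in "simp_all only: rc continuous_on_const")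
   from fun_cong[OF this, of x] show ?thesis using that(2) by simp
  qed
  fix g :: "(nat => int) => complex" assume g: "cont Z g"
  have "restrict (%x. f x + g x) Z = restrict f Z \<oplus>\<^bsub>?C\<^esub> restrict g Z" "restrict (%x. f x*g x) Z = restrict f Z \<otimes>\<^bsub>?C\<^esub> restrict g Z" by(auto simp: cont_algebra_def)
  thus "m (%x. f x + g x) = m f + m g" "m (%x. f x*g x) = m f*m g"
   using ring_hom_add[OF Mh, of "restrict f Z" "restrict g Z"] ring_hom_mult[OF Mh, of "restrict f Z" "restrict g Z"] f g
   by - (intro eqI, simp add: ops vm continuous_on_add continuous_on_mult rc)+
 next
  fix C and w :: "'a calg"
  assume C: "closed_calg C" "W:C" "!!f. cont Z f ==> m f:C"
  have "val ` insert W (m ` {f. cont Z f}) = insert V (M ` carrier ?C)"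
  proof -
   have "val ` m ` {f. cont Z f} = M ` carrier ?C"
   proof (intro equalityI subsetI)
    fix y assume "y:val ` m ` {f. cont Z f}"
    then obtain f where "cont Z f" "y = val (m f)" by blast
    thus "y:M ` carrier ?C" using rc[of f] by(simp add: vm)
   next
    fix y assume "y:M ` carrier ?C"
    then obtain f where f: "f:carrier ?C" "y = M f" by blast
    hence "restrict f Z = f" "cont Z f" by(auto simp: cont_algebra_def extensional_restrict)
    hence "y = val (m f)" using f by(simp add: vm)
    thus "y:val ` m ` {f. cont Z f}" using `cont Z f` by blast
   qed
   thus ?thesis by(simp add: vW)
  qed
  hence "cstar_generated (val ` insert W (m ` {f. cont Z f})) Cx = carrier Cx" using gen by simp
  thus "w:C" by(rule calg_generated[OF ce _ C(1)]) (use C(2,3) in auto)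
 qed
 thus ?thesis using c unfolding counterexample_def by blast
qed

lemma crossed_product_one_neq_zero:
 assumes "is_crossed_product p r A M V" "prime p"
 shows "\<one>\<^bsub>A\<^esub> ~= \<zero>\<^bsub>A\<^esub>"
proof
 let ?C = "padic_cont p"
 have U: "unital_cstar_algebra A" and M: "M:Ring.ring_hom ?C A" and i: "inj_on M (carrier ?C)"
  using assms by(auto simp: is_crossed_product_def covariant_pair_def star_hom_def)
 interpret Q: Ring.ring A by(rule unital_cstar_algebra.axioms(1)[OF U])
 have c: "\<one>\<^bsub>?C\<^esub>:carrier ?C" "\<zero>\<^bsub>?C\<^esub>:carrier ?C" by(auto simp: cont_algebra_def cong: continuous_on_cong)
 have "\<zero>\<^bsub>?C\<^esub> \<oplus>\<^bsub>?C\<^esub> \<zero>\<^bsub>?C\<^esub> = \<zero>\<^bsub>?C\<^esub>" by(auto simp: cont_algebra_def)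
 hence "M \<zero>\<^bsub>?C\<^esub> \<oplus>\<^bsub>A\<^esub> M \<zero>\<^bsub>?C\<^esub> = M \<zero>\<^bsub>?C\<^esub>" using ring_hom_add[OF M c(2) c(2)] by simp
 hence z: "M \<zero>\<^bsub>?C\<^esub> = \<zero>\<^bsub>A\<^esub>" using ring_hom_closed[OF M c(2)] by simp
 assume "\<one>\<^bsub>A\<^esub> = \<zero>\<^bsub>A\<^esub>"
 hence "M \<one>\<^bsub>?C\<^esub> = M \<zero>\<^bsub>?C\<^esub>" using ring_hom_one[OF M] z by simp
 hence "\<one>\<^bsub>?C\<^esub> = \<zero>\<^bsub>?C\<^esub>" by(rule inj_onD[OF i _ c])
 from fun_cong[OF this, of "%n. 0"] have "(%n. 0) ~: carrier (padic_int p)" by(simp add: cont_algebra_def restrict_def split: if_splits)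
 moreover have "(%n. 0):carrier (padic_int p)" using assms(2) by(simp add: padic_int_def prime_gt_0_nat)
 ultimately show False by blast
qed

theorem proposition5p6:
  fixes p :: nat and r :: "nat \<Rightarrow> int"
    and A :: "'a cstar" and M :: "((nat \<Rightarrow> int) \<Rightarrow> complex) \<Rightarrow> 'a" and V :: 'a
  assumes "prime p" and "odd p"
    and "r \<in> Units (padic_int p)"
    and "\<forall>n::nat. n > 0 \<longrightarrow> r [^]\<^bsub>padic_int p\<^esub> n \<noteq> \<one>\<^bsub>padic_int p\<^esub>"
    and "is_crossed_product p r A M V"
  shows "K0 A \<cong> c0_group (H_group (padic_ord p r)) \<times>\<times> integer_group
       \<and> K1 A \<cong> integer_group \<times>\<times> c0_group integer_group"
proof (rule ccontr)
 assume "~ (K0 A \<cong> c0_group (H_group (padic_ord p r)) \<times>\<times> integer_group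
   & K1 A \<cong> integer_group \<times>\<times> c0_group integer_group)"
 hence "counterexample p r A M V"
  unfolding counterexample_def K_theory_claim_def using assms crossed_product_one_neq_zero[OF assms(5,1)] by blast
 hence ce: "ce TYPE('a)" unfolding ce_def by blast
 thus False using counterexample_calg[OF ce] K0_calg[OF ce] K1_calg[OF ce] unfolding K_theory_claim_def by blast
qed

end
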